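(* Let $V$ be a finite set, $s,t\in V$, and let $c:\binom{V}{2}\to\mathbb{Q}_{\ge 0}$ satisfy the triangle inequality. Let $x^*$ be an optimal solution of the subtour elimination LP for the $s$-$t$ path TSP, with optimal value $\mathrm{OPT}_{LP}=c(x^* )$. Then the Best-of-Many With Deletion (BOMD) algorithm described in the context returns an $\{s,t\}$-tour of cost at most $\left(\frac32+\frac1{34}\right)\mathrm{OPT}_{LP}$.
   Context: For $U\subseteq V$, $\delta(U)$ denotes the set of pairs $\{i,j\}$ with $i\in U$, $j\notin U$. The subtour elimination LP for the $s$-$t$ path TSP is: minimize $\sum_e c(e)x(e)$ over $x\in\mathbb{R}^{\binom V2}$ subject to $x\ge 0$, $\sum_{e\in\delta(\{i\})}x(e)=f(\{i\})$ for all $i\in V$, and $\sum_{e\in\delta(U)}x(e)\ge f(U)$ for all $\emptyset\ne U\subsetneq V$, where $f(U)=1$ if $|U\cap\{s,t\}|=1$ and $f(U)=2$ otherwise. Let $E=\{e:x^*(e)>0\}$. Edge sets are identified with their incidence vectors, and for $z\in\mathbb{R}^E$, $H\subseteq E$, $z(H)=\sum_{e\in H}z(e)$, $c(z)=\sum_e c(e)z(e)$. A cut $Q=\delta(U)\cap E$ ($\emptyset\ne U\subsetneq V$) is narrow if $x^*(Q)<2$; $\mathcal{Q}$ is the set of narrow cuts. For an edge (multi)set $S$, $T_S$ is its set of odd-degree vertices. For $T\subseteq V$ of even size, a $T$-join is an edge set whose odd-degree vertex set is $T$. An $\{s,t\}$-tour is an edge multiset forming a connected spanning multigraph on $V$ whose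 set of odd-degree vertices is $\{s\}\triangle\{t\}$. For a spanning tree $S$, $S(s,t)$ is its $s$-$t$ path. Convex combination with lonely edges: a family $\mathcal{S}$ of spanning trees of $(V,E)$ with coefficients $\lambda_S>0$ summing to $1$ (viewed as a random tree $\mathcal{S}$ with $\Pr(\mathcal{S}=S)=\lambda_S$), together with, for each $S$, a set $L(S)\subseteq\{e\in S:\exists Q\in\mathcal{Q},\ Q\cap S=\{e\}\}$ of lonely edges. The lonely cuts of $S$ are $\mathcal{Q}(S)=\{Q\in\mathcal{Q}: Q\cap S=\{e\}\text{ for some }e\in L(S)\}$; for $Q\in\mathcal{Q}(S)$, $e_S^Q$ denotes the unique edge of $Q\cap S$. For $Q\in\mathcal{Q}$ define $x^Q\in\mathbb{R}^E$ by $x^Q(e)=\Pr(Q\in\mathcal{Q}(\mathcal{S})\text{ and } e^Q_{\mathcal{S}}=e)$. A tree $S$ is layered if for every $Q\in\mathcal{Q}(S)$ and every $Q'\in\mathcal{Q}$ with $x^*(Q')\le x^*(Q)$ we have $Q'\in\mathcal{Q}(S)$. The convex combination is layered if $\sum_S\lambda_S S=x^*$, $x^Q(Q)=2-x^*(Q)$ for all $Q\in\mathcal{Q}$, and every $S$ in it is layered. Vector $y_F$ (with $\gamma=1/16$): for a tree $S$ and $F=S\setminus L(S)$, $y_F=\tfrac12x^*+\gamma S(s,t)+\sum_{Q\in\mathcal{Q}(S):\,x^*(Q)<2-2\gamma}\left(1-\tfrac12x^*(Q)-\gamma\right)e_S^Q+\sum_{Q\in\mathcal{Q}:\,x^*(Q)<2-2\gamma,\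 |Q\cap F|\ge2\text{ even}}\frac{1-\frac12x^*(Q)-\gamma}{2-x^*(Q)}x^Q.$ BOMD algorithm: compute $x^*$ and write it as a layered convex combination of $O(|E|)$ spanning trees $\mathcal{S}$. For each $S\in\mathcal{S}$: let $F=S\setminus L(S)$; write $y_F$ as a convex combination of $O(|E|)$ $T_F\triangle\{s,t\}$-joins $\mathcal{J}_F$; for each $J_F\in\mathcal{J}_F$, contract the components of $(V,F+J_F)$, compute a minimum $c$-cost spanning tree $D$ of the contracted graph and set $P_1(F,J_F)=F+J_F+2D$ (with $D$ doubled); let $P_1(S)$ be the cheapest of these; let $P_2(S)=S+J_S$ where $J_S$ is a minimum cost $T_S\triangle\{s,t\}$-join. Output the cheapest among all $P_1(S),P_2(S)$, $S\in\mathcal{S}$.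
   Formalization: "Write y_F as a convex combination of joins" is read as: y_F is at least a convex combination of joins on every edge, since exact equality can be impossible; exact combinations are covered. Joins and the trees D use edges of E only. *)

theory Defs
  imports Complex_Main "HOL-Library.Multiset"
begin

section \<open>Graphs\<close>

text \<open>
  Undirected multigraphs are given by a vertex set, an edge set and a map \<open>ends\<close> sending an edge
  to the set of its end vertices (a singleton for a loop). A simple graph has two-element sets as
  edges and \<open>ends = id\<close>; the general form is needed for contracted graphs, in which
  parallel edges and loops arise. Graph notions for digraphs do not fit here, since acyclicity
  there is about directed cycles.
\<close>

definition vpairs :: "'v set \<Rightarrow> 'v set set" where
  "vpairs V = {e. e \<subseteq> V \<and> card e = 2}"

definition adj_rel :: "('e \<Rightarrow> 'w set) \<Rightarrow> 'e set \<Rightarrow> ('w \<times> 'w) set" where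
  "adj_rel ends A = {(u, v). \<exists>e\<in>A. ends e = {u, v}}"

definition mg_connected :: "'w set \<Rightarrow> ('e \<Rightarrow> 'w set) \<Rightarrow> 'e set \<Rightarrow> bool" where
  "mg_connected W ends A \<longleftrightarrow> (\<forall>u\<in>W. \<forall>v\<in>W. (u, v) \<in> (adj_rel ends A)\<^sup>*)"

text \<open>A loop is a cycle of length 1, a pair of parallel edges a cycle of length 2.\<close>

definition mg_cyclic :: "('e \<Rightarrow> 'w set) \<Rightarrow> 'e set \<Rightarrow> bool" where
  "mg_cyclic ends A \<longleftrightarrow> (\<exists>vs es. es \<noteq> [] \<and> length vs = length es \<and> distinct vs \<and> distinct es \<and>
     set es \<subseteq> A \<and> (\<forall>i < length es. ends (es ! i) = {vs ! i, vs ! (Suc i mod length es)}))"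

definition is_spanning_tree :: "'w set \<Rightarrow> ('e \<Rightarrow> 'w set) \<Rightarrow> 'e set \<Rightarrow> 'e set \<Rightarrow> bool" where
  "is_spanning_tree W ends A D \<longleftrightarrow> D \<subseteq> A \<and> mg_connected W ends D \<and> \<not> mg_cyclic ends D"

definition is_min_spanning_tree ::
  "'w set \<Rightarrow> ('e \<Rightarrow> 'w set) \<Rightarrow> 'e set \<Rightarrow> ('e \<Rightarrow> real) \<Rightarrow> 'e set \<Rightarrow> bool" where
  "is_min_spanning_tree W ends A c D \<longleftrightarrow> is_spanning_tree W ends A D \<and>
     (\<forall>D'. is_spanning_tree W ends A D' \<longrightarrow> sum c D \<le> sum c D')"

definition component_of_vertex :: "'v set \<Rightarrow> 'v set set \<Rightarrow> 'v \<Rightarrow> 'v set" where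
  "component_of_vertex V H v = {w \<in> V. (v, w) \<in> (adj_rel id H)\<^sup>*}"

text \<open>
  The graph obtained from \<open>(V, E)\<close> by contracting the components of \<open>(V, H)\<close> has these components
  as its vertices and keeps every edge of \<open>E\<close>, now joining the components of its end vertices.
\<close>

definition contracted_verts :: "'v set \<Rightarrow> 'v set set \<Rightarrow> 'v set set" where
  "contracted_verts V H = component_of_vertex V H ` V"

definition contracted_ends :: "'v set \<Rightarrow> 'v set set \<Rightarrow> 'v set \<Rightarrow> 'v set set" where
  "contracted_ends V H e = component_of_vertex V H ` e"

definition is_vertex_path :: "'v set \<Rightarrow> 'v set set \<Rightarrow> 'v \<Rightarrow> 'v \<Rightarrow> 'v list \<Rightarrow> bool" where
  "is_vertex_path V A s t vs \<longleftrightarrow> vs \<noteq> [] \<and> hd vs = s \<and> last vs = t \<and> distinct vs \<and> set vs \<subseteq> V \<and>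
     (\<forall>i. Suc i < length vs \<longrightarrow> {vs ! i, vs ! Suc i} \<in> A)"

definition path_edges :: "'v list \<Rightarrow> 'v set set" where
  "path_edges vs = {{vs ! i, vs ! Suc i} | i. Suc i < length vs}"

definition tree_path :: "'v set \<Rightarrow> 'v set set \<Rightarrow> 'v \<Rightarrow> 'v \<Rightarrow> 'v set set" where
  "tree_path V S s t = path_edges (THE vs. is_vertex_path V S s t vs)"

definition odd_verts :: "'v set \<Rightarrow> 'v set multiset \<Rightarrow> 'v set" where
  "odd_verts V M = {v \<in> V. odd (size {#e \<in># M. v \<in> e#})}"

definition is_join :: "'v set \<Rightarrow> 'v set set \<Rightarrow> 'v set \<Rightarrow> 'v set set \<Rightarrow> bool" where
  "is_join V E T J \<longleftrightarrow> J \<subseteq> E \<and> odd_verts V (mset_set J) = T"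

definition is_min_join ::
  "'v set \<Rightarrow> 'v set set \<Rightarrow> ('v set \<Rightarrow> real) \<Rightarrow> 'v set \<Rightarrow> 'v set set \<Rightarrow> bool" where
  "is_min_join V E c T J \<longleftrightarrow> is_join V E T J \<and> (\<forall>J'. is_join V E T J' \<longrightarrow> sum c J \<le> sum c J')"

definition is_tour :: "'v set \<Rightarrow> 'v \<Rightarrow> 'v \<Rightarrow> 'v set multiset \<Rightarrow> bool" where
  "is_tour V s t R \<longleftrightarrow> set_mset R \<subseteq> vpairs V \<and> mg_connected V id (set_mset R) \<and>
     odd_verts V R = sym_diff {s} {t}"

definition tour_cost :: "('v set \<Rightarrow> real) \<Rightarrow> 'v set multiset \<Rightarrow> real" where
  "tour_cost c R = (\<Sum>e\<in>#R. c e)"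

definition is_metric_cost :: "'v set \<Rightarrow> ('v set \<Rightarrow> real) \<Rightarrow> bool" where
  "is_metric_cost V c \<longleftrightarrow> (\<forall>e \<in> vpairs V. c e \<in> \<rat> \<and> 0 \<le> c e) \<and>
     (\<forall>i\<in>V. \<forall>j\<in>V. \<forall>k\<in>V. i \<noteq> j \<and> j \<noteq> k \<and> i \<noteq> k \<longrightarrow> c {i, k} \<le> c {i, j} + c {j, k})"


section \<open>The subtour elimination LP\<close>

definition cut_edges :: "'v set \<Rightarrow> 'v set \<Rightarrow> 'v set set" where
  "cut_edges V U = {{i, j} | i j. i \<in> U \<and> j \<in> V - U}"

definition cut_demand :: "'v \<Rightarrow> 'v \<Rightarrow> 'v set \<Rightarrow> real" where
  "cut_demand s t U = (if card (U \<inter> {s, t}) = 1 then 1 else 2)"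

text \<open>A vector indexed by the pairs of vertices is a function whose values elsewhere are ignored.\<close>

definition lp_feasible :: "'v set \<Rightarrow> 'v \<Rightarrow> 'v \<Rightarrow> ('v set \<Rightarrow> real) \<Rightarrow> bool" where
  "lp_feasible V s t x \<longleftrightarrow>
     (\<forall>e \<in> vpairs V. 0 \<le> x e) \<and>
     (\<forall>i\<in>V. sum x (cut_edges V {i}) = cut_demand s t {i}) \<and>
     (\<forall>U. U \<noteq> {} \<and> U \<subset> V \<longrightarrow> cut_demand s t U \<le> sum x (cut_edges V U))"

definition lp_cost :: "'v set \<Rightarrow> ('v set \<Rightarrow> real) \<Rightarrow> ('v set \<Rightarrow> real) \<Rightarrow> real" where
  "lp_cost V c x = (\<Sum>e \<in> vpairs V. c e * x e)"

definition lp_optimal ::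
  "'v set \<Rightarrow> 'v \<Rightarrow> 'v \<Rightarrow> ('v set \<Rightarrow> real) \<Rightarrow> ('v set \<Rightarrow> real) \<Rightarrow> bool" where
  "lp_optimal V s t c x \<longleftrightarrow> lp_feasible V s t x \<and>
     (\<forall>z. lp_feasible V s t z \<longrightarrow> lp_cost V c x \<le> lp_cost V c z)"

definition supp_edges :: "'v set \<Rightarrow> ('v set \<Rightarrow> real) \<Rightarrow> 'v set set" where
  "supp_edges V x = {e \<in> vpairs V. 0 < x e}"

definition narrow_cuts :: "'v set \<Rightarrow> ('v set \<Rightarrow> real) \<Rightarrow> 'v set set set" where
  "narrow_cuts V x = {Q. \<exists>U. U \<noteq> {} \<and> U \<subset> V \<and> Q = cut_edges V U \<inter> supp_edges V x \<and> sum x Q < 2}"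


section \<open>Layered convex combinations\<close>

text \<open>
  A family of \<open>n\<close> trees is given by coefficients \<open>lam i\<close>, edge sets \<open>S i\<close> and sets of lonely
  edges \<open>L i\<close> for \<open>i < n\<close>. The same tree may occur at several indices, possibly with
  different sets of lonely edges.
\<close>

definition lonely_candidates ::
  "'v set \<Rightarrow> ('v set \<Rightarrow> real) \<Rightarrow> 'v set set \<Rightarrow> 'v set set" where
  "lonely_candidates V x S = {e \<in> S. \<exists>Q \<in> narrow_cuts V x. Q \<inter> S = {e}}"

definition lonely_cuts ::
  "'v set \<Rightarrow> ('v set \<Rightarrow> real) \<Rightarrow> 'v set set \<Rightarrow> 'v set set \<Rightarrow> 'v set set set" where
  "lonely_cuts V x S L = {Q \<in> narrow_cuts V x. \<exists>e\<in>L. Q \<inter> S = {e}}"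

definition lonely_edge :: "'v set set \<Rightarrow> 'v set set \<Rightarrow> 'v set" where
  "lonely_edge S Q = the_elem (Q \<inter> S)"

definition layered_tree ::
  "'v set \<Rightarrow> ('v set \<Rightarrow> real) \<Rightarrow> 'v set set \<Rightarrow> 'v set set \<Rightarrow> bool" where
  "layered_tree V x S L \<longleftrightarrow>
     (\<forall>Q \<in> lonely_cuts V x S L. \<forall>Q' \<in> narrow_cuts V x. sum x Q' \<le> sum x Q \<longrightarrow> Q' \<in> lonely_cuts V x S L)"

text \<open>The vector \<open>x\<^sup>Q\<close>, with the probability under the coefficients written out as a sum.\<close>

definition lonely_vec ::
  "'v set \<Rightarrow> ('v set \<Rightarrow> real) \<Rightarrow> nat \<Rightarrow> (nat \<Rightarrow> real) \<Rightarrow> (nat \<Rightarrow> 'v set set) \<Rightarrow> (nat \<Rightarrow> 'v set set)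
     \<Rightarrow> 'v set set \<Rightarrow> 'v set \<Rightarrow> real" where
  "lonely_vec V x n lam S L Q e =
     (\<Sum>i | i < n \<and> Q \<in> lonely_cuts V x (S i) (L i) \<and> lonely_edge (S i) Q = e. lam i)"

definition tree_combination ::
  "'v set \<Rightarrow> ('v set \<Rightarrow> real) \<Rightarrow> nat \<Rightarrow> (nat \<Rightarrow> real) \<Rightarrow> (nat \<Rightarrow> 'v set set) \<Rightarrow> (nat \<Rightarrow> 'v set set)
     \<Rightarrow> bool" where
  "tree_combination V x n lam S L \<longleftrightarrow>
     (\<forall>i<n. 0 < lam i \<and> is_spanning_tree V id (supp_edges V x) (S i) \<and>
        L i \<subseteq> lonely_candidates V x (S i)) \<and>
     (\<Sum>i<n. lam i) = 1"

definition layered_combination ::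
  "'v set \<Rightarrow> ('v set \<Rightarrow> real) \<Rightarrow> nat \<Rightarrow> (nat \<Rightarrow> real) \<Rightarrow> (nat \<Rightarrow> 'v set set) \<Rightarrow> (nat \<Rightarrow> 'v set set)
     \<Rightarrow> bool" where
  "layered_combination V x n lam S L \<longleftrightarrow>
     tree_combination V x n lam S L \<and>
     (\<forall>e \<in> supp_edges V x. (\<Sum>i<n. lam i * of_bool (e \<in> S i)) = x e) \<and>
     (\<forall>Q \<in> narrow_cuts V x. sum (lonely_vec V x n lam S L Q) Q = 2 - sum x Q) \<and>
     (\<forall>i<n. layered_tree V x (S i) (L i))"


section \<open>Best-of-Many With Deletion\<close>

definition bomd_gamma :: real where
  "bomd_gamma = 1 / 16"

text \<open>The vector \<open>y\<^sub>F\<close> for the \<open>i\<close>-th tree of the family, \<open>F = S i - L i\<close>.\<close>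

definition y_vec ::
  "'v set \<Rightarrow> 'v \<Rightarrow> 'v \<Rightarrow> ('v set \<Rightarrow> real) \<Rightarrow> nat \<Rightarrow> (nat \<Rightarrow> real) \<Rightarrow> (nat \<Rightarrow> 'v set set)
     \<Rightarrow> (nat \<Rightarrow> 'v set set) \<Rightarrow> nat \<Rightarrow> 'v set \<Rightarrow> real" where
  "y_vec V s t x n lam S L i e =
     x e / 2
     + bomd_gamma * of_bool (e \<in> tree_path V (S i) s t)
     + (\<Sum>Q | Q \<in> lonely_cuts V x (S i) (L i) \<and> sum x Q < 2 - 2 * bomd_gamma.
          (1 - sum x Q / 2 - bomd_gamma) * of_bool (lonely_edge (S i) Q = e))
     + (\<Sum>Q | Q \<in> narrow_cuts V x \<and> sum x Q < 2 - 2 * bomd_gamma \<and>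
              2 \<le> card (Q \<inter> (S i - L i)) \<and> even (card (Q \<inter> (S i - L i))).
          (1 - sum x Q / 2 - bomd_gamma) / (2 - sum x Q) * lonely_vec V x n lam S L Q e)"

text \<open>
  Writing \<open>y\<close> as a convex combination of joins refers to the join polyhedron, the convex hull of
  the joins plus the nonnegative orthant: a vector in it need not lie in the convex hull of the
  joins themselves, so \<open>y\<close> is only required to dominate the convex combination.
\<close>

definition join_combination ::
  "'v set \<Rightarrow> 'v set set \<Rightarrow> 'v set \<Rightarrow> ('v set \<Rightarrow> real) \<Rightarrow> nat \<Rightarrow> (nat \<Rightarrow> real) \<Rightarrow> (nat \<Rightarrow> 'v set set)
     \<Rightarrow> bool" where
  "join_combination V E T y m mu J \<longleftrightarrow>
     (\<forall>j<m. 0 < mu j \<and> is_join V E T (J j)) \<and>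
     (\<Sum>j<m. mu j) = 1 \<and>
     (\<forall>e\<in>E. (\<Sum>j<m. mu j * of_bool (e \<in> J j)) \<le> y e)"

text \<open>
  The algorithm is nondeterministic (choice of the convex combinations, ties between minimizers),
  so its steps are relations between inputs and possible results. In \<open>bomd_first\<close> and
  \<open>bomd_output\<close> the number \<open>k\<close> bounds the number of joins in each convex combination.
\<close>

definition bomd_first ::
  "nat \<Rightarrow> 'v set \<Rightarrow> 'v \<Rightarrow> 'v \<Rightarrow> ('v set \<Rightarrow> real) \<Rightarrow> ('v set \<Rightarrow> real) \<Rightarrow> nat \<Rightarrow> (nat \<Rightarrow> real)
     \<Rightarrow> (nat \<Rightarrow> 'v set set) \<Rightarrow> (nat \<Rightarrow> 'v set set) \<Rightarrow> nat \<Rightarrow> 'v set multiset \<Rightarrow> bool" where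
  "bomd_first k V s t c x n lam S L i P \<longleftrightarrow>
     (let E = supp_edges V x;
          F = S i - L i;
          T = sym_diff (odd_verts V (mset_set F)) (sym_diff {s} {t})
      in \<exists>m mu J D. m \<le> k \<and> join_combination V E T (y_vec V s t x n lam S L i) m mu J \<and>
           (\<forall>j<m. is_min_spanning_tree (contracted_verts V (F \<union> J j)) (contracted_ends V (F \<union> J j))
                     E c (D j)) \<and>
           (let cand = (\<lambda>j. mset_set F + mset_set (J j) + repeat_mset 2 (mset_set (D j)))
            in \<exists>j<m. P = cand j \<and> (\<forall>j'<m. tour_cost c (cand j) \<le> tour_cost c (cand j'))))"

definition bomd_second ::
  "'v set \<Rightarrow> 'v \<Rightarrow> 'v \<Rightarrow> ('v set \<Rightarrow> real) \<Rightarrow> ('v set \<Rightarrow> real) \<Rightarrow> 'v set set \<Rightarrow> 'v set multiset \<Rightarrow> bool" where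
  "bomd_second V s t c x S P \<longleftrightarrow>
     (\<exists>J. is_min_join V (supp_edges V x) c
            (sym_diff (odd_verts V (mset_set S)) (sym_diff {s} {t})) J \<and>
          P = mset_set S + mset_set J)"

definition bomd_output ::
  "nat \<Rightarrow> 'v set \<Rightarrow> 'v \<Rightarrow> 'v \<Rightarrow> ('v set \<Rightarrow> real) \<Rightarrow> ('v set \<Rightarrow> real) \<Rightarrow> nat \<Rightarrow> (nat \<Rightarrow> real)
     \<Rightarrow> (nat \<Rightarrow> 'v set set) \<Rightarrow> (nat \<Rightarrow> 'v set set) \<Rightarrow> 'v set multiset \<Rightarrow> bool" where
  "bomd_output k V s t c x n lam S L R \<longleftrightarrow>
     (\<exists>P1 P2. (\<forall>i<n. bomd_first k V s t c x n lam S L i (P1 i) \<and> bomd_second V s t c x (S i) (P2 i)) \<and>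
        R \<in> P1 ` {..<n} \<union> P2 ` {..<n} \<and>
        (\<forall>R' \<in> P1 ` {..<n} \<union> P2 ` {..<n}. tour_cost c R \<le> tour_cost c R'))"

end

theory Submission
  imports Defs
begin

text \<open>
  Only feasibility of \<open>x\<close> and \<open>c \<ge> 0\<close> matter. The LP forces \<open>s \<noteq> t\<close>, and the narrow cuts form a
  chain \<open>Q 1, \<dots>, Q p\<close>; \<open>lev v\<close> is the number of narrow cuts separating \<open>v\<close> from \<open>s\<close>, and
  \<open>x (Q i) = 1 + nu i\<close>.

  For a layered combination it suffices to write \<open>x\<close> as a combination of spanning trees of which the \<open>k\<close>-th meets
  every cut whose threshold exceeds \<open>k\<close> in one edge. By Farkas' lemma and a greedy argument
  this amounts to a rank inequality: \<open>x (E - A)\<close> is at least the weighted sum of the rank deficits of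
  \<open>A\<close> with respect to the matroids of these trees. It is shown by induction over intervals of levels,
  splitting an interval at the cut with the largest threshold; a minimal counterexample cannot be
  enlarged to a full interval, which determines how its edges cross the cuts.

  For the cost, \<open>y\<^sub>F\<close> lies in the dominant of the join polytope (a common tight cut of all minimum
  joins gives the Edmonds-Johnson description by induction). By Kruskal's algorithm, the average cost of
  reconnecting is at most \<open>\<Sum> (1/2 - lambda\<^sub>Q/2) c (e\<^sub>Q)\<close> over the lonely cuts, \<open>lambda\<^sub>Q = 2 - x (Q)\<close>,
  because the superfluous components are charged to join edges crossing two consecutive lonely cuts.
  With \<open>\<gamma> = 1/16\<close> the corrections of \<open>y\<^sub>F\<close> are paid for by the deleted edges, as
  \<open>(lambda - 1/4)\<^sup>2 \<ge> 0\<close>; averaging with weights \<open>16/17\<close> and \<open>1/17\<close> cancels the cost of the paths.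
\<close>

section \<open>Connectivity and parity\<close>

text \<open>Deleting a lonely edge saves its cost but disconnects the tree and changes the parity of
  its cut, so deletions pay only if every cut is lonely with the right probability and nested lonely
  cuts are reconnected cheaply. Slicing the unit interval at the distinct values
  \<open>2 - x (Q i)\<close> serves both: a tree of slice \<open>k\<close> must meet each cut
  reaching above that slice in one edge. Such trees are the bases of a matroid, a direct sum of
  graphic matroids between these cuts and one rank-one matroid per cut, and bases of several
  matroids have to average to \<open>x\<close>. The obstacle is that the rank inequality is not
  inherited by intervals of levels, where \<open>x\<close> weighs less than a tree. The inductive
  claim therefore subtracts \<open>slack\<close>, but only for disconnected edge sets, and it is
  made for all smaller thresholds too, so that a cut can be switched off. Only one configuration
  resists: a single merge across the splitting cut with heavy edges in \<open>A\<close>. The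
  constant \<open>1/16\<close> is the maximum of \<open>lambda / 2 - lambda\<^sup>2\<close>,
  attained at \<open>1/4\<close>: the saving \<open>lambda\<close> per unit of lonely cost then just
  covers the corrections.\<close>

definition conn :: "'v set set \<Rightarrow> 'v \<Rightarrow> 'v \<Rightarrow> bool" where
  "conn H u v \<longleftrightarrow> (u, v) \<in> (adj_rel id H)\<^sup>*"

definition oddv :: "'v set \<Rightarrow> 'v set set \<Rightarrow> 'v set" where
  "oddv V H = {v \<in> V. odd (card {e \<in> H. v \<in> e})}"

lemma conn_refl [simp]: "conn H u u"
  by (simp add: conn_def)

lemma conn_trans [trans]: "conn H u v \<Longrightarrow> conn H v w \<Longrightarrow> conn H u w"
  by (auto simp: conn_def)

lemma adj_rel_id_iff: "(u, v) \<in> adj_rel id H \<longleftrightarrow> {u, v} \<in> H"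
  by (auto simp: adj_rel_def)

lemma sym_adj_rel: "sym (adj_rel ends H)"
  by (auto simp: sym_def adj_rel_def insert_commute)

lemma conn_sym: "conn H u v \<Longrightarrow> conn H v u"
  unfolding conn_def by (meson sym_adj_rel sym_rtrancl symD)

lemma conn_edge: "{u, v} \<in> H \<Longrightarrow> conn H u v"
  by (auto simp: conn_def adj_rel_id_iff)

lemma adj_rel_mono: "H \<subseteq> H' \<Longrightarrow> adj_rel ends H \<subseteq> adj_rel ends H'"
  by (auto simp: adj_rel_def)

lemma conn_mono: "conn H u v \<Longrightarrow> H \<subseteq> H' \<Longrightarrow> conn H' u v"
  unfolding conn_def using rtrancl_mono[OF adj_rel_mono] by blast

lemma conn_induct [consumes 1, case_names refl step]:
  assumes "conn H u v" "P u"
    "\<And>w z. conn H u w \<Longrightarrow> {w, z} \<in> H \<Longrightarrow> P w \<Longrightarrow> P z"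
  shows "P v"
  using assms(1) unfolding conn_def
proof (induction rule: rtrancl_induct)
  case base then show ?case using assms(2) .
next
  case (step y z)
  then show ?case using assms(3)[of y z] by (auto simp: conn_def adj_rel_id_iff)
qed

lemma conn_closed:
  assumes "conn H u v" "u \<in> Z" "\<And>w z. w \<in> Z \<Longrightarrow> {w, z} \<in> H \<Longrightarrow> z \<in> Z"
  shows "v \<in> Z"
  using assms by (induction rule: conn_induct) auto

lemma vpairsD:
  assumes "e \<in> vpairs V"
  obtains u v where "e = {u, v}" "u \<noteq> v" "u \<in> V" "v \<in> V"
  using assms by (auto simp: vpairs_def card_2_iff)

lemma vpairs_iff: "{u, v} \<in> vpairs V \<longleftrightarrow> u \<noteq> v \<and> u \<in> V \<and> v \<in> V"
  by (auto simp: vpairs_def card_2_iff doubleton_eq_iff)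

lemma finite_vpairs: "finite V \<Longrightarrow> finite (vpairs V)"
  unfolding vpairs_def by (rule finite_subset[of _ "Pow V"]) auto

lemma conn_in:
  assumes "conn H u v" "H \<subseteq> vpairs V" "u \<in> V"
  shows "v \<in> V"
  using assms(1)
proof (rule conn_closed)
  fix w z assume "{w, z} \<in> H"
  then have "{w, z} \<in> vpairs V" using assms(2) by blast
  then show "z \<in> V" by (simp add: vpairs_iff)
qed (use assms in simp)

lemma cut_edges_pair_iff:
  "{u, v} \<in> cut_edges V U \<longleftrightarrow> (u \<in> U \<and> v \<in> V - U) \<or> (v \<in> U \<and> u \<in> V - U)"
  by (auto simp: cut_edges_def doubleton_eq_iff)

lemma cut_edges_subset: "U \<subseteq> V \<Longrightarrow> cut_edges V U \<subseteq> vpairs V"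
  by (auto simp: cut_edges_def vpairs_iff)

lemma cut_edges_compl: "U \<subseteq> V \<Longrightarrow> cut_edges V (V - U) = cut_edges V U"
  by (auto simp: cut_edges_def doubleton_eq_iff)

lemma even_card_sym_diff:
  assumes "finite A" "finite B"
  shows "even (card (sym_diff A B)) \<longleftrightarrow> (even (card A) \<longleftrightarrow> even (card B))"
proof -
  have "card A = card (A \<inter> B) + card (A - B)"
    using card_Int_Diff assms(1) .
  moreover have "card B = card (A \<inter> B) + card (B - A)"
    using card_Int_Diff[OF assms(2), of A] by (simp add: inf_commute)
  moreover have "card (sym_diff A B) = card (A - B) + card (B - A)"
    by (rule card_Un_disjoint) (use assms in auto)
  ultimately show ?thesis by auto
qed

lemma oddv_sym_diff:
  assumes "finite H" "finite H'"
  shows "oddv V (sym_diff H H') = sym_diff (oddv V H) (oddv V H')"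
proof -
  have "odd (card {e \<in> sym_diff H H'. v \<in> e}) \<longleftrightarrow>
      odd (card {e \<in> H. v \<in> e}) \<noteq> odd (card {e \<in> H'. v \<in> e})" for v
  proof -
    have "{e \<in> sym_diff H H'. v \<in> e} = sym_diff {e \<in> H. v \<in> e} {e \<in> H'. v \<in> e}" by auto
    then show ?thesis using even_card_sym_diff[of "{e \<in> H. v \<in> e}" "{e \<in> H'. v \<in> e}"] assms by auto
  qed
  then show ?thesis by (auto simp: oddv_def)
qed

lemma oddv_empty [simp]: "oddv V {} = {}"
  by (auto simp: oddv_def)

lemma oddv_subset: "oddv V H \<subseteq> V"
  by (auto simp: oddv_def)

lemma oddv_single: "e \<subseteq> V \<Longrightarrow> oddv V {e} = e"
proof -
  assume "e \<subseteq> V"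
  have "{e' \<in> {e}. v \<in> e'} = (if v \<in> e then {e} else {})" for v by auto
  then show ?thesis using \<open>e \<subseteq> V\<close> by (auto simp: oddv_def)
qed

lemma odd_verts_mset_set:
  assumes "finite H" shows "odd_verts V (mset_set H) = oddv V H"
  using assms by (simp add: odd_verts_def oddv_def filter_mset_mset_set)

text \<open>The handshake lemma modulo 2: adding an edge toggles both of its ends, hence changes the
  parity inside \<open>U\<close> exactly when the edge leaves \<open>U\<close>. The parity arguments
  on joins, paths and cuts below are instances of this.\<close>

lemma oddv_cut_parity:
  assumes "finite H" "H \<subseteq> vpairs V" "finite V" "U \<subseteq> V"
  shows "even (card (oddv V H \<inter> U)) \<longleftrightarrow> even (card (H \<inter> cut_edges V U))"
  using assms(1,2)
proof (induction H rule: finite_induct)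
  case empty then show ?case by simp
next
  case (insert e H)
  have e: "e \<in> vpairs V" and fin: "finite U" using insert assms finite_subset by auto
  have "oddv V (insert e H) = sym_diff (oddv V H) e"
    using oddv_sym_diff[of H "{e}" V] insert oddv_single[of e V] e by (auto simp: vpairs_def)
  then have "oddv V (insert e H) \<inter> U = sym_diff (oddv V H \<inter> U) (e \<inter> U)" by auto
  then have 1: "even (card (oddv V (insert e H) \<inter> U)) \<longleftrightarrow> (even (card (H \<inter> cut_edges V U)) \<longleftrightarrow> even (card (e \<inter> U)))"
    using even_card_sym_diff[of "oddv V H \<inter> U" "e \<inter> U"] insert fin by auto
  obtain u v where uv: "e = {u, v}" "u \<noteq> v" "u \<in> V" "v \<in> V" using e by (rule vpairsD)
  have 2: "odd (card (e \<inter> U)) \<longleftrightarrow> e \<in> cut_edges V U"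
    using uv by (auto simp: cut_edges_pair_iff Int_insert_left)
  show ?case
  proof (cases "e \<in> cut_edges V U")
    case True
    then have "insert e H \<inter> cut_edges V U = insert e (H \<inter> cut_edges V U)" by auto
    then show ?thesis using 1 2 insert True by auto
  next
    case False
    then have "insert e H \<inter> cut_edges V U = H \<inter> cut_edges V U" by auto
    then show ?thesis using 1 2 insert False by auto
  qed
qed

text \<open>The edges of a walk are toggled rather than collected, so no simple path has to be
  extracted.\<close>

lemma join_in_conn:
  assumes "conn H u v" "H \<subseteq> vpairs V" "finite H" "u \<in> V"
  shows "\<exists>J\<subseteq>H. oddv V J = sym_diff {u} {v}"
  using assms(1)
proof (induction rule: conn_induct)
  case refl then show ?case by (intro exI[of _ "{}"]) auto
next
  case (step w z)
  then obtain J where J: "J \<subseteq> H" "oddv V J = sym_diff {u} {w}" by auto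
  have "{w, z} \<in> vpairs V" using step(2) assms(2) by blast
  then have wz: "w \<noteq> z" "w \<in> V" "z \<in> V" by (auto simp: vpairs_iff)
  have "oddv V (sym_diff J {{w, z}}) = sym_diff (sym_diff {u} {w}) {w, z}"
    using oddv_sym_diff[of J "{{w,z}}" V] oddv_single[of "{w,z}" V] J(2) wz finite_subset[OF J(1) assms(3)] by simp
  also have "\<dots> = sym_diff {u} {z}" using wz by auto
  finally show ?case using J step by (intro exI[of _ "sym_diff J {{w, z}}"]) auto
qed

definition ccomp :: "'v set set \<Rightarrow> 'v \<Rightarrow> 'v set" where
  "ccomp H u = {v. conn H u v}"

lemma ccomp_cut:
  assumes "H \<subseteq> vpairs V"
  shows "H \<inter> cut_edges V (ccomp H u) = {}"
  using assms by (auto simp: cut_edges_def ccomp_def dest: conn_edge intro: conn_trans)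

text \<open>No edge of \<open>J\<close> leaves the component of \<open>u\<close>, so by parity this
  component contains an even number of odd vertices; since it contains \<open>u\<close>, it also
  contains \<open>v\<close>.\<close>

lemma conn_of_join:
  assumes "oddv V J = {u, v}" "J \<subseteq> vpairs V" "finite V"
  shows "conn J u v"
proof (rule ccontr)
  assume n: "\<not> conn J u v"
  have u: "u \<in> V" using assms(1) oddv_subset[of V J] by blast
  have sub: "ccomp J u \<subseteq> V" using conn_in[OF _ assms(2) u] by (auto simp: ccomp_def)
  have "oddv V J \<inter> ccomp J u = {u}" using assms n by (auto simp: ccomp_def)
  then show False
    using oddv_cut_parity[of J V "ccomp J u"] ccomp_cut[of J V u] assms sub
      finite_subset[OF assms(2) finite_vpairs] by simp
qed

lemma conn_insert:
  assumes "conn (insert {a, b} H) u v" "\<not> conn H u v"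
  shows "conn H u a \<and> conn H b v \<or> conn H u b \<and> conn H a v"
proof -
  have "conn H u v \<or> conn H u a \<and> conn H b v \<or> conn H u b \<and> conn H a v"
    using assms(1)
  proof (induction rule: conn_induct)
    case refl then show ?case by simp
  next
    case (step w z)
    from step(2) consider "{w, z} = {a, b}" | "conn H w z" by (auto dest: conn_edge)
    then show ?case
    proof cases
      case 1 then show ?thesis using step(3) by (auto simp: doubleton_eq_iff)
    next
      case 2 then show ?thesis using step(3) by (meson conn_trans)
    qed
  qed
  then show ?thesis using assms(2) by simp
qed

section \<open>Numbers of components\<close>

definition ncomp :: "'v set \<Rightarrow> 'v set set \<Rightarrow> nat" where
  "ncomp V H = card (contracted_verts V H)"

abbreviation "vcomp \<equiv> component_of_vertex"

lemma vcomp_def: "vcomp V H v = {w \<in> V. conn H v w}"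
  by (simp add: component_of_vertex_def conn_def)

lemma vcomp_eq_iff:
  assumes "v \<in> V"
  shows "vcomp V H u = vcomp V H v \<longleftrightarrow> conn H u v"
  using assms unfolding vcomp_def by (auto intro: conn_trans conn_sym)

lemma finite_contracted_verts: "finite V \<Longrightarrow> finite (contracted_verts V H)"
  by (simp add: contracted_verts_def)

lemma ncomp_ge1: "finite V \<Longrightarrow> V \<noteq> {} \<Longrightarrow> 1 \<le> ncomp V H"
  by (simp add: ncomp_def contracted_verts_def Suc_le_eq card_gt_0_iff)

lemma ncomp_eq1_conn:
  assumes "finite V" "ncomp V H \<le> 1" "u \<in> V" "v \<in> V"
  shows "conn H u v"
proof -
  have "vcomp V H u \<in> contracted_verts V H" "vcomp V H v \<in> contracted_verts V H"
    using assms by (auto simp: contracted_verts_def)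
  then have "vcomp V H u = vcomp V H v"
    using assms finite_contracted_verts[of V H] unfolding ncomp_def by (metis card_le_Suc0_iff_eq One_nat_def)
  then show ?thesis using vcomp_eq_iff assms by metis
qed

lemma conn_ncomp_eq1:
  assumes "V \<noteq> {}" "\<And>u v. u \<in> V \<Longrightarrow> v \<in> V \<Longrightarrow> conn H u v"
  shows "ncomp V H = 1"
proof -
  obtain u where "u \<in> V" using assms by auto
  have "vcomp V H ` V = (\<lambda>_. vcomp V H u) ` V"
    by (rule image_cong) (use vcomp_eq_iff[of u V H] assms(2) \<open>u \<in> V\<close> in auto)
  then have "contracted_verts V H = {vcomp V H u}"
    using \<open>u \<in> V\<close> unfolding contracted_verts_def by auto
  then show ?thesis by (simp add: ncomp_def)
qed

lemma ncomp_empty: "finite V \<Longrightarrow> ncomp V {} = card V"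
  unfolding ncomp_def contracted_verts_def
  by (rule card_image) (auto simp: inj_on_def vcomp_eq_iff conn_def adj_rel_def)

text \<open>At worst, edges inside \<open>U\<close> melt all components meeting \<open>U\<close>
  into one. The additive form avoids truncated subtraction.\<close>

lemma ncomp_drop:
  assumes "finite V" "U \<subseteq> V" "U \<noteq> {}" "\<And>e. e \<in> F \<Longrightarrow> e \<subseteq> U"
  shows "ncomp V H + 1 \<le> ncomp V (H \<union> F) + card (vcomp V H ` U)"
proof -
  let ?A = "contracted_verts V H - vcomp V H ` U"
  obtain u where u: "u \<in> U" using assms by auto
  have keep: "vcomp V (H \<union> F) v = vcomp V H v" if v: "v \<in> V" "vcomp V H v \<notin> vcomp V H ` U" for v
  proof -
    have "conn H v w" if "conn (H \<union> F) v w" for w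
      using that
    proof (induction rule: conn_induct)
      case refl then show ?case by simp
    next
      case (step w z)
      have "{w, z} \<notin> F"
      proof
        assume "{w, z} \<in> F"
        then have "w \<in> U" using assms(4) by auto
        moreover have "vcomp V H v = vcomp V H w" using vcomp_eq_iff[of w V H v] step assms \<open>w \<in> U\<close> by auto
        ultimately show False using v by auto
      qed
      then show ?case using step by (auto intro: conn_trans conn_edge)
    qed
    then show ?thesis unfolding vcomp_def by (auto intro: conn_mono)
  qed
  have "insert (vcomp V (H \<union> F) u) ?A \<subseteq> contracted_verts V (H \<union> F)"
    using keep u assms(2) unfolding contracted_verts_def by fastforce
  moreover have "vcomp V (H \<union> F) u \<notin> ?A"
  proof
    assume "vcomp V (H \<union> F) u \<in> ?A"
    then obtain v where v: "v \<in> V" "vcomp V (H \<union> F) u = vcomp V H v" "vcomp V H v \<notin> vcomp V H ` U"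
      by (auto simp: contracted_verts_def)
    have "u \<in> vcomp V (H \<union> F) u" using u assms by (auto simp: vcomp_def)
    then have "conn H v u" using v by (auto simp: vcomp_def)
    then have "vcomp V H v = vcomp V H u" using vcomp_eq_iff[of u V H v] u assms(2) by auto
    then show False using v u by auto
  qed
  moreover have fin: "finite (contracted_verts V H)" "finite (contracted_verts V (H \<union> F))"
    using finite_contracted_verts[OF assms(1)] by auto
  ultimately have "card ?A + 1 \<le> ncomp V (H \<union> F)"
    unfolding ncomp_def using card_mono[of "contracted_verts V (H \<union> F)"] by (metis Suc_eq_plus1 card_insert_disjoint finite_Diff)
  moreover have "ncomp V H \<le> card ?A + card (vcomp V H ` U)"
  proof -
    have "ncomp V H \<le> card (?A \<union> vcomp V H ` U)" unfolding ncomp_def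
      by (rule card_mono) (use fin finite_subset[OF assms(2,1)] in auto)
    also have "\<dots> \<le> card ?A + card (vcomp V H ` U)" by (rule card_Un_le)
    finally show ?thesis .
  qed
  ultimately show ?thesis by linarith
qed

text \<open>Each component of \<open>H'\<close> on \<open>U\<close> sits inside one component of
  \<open>H\<close>, and this map is onto. The strict version, where the map identifies two
  components, later gains the decisive unit when an interval is already connected from
  outside.\<close>

lemma vcomp_image_le:
  assumes "finite V" "U \<subseteq> V" "\<And>u v. u \<in> U \<Longrightarrow> v \<in> U \<Longrightarrow> conn H' u v \<Longrightarrow> conn H u v"
  shows "card (vcomp V H ` U) \<le> ncomp U H'"
    and "u \<in> U \<Longrightarrow> v \<in> U \<Longrightarrow> conn H u v \<Longrightarrow> \<not> conn H' u v \<Longrightarrow> card (vcomp V H ` U) < ncomp U H'"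
proof -
  have fU: "finite U" using finite_subset[OF assms(2,1)] .
  define g where "g Z = vcomp V H (SOME u. u \<in> U \<and> vcomp U H' u = Z)" for Z
  have g: "g (vcomp U H' u) = vcomp V H u" if "u \<in> U" for u
  proof -
    define r where "r = (SOME u'. u' \<in> U \<and> vcomp U H' u' = vcomp U H' u)"
    have "r \<in> U \<and> vcomp U H' r = vcomp U H' u"
      unfolding r_def by (rule someI[of _ u]) (use that in simp)
    then have r: "r \<in> U" "conn H' r u" using vcomp_eq_iff[OF that] by auto
    then have "conn H r u" using assms(3) that by blast
    moreover have "g (vcomp U H' u) = vcomp V H r" by (simp add: g_def r_def)
    ultimately show ?thesis using vcomp_eq_iff[of u V H r] that assms(2) by auto
  qed
  have im: "g ` contracted_verts U H' = vcomp V H ` U"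
    unfolding contracted_verts_def image_image using g by auto
  have f: "finite (contracted_verts U H')" using fU finite_contracted_verts by auto
  show "card (vcomp V H ` U) \<le> ncomp U H'"
    unfolding ncomp_def im[symmetric] by (rule card_image_le[OF f])
  assume uv: "u \<in> U" "v \<in> U" "conn H u v" "\<not> conn H' u v"
  have "\<not> inj_on g (contracted_verts U H')"
  proof
    assume "inj_on g (contracted_verts U H')"
    moreover have "g (vcomp U H' u) = g (vcomp U H' v)" using g uv vcomp_eq_iff assms by (metis subsetD)
    ultimately have "vcomp U H' u = vcomp U H' v" using uv unfolding inj_on_def contracted_verts_def by blast
    then show False using vcomp_eq_iff uv by metis
  qed
  then show "card (vcomp V H ` U) < ncomp U H'"
    unfolding ncomp_def im[symmetric] using card_image_le[OF f, of g] eq_card_imp_inj_on[OF f, of g] by linarith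
qed

lemma ncomp_antimono:
  assumes "finite V" "H' \<subseteq> H"
  shows "ncomp V H \<le> ncomp V H'"
proof -
  have "vcomp V H ` V = contracted_verts V H" by (simp add: contracted_verts_def)
  then show ?thesis using vcomp_image_le(1)[OF assms(1) subset_refl conn_mono[OF _ assms(2)]] unfolding ncomp_def by simp
qed

lemma ncomp_insert_conn:
  assumes "finite V" "conn H u v"
  shows "ncomp V (insert {u, v} H) = ncomp V H"
proof (rule antisym)
  show "ncomp V (insert {u, v} H) \<le> ncomp V H" using assms ncomp_antimono by blast
  have "conn H a b" if "conn (insert {u, v} H) a b" for a b
    using conn_insert[OF that] assms(2) by (meson conn_trans conn_sym)
  then have "ncomp V (insert {u, v} H) \<ge> card (vcomp V H ` V)" using assms vcomp_image_le(1)[of V V] by blast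
  then show "ncomp V H \<le> ncomp V (insert {u, v} H)" by (simp add: ncomp_def contracted_verts_def)
qed

lemma ncomp_insert_nconn:
  assumes "finite V" "\<not> conn H u v" "u \<in> V" "v \<in> V"
  shows "ncomp V H = ncomp V (insert {u, v} H) + 1"
proof -
  have "ncomp V H + 1 \<le> ncomp V (H \<union> {{u, v}}) + card (vcomp V H ` {u, v})"
    by (rule ncomp_drop) (use assms in auto)
  moreover have "card (vcomp V H ` {u, v}) \<le> 2" by (simp add: card_insert_if)
  moreover have "ncomp V (insert {u, v} H) < ncomp V H"
  proof -
    have "conn (insert {u, v} H) u v" by (rule conn_edge) simp
    then show ?thesis using vcomp_image_le(2)[of V V H "insert {u, v} H" u v] assms conn_mono[of H _ _ "insert {u, v} H"]
      by (auto simp: ncomp_def contracted_verts_def)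
  qed
  ultimately show ?thesis by simp
qed

lemma card_le_ncomp_edges:
  assumes "finite V" "finite H" "H \<subseteq> vpairs V"
  shows "card V \<le> ncomp V H + card H"
  using assms(2,3)
proof (induction H rule: finite_induct)
  case empty then show ?case using assms by (simp add: ncomp_empty)
next
  case (insert e H)
  obtain u v where "e = {u, v}" "u \<in> V" "v \<in> V" using insert by (auto elim: vpairsD)
  then have "ncomp V H \<le> ncomp V (insert e H) + 1"
    using ncomp_insert_conn[of V H u v] ncomp_insert_nconn[of V H u v] assms(1) by (cases "conn H u v") auto
  then show ?case using insert by auto
qed

definition ind :: "'v set set \<Rightarrow> 'v set \<Rightarrow> 'v set set" where
  "ind H W = {e \<in> H. e \<subseteq> W}"

lemma conn_ind:
  assumes "conn H u v" "u \<in> W" "\<And>e. e \<in> H \<Longrightarrow> e \<subseteq> W \<or> e \<inter> W = {}"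
  shows "conn (ind H W) u v \<and> v \<in> W"
  using assms(1)
proof (induction rule: conn_induct)
  case refl then show ?case using assms by simp
next
  case (step w z)
  then have "{w, z} \<subseteq> W" using assms(3)[of "{w, z}"] by auto
  then have "{w, z} \<in> ind H W" using step by (auto simp: ind_def)
  then show ?case using step conn_edge conn_trans \<open>{w, z} \<subseteq> W\<close> by fast
qed

lemma ind_subset: "ind H W \<subseteq> H"
  by (auto simp: ind_def)

lemma ncomp_split:
  assumes "finite V" "V = V1 \<union> V2" "V1 \<inter> V2 = {}" "\<And>e. e \<in> H \<Longrightarrow> e \<subseteq> V1 \<or> e \<subseteq> V2"
  shows "ncomp V H = ncomp V1 (ind H V1) + ncomp V2 (ind H V2)"
proof -
  have c1: "vcomp V H v = vcomp V1 (ind H V1) v" if "v \<in> V1" for v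
    unfolding vcomp_def using conn_ind[of H v _ V1] that assms conn_mono[OF _ ind_subset, of H V1] by blast
  have c2: "vcomp V H v = vcomp V2 (ind H V2) v" if "v \<in> V2" for v
    unfolding vcomp_def using conn_ind[of H v _ V2] that assms conn_mono[OF _ ind_subset, of H V2] by blast
  have "contracted_verts V H = contracted_verts V1 (ind H V1) \<union> contracted_verts V2 (ind H V2)"
    unfolding contracted_verts_def assms(2) image_Un using c1 c2 assms(2) by auto
  moreover have "contracted_verts V1 (ind H V1) \<inter> contracted_verts V2 (ind H V2) = {}"
  proof -
    have "vcomp V1 (ind H V1) v \<noteq> vcomp V2 (ind H V2) w" if "v \<in> V1" "w \<in> V2" for v w
    proof -
      have "v \<in> vcomp V1 (ind H V1) v" "v \<notin> vcomp V2 (ind H V2) w" using that assms(3) by (auto simp: vcomp_def)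
      then show ?thesis by auto
    qed
    then show ?thesis unfolding contracted_verts_def by auto
  qed
  ultimately show ?thesis
    unfolding ncomp_def using assms finite_contracted_verts by (metis card_Un_disjoint finite_Un)
qed

text \<open>The components of \<open>H\<close> partition \<open>V\<close> and each obeys the forest
  inequality; summing turns the \<open>- 1\<close> into the number of components.\<close>

lemma sum_le_card_minus_ncomp:
  fixes x :: "'v set \<Rightarrow> real"
  assumes "finite V" "H \<subseteq> vpairs V"
    and forest: "\<And>W. W \<subseteq> V \<Longrightarrow> W \<noteq> {} \<Longrightarrow> sum x (ind H W) \<le> real (card W) - 1"
  shows "sum x H \<le> real (card V) - real (ncomp V H)"
proof -
  let ?C = "contracted_verts V H"
  have finH: "finite H" using assms finite_vpairs finite_subset by blast
  have sub: "Z \<subseteq> V \<and> Z \<noteq> {}" if "Z \<in> ?C" for Z using that by (auto simp: contracted_verts_def vcomp_def)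
  have dis: "Z \<inter> Z' = {}" if "Z \<in> ?C" "Z' \<in> ?C" "Z \<noteq> Z'" for Z Z'
  proof (rule ccontr)
    assume "Z \<inter> Z' \<noteq> {}"
    then obtain a where a: "a \<in> Z" "a \<in> Z'" by auto
    from that(1,2) obtain u v where uv: "u \<in> V" "v \<in> V" "Z = vcomp V H u" "Z' = vcomp V H v"
      unfolding contracted_verts_def by blast
    then have "conn H u a" "conn H v a" using a by (auto simp: vcomp_def)
    then have "conn H u v" using conn_trans conn_sym by metis
    then show False using uv vcomp_eq_iff[of v V H u] that(3) by simp
  qed
  have cov: "H = (\<Union>Z\<in>?C. ind H Z)"
  proof -
    have "\<exists>Z\<in>?C. e \<subseteq> Z" if "e \<in> H" for e
    proof -
      have "e \<in> vpairs V" using that assms(2) by blast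
      then obtain u v where "e = {u, v}" "u \<in> V" "v \<in> V" by (rule vpairsD)
      then show ?thesis using that
        by (intro bexI[of _ "vcomp V H u"]) (auto simp: vcomp_def contracted_verts_def intro: conn_edge)
    qed
    then show ?thesis by (auto simp: ind_def)
  qed
  have "ind H Z \<inter> ind H Z' = {}" if Z: "Z \<in> ?C" "Z' \<in> ?C" "Z \<noteq> Z'" for Z Z'
  proof -
    have "e \<notin> ind H Z'" if e: "e \<in> ind H Z" for e
    proof -
      have "e \<noteq> {}" using e assms(2) by (auto simp: ind_def vpairs_def)
      then show ?thesis using e dis[OF Z] by (auto simp: ind_def)
    qed
    then show ?thesis by auto
  qed
  then have "sum x (\<Union>Z\<in>?C. ind H Z) = (\<Sum>Z\<in>?C. sum x (ind H Z))"
    using finite_contracted_verts[OF assms(1)] finite_subset[OF ind_subset finH]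
    by (intro sum.UNION_disjoint) auto
  then have "sum x H = (\<Sum>Z\<in>?C. sum x (ind H Z))" using cov by simp
  also have "\<dots> \<le> (\<Sum>Z\<in>?C. real (card Z) - 1)" by (rule sum_mono) (use forest sub in auto)
  also have "\<dots> = real (\<Sum>Z\<in>?C. card Z) - real (ncomp V H)" by (simp add: sum_subtractf ncomp_def)
  also have "(\<Sum>Z\<in>?C. card Z) = card (\<Union>?C)"
    by (rule card_Union_disjoint[symmetric]) (use dis sub finite_subset[OF _ assms(1)] in \<open>auto simp: pairwise_def disjnt_def\<close>)
  also have "\<Union>?C = V" by (auto simp: contracted_verts_def vcomp_def)
  finally show ?thesis .
qed

text \<open>The hypotheses say that \<open>f\<close> behaves like the corank of a matroid: unit
  steps, and a spanned element stays spanned in larger sets. Greedy selection by decreasing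
  \<open>c\<close> then gives one basis that is also a basis of every upper level set of
  \<open>c\<close>. It produces the maximum-weight trees of the decomposition and, with
  \<open>- c\<close>, Kruskal's trees.\<close>

lemma greedy_basis:
  fixes f :: "'e set \<Rightarrow> int" and c :: "'e \<Rightarrow> real"
  assumes "finite S"
    and step: "\<And>e A. e \<in> S \<Longrightarrow> A \<subseteq> S \<Longrightarrow> f (insert e A) = f A \<or> f (insert e A) = f A - 1"
    and cl: "\<And>e A B. e \<in> S \<Longrightarrow> A \<subseteq> B \<Longrightarrow> B \<subseteq> S \<Longrightarrow> f (insert e A) = f A \<Longrightarrow> f (insert e B) = f B"
  shows "\<exists>R\<subseteq>S. f R = f S \<and>
    (\<forall>X\<subseteq>S. (\<forall>e\<in>X. \<forall>e'\<in>S. c e \<le> c e' \<longrightarrow> e' \<in> X) \<longrightarrow> int (card (R \<inter> X)) = f {} - f X)"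
proof -
  have anti: "f (A \<union> D) \<le> f A" if "finite D" "A \<union> D \<subseteq> S" for A D
    using that
  proof (induction D rule: finite_induct)
    case (insert e D)
    then show ?case using step[of e "A \<union> D"] by auto
  qed simp
  define P where "P D R \<longleftrightarrow> R \<subseteq> D \<and> f R = f D \<and>
    (\<forall>X\<subseteq>D. (\<forall>e\<in>X. \<forall>e'\<in>D. c e \<le> c e' \<longrightarrow> e' \<in> X) \<longrightarrow> int (card (R \<inter> X)) = f {} - f X)" for D R
  \<comment> \<open>Ranking by \<open>- c\<close> inserts the elements by decreasing
    \<open>c\<close>. The new element has the least value so far, so an upward closed set containing
    it is everything.\<close>
  have "D \<subseteq> S \<longrightarrow> (\<exists>R. P D R)" if "finite D" for D
    using that
  proof (induction rule: finite_ranking_induct[where f = "\<lambda>e. - c e"])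
    case empty
    have "P {} {}" by (auto simp: P_def)
    then show ?case by blast
  next
    case (insert e D)
    show ?case
    proof (intro impI, cases "e \<in> D")
      case True
      moreover assume "insert e D \<subseteq> S"
      ultimately show "\<exists>R. P (insert e D) R" using insert by (simp add: insert_absorb)
    next
      case new: False
      assume sub: "insert e D \<subseteq> S"
      then obtain R where R: "P D R" using insert by auto
      then have RD: "R \<subseteq> D" "f R = f D" and cr: "int (card R) = f {} - f D"
        using spec[of _ D] by (auto simp: P_def Int_absorb2)
      define R' where "R' = (if f (insert e R) = f R then R else insert e R)"
      have f': "f R' = f (insert e D) \<and> int (card R') = f {} - f (insert e D)"
      proof (cases "f (insert e R) = f R")
        case True
        then have "f (insert e D) = f D" using cl[of e R D] RD sub by auto
        then show ?thesis using True RD cr by (simp add: R'_def)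
      next
        case False
        then have 1: "f (insert e R) = f R - 1" using step[of e R] RD sub by auto
        have "f (insert e R \<union> D) \<le> f (insert e R)" using anti insert(1) RD sub by (metis Un_insert_left insert_mono subset_Un_eq subset_trans)
        moreover have "insert e R \<union> D = insert e D" using RD by auto
        ultimately have "f (insert e D) = f D - 1" using step[of e D] 1 RD sub by auto
        moreover have "e \<notin> R" "finite R" using new RD(1) insert(1) finite_subset[OF RD(1)] by auto
        then have "card R' = card R + 1" using False by (simp add: R'_def)
        ultimately show ?thesis using 1 RD cr False by (simp add: R'_def)
      qed
      have "int (card (R' \<inter> X)) = f {} - f X"
        if X: "X \<subseteq> insert e D" "\<forall>a\<in>X. \<forall>b\<in>insert e D. c a \<le> c b \<longrightarrow> b \<in> X" for X
      proof (cases "e \<in> X")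
        case True
        then have "X = insert e D" using X insert(2) by fastforce
        moreover have "R' \<subseteq> insert e D" using RD by (auto simp: R'_def)
        ultimately show ?thesis using f' by (simp add: Int_absorb2)
      next
        case False
        then have "X \<subseteq> D" "R' \<inter> X = R \<inter> X" using X by (auto simp: R'_def)
        then show ?thesis using R X by (simp add: P_def)
      qed
      then have "P (insert e D) R'" using f' RD by (auto simp: P_def R'_def)
      then show "\<exists>R. P (insert e D) R" by blast
    qed
  qed
  then show ?thesis using assms(1) unfolding P_def by blast
qed

text \<open>A discrete form of integrating \<open>p {c > r}\<close> over \<open>r\<close>:
  subtracting the least positive value \<open>m\<close> from all positive entries splits off
  \<open>m\<close> times the sum of \<open>p\<close> over the support and shrinks the
  support.\<close>

lemma layer_cake_nonneg:
  fixes c p :: "'e \<Rightarrow> real"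
  assumes "finite I" "\<And>i. i \<in> I \<Longrightarrow> 0 \<le> c i"
    and "\<And>r. 0 \<le> r \<Longrightarrow> 0 \<le> sum p {i \<in> I. r < c i}"
  shows "0 \<le> (\<Sum>i\<in>I. p i * c i)"
  using assms(2,3)
proof (induction "card {i \<in> I. 0 < c i}" arbitrary: c rule: less_induct)
  case (less c)
  let ?P = "{i \<in> I. 0 < c i}"
  have finP: "finite ?P" using assms(1) by auto
  show ?case
  proof (cases "?P = {}")
    case True
    then have "p i * c i = 0" if "i \<in> I" for i using less(2)[OF that] that by auto
    then have "(\<Sum>i\<in>I. p i * c i) = 0" by (simp add: sum.neutral)
    then show ?thesis by simp
  next
    case False
    define m where "m = Min (c ` ?P)"
    have m: "m \<in> c ` ?P" "\<And>i. i \<in> ?P \<Longrightarrow> m \<le> c i" using False finP by (auto simp: m_def)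
    then have m0: "0 < m" by auto
    define c' where "c' i = (if 0 < c i then c i - m else 0)" for i
    have pos: "0 \<le> c' i" if "i \<in> I" for i using m(2)[of i] that by (auto simp: c'_def)
    have "{i \<in> I. 0 < c' i} \<subset> ?P"
    proof
      show "{i \<in> I. 0 < c' i} \<subseteq> ?P" by (auto simp: c'_def)
      obtain i where "i \<in> ?P" "c i = m" using m(1) by auto
      then show "{i \<in> I. 0 < c' i} \<noteq> ?P" by (auto simp: c'_def)
    qed
    then have lt: "card {i \<in> I. 0 < c' i} < card ?P" using finP psubset_card_mono by blast
    have "0 \<le> (\<Sum>i\<in>I. p i * c' i)"
    proof (rule less(1)[OF lt pos])
      fix r :: real assume "0 \<le> r"
      then have "{i \<in> I. r < c' i} = {i \<in> I. r + m < c i}" using m0 by (auto simp: c'_def)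
      then show "0 \<le> sum p {i \<in> I. r < c' i}" using less(3)[of "r + m"] \<open>0 \<le> r\<close> m0 by simp
    qed
    moreover have "(\<Sum>i\<in>I. p i * c i) = (\<Sum>i\<in>I. p i * c' i) + m * sum p ?P"
    proof -
      have "(\<Sum>i\<in>I. p i * c i) = (\<Sum>i\<in>I. p i * c' i + (if 0 < c i then m * p i else 0))"
        by (rule sum.cong) (use less(2) in \<open>auto simp: c'_def algebra_simps not_less intro: antisym\<close>)
      also have "\<dots> = (\<Sum>i\<in>I. p i * c' i) + (\<Sum>i\<in>?P. m * p i)"
        using assms(1) by (simp add: sum.distrib sum.inter_filter)
      finally show ?thesis by (simp add: sum_distrib_left)
    qed
    moreover have "0 \<le> sum p ?P" using less(3)[of 0] by simp
    ultimately show ?thesis using m0 by simp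
  qed
qed

section \<open>Conic combinations\<close>

text \<open>Induction on the generators. If \<open>b\<close> is not in the cone of the others, some
  \<open>w\<close> separates it from them and must be negative on \<open>a k\<close>; projecting
  along \<open>a k\<close> onto the hyperplane orthogonal to \<open>w\<close> reduces to one
  generator fewer.\<close>

lemma farkas_cone:
  fixes a :: "'j \<Rightarrow> 'e \<Rightarrow> real" and b :: "'e \<Rightarrow> real"
  assumes "finite J" "finite E"
    and "\<And>w. (\<And>j. j \<in> J \<Longrightarrow> 0 \<le> (\<Sum>e\<in>E. w e * a j e)) \<Longrightarrow> 0 \<le> (\<Sum>e\<in>E. w e * b e)"
  shows "\<exists>mu. (\<forall>j\<in>J. 0 \<le> mu j) \<and> (\<forall>e\<in>E. (\<Sum>j\<in>J. mu j * a j e) = b e)"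
  using assms(1,3)
proof (induction J arbitrary: a b rule: finite_induct)
  case empty
  have "0 \<le> (\<Sum>e\<in>E. - b e * b e)" by (rule empty) simp
  moreover have "(\<Sum>e\<in>E. - b e * b e) = - (\<Sum>e\<in>E. b e * b e)" by (simp add: sum_negf)
  ultimately have "(\<Sum>e\<in>E. b e * b e) = 0" using sum_nonneg[of E "\<lambda>e. b e * b e"] by fastforce
  then have "\<forall>e\<in>E. b e = 0" using sum_nonneg_eq_0_iff[OF assms(2), of "\<lambda>e. b e * b e"] by simp
  then show ?case by auto
next
  case (insert k J)
  show ?case
  proof (cases "\<exists>mu. (\<forall>j\<in>J. 0 \<le> mu j) \<and> (\<forall>e\<in>E. (\<Sum>j\<in>J. mu j * a j e) = b e)")
    case True
    then obtain mu where mu: "\<forall>j\<in>J. 0 \<le> mu j" "\<forall>e\<in>E. (\<Sum>j\<in>J. mu j * a j e) = b e" by auto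
    have "(\<Sum>j\<in>insert k J. (mu(k := 0)) j * a j e) = b e" if "e \<in> E" for e
    proof -
      have "(\<Sum>j\<in>J. (mu(k := 0)) j * a j e) = (\<Sum>j\<in>J. mu j * a j e)"
        by (rule sum.cong) (use insert(2) in auto)
      then show ?thesis using insert(1,2) mu(2) that by simp
    qed
    then show ?thesis using mu by (intro exI[of _ "mu(k := 0)"]) auto
  next
    case False
    define ip where "ip w v = (\<Sum>e\<in>E. w e * v e)" for w v :: "'e \<Rightarrow> real"
    have lin: "ip w (\<lambda>e. v e - r * v' e) = ip w v - r * ip w v'"
      "ip (\<lambda>e. w e - r * w' e) v = ip w v - r * ip w' v" for w w' v v' r
      by (simp_all add: ip_def algebra_simps sum_subtractf sum_distrib_left)
    obtain w where w: "\<And>j. j \<in> J \<Longrightarrow> 0 \<le> ip w (a j)" "ip w b < 0"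
      using insert(3)[of a b] False unfolding ip_def by (metis not_less)
    have wk: "ip w (a k) < 0"
    proof (rule ccontr)
      assume "\<not> ip w (a k) < 0"
      then have "0 \<le> (\<Sum>e\<in>E. w e * b e)" using w(1) by (intro insert(4)) (auto simp: ip_def)
      then show False using w(2) by (simp add: ip_def)
    qed
    \<comment> \<open>Chosen so that \<open>a'\<close> and \<open>b'\<close> are orthogonal to
      \<open>w\<close>.\<close>
    define q where "q v = ip w v / ip w (a k)" for v
    define a' where "a' j e = a j e - q (a j) * a k e" for j e
    define b' where "b' e = b e - q b * a k e" for e
    have "\<exists>mu. (\<forall>j\<in>J. 0 \<le> mu j) \<and> (\<forall>e\<in>E. (\<Sum>j\<in>J. mu j * a' j e) = b' e)"
    proof (rule insert(3))
      fix w' assume nn: "\<And>j. j \<in> J \<Longrightarrow> 0 \<le> (\<Sum>e\<in>E. w' e * a' j e)"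
      define r where "r = ip w' (a k) / ip w (a k)"
      define w2 where "w2 e = w' e - r * w e" for e
      have ip2: "ip w2 v = ip w' v - r * ip w v" for v unfolding w2_def by (rule lin)
      have rel: "ip w' (\<lambda>e. v e - q v * a k e) = ip w2 v" for v
        unfolding lin ip2 q_def r_def by simp
      have "0 \<le> (\<Sum>e\<in>E. w2 e * b e)"
      proof (rule insert(4))
        fix j assume "j \<in> insert k J"
        moreover have "ip w2 (a k) = 0" using wk by (simp add: ip2 r_def)
        moreover have "0 \<le> ip w2 (a j)" if "j \<in> J" using nn[OF that] rel[of "a j"] by (simp add: ip_def a'_def)
        ultimately show "0 \<le> (\<Sum>e\<in>E. w2 e * a j e)" by (auto simp: ip_def)
      qed
      then show "0 \<le> (\<Sum>e\<in>E. w' e * b' e)" using rel[of b] by (simp add: ip_def b'_def)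
    qed
    then obtain mu where mu: "\<forall>j\<in>J. 0 \<le> mu j" "\<And>e. e \<in> E \<Longrightarrow> (\<Sum>j\<in>J. mu j * a' j e) = b' e" by auto
    \<comment> \<open>The multiple of \<open>a k\<close> that undoes the projection. It is
      nonnegative because \<open>ip w b\<close> and \<open>ip w (a k)\<close> are both negative
      while the other generators have nonnegative product with \<open>w\<close>.\<close>
    define m where "m = q b - (\<Sum>j\<in>J. mu j * q (a j))"
    have "m = (ip w b - (\<Sum>j\<in>J. mu j * ip w (a j))) / ip w (a k)"
      by (simp add: m_def q_def diff_divide_distrib sum_divide_distrib)
    moreover have "0 \<le> (\<Sum>j\<in>J. mu j * ip w (a j))" using mu(1) w(1) by (intro sum_nonneg) auto
    ultimately have m: "0 \<le> m" using w(2) wk by (simp add: divide_nonpos_neg)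
    have "(\<Sum>j\<in>insert k J. (mu(k := m)) j * a j e) = b e" if "e \<in> E" for e
    proof -
      have "(\<Sum>j\<in>J. (mu(k := m)) j * a j e) = (\<Sum>j\<in>J. mu j * a j e)"
        by (rule sum.cong) (use insert(2) in auto)
      moreover have "(\<Sum>j\<in>J. mu j * a j e) - (\<Sum>j\<in>J. mu j * q (a j)) * a k e = b e - q b * a k e"
        using mu(2)[OF that] by (simp add: a'_def b'_def algebra_simps sum_subtractf sum_distrib_left)
      ultimately show ?thesis using insert(1,2) by (simp add: m_def algebra_simps)
    qed
    then show ?thesis using mu m by (intro exI[of _ "mu(k := m)"]) auto
  qed
qed

lemma linear_dependence:
  fixes a :: "'j \<Rightarrow> 'e \<Rightarrow> real"
  assumes "finite E" "finite J" "card E < card J"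
  shows "\<exists>\<beta>. (\<exists>j\<in>J. \<beta> j \<noteq> 0) \<and> (\<forall>e\<in>E. (\<Sum>j\<in>J. \<beta> j * a j e) = 0)"
  using assms
proof (induction E arbitrary: J a rule: finite_induct)
  case empty
  then obtain j where "j \<in> J" by fastforce
  then show ?case by (intro exI[of _ "\<lambda>_. 1"]) auto
next
  case (insert e0 E)
  show ?case
  proof (cases "\<forall>j\<in>J. a j e0 = 0")
    case True
    have "card E < card J" using insert by simp
    then obtain \<beta> where "\<exists>j\<in>J. \<beta> j \<noteq> 0" "\<forall>e\<in>E. (\<Sum>j\<in>J. \<beta> j * a j e) = 0" using insert(3)[of J a] insert(4) by auto
    then show ?thesis using True by (intro exI[of _ \<beta>]) auto
  next
    case False
    then obtain k where k: "k \<in> J" "a k e0 \<noteq> 0" by auto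
    define a' where "a' j e = a j e - a j e0 / a k e0 * a k e" for j e
    have "card E < card (J - {k})" using insert k by simp
    then obtain \<beta> where b: "\<exists>j\<in>J - {k}. \<beta> j \<noteq> 0" "\<forall>e\<in>E. (\<Sum>j\<in>J - {k}. \<beta> j * a' j e) = 0"
      using insert(3)[of "J - {k}" a'] insert(4) by auto
    define bk where "bk = - (\<Sum>j\<in>J - {k}. \<beta> j * (a j e0 / a k e0))"
    have eq: "(\<Sum>j\<in>J. (\<beta>(k := bk)) j * a j e) = (\<Sum>j\<in>J - {k}. \<beta> j * a' j e)" for e
    proof -
      have "(\<Sum>j\<in>J. (\<beta>(k := bk)) j * a j e) = bk * a k e + (\<Sum>j\<in>J - {k}. (\<beta>(k := bk)) j * a j e)"
        using insert(4) k by (simp add: sum.remove)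
      also have "(\<Sum>j\<in>J - {k}. (\<beta>(k := bk)) j * a j e) = (\<Sum>j\<in>J - {k}. \<beta> j * a j e)"
        by (rule sum.cong) auto
      finally show ?thesis
        by (simp add: bk_def a'_def algebra_simps sum_subtractf sum_distrib_left sum_distrib_right)
    qed
    have "a' j e0 = 0" for j using k by (simp add: a'_def)
    then show ?thesis using b eq by (intro exI[of _ "\<beta>(k := bk)"]) auto
  qed
qed

text \<open>With more generators than coordinates, a linear dependence allows the coefficients to
  move until one of them vanishes. This keeps the numbers of trees and of joins linear in
  \<open>card E\<close>.\<close>

lemma caratheodory_cone:
  fixes a :: "'j \<Rightarrow> 'e \<Rightarrow> real"
  assumes "finite E" "finite J" "\<And>j. j \<in> J \<Longrightarrow> 0 \<le> mu j"
  shows "\<exists>J'\<subseteq>J. card J' \<le> card E \<and> (\<exists>mu'. (\<forall>j\<in>J'. 0 < mu' j) \<and>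
    (\<forall>e\<in>E. (\<Sum>j\<in>J'. mu' j * a j e) = (\<Sum>j\<in>J. mu j * a j e)))"
  using assms(2,3)
proof (induction "card J" arbitrary: J mu rule: less_induct)
  case less
  show ?case
  proof (cases "\<exists>k\<in>J. mu k = 0")
    case True
    then obtain k where k: "k \<in> J" "mu k = 0" by auto
    have IH: "\<exists>J'\<subseteq>J - {k}. card J' \<le> card E \<and> (\<exists>mu'. (\<forall>j\<in>J'. 0 < mu' j) \<and>
      (\<forall>e\<in>E. (\<Sum>j\<in>J'. mu' j * a j e) = (\<Sum>j\<in>J - {k}. mu j * a j e)))"
      by (rule less(1)) (use k less(2,3) card_Diff1_less[OF less(2) k(1)] in auto)
    have eq: "(\<Sum>j\<in>J. mu j * a j e) = (\<Sum>j\<in>J - {k}. mu j * a j e)" for e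
      using k less(2) by (simp add: sum.remove)
    obtain J' mu' where J': "J' \<subseteq> J - {k}" "card J' \<le> card E" "\<forall>j\<in>J'. 0 < mu' j"
      "\<forall>e\<in>E. (\<Sum>j\<in>J'. mu' j * a j e) = (\<Sum>j\<in>J - {k}. mu j * a j e)" using IH by blast
    show ?thesis by (intro exI[of _ J'] conjI exI[of _ mu']) (use J' eq in auto)
  next
    case False
    then have pos: "0 < mu j" if "j \<in> J" for j using less(3)[OF that] that by fastforce
    show ?thesis
    proof (cases "card J \<le> card E")
      case True then show ?thesis using pos by auto
    next
      case False
      then obtain \<beta>0 where b0: "\<exists>j\<in>J. \<beta>0 j \<noteq> 0" "\<forall>e\<in>E. (\<Sum>j\<in>J. \<beta>0 j * a j e) = 0"
        using linear_dependence[OF assms(1) less(2), of a] by auto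
      obtain \<beta> where b: "\<exists>j\<in>J. 0 < \<beta> j" "\<forall>e\<in>E. (\<Sum>j\<in>J. \<beta> j * a j e) = 0"
      proof (cases "\<exists>j\<in>J. 0 < \<beta>0 j")
        case True then show ?thesis using b0 that by blast
      next
        case False
        then have "\<exists>j\<in>J. 0 < - \<beta>0 j" using b0(1) by (metis neg_0_less_iff_less not_less_iff_gr_or_eq)
        moreover have "\<forall>e\<in>E. (\<Sum>j\<in>J. - \<beta>0 j * a j e) = 0" using b0(2) by (simp add: sum_negf)
        ultimately show ?thesis using that[of "\<lambda>j. - \<beta>0 j"] by blast
      qed
      define R where "R = (\<lambda>j. mu j / \<beta> j) ` {j \<in> J. 0 < \<beta> j}"
      have R: "finite R" "R \<noteq> {}" using less(2) b(1) by (auto simp: R_def)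
      define r where "r = Min R"
      obtain k where k: "k \<in> J" "0 < \<beta> k" "r = mu k / \<beta> k" using Min_in[OF R] by (auto simp: R_def r_def)
      have rpos: "0 < r" using k pos by simp
      have nn: "0 \<le> mu j - r * \<beta> j" if "j \<in> J" for j
      proof (cases "0 < \<beta> j")
        case True
        then have "r \<le> mu j / \<beta> j" using Min_le[OF R(1)] that by (auto simp: R_def r_def)
        then show ?thesis using True by (simp add: field_simps)
      next
        case False
        then have "r * \<beta> j \<le> 0" using rpos by (simp add: mult_nonneg_nonpos)
        then show ?thesis using pos[OF that] by simp
      qed
      have zk: "mu k - r * \<beta> k = 0" using k by simp
      have IH: "\<exists>J'\<subseteq>J - {k}. card J' \<le> card E \<and> (\<exists>mu'. (\<forall>j\<in>J'. 0 < mu' j) \<and>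
        (\<forall>e\<in>E. (\<Sum>j\<in>J'. mu' j * a j e) = (\<Sum>j\<in>J - {k}. (mu j - r * \<beta> j) * a j e)))"
        by (rule less(1)) (use k less(2) nn card_Diff1_less[OF less(2) k(1)] in auto)
      have "(\<Sum>j\<in>J - {k}. (mu j - r * \<beta> j) * a j e) = (\<Sum>j\<in>J. mu j * a j e)" if "e \<in> E" for e
      proof -
        have "(\<Sum>j\<in>J - {k}. (mu j - r * \<beta> j) * a j e) = (\<Sum>j\<in>J. (mu j - r * \<beta> j) * a j e)"
          using k zk less(2) by (simp add: sum.remove)
        also have "\<dots> = (\<Sum>j\<in>J. mu j * a j e) - r * (\<Sum>j\<in>J. \<beta> j * a j e)"
          by (simp add: algebra_simps sum_subtractf sum_distrib_left)
        finally show ?thesis using b that by simp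
      qed
      note eq = this
      obtain J' mu' where J': "J' \<subseteq> J - {k}" "card J' \<le> card E" "\<forall>j\<in>J'. 0 < mu' j"
        "\<forall>e\<in>E. (\<Sum>j\<in>J'. mu' j * a j e) = (\<Sum>j\<in>J - {k}. (mu j - r * \<beta> j) * a j e)" using IH by blast
      show ?thesis by (intro exI[of _ J'] conjI exI[of _ mu']) (use J' eq in auto)
    qed
  qed
qed

lemma cone_combination:
  fixes a :: "'j \<Rightarrow> 'e \<Rightarrow> real"
  assumes "finite J" "finite E"
    and "\<And>w. (\<And>j. j \<in> J \<Longrightarrow> 0 \<le> (\<Sum>e\<in>E. w e * a j e)) \<Longrightarrow> 0 \<le> (\<Sum>e\<in>E. w e * b e)"
  obtains J' mu where "J' \<subseteq> J" "card J' \<le> card E" "\<And>j. j \<in> J' \<Longrightarrow> 0 < mu j"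
    "\<And>e. e \<in> E \<Longrightarrow> (\<Sum>j\<in>J'. mu j * a j e) = b e"
proof -
  obtain mu where mu: "\<forall>j\<in>J. 0 \<le> mu j" "\<forall>e\<in>E. (\<Sum>j\<in>J. mu j * a j e) = b e"
    using farkas_cone[of J E a b] assms by blast
  obtain J' mu' where "J' \<subseteq> J" "card J' \<le> card E" and p: "\<forall>j\<in>J'. 0 < mu' j" "\<forall>e\<in>E. (\<Sum>j\<in>J'. mu' j * a j e) = (\<Sum>j\<in>J. mu j * a j e)"
    using caratheodory_cone[OF assms(2,1), of mu a] mu(1) by blast
  then show ?thesis using mu(2) p by (intro that[of J' mu']) auto
qed

lemma convex_combination_below:
  fixes y :: "'e \<Rightarrow> real" and \<J> :: "'e set set"
  assumes "finite E" "finite \<J>" "\<And>J. J \<in> \<J> \<Longrightarrow> J \<subseteq> E"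
    and "\<And>w. (\<And>e. e \<in> E \<Longrightarrow> 0 \<le> w e) \<Longrightarrow> \<exists>J\<in>\<J>. sum w J \<le> (\<Sum>e\<in>E. w e * y e)"
  shows "\<exists>m mu J. m \<le> card E + 1 \<and> (\<forall>j<m. 0 < mu j \<and> J j \<in> \<J>) \<and> (\<Sum>j<m. mu j) = (1::real) \<and>
    (\<forall>e\<in>E. (\<Sum>j<m. mu j * of_bool (e \<in> J j)) \<le> y e)"
proof -
  \<comment> \<open>The coordinate \<open>None\<close> records the total weight, and the generators
    \<open>Inr f\<close> are unit vectors that fill the gap between the convex combination and
    \<open>y\<close>.\<close>
  define a :: "'e set + 'e \<Rightarrow> 'e option \<Rightarrow> real" where
    "a g r = (case g of
       Inl J \<Rightarrow> (case r of None \<Rightarrow> 1 | Some e \<Rightarrow> of_bool (e \<in> J))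
     | Inr f \<Rightarrow> (case r of None \<Rightarrow> 0 | Some e \<Rightarrow> of_bool (e = f)))" for g r
  define b where "b r = (case r of None \<Rightarrow> 1 | Some e \<Rightarrow> y e)" for r
  let ?G = "Inl ` \<J> \<union> Inr ` E" and ?R = "insert None (Some ` E)"
  have sumR: "(\<Sum>r\<in>?R. h r) = h None + (\<Sum>e\<in>E. h (Some e))" for h :: "'e option \<Rightarrow> real"
    using assms(1) by (simp add: sum.reindex)
  have fGR: "finite ?G" "finite ?R" using assms(1,2) by auto
  have key: "0 \<le> (\<Sum>r\<in>?R. w r * b r)" if nn: "\<And>g. g \<in> ?G \<Longrightarrow> 0 \<le> (\<Sum>r\<in>?R. w r * a g r)" for w
  proof -
    have "0 \<le> w (Some e)" if "e \<in> E" for e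
    proof -
      have "0 \<le> (\<Sum>r\<in>?R. w r * a (Inr e) r)" using nn that by blast
      also have "\<dots> = (\<Sum>f\<in>E. w (Some f) * of_bool (f = e))" by (simp add: sumR a_def)
      also have "\<dots> = w (Some e)" using that assms(1) by (simp add: of_bool_def sum.delta if_distrib cong: if_cong)
      finally show ?thesis .
    qed
    then obtain J where J: "J \<in> \<J>" "(\<Sum>e\<in>J. w (Some e)) \<le> (\<Sum>e\<in>E. w (Some e) * y e)"
      using assms(4)[of "\<lambda>e. w (Some e)"] by blast
    have "0 \<le> (\<Sum>r\<in>?R. w r * a (Inl J) r)" using nn J by blast
    also have "\<dots> = w None + (\<Sum>e\<in>E. w (Some e) * of_bool (e \<in> J))" by (simp add: sumR a_def)
    also have "(\<Sum>e\<in>E. w (Some e) * of_bool (e \<in> J)) = (\<Sum>e\<in>J. w (Some e))"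
      using assms(1) assms(3)[OF J(1)] by (simp add: of_bool_def if_distrib sum.If_cases Int_absorb1 Collect_mem_eq cong: if_cong)
    finally show ?thesis using J(2) by (simp add: sumR b_def)
  qed
  obtain G mu where G: "G \<subseteq> ?G" "card G \<le> card ?R" "\<And>g. g \<in> G \<Longrightarrow> 0 < mu g"
    "\<And>r. r \<in> ?R \<Longrightarrow> (\<Sum>g\<in>G. mu g * a g r) = b r"
    using cone_combination[OF fGR key] by blast
  define G1 where "G1 = {J. Inl J \<in> G}"
  define G2 where "G2 = {e. Inr e \<in> G}"
  have finG: "finite G" by (rule finite_subset[OF G(1)]) (use assms(1,2) in simp)
  have Gs: "G = Inl ` G1 \<union> Inr ` G2"
  proof -
    have "g \<in> Inl ` G1 \<union> Inr ` G2" if "g \<in> G" for g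
      using that by (cases g) (auto simp: G1_def G2_def)
    then show ?thesis by (auto simp: G1_def G2_def)
  qed
  have fin12: "finite G1" "finite G2"
    using finite_vimageI[OF finG, of Inl] finite_vimageI[OF finG, of Inr]
    by (simp_all add: G1_def G2_def vimage_def)
  have sumG: "(\<Sum>g\<in>G. h g) = (\<Sum>J\<in>G1. h (Inl J)) + (\<Sum>e\<in>G2. h (Inr e))" for h :: "'e set + 'e \<Rightarrow> real"
    unfolding Gs using fin12 by (subst sum.union_disjoint) (auto simp: sum.reindex inj_on_def)
  have c1: "card G1 \<le> card E + 1"
  proof -
    have "card G1 = card (Inl ` G1 :: ('e set + 'e) set)" by (simp add: card_image)
    also have "\<dots> \<le> card G" using finG by (intro card_mono) (auto simp: Gs)
    finally have "card G1 \<le> card G" .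
    moreover have "card ?R = card E + 1" using assms(1) by (simp add: card_image)
    ultimately show ?thesis using G(2) by simp
  qed
  obtain f where f: "bij_betw f {..<card G1} G1" using ex_bij_betw_nat_finite[OF fin12(1)] by (auto simp: atLeast0LessThan)
  have reidx: "(\<Sum>j<card G1. h (f j)) = (\<Sum>J\<in>G1. h J)" for h :: "'e set \<Rightarrow> real"
    using sum.reindex_bij_betw[OF f] by simp
  have "(\<Sum>J\<in>G1. mu (Inl J)) = 1" using G(4)[of None] by (simp add: sumG a_def b_def)
  moreover have "(\<Sum>J\<in>G1. mu (Inl J) * of_bool (e \<in> J)) \<le> y e" if "e \<in> E" for e
  proof -
    have "(\<Sum>J\<in>G1. mu (Inl J) * of_bool (e \<in> J)) + (\<Sum>f\<in>G2. mu (Inr f) * of_bool (e = f)) = y e"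
      using G(4)[of "Some e"] that by (simp add: sumG a_def b_def)
    moreover have "0 \<le> (\<Sum>f\<in>G2. mu (Inr f) * of_bool (e = f))"
      using G(3) by (intro sum_nonneg) (auto simp: G2_def less_imp_le)
    ultimately show ?thesis by simp
  qed
  moreover have "0 < mu (Inl (f j)) \<and> f j \<in> \<J>" if "j < card G1" for j
  proof -
    have "f j \<in> G1" using f that by (auto simp: bij_betw_def)
    then show ?thesis using G(1,3) by (auto simp: G1_def)
  qed
  ultimately show ?thesis using c1 reidx[of "\<lambda>J. mu (Inl J)"] reidx[of "\<lambda>J. mu (Inl J) * of_bool (e \<in> J)" for e]
    by (intro exI[of _ "card G1"] exI[of _ "\<lambda>j. mu (Inl (f j))"] exI[of _ f]) auto
qed

section \<open>The rank inequality\<close>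

text \<open>The part of the LP in which the rank inequality lives: cut \<open>i\<close> separates
  the levels below \<open>i\<close> from the others. \<open>cross2\<close> is an equation because
  the degrees are prescribed: what a layer lacks to the weight of a spanning tree, plus the weight
  jumping over the layer, is determined by the two cuts that bound it.\<close>

locale leveled_graph =
  fixes V :: "'v set" and E :: "'v set set" and x :: "'v set \<Rightarrow> real"
    and lev :: "'v \<Rightarrow> nat" and p :: nat and nu :: "nat \<Rightarrow> real" and n :: nat and w :: "nat \<Rightarrow> real"
  assumes finV: "finite V" and EV: "E \<subseteq> vpairs V" and xnn: "\<And>e. e \<in> E \<Longrightarrow> 0 \<le> x e"
    and lev_le: "\<And>v. v \<in> V \<Longrightarrow> lev v \<le> p" and lev_ex: "\<And>j. j \<le> p \<Longrightarrow> \<exists>v\<in>V. lev v = j"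
    and forest: "\<And>U. U \<subseteq> V \<Longrightarrow> U \<noteq> {} \<Longrightarrow> sum x (ind E U) \<le> real (card U) - 1"
    and cross1: "\<And>i. 1 \<le> i \<Longrightarrow> i \<le> p \<Longrightarrow>
      sum x {e \<in> E. (\<exists>u\<in>e. lev u < i) \<and> (\<exists>u\<in>e. i \<le> lev u)} \<le> 1 + nu i"
    and cross2: "\<And>a b. a < b \<Longrightarrow> b \<le> p + 1 \<Longrightarrow>
      real (card {v \<in> V. a \<le> lev v \<and> lev v < b}) - 1 - sum x (ind E {v \<in> V. a \<le> lev v \<and> lev v < b})
      + sum x {e \<in> E. (\<exists>u\<in>e. lev u < a) \<and> (\<exists>u\<in>e. b \<le> lev u)} = (nu a + nu b) / 2"
    and wpos: "\<And>k. k < n \<Longrightarrow> 0 < w k" and wsum: "(\<Sum>k<n. w k) = 1"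
begin

text \<open>Indices \<open>0\<close> and \<open>p + 1\<close> stand for the two trivial cuts.\<close>

definition Lv :: "nat \<Rightarrow> nat \<Rightarrow> 'v set" where
  "Lv a b = {v \<in> V. a \<le> lev v \<and> lev v < b}"

definition Ein :: "nat \<Rightarrow> nat \<Rightarrow> 'v set set" where
  "Ein a b = ind E (Lv a b)"

definition crosses :: "nat \<Rightarrow> 'v set \<Rightarrow> bool" where
  "crosses j e \<longleftrightarrow> (\<exists>u\<in>e. lev u < j) \<and> (\<exists>u\<in>e. j \<le> lev u)"

definition slack :: "nat \<Rightarrow> nat \<Rightarrow> real" where
  "slack a b = real (card (Lv a b)) - 1 - sum x (Ein a b)"

definition W :: "nat \<Rightarrow> real" where
  "W m = (\<Sum>k<m. w k)"

text \<open>For tree \<open>k\<close> the cuts with \<open>k < t j\<close> are active.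
  \<open>unc\<close> is the graphic part of the matroid, the edges inside the pieces between active
  cuts; \<open>hits\<close> collects the rank-one parts, where an edge counts only if it crosses a
  single active cut.\<close>

definition unc :: "(nat \<Rightarrow> nat) \<Rightarrow> nat \<Rightarrow> 'v set set \<Rightarrow> 'v set set" where
  "unc t k A = {e \<in> A. \<forall>j. crosses j e \<longrightarrow> t j \<le> k}"

definition hits :: "(nat \<Rightarrow> nat) \<Rightarrow> nat \<Rightarrow> 'v set set \<Rightarrow> nat set" where
  "hits t k A = {j. k < t j \<and> (\<exists>e\<in>A. crosses j e \<and> (\<forall>j'. crosses j' e \<and> k < t j' \<longrightarrow> j' = j))}"

text \<open>The corank of \<open>A\<close> in the matroid whose bases are the trees on the levels from \<open>a\<close> to \<open>b\<close> that have one
  edge in each cut with threshold above \<open>k\<close>: an edge in two such cuts is a loop.\<close>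

definition cor :: "(nat \<Rightarrow> nat) \<Rightarrow> nat \<Rightarrow> nat \<Rightarrow> nat \<Rightarrow> 'v set set \<Rightarrow> real" where
  "cor t k a b A = real (ncomp (Lv a b) (unc t k A)) - 1 - real (card (hits t k A))"

text \<open>The correction by \<open>slack\<close> is needed since \<open>x\<close> restricted to an interval has less weight than a
  spanning tree of it.\<close>

definition bound :: "(nat \<Rightarrow> nat) \<Rightarrow> nat \<Rightarrow> nat \<Rightarrow> 'v set set \<Rightarrow> bool" where
  "bound t a b A \<longleftrightarrow>
    (\<Sum>k<n. w k * cor t k a b A) - (if 2 \<le> ncomp (Lv a b) A then slack a b else 0) \<le> sum x (Ein a b - A)"

text \<open>The trees below the threshold \<open>t j\<close> are those for which cut \<open>j\<close> is lonely.\<close>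

definition adm :: "(nat \<Rightarrow> nat) \<Rightarrow> bool" where
  "adm t \<longleftrightarrow> (\<forall>j\<le>p + 1. t j \<le> n \<and> W (t j) \<le> 1 - nu j)"

text \<open>The ends dominate the inner cuts, so whenever an inner cut is active both ends are, and
  \<open>slack\<close> of the interval is controlled by the threshold of any inner cut.\<close>

definition layer :: "(nat \<Rightarrow> nat) \<Rightarrow> nat \<Rightarrow> nat \<Rightarrow> bool" where
  "layer t a b \<longleftrightarrow> a < b \<and> b \<le> p + 1 \<and> (\<forall>j. a < j \<and> j < b \<longrightarrow> t j \<le> t a \<and> t j \<le> t b)"

lemma finE: "finite E" using EV finite_vpairs[OF finV] finite_subset by blast

lemma finLv: "finite (Lv a b)" using finV by (simp add: Lv_def)

lemma Lv_sub: "Lv a b \<subseteq> V" by (auto simp: Lv_def)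

lemma Ein_sub: "Ein a b \<subseteq> E" by (auto simp: Ein_def ind_def)

lemma finEin: "finite (Ein a b)" using finite_subset[OF Ein_sub finE] .

lemma Ein_vpairs: "Ein a b \<subseteq> vpairs (Lv a b)"
  using EV by (auto simp: Ein_def ind_def vpairs_def)

lemma Lv_nonempty: "a < b \<Longrightarrow> b \<le> p + 1 \<Longrightarrow> Lv a b \<noteq> {}"
  using lev_ex[of a] by (force simp: Lv_def)

lemma Lv_split: "a \<le> i \<Longrightarrow> i \<le> b \<Longrightarrow> Lv a b = Lv a i \<union> Lv i b \<and> Lv a i \<inter> Lv i b = {}"
  by (auto simp: Lv_def)

lemma Ein_mono: "a \<le> c \<Longrightarrow> d \<le> b \<Longrightarrow> Ein c d \<subseteq> Ein a b"
  by (fastforce simp: Ein_def ind_def Lv_def)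

lemma E_ex2: "e \<in> E \<Longrightarrow> \<exists>u v. e = {u, v} \<and> u \<noteq> v \<and> u \<in> V \<and> v \<in> V"
  using EV by (meson subsetD vpairsD)

lemma crosses_between: "crosses i e \<Longrightarrow> crosses k e \<Longrightarrow> i \<le> j \<Longrightarrow> j \<le> k \<Longrightarrow> crosses j e"
  by (auto simp: crosses_def) (meson less_le_trans le_trans)+

lemma crosses_Ein: "e \<in> Ein a b \<Longrightarrow> crosses j e \<Longrightarrow> a < j \<and> j < b"
  by (fastforce simp: Ein_def ind_def Lv_def crosses_def)

lemma Ein_left: "e \<in> Ein a b \<Longrightarrow> \<not> crosses c e \<Longrightarrow> u \<in> e \<Longrightarrow> lev u < c \<Longrightarrow> e \<in> Ein a c"
  by (fastforce simp: Ein_def ind_def Lv_def crosses_def)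

lemma Ein_right: "e \<in> Ein a b \<Longrightarrow> \<not> crosses c e \<Longrightarrow> u \<in> e \<Longrightarrow> c \<le> lev u \<Longrightarrow> e \<in> Ein c b"
  by (fastforce simp: Ein_def ind_def Lv_def crosses_def)

lemma Ein_u: "e \<in> Ein a b \<Longrightarrow> \<exists>u. u \<in> e"
  using E_ex2[of e] Ein_sub[of a b] by blast

lemma Ein_noncross: 
  assumes "e \<in> Ein a b" "\<not> crosses i e" shows "e \<in> Ein a i \<or> e \<in> Ein i b"
proof -
  obtain u where "u \<in> e" using Ein_u[OF assms(1)] by blast
  then show ?thesis using Ein_left[OF assms] Ein_right[OF assms] by (cases "lev u < i") auto
qed

lemma Ein_cross_l: "e \<in> Ein a b \<Longrightarrow> crosses i e \<Longrightarrow> \<not> crosses l e \<Longrightarrow> l \<le> i \<Longrightarrow> e \<in> Ein l b"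
  using Ein_right[of e a b l] by (metis crosses_def le_trans)

lemma Ein_cross_r: "e \<in> Ein a b \<Longrightarrow> crosses i e \<Longrightarrow> \<not> crosses r e \<Longrightarrow> i \<le> r \<Longrightarrow> e \<in> Ein a r"
  using Ein_left[of e a b r] by (metis crosses_def less_le_trans)

lemma Ein_sub_Lv: "e \<in> Ein a b \<Longrightarrow> e \<subseteq> Lv a b" by (simp add: Ein_def ind_def)

lemma Ein_disj: assumes "a \<le> i" "i \<le> b" shows "Ein a i \<inter> Ein i b = {}"
proof -
  have "e \<notin> Ein i b" if "e \<in> Ein a i" for e
  proof
    assume "e \<in> Ein i b"
    moreover obtain u where "u \<in> e" using Ein_u[OF \<open>e \<in> Ein i b\<close>] by blast
    ultimately show False using Ein_sub_Lv[OF that] Ein_sub_Lv[of e i b] by (fastforce simp: Lv_def)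
  qed
  then show ?thesis by blast
qed

lemma Ein_split:
  assumes "a \<le> i" "i \<le> b"
  shows "Ein a b = Ein a i \<union> Ein i b \<union> {e \<in> Ein a b. crosses i e}"
  using Ein_noncross[of _ a b i] Ein_mono[of a a i b] Ein_mono[of a i b b] assms by auto

lemma xnn': "A \<subseteq> E \<Longrightarrow> 0 \<le> sum x A" using xnn by (meson subsetD sum_nonneg)

lemma sum_split:
  assumes "a \<le> i" "i \<le> b" "A \<subseteq> Ein a b"
  shows "sum x A = sum x (A \<inter> Ein a i) + sum x (A \<inter> Ein i b) + sum x {e \<in> A. crosses i e}"
proof -
  have fin: "finite A" using finite_subset[OF assms(3) finEin] .
  have "A = (A \<inter> Ein a i \<union> A \<inter> Ein i b) \<union> {e \<in> A. crosses i e}"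
    using Ein_split[OF assms(1,2)] assms(3) by auto
  moreover have "(A \<inter> Ein a i \<union> A \<inter> Ein i b) \<inter> {e \<in> A. crosses i e} = {}"
    using crosses_Ein[of _ a i i] crosses_Ein[of _ i b i] by auto
  moreover have "(A \<inter> Ein a i) \<inter> (A \<inter> Ein i b) = {}" using Ein_disj[OF assms(1,2)] by auto
  ultimately have "sum x A = sum x (A \<inter> Ein a i \<union> A \<inter> Ein i b) + sum x {e \<in> A. crosses i e}"
    "sum x (A \<inter> Ein a i \<union> A \<inter> Ein i b) = sum x (A \<inter> Ein a i) + sum x (A \<inter> Ein i b)"
    using fin by (metis (no_types, lifting) finite_Un sum.union_disjoint, metis finite_Int sum.union_disjoint)
  then show ?thesis by simp
qed

lemma slack_nonneg: "a < b \<Longrightarrow> b \<le> p + 1 \<Longrightarrow> 0 \<le> slack a b"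
  using forest[OF Lv_sub Lv_nonempty, of a b] by (simp add: slack_def Ein_def)

lemma W_mono: "m \<le> m' \<Longrightarrow> m' \<le> n \<Longrightarrow> W m \<le> W m'"
  unfolding W_def by (rule sum_mono2) (use wpos in \<open>force simp: less_imp_le\<close>)+

lemma W_0 [simp]: "W 0 = 0" by (simp add: W_def)

lemma W_n: "W n = 1" using wsum by (simp add: W_def)

lemma W_pos: "0 < m \<Longrightarrow> m \<le> n \<Longrightarrow> 0 < W m"
  unfolding W_def by (rule sum_pos) (use wpos in auto)

lemma slack_eq:
  assumes "a < b" "b \<le> p + 1"
  shows "slack a b + sum x {e \<in> E. crosses a e \<and> crosses b e} = (nu a + nu b) / 2"
proof -
  have "{e \<in> E. crosses a e \<and> crosses b e} = {e \<in> E. (\<exists>u\<in>e. lev u < a) \<and> (\<exists>u\<in>e. b \<le> lev u)}"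
    using assms unfolding crosses_def by (auto intro: less_trans le_trans less_imp_le order.strict_trans2)
  then show ?thesis using cross2[OF assms] by (simp add: slack_def Ein_def Lv_def)
qed

text \<open>Thresholds of at least \<open>m\<close> at both ends force \<open>nu a\<close> and
  \<open>nu b\<close> down to \<open>1 - W m\<close>, and both terms on the left of
  \<open>slack_eq\<close> are nonnegative.\<close>

lemma both_cross_le:
  assumes "a < b" "b \<le> p + 1" "adm t" "m \<le> t a" "m \<le> t b"
  shows "slack a b \<le> 1 - W m" "sum x {e \<in> E. crosses a e \<and> crosses b e} \<le> 1 - W m"
proof -
  have "W m \<le> W (t a)" "W m \<le> W (t b)" "W (t a) \<le> 1 - nu a" "W (t b) \<le> 1 - nu b"
    using assms W_mono by (auto simp: adm_def)
  moreover have "0 \<le> slack a b" "0 \<le> sum x {e \<in> E. crosses a e \<and> crosses b e}"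
    using slack_nonneg[OF assms(1,2)] xnn'[of "{e \<in> E. crosses a e \<and> crosses b e}"] by auto
  ultimately show "slack a b \<le> 1 - W m" "sum x {e \<in> E. crosses a e \<and> crosses b e} \<le> 1 - W m"
    using slack_eq[OF assms(1,2)] by simp_all
qed

text \<open>The case without active cuts: the corank is the number of components minus one, and the
  forest inequality falls short of it by \<open>slack\<close>.\<close>

lemma base_bound:
  assumes "A \<subseteq> Ein a b" "a < b" "b \<le> p + 1"
  shows "real (ncomp (Lv a b) A) - 1 - slack a b \<le> sum x (Ein a b - A)"
proof -
  have "sum x A \<le> real (card (Lv a b)) - real (ncomp (Lv a b) A)"
  proof (rule sum_le_card_minus_ncomp[OF finLv])
    show "A \<subseteq> vpairs (Lv a b)" using assms(1) Ein_vpairs by blast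
    fix U assume U: "U \<subseteq> Lv a b" "U \<noteq> {}"
    have "sum x (ind A U) \<le> sum x (ind E U)"
      by (rule sum_mono2) (use assms(1) Ein_sub finE xnn finite_subset[OF ind_subset finE] in \<open>auto simp: ind_def\<close>)
    also have "\<dots> \<le> real (card U) - 1" using forest[OF subset_trans[OF U(1) Lv_sub] U(2)] .
    finally show "sum x (ind A U) \<le> real (card U) - 1" .
  qed
  moreover have "sum x (Ein a b - A) = sum x (Ein a b) - sum x A"
    using sum_diff[OF finEin assms(1)] .
  ultimately show ?thesis by (simp add: slack_def)
qed

lemma cross_sum:
  assumes "a < i" "i < b"
  shows "sum x {e \<in> Ein a b. crosses i e} = 1 - slack a b + slack a i + slack i b"
proof -
  have "card (Lv a b) = card (Lv a i) + card (Lv i b)"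
    using Lv_split[of a i b] assms finLv by (metis card_Un_disjoint less_imp_le)
  moreover have "sum x (Ein a b) = sum x (Ein a i) + sum x (Ein i b) + sum x {e \<in> Ein a b. crosses i e}"
    using sum_split[of a i b "Ein a b"] Ein_mono[of a a i b] Ein_mono[of a i b b] assms by (simp add: Int_absorb1)
  ultimately show ?thesis by (simp add: slack_def)
qed

lemma hitsE:
  assumes "j \<in> hits t k A"
  obtains e where "k < t j" "e \<in> A" "crosses j e" "\<And>j'. crosses j' e \<Longrightarrow> k < t j' \<Longrightarrow> j' = j"
  using assms unfolding hits_def by blast

lemma hitsI:
  assumes "k < t j" "e \<in> A" "crosses j e" "\<And>j'. crosses j' e \<Longrightarrow> k < t j' \<Longrightarrow> j' = j"
  shows "j \<in> hits t k A"
  using assms unfolding hits_def by blast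

lemma hits_sub: "A \<subseteq> Ein a b \<Longrightarrow> hits t k A \<subseteq> {a<..<b}"
proof
  fix j assume "A \<subseteq> Ein a b" "j \<in> hits t k A"
  then obtain e where "e \<in> Ein a b" "crosses j e" using hitsE by blast
  then show "j \<in> {a<..<b}" using crosses_Ein by auto
qed

lemma finhits: "A \<subseteq> Ein a b \<Longrightarrow> finite (hits t k A)"
  using finite_subset[OF hits_sub] by blast

lemma unc_sub: "unc t k A \<subseteq> A" by (auto simp: unc_def)

text \<open>At an active cut the matroid is the direct sum of the matroids on both sides and a
  rank-one summand, which contributes \<open>1\<close> unless the cut is hit.\<close>

lemma cor_split:
  assumes "a < i" "i < b" "k < t i" "A \<subseteq> Ein a b"
  shows "cor t k a b A = cor t k a i (A \<inter> Ein a i) + cor t k i b (A \<inter> Ein i b) + 1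
    - (if i \<in> hits t k A then 1 else 0)"
proof -
  have i1: "ind (unc t k A) (Lv a i) = unc t k (A \<inter> Ein a i)"
    using assms(4) Ein_sub by (auto simp: ind_def unc_def Ein_def)
  have i2: "ind (unc t k A) (Lv i b) = unc t k (A \<inter> Ein i b)"
    using assms(4) Ein_sub by (auto simp: ind_def unc_def Ein_def)
  have "e \<subseteq> Lv a i \<or> e \<subseteq> Lv i b" if "e \<in> unc t k A" for e
  proof -
    have "\<not> crosses i e" "e \<in> Ein a b" using that assms by (auto simp: unc_def)
    then show ?thesis using Ein_noncross Ein_sub_Lv by blast
  qed
  then have nc: "ncomp (Lv a b) (unc t k A) = ncomp (Lv a i) (unc t k (A \<inter> Ein a i)) + ncomp (Lv i b) (unc t k (A \<inter> Ein i b))"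
    using ncomp_split[of "Lv a b" "Lv a i" "Lv i b" "unc t k A"] Lv_split[of a i b] assms(1,2) finLv i1 i2 by simp
  let ?h = "hits t k"
  let ?x = "if i \<in> ?h A then {i} else {}"
  have h1: "?h (A \<inter> Ein a i) \<subseteq> {a<..<i}" "?h (A \<inter> Ein i b) \<subseteq> {i<..<b}" by (rule hits_sub, blast)+
  have "?h A \<subseteq> ?h (A \<inter> Ein a i) \<union> ?h (A \<inter> Ein i b) \<union> ?x"
  proof
    fix j assume j: "j \<in> ?h A"
    then obtain e where e: "k < t j" "e \<in> A" "crosses j e" "\<And>j'. crosses j' e \<Longrightarrow> k < t j' \<Longrightarrow> j' = j"
      using hitsE by blast
    show "j \<in> ?h (A \<inter> Ein a i) \<union> ?h (A \<inter> Ein i b) \<union> ?x"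
    proof (cases "j = i")
      case True then show ?thesis using j by simp
    next
      case False
      then have "\<not> crosses i e" using e(4)[of i] assms(3) by blast
      then have "e \<in> A \<inter> Ein a i \<or> e \<in> A \<inter> Ein i b" using Ein_noncross e(2) assms(4) by blast
      then show ?thesis using hitsI[of k t j e] e by blast
    qed
  qed
  moreover have "?h (A \<inter> Ein a i) \<union> ?h (A \<inter> Ein i b) \<union> ?x \<subseteq> ?h A" unfolding hits_def by (auto split: if_splits)
  ultimately have "?h A = (?h (A \<inter> Ein a i) \<union> ?h (A \<inter> Ein i b)) \<union> ?x" by blast
  moreover have "card ((?h (A \<inter> Ein a i) \<union> ?h (A \<inter> Ein i b)) \<union> ?x)
    = card (?h (A \<inter> Ein a i)) + card (?h (A \<inter> Ein i b)) + (if i \<in> ?h A then 1 else 0)"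
  proof -
    have f: "finite (?h (A \<inter> Ein a i))" "finite (?h (A \<inter> Ein i b))" using h1 finite_subset by blast+
    have "?h (A \<inter> Ein a i) \<inter> ?h (A \<inter> Ein i b) = {}" "i \<notin> ?h (A \<inter> Ein a i) \<union> ?h (A \<inter> Ein i b)" using h1 by fastforce+
    then show ?thesis using f by (auto simp: card_Un_disjoint)
  qed
  ultimately have "card (?h A) = card (?h (A \<inter> Ein a i)) + card (?h (A \<inter> Ein i b)) + (if i \<in> ?h A then 1 else 0)"
    by (rule subst[OF sym])
  then show ?thesis using nc by (simp add: cor_def)
qed

lemma cor_top:
  assumes "\<And>j. a < j \<Longrightarrow> j < b \<Longrightarrow> t j \<le> k" "A \<subseteq> Ein a b"
  shows "cor t k a b A = real (ncomp (Lv a b) A) - 1" "unc t k A = A"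
proof -
  have "t j \<le> k" if "e \<in> A" "crosses j e" for e j
    using assms(1)[of j] crosses_Ein[of e a b j] assms(2) that by blast
  then have "unc t k A = A" unfolding unc_def by blast
  moreover have "j \<notin> hits t k A" for j
    using hits_sub[OF assms(2), of t k] assms(1)[of j] hitsE[of j t k A] by (metis greaterThanLessThan_iff not_le subsetD)
  then have "hits t k A = {}" by blast
  ultimately show "cor t k a b A = real (ncomp (Lv a b) A) - 1" "unc t k A = A" by (auto simp: cor_def)
qed

lemma cor_nonneg:
  assumes "a < b" "b \<le> p + 1" "A \<subseteq> Ein a b"
  shows "0 \<le> cor t k a b A"
  using assms
proof (induction "b - a" arbitrary: a b A rule: less_induct)
  case less
  show ?case
  proof (cases "\<exists>i. a < i \<and> i < b \<and> k < t i")
    case True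
    then obtain i where i: "a < i" "i < b" "k < t i" by auto
    have "0 \<le> cor t k a i (A \<inter> Ein a i)" "0 \<le> cor t k i b (A \<inter> Ein i b)"
      using less(1)[of i a "A \<inter> Ein a i"] less(1)[of b i "A \<inter> Ein i b"] i less(2,3) by auto
    then show ?thesis unfolding cor_split[of a i b k t A, OF i less(4)] by simp
  next
    case False
    then have "t j \<le> k" if "a < j" "j < b" for j using that by (meson not_le)
    then have "cor t k a b A = real (ncomp (Lv a b) A) - 1" using cor_top(1) less(4) by blast
    moreover have "1 \<le> ncomp (Lv a b) A" using ncomp_ge1[OF finLv Lv_nonempty[OF less(2,3)]] .
    ultimately show ?thesis by simp
  qed
qed

text \<open>Active ends make the subinterval a direct summand, so edges inside it change only the
  corank of this summand.\<close>

lemma cor_dec_sep: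
  assumes "a \<le> c" "c < d" "d \<le> b" "c = a \<or> k < t c" "d = b \<or> k < t d" "A \<subseteq> Ein a b" "F \<subseteq> Ein c d"
  shows "cor t k a b A - cor t k a b (A \<union> F) = cor t k c d (A \<inter> Ein c d) - cor t k c d (A \<inter> Ein c d \<union> F)"
proof -
  have step1: "cor t k a b A - cor t k a b (A \<union> F) = cor t k c b (A \<inter> Ein c b) - cor t k c b (A \<inter> Ein c b \<union> F)"
  proof (cases "c = a")
    case True
    have "A \<inter> Ein a b = A" using assms by blast
    then show ?thesis using True by simp
  next
    case False
    then have c: "a < c" "c < b" "k < t c" using assms by auto
    have F: "F \<subseteq> Ein c b" using assms Ein_mono[of c c d b] by auto
    then have F1: "F \<subseteq> Ein a b" using Ein_mono[of a c b b] c by auto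
    have "(A \<union> F) \<inter> Ein a c = A \<inter> Ein a c" using F Ein_disj[of a c b] c by auto
    moreover have "(A \<union> F) \<inter> Ein c b = A \<inter> Ein c b \<union> F" using F by auto
    moreover have "c \<in> hits t k (A \<union> F) \<longleftrightarrow> c \<in> hits t k A"
      using F crosses_Ein[of _ c b c] by (auto simp: hits_def)
    ultimately show ?thesis using cor_split[of a c b k t A] cor_split[of a c b k t "A \<union> F"] c assms(6) F1 by simp
  qed
  have step2: "cor t k c b B - cor t k c b (B \<union> F) = cor t k c d (B \<inter> Ein c d) - cor t k c d (B \<inter> Ein c d \<union> F)"
    if B: "B \<subseteq> Ein c b" for B
  proof (cases "d = b")
    case True
    have "B \<inter> Ein c b = B" using B by blast
    then show ?thesis using True by simp
  next
    case False
    then have d: "c < d" "d < b" "k < t d" using assms by auto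
    have F1: "F \<subseteq> Ein c b" using assms Ein_mono[of c c d b] by auto
    have "(B \<union> F) \<inter> Ein d b = B \<inter> Ein d b" using assms(7) Ein_disj[of c d b] d by auto
    moreover have "(B \<union> F) \<inter> Ein c d = B \<inter> Ein c d \<union> F" using assms(7) by auto
    moreover have "d \<in> hits t k (B \<union> F) \<longleftrightarrow> d \<in> hits t k B"
      using assms(7) crosses_Ein[of _ c d d] by (auto simp: hits_def)
    ultimately show ?thesis using cor_split[of c d b k t B] cor_split[of c d b k t "B \<union> F"] d B F1 by simp
  qed
  have "A \<inter> Ein c b \<inter> Ein c d = A \<inter> Ein c d" using Ein_mono[of c c d b] assms by auto
  then show ?thesis using step1 step2[of "A \<inter> Ein c b"] by simp
qed

lemma cor_dec_le:
  assumes "a \<le> c" "c < d" "d \<le> b" "b \<le> p + 1" "c = a \<or> k < t c" "d = b \<or> k < t d" "A \<subseteq> Ein a b" "F \<subseteq> Ein c d"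
  shows "cor t k a b A - cor t k a b (A \<union> F) \<le> cor t k c d (A \<inter> Ein c d)"
  using cor_dec_sep[OF assms(1-3,5-8)] cor_nonneg[of c d "A \<inter> Ein c d \<union> F" t k] assms by simp

lemma hits_mono_level: "i \<in> hits t k A \<Longrightarrow> k \<le> k' \<Longrightarrow> k' < t i \<Longrightarrow> i \<in> hits t k' A"
  by (auto simp: hits_def)

end

section \<open>Combining the bounds of two adjacent intervals\<close>

context leveled_graph
begin

text \<open>The ends of a layer are active whenever an inner cut is, so nearest active cuts exist on
  both sides of \<open>i\<close>.\<close>

lemma neighbors:
  assumes "layer t a b" "a < i" "i < b" "k < t i"
  obtains l r where "a \<le> l" "l < i" "i < r" "r \<le> b" "k < t l" "k < t r"
    "\<And>j. l < j \<Longrightarrow> j < r \<Longrightarrow> j \<noteq> i \<Longrightarrow> t j \<le> k"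
proof -
  have ab: "k < t a" "k < t b" using assms by (auto simp: layer_def dest: less_le_trans)
  define l where "l = Max {l. a \<le> l \<and> l < i \<and> k < t l}"
  define r where "r = (LEAST r. i < r \<and> k < t r)"
  have fin: "finite {l. a \<le> l \<and> l < i \<and> k < t l}" by (rule finite_subset[of _ "{..<i}"]) auto
  have ne: "a \<in> {l. a \<le> l \<and> l < i \<and> k < t l}" using assms ab by simp
  have "l \<in> {l. a \<le> l \<and> l < i \<and> k < t l}" unfolding l_def by (rule Max_in[OF fin]) (use ne in blast)
  then have l: "a \<le> l" "l < i" "k < t l" by auto
  have lm: "t j \<le> k" if "l < j" "j < i" for j
  proof (rule ccontr)
    assume "\<not> t j \<le> k"
    then have "j \<le> l" unfolding l_def by (intro Max_ge[OF fin]) (use that l in auto)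
    then show False using that by simp
  qed
  have r: "i < r" "k < t r" using LeastI[of "\<lambda>r. i < r \<and> k < t r" b] assms ab by (auto simp: r_def)
  have "r \<le> b" unfolding r_def by (rule Least_le) (use assms ab in simp)
  have rm: "t j \<le> k" if "i < j" "j < r" for j
    using not_less_Least[of j "\<lambda>r. i < r \<and> k < t r"] that by (auto simp: r_def)
  show ?thesis by (rule that[of l r]) (use l r \<open>r \<le> b\<close> lm rm in \<open>auto simp: neq_iff\<close>)
qed

lemma hits_of_between:
  assumes "e \<in> A" "e \<in> Ein l r" "crosses i e" "k < t i"
    "\<And>j. l < j \<Longrightarrow> j < r \<Longrightarrow> j \<noteq> i \<Longrightarrow> t j \<le> k"
  shows "i \<in> hits t k A"
proof (rule hitsI[of k t i e])
  fix j assume "crosses j e" "k < t j"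
  then show "j = i" using crosses_Ein[OF assms(2)] assms(5)[of j] by (metis not_le)
qed (use assms in auto)

lemma layer_sub:
  assumes "\<And>j. l < j \<Longrightarrow> j < r \<Longrightarrow> t j \<le> k" "k \<le> t l" "k \<le> t r" "l < r" "r \<le> p + 1"
  shows "layer t l r"
  using assms by (auto simp: layer_def intro: le_trans)

text \<open>Between the active neighbours of \<open>i\<close>, an edge crossing \<open>i\<close>
  crosses no other active cut, so none of these edges lies in \<open>A\<close>. Their weight is at
  least \<open>1 - slack l r\<close>, and both neighbours have thresholds above
  \<open>k\<close>.\<close>

lemma unhit_weight:
  assumes "layer t a b" "adm t" "a < i" "i < b" "k < t i" "i \<notin> hits t k A"
  shows "W (Suc k) \<le> sum x {e \<in> Ein a b - A. crosses i e}"
proof -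
  obtain l r where lr: "a \<le> l" "l < i" "i < r" "r \<le> b" "k < t l" "k < t r"
    "\<And>j. l < j \<Longrightarrow> j < r \<Longrightarrow> j \<noteq> i \<Longrightarrow> t j \<le> k" using neighbors[OF assms(1,3,4,5)] by blast
  have bp: "b \<le> p + 1" using assms by (simp add: layer_def)
  have "1 - slack l r \<le> sum x {e \<in> Ein l r. crosses i e}"
    using cross_sum[OF lr(2,3)] slack_nonneg[of l i] slack_nonneg[of i r] lr bp by simp
  moreover have "slack l r \<le> 1 - W (Suc k)"
    by (rule both_cross_le(1)[OF _ _ assms(2)]) (use lr bp in auto)
  moreover have "sum x {e \<in> Ein l r. crosses i e} \<le> sum x {e \<in> Ein a b - A. crosses i e}"
  proof (rule sum_mono2)
    show "{e \<in> Ein l r. crosses i e} \<subseteq> {e \<in> Ein a b - A. crosses i e}"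
    proof
      fix e assume e: "e \<in> {e \<in> Ein l r. crosses i e}"
      then have "e \<notin> A" using hits_of_between[of e A l r i k t] assms lr by blast
      then show "e \<in> {e \<in> Ein a b - A. crosses i e}" using e Ein_mono[of a l r b] lr by auto
    qed
  qed (use finEin xnn[OF subsetD[OF Ein_sub]] in auto)
  ultimately show ?thesis by simp
qed

lemma sum_w_cases:
  assumes "m \<le> n"
  shows "(\<Sum>k<n. w k * (if k < m then u else v)) = W m * u + (1 - W m) * v"
proof -
  have "{..<n} = {..<m} \<union> {m..<n}" using assms by auto
  then have *: "(\<Sum>k<n. h k) = (\<Sum>k<m. h k) + (\<Sum>k=m..<n. h k)" for h :: "nat \<Rightarrow> real"
    by (simp add: sum.union_disjoint ivl_disj_int)
  have "1 - W m = (\<Sum>k=m..<n. w k)" using *[of w] wsum by (simp add: W_def)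
  then show ?thesis unfolding * by (simp add: W_def sum_distrib_right)
qed

text \<open>Raising \<open>k\<close> only deactivates cuts, so a hit persists. The levels at which
  \<open>i\<close> is active but unhit thus form an initial segment, and this is its length; the
  value is \<open>t i\<close> if \<open>i\<close> is never hit.\<close>

definition first_hit :: "(nat \<Rightarrow> nat) \<Rightarrow> nat \<Rightarrow> 'v set set \<Rightarrow> nat" where
  "first_hit t i A = (LEAST k. t i \<le> k \<or> i \<in> hits t k A)"

lemma first_hit:
  shows "first_hit t i A \<le> t i" "k < first_hit t i A \<Longrightarrow> k < t i \<and> i \<notin> hits t k A"
    "first_hit t i A \<le> k \<Longrightarrow> k < t i \<Longrightarrow> i \<in> hits t k A"
proof -
  let ?P = "\<lambda>k. t i \<le> k \<or> i \<in> hits t k A"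
  show le: "first_hit t i A \<le> t i" unfolding first_hit_def by (rule Least_le) simp
  show "k < first_hit t i A \<Longrightarrow> k < t i \<and> i \<notin> hits t k A"
    using not_less_Least[of k ?P] by (auto simp: first_hit_def)
  assume k: "first_hit t i A \<le> k" "k < t i"
  have "?P (first_hit t i A)" unfolding first_hit_def by (rule LeastI[of ?P "t i"]) simp
  then have "i \<in> hits t (first_hit t i A) A" using k by auto
  then show "i \<in> hits t k A" using hits_mono_level k by blast
qed

lemma unhit_weight':
  assumes "layer t a b" "adm t" "a < i" "i < b"
  shows "W (first_hit t i A) \<le> sum x {e \<in> Ein a b - A. crosses i e}"
proof (cases "first_hit t i A")
  case 0
  then show ?thesis using xnn'[of "{e \<in> Ein a b - A. crosses i e}"] Ein_sub by auto
next
  case (Suc k)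
  then show ?thesis using unhit_weight[OF assms, of k A] first_hit(2)[of k t i A] by simp
qed

lemma ncomp_join:
  assumes "a < i" "i < b" "A \<subseteq> Ein a b"
  shows "ncomp (Lv a b) {e \<in> A. \<not> crosses i e} = ncomp (Lv a i) (A \<inter> Ein a i) + ncomp (Lv i b) (A \<inter> Ein i b)"
proof -
  have i1: "ind {e \<in> A. \<not> crosses i e} (Lv a i) = A \<inter> Ein a i"
    using assms(3) Ein_sub crosses_Ein[of _ a i i] by (auto simp: ind_def Ein_def)
  have i2: "ind {e \<in> A. \<not> crosses i e} (Lv i b) = A \<inter> Ein i b"
    using assms(3) Ein_sub crosses_Ein[of _ i b i] by (auto simp: ind_def Ein_def)
  have "e \<subseteq> Lv a i \<or> e \<subseteq> Lv i b" if "e \<in> {e \<in> A. \<not> crosses i e}" for e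
    using that Ein_noncross Ein_sub_Lv assms(3) by blast
  then show ?thesis using ncomp_split[of "Lv a b" "Lv a i" "Lv i b" "{e \<in> A. \<not> crosses i e}"] Lv_split[of a i b]
      assms(1,2) finLv i1 i2 by simp
qed

lemma crossing_ends:
  assumes "e \<in> E" "crosses i e"
  obtains u v where "e = {u, v}" "u \<in> V" "v \<in> V" "lev u < i" "i \<le> lev v"
proof -
  obtain a b where ab: "e = {a, b}" "a \<in> V" "b \<in> V" using E_ex2[OF assms(1)] by blast
  show ?thesis
  proof (cases "lev a < i")
    case True then show ?thesis using that[of a b] ab assms(2) by (auto simp: crosses_def)
  next
    case False then show ?thesis using that[of b a] ab assms(2) by (auto simp: crosses_def insert_commute)
  qed
qed

lemma nonconn_across:
  assumes "\<And>e. e \<in> A \<Longrightarrow> \<not> crosses i e" "lev u < i" "i \<le> lev v"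
  shows "\<not> conn A u v"
proof
  assume "conn A u v"
  then have "v \<in> {v. lev v < i}"
  proof (rule conn_closed)
    show "u \<in> {v. lev v < i}" using assms by simp
    fix a b assume "a \<in> {v. lev v < i}" "{a, b} \<in> A"
    then show "b \<in> {v. lev v < i}" using assms(1)[of "{a, b}"] by (auto simp: crosses_def not_less)
  qed
  then show False using assms by simp
qed

text \<open>Trees \<open>k < t i\<close> decompose at \<open>i\<close>, and the others have no
  active cut inside. With \<open>D = k1 + k2 - k0\<close> merges made by edges across
  \<open>i\<close>, what remains to be checked involves only \<open>D\<close>, the three slacks and
  the weight across \<open>i\<close>. The case not settled by these is \<open>D = 1\<close> with
  \<open>A\<close> disconnected, and there \<open>ok\<close> is used.\<close>

lemma join_bound:
  assumes L: "layer t a b" and "adm t" and i: "a < i" "i < b"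
    and top: "\<And>j. a < j \<Longrightarrow> j < b \<Longrightarrow> t j \<le> t i" and A: "A \<subseteq> Ein a b"
    and b1: "bound t a i (A \<inter> Ein a i)" and b2: "bound t i b (A \<inter> Ein i b)"
    and ok: "ncomp (Lv a b) A + 1 = ncomp (Lv a i) (A \<inter> Ein a i) + ncomp (Lv i b) (A \<inter> Ein i b) \<Longrightarrow>
      2 \<le> ncomp (Lv a b) A \<Longrightarrow> sum x {e \<in> A. crosses i e} \<le> 1 - W (first_hit t i A)"
  shows "bound t a b A"
proof -
  let ?A1 = "A \<inter> Ein a i" and ?A2 = "A \<inter> Ein i b"
  let ?S = "{e \<in> A. crosses i e}"
  define k0 k1 k2 where "k0 = ncomp (Lv a b) A" and "k1 = ncomp (Lv a i) ?A1" and "k2 = ncomp (Lv i b) ?A2"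
  define q where "q = first_hit t i A"
  define c c1 c2 where "c = slack a b" and "c1 = slack a i" and "c2 = slack i b"
  have bp: "b \<le> p + 1" "a < b" using L by (auto simp: layer_def)
  have tn: "t i \<le> n" and Wi: "W (t i) \<le> 1 - nu i" using assms(2) i bp by (auto simp: adm_def)
  have q: "q \<le> t i" "q \<le> n" using first_hit(1)[of t i A] tn by (auto simp: q_def)
  have WW: "W q \<le> W (t i)" "0 \<le> W q" "W (t i) \<le> 1"
    using W_mono[of q "t i"] W_mono[of 0 q] W_mono[of "t i" n] q tn W_n by auto
  \<comment> \<open>For \<open>k < q\<close> the cut is active and unhit and costs one; for
    \<open>q \<le> k < t i\<close> it is hit; from \<open>t i\<close> on nothing inside is active
    and coranks are plain component counts.\<close>
  have g: "cor t k a b A = cor t k a i ?A1 + cor t k i b ?A2 +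
      (if k < q then 1 else if k < t i then 0 else 1 - (real k1 + real k2 - real k0))" for k
  proof (cases "k < t i")
    case True
    have "i \<in> hits t k A \<longleftrightarrow> \<not> k < q"
      using first_hit(2)[of k t i A] first_hit(3)[of t i A k] True by (metis not_less q_def)
    then show ?thesis using cor_split[of a i b k t A, OF i True A] True by simp
  next
    case False
    then have "t j \<le> k" if "a < j" "j < b" for j using top[OF that] by simp
    then have "cor t k a b A = real k0 - 1" "cor t k a i ?A1 = real k1 - 1" "cor t k i b ?A2 = real k2 - 1"
      unfolding k0_def k1_def k2_def using i by (intro cor_top(1) A; auto)+
    then show ?thesis using False q by simp
  qed
  have wg: "(\<Sum>k<n. w k * (if k < q then 1 else if k < t i then 0 else 1 - (real k1 + real k2 - real k0)))
      = W q + (1 - W (t i)) * (1 - (real k1 + real k2 - real k0))" (is "?lhs = _")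
  proof -
    have "?lhs = (\<Sum>k<n. w k * (if k < q then 1 else 0) + w k * (if k < t i then 0 else 1 - (real k1 + real k2 - real k0)))"
      by (rule sum.cong) (use q in auto)
    then show ?thesis using sum_w_cases[OF q(2), of 1 0] sum_w_cases[OF tn, of 0] by (simp add: sum.distrib)
  qed
  have lhs: "(\<Sum>k<n. w k * cor t k a b A) = (\<Sum>k<n. w k * cor t k a i ?A1) + (\<Sum>k<n. w k * cor t k i b ?A2)
      + W q + (1 - W (t i)) * (1 - (real k1 + real k2 - real k0))"
    unfolding g distrib_left sum.distrib wg by simp
  have X: "sum x {e \<in> Ein a b. crosses i e} = 1 - c + c1 + c2"
    using cross_sum[OF i] by (simp add: c_def c1_def c2_def)
  have Xle: "1 - c + c1 + c2 \<le> 2 - W (t i)"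
  proof -
    have "sum x {e \<in> Ein a b. crosses i e} \<le> sum x {e \<in> E. (\<exists>u\<in>e. lev u < i) \<and> (\<exists>u\<in>e. i \<le> lev u)}"
      by (rule sum_mono2) (use finE xnn subsetD[OF Ein_sub] in \<open>auto simp: crosses_def\<close>)
    also have "\<dots> \<le> 1 + nu i" using cross1 i bp by simp
    finally show ?thesis using X Wi by simp
  qed
  have XS: "sum x {e \<in> Ein a b - A. crosses i e} = 1 - c + c1 + c2 - sum x ?S"
  proof -
    have "{e \<in> Ein a b - A. crosses i e} = {e \<in> Ein a b. crosses i e} - ?S" by auto
    then show ?thesis using X sum_diff[of "{e \<in> Ein a b. crosses i e}" ?S x] finEin A by auto
  qed
  have ch: "W q \<le> 1 - c + c1 + c2 - sum x ?S" using unhit_weight'[OF L assms(2) i, of A] XS by (simp add: q_def)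
  have tot: "sum x (Ein a b - A) = sum x (Ein a i - ?A1) + sum x (Ein i b - ?A2) + (1 - c + c1 + c2 - sum x ?S)"
  proof -
    have "(Ein a b - A) \<inter> Ein a i = Ein a i - ?A1" "(Ein a b - A) \<inter> Ein i b = Ein i b - ?A2"
      using Ein_mono[of a a i b] Ein_mono[of a i b b] i by auto
    then show ?thesis using sum_split[of a i b "Ein a b - A"] i XS by simp
  qed
  have cs: "0 \<le> c" "0 \<le> c1" "0 \<le> c2" using slack_nonneg i bp by (auto simp: c_def c1_def c2_def)
  have tab: "t i \<le> t a" "t i \<le> t b" using L i by (auto simp: layer_def)
  have c2W: "c2 \<le> 1 - W (t i)" "c1 \<le> 1 - W (t i)" "c \<le> 1 - W (t i)"
    unfolding c_def c1_def c2_def using tab i bp assms(2) by (auto intro!: both_cross_le(1))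
  have nc: "ncomp (Lv a b) {e \<in> A. \<not> crosses i e} = k1 + k2"
    using ncomp_join[OF i A] by (simp add: k1_def k2_def)
  have kle: "k0 \<le> k1 + k2"
    using ncomp_antimono[OF finLv, of "{e \<in> A. \<not> crosses i e}" A a b] nc by (auto simp: k0_def)
  have kpos: "1 \<le> k0" "1 \<le> k1" "1 \<le> k2"
    unfolding k0_def k1_def k2_def using i bp by (intro ncomp_ge1 finLv Lv_nonempty; simp)+
  have S0: "sum x ?S = 0" if "k0 = k1 + k2"
  proof -
    have "?S = {}"
    proof (rule ccontr)
      assume "?S \<noteq> {}"
      then obtain e where e: "e \<in> A" "crosses i e" by auto
      then obtain u v where uv: "e = {u, v}" "u \<in> V" "v \<in> V" "lev u < i" "i \<le> lev v"
        using crossing_ends A Ein_sub by (metis subsetD)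
      have "u \<in> Lv a b" "v \<in> Lv a b" using Ein_sub_Lv[of e a b] e A uv by auto
      moreover have "\<not> conn {e \<in> A. \<not> crosses i e} u v" using nonconn_across[of "{e \<in> A. \<not> crosses i e}" i u v] uv by simp
      ultimately have "k1 + k2 = ncomp (Lv a b) (insert e {e \<in> A. \<not> crosses i e}) + 1"
        using ncomp_insert_nconn[OF finLv, of "{e \<in> A. \<not> crosses i e}" u v a b] nc uv by simp
      moreover have "k0 \<le> ncomp (Lv a b) (insert e {e \<in> A. \<not> crosses i e})"
        unfolding k0_def by (rule ncomp_antimono[OF finLv]) (use e in auto)
      ultimately show False using that by simp
    qed
    then show ?thesis by (simp only: sum.empty)
  qed
  have Snn: "0 \<le> sum x ?S" using xnn'[of ?S] A Ein_sub by auto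
  have B1: "(\<Sum>k<n. w k * cor t k a i ?A1) - (if 2 \<le> k1 then c1 else 0) \<le> sum x (Ein a i - ?A1)"
    using b1 unfolding bound_def k1_def c1_def .
  have B2: "(\<Sum>k<n. w k * cor t k i b ?A2) - (if 2 \<le> k2 then c2 else 0) \<le> sum x (Ein i b - ?A2)"
    using b2 unfolding bound_def k2_def c2_def .
  have main: "W q + (1 - W (t i)) * (1 - (real k1 + real k2 - real k0)) - (if 2 \<le> k0 then c else 0)
      \<le> 1 - c + c1 + c2 - sum x ?S - (if 2 \<le> k1 then c1 else 0) - (if 2 \<le> k2 then c2 else 0)"
  proof -
    have mul: "(1 - W (t i)) * (1 - (real k1 + real k2 - real k0)) \<le> - ((1 - W (t i)) * real m)" if "k0 + 1 + m \<le> k1 + k2" for m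
    proof -
      have "1 - (real k1 + real k2 - real k0) \<le> - real m" using that by linarith
      then show ?thesis using WW(3) mult_left_mono[of "1 - (real k1 + real k2 - real k0)" "- real m" "1 - W (t i)"] by simp
    qed
    \<comment> \<open>Without a merge no edge of \<open>A\<close> crosses \<open>i\<close>. Every
      merge beyond the first gains \<open>1 - W (t i)\<close>, which pays for the slacks through
      \<open>Xle\<close> or \<open>c2W\<close>.\<close>
    consider (none) "k0 = k1 + k2" | (one) "k0 + 1 = k1 + k2" "2 \<le> k0" | (one1) "k0 + 1 = k1 + k2" "k0 = 1"
      | (two) "k0 + 2 \<le> k1 + k2" "2 \<le> k0" | (two1) "k0 + 2 \<le> k1 + k2" "k0 = 1"
      using kle kpos by linarith
    then show ?thesis
    proof cases
      case none
      then show ?thesis using S0 WW cs kpos by auto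
    next
      case one
      have D: "real k1 + real k2 - real k0 = 1" using one by linarith
      have "sum x ?S \<le> 1 - W q" using ok one by (simp add: k0_def k1_def k2_def q_def)
      then show ?thesis unfolding D using one cs by auto
    next
      case one1
      then have "k1 = 1" "k2 = 1" "k0 = 1" using kpos by linarith+
      then show ?thesis using ch by (simp only:) simp
    next
      case two
      have "(1 - W (t i)) * (1 - (real k1 + real k2 - real k0)) \<le> - (1 - W (t i))" using mul[of 1] two by simp
      then show ?thesis using two ch Xle cs by auto
    next
      case two1
      show ?thesis
      proof (cases "2 \<le> k1 \<and> 2 \<le> k2")
        case True
        then have "(1 - W (t i)) * (1 - (real k1 + real k2 - real k0)) \<le> - ((1 - W (t i)) * 2)" using mul[of 2] two1 by simp
        then show ?thesis using two1 True ch Xle c2W by simp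
      next
        case False
        have "(1 - W (t i)) * (1 - (real k1 + real k2 - real k0)) \<le> - (1 - W (t i))" using mul[of 1] two1 by simp
        then show ?thesis using two1 False ch c2W kpos cs by auto
      qed
    qed
  qed
  show ?thesis unfolding bound_def lhs tot using B1 B2 main unfolding k0_def[symmetric] c_def[symmetric] by linarith
qed

end

lemma conn_union_conn:
  assumes "\<And>a b. {a, b} \<in> Z \<Longrightarrow> conn H a b" "conn (H \<union> Z) u v"
  shows "conn H u v"
  using assms(2)
proof (induction rule: conn_induct)
  case refl then show ?case by simp
next
  case (step w z)
  have "conn H w z" using step(2) assms(1)[of w z] conn_edge[of w z H] by blast
  then show ?case using conn_trans[OF step(3)] by blast
qed

section \<open>How coranks fall when edges are added\<close>

context leveled_graph
begin

text \<open>Only positive thresholds count, so switching off a cut by \<open>t(i := 0)\<close> is as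
  much progress in the induction as cutting the interval at \<open>i\<close>.\<close>

definition pos :: "(nat \<Rightarrow> nat) \<Rightarrow> nat \<Rightarrow> nat \<Rightarrow> nat" where
  "pos t a b = card {j. a < j \<and> j < b \<and> 0 < t j}"

lemma pos_less:
  assumes "{j. c < j \<and> j < d \<and> 0 < t' j} \<subseteq> {j. a < j \<and> j < b \<and> 0 < t j} - {i}" "a < i" "i < b" "0 < t i"
  shows "pos t' c d < pos t a b"
proof -
  have f: "finite {j. a < j \<and> j < b \<and> 0 < t j}" by (rule finite_subset[of _ "{..<b}"]) auto
  have "pos t' c d \<le> card ({j. a < j \<and> j < b \<and> 0 < t j} - {i})" unfolding pos_def using f assms(1) by (intro card_mono) auto
  also have "\<dots> < pos t a b" unfolding pos_def by (rule card_Diff1_less[OF f]) (use assms in auto)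
  finally show ?thesis .
qed

text \<open>This is the reason for the inequality in \<open>adm\<close>: the induction passes to
  thresholds for which a cut is lonely in fewer trees than the LP provides for.\<close>

lemma adm_upd: "adm t \<Longrightarrow> adm (t(j := 0))"
proof -
  assume t: "adm t"
  have "W 0 \<le> 1 - nu j" if "j \<le> p + 1"
  proof -
    have "W (t j) \<le> 1 - nu j" "0 \<le> W (t j)" using t that W_mono[of 0 "t j"] by (auto simp: adm_def)
    then show ?thesis by simp
  qed
  then show ?thesis using t by (auto simp: adm_def)
qed

text \<open>A new edge crossing a cut that is already hit is spanned if this is its only active cut
  and a loop otherwise. Hence the rank-one summands stay as they are and only the graphic part
  changes.\<close>

lemma dec_unc:
  assumes "\<And>e. e \<in> F \<Longrightarrow> (\<forall>j. crosses j e \<longrightarrow> t j \<le> k) \<or> (\<exists>j\<in>hits t k A. crosses j e)"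
  shows "cor t k a b A - cor t k a b (A \<union> F) =
    real (ncomp (Lv a b) (unc t k A)) - real (ncomp (Lv a b) (unc t k A \<union> unc t k F))"
proof -
  have "hits t k (A \<union> F) = hits t k A"
  proof
    show "hits t k (A \<union> F) \<subseteq> hits t k A"
    proof
      fix j assume "j \<in> hits t k (A \<union> F)"
      then obtain e where e: "k < t j" "e \<in> A \<union> F" "crosses j e" "\<And>j'. crosses j' e \<Longrightarrow> k < t j' \<Longrightarrow> j' = j"
        by (rule hitsE) blast
      show "j \<in> hits t k A"
      proof (cases "e \<in> A")
        case True then show ?thesis using hitsI[of k t j e A] e by blast
      next
        case False
        then obtain j' where "j' \<in> hits t k A" "crosses j' e" using assms[of e] e by (auto simp: not_le[symmetric])
        moreover then have "k < t j'" by (auto elim: hitsE)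
        ultimately show ?thesis using e(4)[of j'] by simp
      qed
    qed
    show "hits t k A \<subseteq> hits t k (A \<union> F)" by (auto elim!: hitsE intro!: hitsI)
  qed
  moreover have "unc t k (A \<union> F) = unc t k A \<union> unc t k F" by (auto simp: unc_def)
  ultimately show ?thesis by (simp add: cor_def)
qed

text \<open>Filling an interval merges the components that meet it, and \<open>A'\<close> bounds
  their number. If \<open>H\<close> already joins two components of \<open>A'\<close>, there is one
  fewer left to merge.\<close>

lemma drop_le:
  assumes "a \<le> c" "d \<le> b" "c < d" "b \<le> p + 1" "F \<subseteq> Ein c d"
    "A' \<subseteq> H"
  shows "real (ncomp (Lv a b) H) - real (ncomp (Lv a b) (H \<union> F)) \<le> real (ncomp (Lv c d) A') - 1"
    and "u \<in> Lv c d \<Longrightarrow> v \<in> Lv c d \<Longrightarrow> conn H u v \<Longrightarrow> \<not> conn A' u v \<Longrightarrow>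
     real (ncomp (Lv a b) H) - real (ncomp (Lv a b) (H \<union> F)) \<le> real (ncomp (Lv c d) A') - 2"
proof -
  have sub: "Lv c d \<subseteq> Lv a b" using assms by (auto simp: Lv_def)
  have d: "ncomp (Lv a b) H + 1 \<le> ncomp (Lv a b) (H \<union> F) + card (vcomp (Lv a b) H ` Lv c d)"
  proof (rule ncomp_drop[OF finLv sub])
    show "Lv c d \<noteq> {}" using Lv_nonempty[of c d] assms by simp
    fix e assume "e \<in> F"
    then show "e \<subseteq> Lv c d" using Ein_sub_Lv[of e c d] assms(5) by blast
  qed
  have m: "u \<in> Lv c d \<Longrightarrow> v \<in> Lv c d \<Longrightarrow> conn A' u v \<Longrightarrow> conn H u v" for u v by (rule conn_mono[OF _ assms(6)])
  show "real (ncomp (Lv a b) H) - real (ncomp (Lv a b) (H \<union> F)) \<le> real (ncomp (Lv c d) A') - 1"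
  proof -
    have "card (vcomp (Lv a b) H ` Lv c d) \<le> ncomp (Lv c d) A'"
      by (rule vcomp_image_le(1)[OF finLv sub]) (rule m)
    then show ?thesis using d by linarith
  qed
  show "u \<in> Lv c d \<Longrightarrow> v \<in> Lv c d \<Longrightarrow> conn H u v \<Longrightarrow> \<not> conn A' u v \<Longrightarrow>
     real (ncomp (Lv a b) H) - real (ncomp (Lv a b) (H \<union> F)) \<le> real (ncomp (Lv c d) A') - 2"
  proof -
    assume uv: "u \<in> Lv c d" "v \<in> Lv c d" "conn H u v" "\<not> conn A' u v"
    have "card (vcomp (Lv a b) H ` Lv c d) < ncomp (Lv c d) A'"
      by (rule vcomp_image_le(2)[OF finLv sub _ uv]) (rule m)
    then show ?thesis using d by linarith
  qed
qed

end

text \<open>Minimal in two ways: \<open>IH1\<close> is the induction on \<open>pos\<close> over all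
  thresholds and intervals, \<open>IH2\<close> an inner induction on the number of missing edges. A
  failure is thus maximal in \<open>A\<close>, which is exploited by filling in whole
  subintervals.\<close>

locale min_counter = leveled_graph +
  fixes t :: "nat \<Rightarrow> nat" and a b :: nat and A :: "'a set set"
  assumes adm: "adm t" and L: "layer t a b" and A: "A \<subseteq> Ein a b"
    and IH1: "\<And>t' c d B. adm t' \<Longrightarrow> layer t' c d \<Longrightarrow> B \<subseteq> Ein c d \<Longrightarrow> pos t' c d < pos t a b \<Longrightarrow> bound t' c d B"
    and IH2: "\<And>F. F \<subseteq> Ein a b \<Longrightarrow> \<not> F \<subseteq> A \<Longrightarrow> bound t a b (A \<union> F)"
    and neg: "\<not> bound t a b A"
begin

lemma bp: "a < b" "b \<le> p + 1" using L by (auto simp: layer_def)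

lemma tab: "a < j \<Longrightarrow> j < b \<Longrightarrow> t j \<le> t a \<and> t j \<le> t b" using L by (auto simp: layer_def)

lemma tn: "j \<le> p + 1 \<Longrightarrow> t j \<le> n" using adm by (auto simp: adm_def)

text \<open>Adding \<open>F\<close> lowers the right side of the bound by
  \<open>sum x (F - A)\<close>, and the slack correction can only disappear. If the average corank
  falls by no more than this weight, the bound for \<open>A\<close> follows from the one for the
  larger set.\<close>

lemma no_fill:
  assumes F: "F \<subseteq> Ein a b" and le: "(\<Sum>k<n. w k * (cor t k a b A - cor t k a b (A \<union> F))) \<le> sum x (F - A)"
  shows "F \<subseteq> A"
proof (rule ccontr)
  assume nF: "\<not> F \<subseteq> A"
  have b: "(\<Sum>k<n. w k * cor t k a b (A \<union> F)) - (if 2 \<le> ncomp (Lv a b) (A \<union> F) then slack a b else 0)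
    \<le> sum x (Ein a b - (A \<union> F))" using IH2[OF F nF] by (simp add: bound_def)
  have "sum x (Ein a b - A) = sum x (Ein a b - (A \<union> F)) + sum x (F - A)"
  proof -
    have "Ein a b - A = (Ein a b - (A \<union> F)) \<union> (F - A)" using F by auto
    moreover have "(Ein a b - (A \<union> F)) \<inter> (F - A) = {}" by auto
    moreover have "finite F" using F finEin finite_subset by blast
    ultimately show ?thesis using finEin by (simp add: sum.union_disjoint)
  qed
  moreover have "ncomp (Lv a b) (A \<union> F) \<le> ncomp (Lv a b) A" by (rule ncomp_antimono[OF finLv]) auto
  moreover have "0 \<le> slack a b" using slack_nonneg bp by blast
  moreover have "(\<Sum>k<n. w k * (cor t k a b A - cor t k a b (A \<union> F))) =
    (\<Sum>k<n. w k * cor t k a b A) - (\<Sum>k<n. w k * cor t k a b (A \<union> F))"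
    by (simp add: right_diff_distrib sum_subtractf)
  ultimately have "bound t a b A" using b le unfolding bound_def by (auto split: if_splits)
  then show False using neg by simp
qed

text \<open>By \<open>hi\<close> every tree from \<open>m\<close> on saves one unit, in total
  \<open>1 - W m\<close>. This pays for the slack in the bound of the subinterval, so filling the
  subinterval is affordable and \<open>no_fill\<close> shows that \<open>A\<close> already contains
  it.\<close>

lemma fill_gen:
  assumes cd: "a \<le> c" "c < d" "d \<le> b" and two: "2 \<le> ncomp (Lv c d) (A \<inter> Ein c d)"
    and b: "bound t' c d (A \<inter> Ein c d)" and sl: "slack c d \<le> 1 - W m" and m: "0 < m" "m \<le> n"
    and lo: "\<And>k. k < m \<Longrightarrow> cor t k a b A - cor t k a b (A \<union> Ein c d) \<le> cor t' k c d (A \<inter> Ein c d)"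
    and hi: "\<And>k. m \<le> k \<Longrightarrow> cor t k a b A - cor t k a b (A \<union> Ein c d) \<le> cor t' k c d (A \<inter> Ein c d) - 1"
  shows False
proof -
  let ?A' = "A \<inter> Ein c d"
  have "(\<Sum>k<n. w k * (cor t k a b A - cor t k a b (A \<union> Ein c d)))
      \<le> (\<Sum>k<n. w k * cor t' k c d ?A' + w k * (if k < m then 0 else - 1))"
    unfolding distrib_left[symmetric]
    by (intro sum_mono mult_left_mono) (use lo hi less_imp_le[OF wpos] in \<open>auto simp: not_less\<close>)
  also have "\<dots> = (\<Sum>k<n. w k * cor t' k c d ?A') - (1 - W m)"
    using sum_w_cases[OF m(2), of 0 "- 1"] by (simp add: sum.distrib)
  also have "\<dots> \<le> (\<Sum>k<n. w k * cor t' k c d ?A') - slack c d" using sl by simp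
  also have "\<dots> \<le> sum x (Ein c d - ?A')" using b two by (simp add: bound_def)
  also have "Ein c d - ?A' = Ein c d - A" by auto
  finally have "Ein c d \<subseteq> A" using no_fill[OF Ein_mono] cd by blast
  then have "?A' = Ein c d" by auto
  \<comment> \<open>A full interval has at most \<open>1 + slack c d\<close> components, and this is
    below \<open>2\<close> since \<open>W m\<close> is positive.\<close>
  then have "real (ncomp (Lv c d) ?A') - 1 - slack c d \<le> 0" using base_bound[of ?A' c d] cd bp by simp
  then show False using two sl W_pos[OF m] by linarith
qed

text \<open>Suppose \<open>u\<close> and \<open>v\<close> are joined only by a detour outside the
  interval. All trees from \<open>m\<close> on see the detour and have no active cut inside, so each
  saves one component when the interval is filled, which is the situation of
  \<open>fill_gen\<close>.\<close>

lemma fill1: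
  assumes cd: "a \<le> c" "d \<le> b" "(c, d) \<noteq> (a, b)" "c < d" and m: "m \<le> t c" "m \<le> t d" "0 < m"
    and inner: "\<And>j. c < j \<Longrightarrow> j < d \<Longrightarrow> t j \<le> m"
    and uv: "u \<in> Lv c d" "v \<in> Lv c d" "conn (unc t m A) u v"
  shows "conn (A \<inter> Ein c d) u v"
proof (rule ccontr)
  assume nc: "\<not> conn (A \<inter> Ein c d) u v"
  let ?A' = "A \<inter> Ein c d"
  have dp: "d \<le> p + 1" using cd bp by simp
  have lay: "layer t c d" using layer_sub[of c d t m] inner m cd dp by blast
  obtain i where i: "i = c \<or> i = d" "a < i" "i < b" using cd by (metis le_neq_implies_less less_le_trans le_less_trans prod.inject)
  have pl: "pos t c d < pos t a b" by (rule pos_less[of _ _ _ _ _ _ i]) (use i cd m in auto)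
  have two: "2 \<le> ncomp (Lv c d) ?A'" using ncomp_eq1_conn[OF finLv _ uv(1,2), of ?A'] nc by linarith
  have cross: "t j \<le> k" if "e \<in> Ein c d" "crosses j e" "m \<le> k" for e j k
    using inner[of j] crosses_Ein[OF that(1,2)] that(3) by simp
  show False
  proof (rule fill_gen[of c d t m])
    show "slack c d \<le> 1 - W m" using both_cross_le(1)[of c d t m] cd dp adm m by blast
    show "m \<le> n" using m tn[OF dp] by simp
    show "bound t c d ?A'" using IH1[OF adm lay _ pl] by blast
    fix k assume "k < m"
    then show "cor t k a b A - cor t k a b (A \<union> Ein c d) \<le> cor t k c d ?A'"
      using cor_dec_le[of a c d b k t A "Ein c d"] cd bp m A by simp
  next
    fix k assume k: "m \<le> k"
    have u: "unc t k (Ein c d) = Ein c d" using cross k by (auto simp: unc_def)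
    have sub: "?A' \<subseteq> unc t k A" using cross k by (auto simp: unc_def)
    have c2: "conn (unc t k A) u v" using uv(3) by (rule conn_mono) (use k in \<open>auto simp: unc_def intro: le_trans\<close>)
    have "cor t k a b A - cor t k a b (A \<union> Ein c d) =
      real (ncomp (Lv a b) (unc t k A)) - real (ncomp (Lv a b) (unc t k A \<union> Ein c d))"
      using dec_unc[of "Ein c d" t k A a b] cross k u by auto
    also have "\<dots> \<le> real (ncomp (Lv c d) ?A') - 2"
      using drop_le(2)[of a c d b "Ein c d" ?A' "unc t k A" u v] cd bp sub uv(1,2) c2 nc by blast
    also have "\<dots> = cor t k c d ?A' - 1"
    proof -
      have "t j \<le> k" if "c < j" "j < d" for j using inner[OF that] k by linarith
      then show ?thesis using cor_top(1)[of c d t k ?A'] by simp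
    qed
    finally show "cor t k a b A - cor t k a b (A \<union> Ein c d) \<le> cor t k c d ?A' - 1" .
  qed (use cd two m in auto)
qed

text \<open>The analogue of \<open>fill1\<close> with one active cut \<open>j\<close> inside. As
  \<open>j\<close> is unhit at \<open>k0\<close>, no edge of \<open>A\<close> between its neighbours
  crosses it, and setting its threshold to \<open>0\<close> leaves the coranks there unchanged; at
  higher levels \<open>j\<close> is already hit, so new edges crossing it do not lower the
  corank.\<close>

lemma fill2:
  assumes j: "a < j" "j < b" "k0 < t j" "j \<notin> hits t k0 A"
    and hit: "\<And>k. k0 < k \<Longrightarrow> k < t j \<Longrightarrow> j \<in> hits t k A"
    and lr: "a \<le> l" "l < j" "j < r" "r \<le> b" "k0 < t l" "k0 < t r"
      "\<And>i. l < i \<Longrightarrow> i < r \<Longrightarrow> i \<noteq> j \<Longrightarrow> t i \<le> k0"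
    and uv: "u \<in> Lv l r" "v \<in> Lv l r" "conn (unc t (t j) A) u v"
  shows "conn (A \<inter> Ein l r) u v"
proof (rule ccontr)
  assume nc: "\<not> conn (A \<inter> Ein l r) u v"
  let ?A' = "A \<inter> Ein l r"
  let ?t = "t(j := 0)"
  have rp: "r \<le> p + 1" using lr bp by simp
  have ncross: "\<not> crosses j e" if "e \<in> ?A'" for e
    using hits_of_between[of e A l r j k0 t] that j lr(7) by blast
  have lay: "layer ?t l r" by (rule layer_sub[of _ _ _ k0]) (use lr rp in \<open>auto simp: less_imp_le\<close>)
  have pl: "pos ?t l r < pos t a b" by (rule pos_less[of _ _ _ _ _ _ j]) (use j lr in auto)
  have two: "2 \<le> ncomp (Lv l r) ?A'" using ncomp_eq1_conn[OF finLv _ uv(1,2), of ?A'] nc by linarith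
  have ceq: "cor ?t k l r ?A' = cor t k l r ?A'" for k
  proof -
    have *: "crosses j' e \<Longrightarrow> ?t j' = t j'" if "e \<in> ?A'" for e j' using ncross[OF that] by auto
    have "(\<forall>i. crosses i e \<longrightarrow> ?t i \<le> k) \<longleftrightarrow> (\<forall>i. crosses i e \<longrightarrow> t i \<le> k)" if "e \<in> ?A'" for e
      using ncross[OF that] by auto
    then have "unc ?t k ?A' = unc t k ?A'" unfolding unc_def by blast
    moreover have "hits ?t k ?A' = hits t k ?A'"
    proof (intro equalityI subsetI)
      fix i assume "i \<in> hits ?t k ?A'"
      then obtain e where e: "k < ?t i" "e \<in> ?A'" "crosses i e" "\<And>j'. crosses j' e \<Longrightarrow> k < ?t j' \<Longrightarrow> j' = i"
        by (rule hitsE) blast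
      show "i \<in> hits t k ?A'"
      proof (rule hitsI[of k t i e])
        show "k < t i" using e(1) *[OF e(2,3)] by simp
        fix j' assume j': "crosses j' e" "k < t j'"
        then show "j' = i" using e(4)[OF j'(1)] *[OF e(2) j'(1)] by simp
      qed (use e(2,3) in simp_all)
    next
      fix i assume "i \<in> hits t k ?A'"
      then obtain e where e: "k < t i" "e \<in> ?A'" "crosses i e" "\<And>j'. crosses j' e \<Longrightarrow> k < t j' \<Longrightarrow> j' = i"
        by (rule hitsE) blast
      show "i \<in> hits ?t k ?A'"
      proof (rule hitsI[of k ?t i e])
        show "k < ?t i" using e(1) *[OF e(2,3)] by simp
        fix j' assume j': "crosses j' e" "k < ?t j'"
        then show "j' = i" using e(4)[OF j'(1)] *[OF e(2) j'(1)] by simp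
      qed (use e(2,3) in simp_all)
    qed
    ultimately show ?thesis by (simp add: cor_def)
  qed
  have inner: "?t i \<le> k0" if "l < i" "i < r" for i using lr(7) that by auto
  have split: "ncomp (Lv l r) ?A' = ncomp (Lv l j) (?A' \<inter> Ein l j) + ncomp (Lv j r) (?A' \<inter> Ein j r)"
  proof -
    have "{e \<in> ?A'. \<not> crosses j e} = ?A'" using ncross by blast
    then show ?thesis using ncomp_join[of l j r ?A'] lr by simp
  qed
  show False
  proof (rule fill_gen[of l r ?t "Suc k0"])
    show "slack l r \<le> 1 - W (Suc k0)" using both_cross_le(1)[of l r t "Suc k0"] lr rp adm by simp
    show "Suc k0 \<le> n" using lr(6) tn[OF rp] by simp
    show "bound ?t l r ?A'" using IH1[OF adm_upd[OF adm] lay _ pl] by blast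
    fix k assume "k < Suc k0"
    then show "cor t k a b A - cor t k a b (A \<union> Ein l r) \<le> cor ?t k l r ?A'"
      unfolding ceq using cor_dec_le[of a l r b k t A "Ein l r"] lr bp A by simp
  next
    fix k assume k: "Suc k0 \<le> k"
    have cc: "t i \<le> k \<or> i = j" if "e \<in> Ein l r" "crosses i e" for e i
      using lr(7)[of i] crosses_Ein[OF that] k by auto
    have sub: "?A' \<subseteq> unc t k A"
    proof
      fix e assume e: "e \<in> ?A'"
      then have "t i \<le> k" if "crosses i e" for i using cc[of e i] ncross[OF e] that by blast
      then show "e \<in> unc t k A" using e by (auto simp: unc_def)
    qed
    have "cor t k a b A - cor t k a b (A \<union> Ein l r) =
      real (ncomp (Lv a b) (unc t k A)) - real (ncomp (Lv a b) (unc t k A \<union> unc t k (Ein l r)))"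
    proof (rule dec_unc)
      fix e assume e: "e \<in> Ein l r"
      show "(\<forall>i. crosses i e \<longrightarrow> t i \<le> k) \<or> (\<exists>i\<in>hits t k A. crosses i e)"
      proof (cases "crosses j e \<and> k < t j")
        case True then show ?thesis using hit[of k] k by auto
      next
        case False then show ?thesis using cc[OF e] by (metis not_le)
      qed
    qed
    also have "\<dots> \<le> real (ncomp (Lv l r) ?A') - 2"
    proof (cases "k < t j")
      case True
      have u: "unc t k (Ein l r) = Ein l j \<union> Ein j r"
      proof (intro equalityI subsetI)
        fix e assume "e \<in> unc t k (Ein l r)"
        then have "e \<in> Ein l r" "\<not> crosses j e" using True by (auto simp: unc_def)
        then show "e \<in> Ein l j \<union> Ein j r" using Ein_noncross by blast
      next
        fix e assume e: "e \<in> Ein l j \<union> Ein j r"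
        then have e1: "e \<in> Ein l r" using Ein_mono[of l l j r] Ein_mono[of l j r r] lr by auto
        have "\<not> crosses j e" using e crosses_Ein[of e l j j] crosses_Ein[of e j r j] by auto
        then have "t i \<le> k" if "crosses i e" for i using cc[OF e1 that] that by blast
        then show "e \<in> unc t k (Ein l r)" using e1 by (auto simp: unc_def)
      qed
      \<comment> \<open>While \<open>j\<close> is active its two sides are filled separately. Each
        side keeps at least one component, which gives the required \<open>- 2\<close> without using
        the detour.\<close>
      have "real (ncomp (Lv a b) (unc t k A)) - real (ncomp (Lv a b) (unc t k A \<union> Ein l j))
          \<le> real (ncomp (Lv l j) (?A' \<inter> Ein l j)) - 1"
        by (rule drop_le(1)) (use lr bp j sub in auto)
      moreover have "real (ncomp (Lv a b) (unc t k A \<union> Ein l j)) - real (ncomp (Lv a b) ((unc t k A \<union> Ein l j) \<union> Ein j r))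
          \<le> real (ncomp (Lv j r) (?A' \<inter> Ein j r)) - 1"
        by (rule drop_le(1)) (use lr bp j sub in auto)
      ultimately show ?thesis unfolding u split by (simp add: Un_assoc)
    next
      case False
      have u: "unc t k (Ein l r) = Ein l r"
      proof -
        have "t i \<le> k" if "e \<in> Ein l r" "crosses i e" for i e using cc[OF that] False by auto
        then show ?thesis by (auto simp: unc_def)
      qed
      have c2: "conn (unc t k A) u v" using uv(3) by (rule conn_mono) (use False in \<open>auto simp: unc_def intro: le_trans\<close>)
      show ?thesis unfolding u
        using drop_le(2)[of a l r b "Ein l r" ?A' "unc t k A" u v] lr bp sub uv(1,2) c2 nc by simp
    qed
    also have "\<dots> = cor ?t k l r ?A' - 1"
    proof -
      have "?t i \<le> k" if "l < i" "i < r" for i using inner[OF that] k by linarith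
      then show ?thesis using cor_top(1)[of l r ?t k ?A'] by auto
    qed
    finally show "cor t k a b A - cor t k a b (A \<union> Ein l r) \<le> cor ?t k l r ?A' - 1" .
  qed (use lr two in auto)
qed

text \<open>The claim is clear for \<open>(a, b)\<close> and is carried inwards through a sequence
  of nested layers, \<open>fill1\<close> performing each step from a layer to the next smaller
  one.\<close>

lemma no_merge:
  assumes "layer t c d" "a \<le> c" "d \<le> b" "0 < t c" "0 < t d" "u \<in> Lv c d" "v \<in> Lv c d" "conn A u v"
  shows "conn (A \<inter> Ein c d) u v"
  using assms
proof (induction "(c - a) + (b - d)" arbitrary: c d rule: less_induct)
  case less
  show ?case
  proof (cases "(c, d) = (a, b)")
    case True then show ?thesis using less(9) A by (simp add: Int_absorb2)
  next
    case False
    \<comment> \<open>Each end is pushed out to the nearest cut of threshold above \<open>m\<close>,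
      stopping at \<open>a\<close> and \<open>b\<close>. Inside the larger interval all thresholds
      are then at most \<open>m\<close>, so a connection there lies in \<open>unc t m A\<close>, as
      \<open>fill1\<close> requires.\<close>
    define m where "m = min (t c) (t d)"
    define c' where "c' = Max {j. a \<le> j \<and> j \<le> c \<and> (j = a \<or> m < t j)}"
    define d' where "d' = (LEAST j. d \<le> j \<and> (j = b \<or> m < t j))"
    have cd: "c < d" "\<And>j. c < j \<Longrightarrow> j < d \<Longrightarrow> t j \<le> m" using less(2) by (auto simp: layer_def m_def)
    have fin: "finite {j. a \<le> j \<and> j \<le> c \<and> (j = a \<or> m < t j)}" by (rule finite_subset[of _ "{..c}"]) auto
    have "c' \<in> {j. a \<le> j \<and> j \<le> c \<and> (j = a \<or> m < t j)}"
      unfolding c'_def by (rule Max_in[OF fin]) (use less(3) in auto)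
    then have c': "a \<le> c'" "c' \<le> c" "c' = a \<or> m < t c'" by auto
    have cm: "t j \<le> m" if "c' < j" "j \<le> c" for j
    proof (rule ccontr)
      assume "\<not> t j \<le> m"
      then have "j \<le> c'" unfolding c'_def by (intro Max_ge[OF fin]) (use that c' in auto)
      then show False using that by simp
    qed
    have d': "d \<le> d'" "d' = b \<or> m < t d'"
      using LeastI[of "\<lambda>j. d \<le> j \<and> (j = b \<or> m < t j)" b] less(4) by (auto simp: d'_def)
    have d'b: "d' \<le> b" unfolding d'_def by (rule Least_le) (use less(4) in simp)
    have dm: "t j \<le> m" if "d \<le> j" "j < d'" for j
      using not_less_Least[of j "\<lambda>j. d \<le> j \<and> (j = b \<or> m < t j)"] that by (auto simp: d'_def)
    have inner: "t j \<le> m" if "c' < j" "j < d'" for j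
      using cm[of j] dm[of j] cd(2)[of j] that by (meson not_le)
    have ma: "m \<le> t a"
    proof (cases "c = a")
      case False
      then have "a < c" "c < b" using less(3,4) cd by auto
      then show ?thesis using tab[of c] by (simp add: m_def min_le_iff_disj)
    qed (simp add: m_def)
    have mb: "m \<le> t b"
    proof (cases "d = b")
      case False
      then have "a < d" "d < b" using less(3,4) cd by auto
      then show ?thesis using tab[of d] by (simp add: m_def min_le_iff_disj)
    qed (simp add: m_def)
    have mcd: "m \<le> t c'" "m \<le> t d'" using c'(3) d'(2) ma mb by auto
    have m0: "0 < m" using less(5,6) by (simp add: m_def)
    have lay: "layer t c' d'" using layer_sub[of c' d' t m] inner mcd c' d' d'b cd bp by simp
    have ne: "c' \<noteq> c \<or> d' \<noteq> d"
    proof (rule ccontr)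
      assume "\<not> (c' \<noteq> c \<or> d' \<noteq> d)"
      then have *: "c = a \<or> m < t c" "d = b \<or> m < t d" using c'(3) d'(2) by auto
      have "t c = m \<or> t d = m" by (auto simp: m_def min_def)
      then show False
      proof
        assume "t c = m"
        then have "c = a" "d \<noteq> b" using * False by auto
        then have "t d \<le> m" using tab[of d] cd less(4) \<open>t c = m\<close> by auto
        then show False using * \<open>d \<noteq> b\<close> by simp
      next
        assume "t d = m"
        then have "d = b" "c \<noteq> a" using * False by auto
        then have "t c \<le> m" using tab[of c] cd less(3) \<open>t d = m\<close> by auto
        then show False using * \<open>c \<noteq> a\<close> by simp
      qed
    qed
    have sub: "Lv c d \<subseteq> Lv c' d'" using c' d' by (auto simp: Lv_def)
    have "conn (A \<inter> Ein c' d') u v"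
    proof (rule less(1))
      show "c' - a + (b - d') < c - a + (b - d)" using ne c' d' d'b less(4) by linarith
    qed (use lay c' d'b m0 mcd less(7,8,9) sub in auto)
    then have cu: "conn (unc t m A) u v"
    proof (rule conn_mono)
      show "A \<inter> Ein c' d' \<subseteq> unc t m A" using inner crosses_Ein[of _ c' d'] by (auto simp: unc_def)
    qed
    have "m \<le> t c" "m \<le> t d" by (simp_all add: m_def)
    then show ?thesis
      by (rule fill1[OF less(3,4) False cd(1) _ _ m0 cd(2) less(7,8) cu])
  qed
qed

end

context leveled_graph
begin

lemma conn_Ein:
  assumes "conn {e \<in> A. \<not> crosses i e} u v" "u \<in> Lv c d" "A \<subseteq> Ein a b"
    "c = a \<and> d = i \<or> c = i \<and> d = b" "a < i" "i < b"
  shows "conn (A \<inter> Ein c d) u v"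
proof -
  let ?H = "{e \<in> A. \<not> crosses i e}"
  have "e \<subseteq> Lv c d \<or> e \<inter> Lv c d = {}" if "e \<in> ?H" for e
  proof -
    have "e \<in> Ein a i \<or> e \<in> Ein i b" using that assms(3) Ein_noncross by blast
    then have "e \<subseteq> Lv a i \<or> e \<subseteq> Lv i b" using Ein_sub_Lv by blast
    then show ?thesis using assms(4) Lv_split[of a i b] assms(5,6) by auto
  qed
  then have "conn (ind ?H (Lv c d)) u v" using conn_ind[OF assms(1,2)] by blast
  then show ?thesis
    by (rule conn_mono) (use assms(3) Ein_sub in \<open>auto simp: ind_def Ein_def\<close>)
qed

end

section \<open>The cut of largest threshold in a minimal counterexample\<close>

context min_counter
begin

text \<open>When \<open>i\<close> is switched off, an edge \<open>e\<close> crossing only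
  \<open>i\<close> and \<open>j\<close> becomes a hit of \<open>j\<close>; this excludes that such a
  hit is new. The upper end of \<open>e\<close> lies above \<open>j\<close>, that of
  \<open>e0\<close> below, and both are joined in \<open>A\<close>. \<open>no_merge\<close> and
  \<open>fill2\<close> pull this connection between the neighbours of \<open>j\<close>, where no
  edge of \<open>A\<close> crosses the unhit cut \<open>j\<close>.\<close>

lemma no_new_hit_right:
  assumes i: "a < i" "i < j" "j < b" and k: "k < t j" "t j \<le> t i" and nh: "j \<notin> hits t k A"
    and e: "e \<in> A" "crosses i e" "crosses j e" "\<And>j'. crosses j' e \<Longrightarrow> k < t j' \<Longrightarrow> j' = i \<or> j' = j"
    and e0: "e0 \<in> A" "crosses i e0" "\<And>j'. crosses j' e0 \<Longrightarrow> k < t j' \<Longrightarrow> j' = i"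
    and conn: "\<And>v v0. v \<in> e \<Longrightarrow> i \<le> lev v \<Longrightarrow> v0 \<in> e0 \<Longrightarrow> i \<le> lev v0 \<Longrightarrow> conn A v0 v"
  shows False
proof -
  \<comment> \<open>The last level at which \<open>j\<close> is unhit, since \<open>fill2\<close>
    needs \<open>j\<close> to be hit at all later ones. The subtraction is not truncated because
    \<open>j\<close> is unhit at \<open>k\<close>.\<close>
  define k0 where "k0 = first_hit t j A - 1"
  have fk: "k < first_hit t j A" using first_hit(3)[of t j A k] k nh by (meson not_le)
  have k0: "k \<le> k0" "k0 < t j" "j \<notin> hits t k0 A"
    using fk first_hit(2)[of k0 t j A] by (auto simp: k0_def)
  have hit: "j \<in> hits t k' A" if "k0 < k'" "k' < t j" for k'
    using first_hit(3)[of t j A k'] that fk by (simp add: k0_def)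
  have aj: "a < j" using i by simp
  obtain l r where lr: "a \<le> l" "l < j" "j < r" "r \<le> b" "k0 < t l" "k0 < t r"
    "\<And>j'. l < j' \<Longrightarrow> j' < r \<Longrightarrow> j' \<noteq> j \<Longrightarrow> t j' \<le> k0" using neighbors[OF L aj i(3) k0(2)] by blast
  have eE: "e \<in> Ein a b" "e0 \<in> Ein a b" using e(1) e0(1) A by auto
  have between: "t j' \<le> k" if "i < j'" "j' < j" for j'
    using crosses_between[OF e(2,3), of j'] e(4)[of j'] that by force
  \<comment> \<open>Every cut between \<open>i\<close> and \<open>j\<close> is crossed by
    \<open>e\<close>, hence inactive, so \<open>i\<close> is the lower active neighbour of
    \<open>j\<close>.\<close>
  have "l = i"
  proof (rule ccontr)
    assume "l \<noteq> i"
    then consider "l < i" | "i < l" by linarith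
    then show False
    proof cases
      case 1 then show False using lr(7)[of i] lr(3) i k0 k by simp
    next
      case 2 then show False using between[of l] lr(2,5) k0(1) by simp
    qed
  qed
  obtain u v where uv: "e = {u, v}" "u \<in> V" "v \<in> V" "lev u < j" "j \<le> lev v"
    using crossing_ends[OF subsetD[OF Ein_sub eE(1)] e(3)] by blast
  obtain u0 v0 where uv0: "e0 = {u0, v0}" "u0 \<in> V" "v0 \<in> V" "lev u0 < i" "i \<le> lev v0"
    using crossing_ends[OF subsetD[OF Ein_sub eE(2)] e0(2)] by blast
  have vr: "lev v < r"
  proof (cases "r = b")
    case True then show ?thesis using Ein_sub_Lv[OF eE(1)] uv by (auto simp: Lv_def)
  next
    case False
    show ?thesis
    proof (rule ccontr)
      assume "\<not> lev v < r"
      then have "crosses r e" using uv lr(3) by (auto simp: crosses_def)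
      then show False using e(4)[of r] lr i k0 by auto
    qed
  qed
  have v0j: "lev v0 < j"
  proof (rule ccontr)
    assume "\<not> lev v0 < j"
    then have "crosses j e0" using uv0 i by (auto simp: crosses_def)
    then show False using e0(3)[of j] k i by simp
  qed
  have vv: "v0 \<in> Lv i r" "v \<in> Lv i r" using uv uv0 v0j vr i lr by (auto simp: Lv_def)
  have cA: "conn A v0 v" using conn[of v v0] uv uv0 i by auto
  \<comment> \<open>This gives a layer starting at \<open>i\<close> whose inner thresholds are at
    most \<open>t j\<close>. Connections in it stay in \<open>unc t (t j) A\<close>, the level at
    which \<open>fill2\<close> takes its input.\<close>
  define d where "d = (LEAST d. j < d \<and> (d = b \<or> t j < t d))"
  have d: "j < d" "d = b \<or> t j < t d" using LeastI[of "\<lambda>d. j < d \<and> (d = b \<or> t j < t d)" b] i by (auto simp: d_def)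
  have db: "d \<le> b" unfolding d_def by (rule Least_le) (use i in simp)
  have dm: "t j' \<le> t j" if "j < j'" "j' < d" for j'
    using not_less_Least[of j' "\<lambda>d. j < d \<and> (d = b \<or> t j < t d)"] that by (auto simp: d_def)
  have rd: "r \<le> d"
  proof (rule ccontr)
    assume "\<not> r \<le> d"
    then have "t d \<le> k0" using lr(7)[of d] d lr by simp
    then show False using d(2) k0 \<open>\<not> r \<le> d\<close> lr(4) by auto
  qed
  have inner: "t j' \<le> t j" if "i < j'" "j' < d" for j'
    using between[of j'] dm[of j'] that k by (cases j' j rule: linorder_cases) auto
  have tjd: "t j \<le> t d" using d(2) tab[of j] i by auto
  have lay: "layer t i d" using layer_sub[of i d t "t j"] inner k tjd d i db bp by simp
  have "conn (A \<inter> Ein i d) v0 v"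
  proof (rule no_merge[OF lay])
    show "v0 \<in> Lv i d" "v \<in> Lv i d" using vv rd by (auto simp: Lv_def)
  qed (use i db k tjd cA in auto)
  then have "conn (unc t (t j) A) v0 v"
  proof (rule conn_mono)
    show "A \<inter> Ein i d \<subseteq> unc t (t j) A" using inner crosses_Ein[of _ i d] by (auto simp: unc_def)
  qed
  then have "conn (A \<inter> Ein i r) v0 v"
    using fill2[OF aj i(3) k0(2,3) hit lr, of v0 v] vv \<open>l = i\<close> by simp
  moreover have "\<not> crosses j e" if "e \<in> A \<inter> Ein i r" for e
    using hits_of_between[of e A l r j k0 t] that k0 lr(7) \<open>l = i\<close> by blast
  ultimately show False using nonconn_across[of "A \<inter> Ein i r" j v0 v] v0j uv(5) by blast
qed

text \<open>The mirror image of \<open>no_new_hit_right\<close>, with lower ends of edges in place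
  of upper ends.\<close>

lemma no_new_hit_left:
  assumes i: "a < j" "j < i" "i < b" and k: "k < t j" "t j \<le> t i" and nh: "j \<notin> hits t k A"
    and e: "e \<in> A" "crosses i e" "crosses j e" "\<And>j'. crosses j' e \<Longrightarrow> k < t j' \<Longrightarrow> j' = i \<or> j' = j"
    and e0: "e0 \<in> A" "crosses i e0" "\<And>j'. crosses j' e0 \<Longrightarrow> k < t j' \<Longrightarrow> j' = i"
    and conn: "\<And>v v0. v \<in> e \<Longrightarrow> lev v < i \<Longrightarrow> v0 \<in> e0 \<Longrightarrow> lev v0 < i \<Longrightarrow> conn A v v0"
  shows False
proof -
  define k0 where "k0 = first_hit t j A - 1"
  have fk: "k < first_hit t j A" using first_hit(3)[of t j A k] k nh by (meson not_le)
  have k0: "k \<le> k0" "k0 < t j" "j \<notin> hits t k0 A"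
    using fk first_hit(2)[of k0 t j A] by (auto simp: k0_def)
  have hit: "j \<in> hits t k' A" if "k0 < k'" "k' < t j" for k'
    using first_hit(3)[of t j A k'] that fk by (simp add: k0_def)
  have jb: "j < b" using i by simp
  obtain l r where lr: "a \<le> l" "l < j" "j < r" "r \<le> b" "k0 < t l" "k0 < t r"
    "\<And>j'. l < j' \<Longrightarrow> j' < r \<Longrightarrow> j' \<noteq> j \<Longrightarrow> t j' \<le> k0" using neighbors[OF L i(1) jb k0(2)] by blast
  have eE: "e \<in> Ein a b" "e0 \<in> Ein a b" using e(1) e0(1) A by auto
  have between: "t j' \<le> k" if "j < j'" "j' < i" for j'
    using crosses_between[OF e(3,2), of j'] e(4)[of j'] that by force
  have "r = i"
  proof (rule ccontr)
    assume "r \<noteq> i"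
    then consider "i < r" | "r < i" by linarith
    then show False
    proof cases
      case 1 then show False using lr(7)[of i] lr(2) i k0 k by simp
    next
      case 2 then show False using between[of r] lr(3,6) k0(1) by simp
    qed
  qed
  obtain u v where uv: "e = {u, v}" "u \<in> V" "v \<in> V" "lev u < j" "j \<le> lev v"
    using crossing_ends[OF subsetD[OF Ein_sub eE(1)] e(3)] by blast
  obtain u0 v0 where uv0: "e0 = {u0, v0}" "u0 \<in> V" "v0 \<in> V" "lev u0 < i" "i \<le> lev v0"
    using crossing_ends[OF subsetD[OF Ein_sub eE(2)] e0(2)] by blast
  have ur: "l \<le> lev u"
  proof (cases "l = a")
    case True then show ?thesis using Ein_sub_Lv[OF eE(1)] uv by (auto simp: Lv_def)
  next
    case False
    show ?thesis
    proof (rule ccontr)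
      assume "\<not> l \<le> lev u"
      then have "crosses l e" using uv lr(2) by (auto simp: crosses_def)
      then show False using e(4)[of l] lr i k0 by auto
    qed
  qed
  have u0j: "j \<le> lev u0"
  proof (rule ccontr)
    assume "\<not> j \<le> lev u0"
    then have "crosses j e0" using uv0 i by (auto simp: crosses_def)
    then show False using e0(3)[of j] k i by simp
  qed
  have vv: "u \<in> Lv l i" "u0 \<in> Lv l i" using uv uv0 u0j ur i lr by (auto simp: Lv_def)
  have cA: "conn A u u0" using conn[of u u0] uv uv0 i by auto
  define c where "c = Max {c. a \<le> c \<and> c < j \<and> (c = a \<or> t j < t c)}"
  have fin: "finite {c. a \<le> c \<and> c < j \<and> (c = a \<or> t j < t c)}" by (rule finite_subset[of _ "{..<j}"]) auto
  have "c \<in> {c. a \<le> c \<and> c < j \<and> (c = a \<or> t j < t c)}" unfolding c_def by (rule Max_in[OF fin]) (use i in auto)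
  then have c: "a \<le> c" "c < j" "c = a \<or> t j < t c" by auto
  have cm: "t j' \<le> t j" if "c < j'" "j' < j" for j'
  proof (rule ccontr)
    assume "\<not> t j' \<le> t j"
    then have "j' \<le> c" unfolding c_def by (intro Max_ge[OF fin]) (use that c in auto)
    then show False using that by simp
  qed
  have rd: "c \<le> l"
  proof (rule ccontr)
    assume "\<not> c \<le> l"
    then have "t c \<le> k0" using lr(7)[of c] c lr by simp
    then show False using c(3) k0 \<open>\<not> c \<le> l\<close> lr(1) by auto
  qed
  have inner: "t j' \<le> t j" if "c < j'" "j' < i" for j'
    using between[of j'] cm[of j'] that k by (cases j' j rule: linorder_cases) auto
  have tjd: "t j \<le> t c" using c(3) tab[of j] i by auto
  have lay: "layer t c i" using layer_sub[of c i t "t j"] inner k tjd c i bp by simp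
  have "conn (A \<inter> Ein c i) u u0"
  proof (rule no_merge[OF lay])
    show "u \<in> Lv c i" "u0 \<in> Lv c i" using vv rd by (auto simp: Lv_def)
  qed (use i c k tjd cA in auto)
  then have "conn (unc t (t j) A) u u0"
  proof (rule conn_mono)
    show "A \<inter> Ein c i \<subseteq> unc t (t j) A" using inner crosses_Ein[of _ c i] by (auto simp: unc_def)
  qed
  then have "conn (A \<inter> Ein l i) u u0"
    using fill2[OF i(1) jb k0(2,3) hit lr, of u u0] vv \<open>r = i\<close> by simp
  moreover have "\<not> crosses j e" if "e \<in> A \<inter> Ein l i" for e
    using hits_of_between[of e A l r j k0 t] that k0 lr(7) \<open>r = i\<close> by blast
  ultimately show False using nonconn_across[of "A \<inter> Ein l i" j u u0] u0j uv(4) by blast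
qed

text \<open>If the crossing edges cause just one merge, any one of them already causes it. A second
  crossing edge therefore closes a cycle, which splits into a connection on each side of
  \<open>i\<close>.\<close>

lemma single_merge:
  assumes i: "a < i" "i < b"
    and one: "ncomp (Lv a b) A + 1 = ncomp (Lv a i) (A \<inter> Ein a i) + ncomp (Lv i b) (A \<inter> Ein i b)"
    and e: "{u, v} \<in> A" "lev u < i" "i \<le> lev v" and e': "{u', v'} \<in> A" "lev u' < i" "i \<le> lev v'"
  shows "conn (A \<inter> Ein a i) u u'" "conn (A \<inter> Ein i b) v v'"
proof -
  let ?H = "{e \<in> A. \<not> crosses i e}"
  have nH: "ncomp (Lv a b) ?H = ncomp (Lv a b) A + 1" using ncomp_join[OF i A] one by simp
  have sub: "{u, v} \<subseteq> Lv a b" "{u', v'} \<subseteq> Lv a b" using Ein_sub_Lv A e(1) e'(1) by blast+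
  have nc: "\<not> conn ?H x y" if "lev x < i" "i \<le> lev y" for x y using nonconn_across[of ?H i x y] that by simp
  have "ncomp (Lv a b) ?H = ncomp (Lv a b) (insert {u, v} ?H) + 1"
    by (rule ncomp_insert_nconn[OF finLv]) (use nc[OF e(2,3)] sub in auto)
  then have n1: "ncomp (Lv a b) (insert {u, v} ?H) = ncomp (Lv a b) A" using nH by simp
  have "conn (insert {u, v} ?H) u' v'"
  proof (rule ccontr)
    assume "\<not> conn (insert {u, v} ?H) u' v'"
    then have "ncomp (Lv a b) (insert {u, v} ?H) = ncomp (Lv a b) (insert {u', v'} (insert {u, v} ?H)) + 1"
      by (rule ncomp_insert_nconn[OF finLv]) (use sub in auto)
    moreover have "ncomp (Lv a b) A \<le> ncomp (Lv a b) (insert {u', v'} (insert {u, v} ?H))"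
      by (rule ncomp_antimono[OF finLv]) (use e e' in auto)
    ultimately show False using n1 by simp
  qed
  then have "conn ?H u' u \<and> conn ?H v v' \<or> conn ?H u' v \<and> conn ?H u v'"
    by (rule conn_insert) (rule nc[OF e'(2,3)])
  then have "conn ?H u' u \<and> conn ?H v v'" using nc[OF e'(2) e(3)] by metis
  then have c: "conn ?H u u'" "conn ?H v v'" using conn_sym[of ?H u' u] by metis+
  show "conn (A \<inter> Ein a i) u u'" by (rule conn_Ein[OF c(1) _ A _ i]) (use sub e in \<open>auto simp: Lv_def\<close>)
  show "conn (A \<inter> Ein i b) v v'" by (rule conn_Ein[OF c(2) _ A _ i]) (use sub e in \<open>auto simp: Lv_def\<close>)
qed

lemma contradiction: False
proof (cases "\<exists>j. a < j \<and> j < b \<and> 0 < t j")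
  case False
  then have z: "t j \<le> k" if "a < j" "j < b" for j k using that by auto
  have "cor t k a b A = real (ncomp (Lv a b) A) - 1" for k by (rule cor_top(1)[OF z A])
  then have "(\<Sum>k<n. w k * cor t k a b A) = real (ncomp (Lv a b) A) - 1"
    using wsum by (simp add: sum_distrib_right[symmetric])
  moreover have "real (ncomp (Lv a b) A) - 1 - slack a b \<le> sum x (Ein a b - A)" by (rule base_bound[OF A bp])
  moreover have "0 \<le> sum x (Ein a b - A)" by (rule xnn') (use Ein_sub in blast)
  ultimately have "bound t a b A" unfolding bound_def by (auto split: if_splits)
  then show False using neg by simp
next
  case True
  let ?I = "{j. a < j \<and> j < b}"
  have finI: "finite ?I" "?I \<noteq> {}" using True finite_subset[of ?I "{..<b}"] by auto
  define i where "i = (ARG_MAX t j. j \<in> ?I)"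
  have "i \<in> ?I \<and> (\<forall>j. j \<in> ?I \<longrightarrow> t j \<le> t i)"
    unfolding i_def
  proof (rule arg_max_nat_lemma)
    show "(SOME j. j \<in> ?I) \<in> ?I" using finI(2) by (metis someI_ex ex_in_conv)
    have "t j \<le> Max (t ` ?I)" if "j \<in> ?I" for j using finI that by auto
    then show "\<forall>j. j \<in> ?I \<longrightarrow> t j < Suc (Max (t ` ?I))" by (simp add: less_Suc_eq_le)
  qed
  then have i: "a < i" "i < b" and top: "\<And>j. a < j \<Longrightarrow> j < b \<Longrightarrow> t j \<le> t i" by auto
  have ti: "0 < t i" using True top by (meson less_le_trans)
  let ?A1 = "A \<inter> Ein a i" and ?A2 = "A \<inter> Ein i b" and ?S = "{e \<in> A. crosses i e}"
  have la: "layer t a i" by (rule layer_sub[of _ _ _ "t i"]) (use top tab[of i] i bp in auto)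
  have lb: "layer t i b" by (rule layer_sub[of _ _ _ "t i"]) (use top tab[of i] i bp in auto)
  have b1: "bound t a i ?A1" by (rule IH1[OF adm la _ pos_less[of a i t a b t i]]) (use i ti in auto)
  have b2: "bound t i b ?A2" by (rule IH1[OF adm lb _ pos_less[of i b t a b t i]]) (use i ti in auto)
  define q where "q = first_hit t i A"
  have fail: "ncomp (Lv a b) A + 1 = ncomp (Lv a i) ?A1 + ncomp (Lv i b) ?A2 \<and> 1 - W q < sum x ?S"
    using join_bound[OF L adm i top A b1 b2] neg unfolding q_def by (meson not_le)
  note one = conjunct1[OF fail] and big = conjunct2[OF fail]
  have Sends: "\<exists>u v. e = {u, v} \<and> u \<in> V \<and> v \<in> V \<and> lev u < i \<and> i \<le> lev v" if "e \<in> ?S" for e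
  proof -
    have "e \<in> E" "crosses i e" using that A Ein_sub[of a b] by auto
    then show ?thesis by (rule crossing_ends) blast
  qed
  have AE: "A \<subseteq> E" using A Ein_sub[of a b] by blast
  have uncA: "unc t (t i) A = A" by (rule cor_top(2)[OF top A])
  show False
  proof (cases q)
    case (Suc k0)
    then have k0: "k0 < t i" "i \<notin> hits t k0 A" using first_hit(2)[of k0 t i A] by (auto simp: q_def)
    have hit: "i \<in> hits t k A" if "k0 < k" "k < t i" for k
      using first_hit(3)[of t i A k] that Suc by (simp add: q_def)
    obtain l r where lr: "a \<le> l" "l < i" "i < r" "r \<le> b" "k0 < t l" "k0 < t r"
      "\<And>j'. l < j' \<Longrightarrow> j' < r \<Longrightarrow> j' \<noteq> i \<Longrightarrow> t j' \<le> k0" using neighbors[OF L i k0(1)] by blast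
    have ncross: "\<not> crosses i e" if "e \<in> A \<inter> Ein l r" for e
      using hits_of_between[of e A l r i k0 t] that k0 lr(7) by blast
    \<comment> \<open>An edge of \<open>?S\<close> staying above \<open>l\<close> and one staying
      below \<open>r\<close> would, by the single merge, join two vertices on different sides of
      \<open>i\<close> within these levels. \<open>fill2\<close> would realize this by edges between
      \<open>l\<close> and \<open>r\<close>, none of which crosses \<open>i\<close>.\<close>
    have "(\<forall>e\<in>?S. crosses l e) \<or> (\<forall>e\<in>?S. crosses r e)"
    proof (rule ccontr)
      assume "\<not> ?thesis"
      then obtain e e' where e: "e \<in> ?S" "\<not> crosses l e" and e': "e' \<in> ?S" "\<not> crosses r e'" by blast
      obtain u v where uv: "e = {u, v}" "u \<in> V" "v \<in> V" "lev u < i" "i \<le> lev v" using Sends[OF e(1)] by blast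
      obtain u' v' where uv': "e' = {u', v'}" "u' \<in> V" "v' \<in> V" "lev u' < i" "i \<le> lev v'" using Sends[OF e'(1)] by blast
      have "l \<le> lev u" using e(2) uv lr(2) by (auto simp: crosses_def)
      moreover have "lev v' < r" using e'(2) uv' lr(3) by (auto simp: crosses_def)
      ultimately have in': "u \<in> Lv l r" "v' \<in> Lv l r" using uv uv' lr by (auto simp: Lv_def)
      have "conn ?A2 v v'" using single_merge(2)[OF i one, of u v u' v'] e e' uv uv' by auto
      then have "conn A v v'" by (rule conn_mono) auto
      moreover have "conn A u v" by (rule conn_edge) (use e uv in auto)
      ultimately have "conn (unc t (t i) A) u v'" unfolding uncA by (rule conn_trans[rotated])
      then have "conn (A \<inter> Ein l r) u v'" using fill2[OF i k0 hit lr in'] by blast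
      then show False using nonconn_across[of "A \<inter> Ein l r" i u v'] ncross uv(4) uv'(5) by blast
    qed
    then have "sum x ?S \<le> 1 - W q"
    proof
      assume all: "\<forall>e\<in>?S. crosses l e"
      have "sum x ?S \<le> sum x {e \<in> E. crosses l e \<and> crosses i e}"
        by (rule sum_mono2) (use finE xnn all subsetD[OF AE] in auto)
      also have "\<dots> \<le> 1 - W q" by (rule both_cross_le(2)) (use lr i bp adm k0 Suc in auto)
      finally show ?thesis .
    next
      assume all: "\<forall>e\<in>?S. crosses r e"
      have "sum x ?S \<le> sum x {e \<in> E. crosses i e \<and> crosses r e}"
        by (rule sum_mono2) (use finE xnn all subsetD[OF AE] in auto)
      also have "\<dots> \<le> 1 - W q" by (rule both_cross_le(2)) (use lr i bp adm k0 Suc in auto)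
      finally show ?thesis .
    qed
    then show False using big by simp
  next
    case 0
    have hit: "i \<in> hits t k A" if "k < t i" for k
      using first_hit(3)[of t i A k] that 0 by (simp add: q_def)
    \<comment> \<open>Switching \<open>i\<close> off loses one hit at each level where it was active
      and merges at most one pair of components. Hence no corank falls, and the bound for
      \<open>?t\<close>, which has smaller \<open>pos\<close>, implies the one for
      \<open>t\<close>.\<close>
    let ?t = "t(i := 0)"
    have "bound ?t a b A"
    proof (rule IH1[OF adm_upd[OF adm] _ A])
      show "layer ?t a b" using L i by (auto simp: layer_def)
      show "pos ?t a b < pos t a b" by (rule pos_less[of a b ?t a b t i]) (use i ti in auto)
    qed
    moreover have "cor t k a b A \<le> cor ?t k a b A" for k
    proof (cases "k < t i")
      case False
      then have 1: "t j \<le> k" if "a < j" "j < b" for j using top[OF that] by simp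
      then have 2: "?t j \<le> k" if "a < j" "j < b" for j using that by simp
      show ?thesis using cor_top(1)[of a b t k A] cor_top(1)[of a b ?t k A] 1 2 A by simp
    next
      case k: True
      obtain l r where lr: "a \<le> l" "l < i" "i < r" "r \<le> b" "k < t l" "k < t r"
        "\<And>j'. l < j' \<Longrightarrow> j' < r \<Longrightarrow> j' \<noteq> i \<Longrightarrow> t j' \<le> k" using neighbors[OF L i k] by blast
      obtain e0 where e0: "e0 \<in> A" "crosses i e0" "\<And>j'. crosses j' e0 \<Longrightarrow> k < t j' \<Longrightarrow> j' = i"
        using hit[OF k] by (rule hitsE) blast
      obtain u0 v0 where uv0: "e0 = {u0, v0}" "u0 \<in> V" "v0 \<in> V" "lev u0 < i" "i \<le> lev v0"
        using Sends[of e0] e0 by blast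
      have u0v0: "v0' = v0 \<or> lev v0' < i" "u0' = u0 \<or> i \<le> lev u0'" if "u0' \<in> e0" "v0' \<in> e0" for u0' v0'
        using that uv0 by auto
      have connv: "conn A v0' v" if e: "e \<in> ?S" and v: "v \<in> e" "i \<le> lev v" "v0' \<in> e0" "i \<le> lev v0'" for e v v0'
      proof -
        obtain u' v' where uv': "e = {u', v'}" "lev u' < i" "i \<le> lev v'" using Sends[OF e] by blast
        then have "v = v'" "v0' = v0" using v uv0 by auto
        then have "conn ?A2 v0' v" using single_merge(2)[OF i one, of u0 v0 u' v'] uv0 uv' e e0 by auto
        then show ?thesis by (rule conn_mono) auto
      qed
      have connu: "conn A u u0'" if e: "e \<in> ?S" and u: "u \<in> e" "lev u < i" "u0' \<in> e0" "lev u0' < i" for e u u0'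
      proof -
        obtain u' v' where uv': "e = {u', v'}" "lev u' < i" "i \<le> lev v'" using Sends[OF e] by blast
        then have "u = u'" "u0' = u0" using u uv0 by auto
        then have "conn ?A1 u u0'" using single_merge(1)[OF i one, of u' v' u0 v0] uv0 uv' e e0 by auto
        then show ?thesis by (rule conn_mono) auto
      qed
      have hsub: "hits ?t k A \<subseteq> hits t k A - {i}"
      proof
        fix j assume "j \<in> hits ?t k A"
        then obtain e where e: "k < ?t j" "e \<in> A" "crosses j e" "\<And>j'. crosses j' e \<Longrightarrow> k < ?t j' \<Longrightarrow> j' = j"
          by (rule hitsE) blast
        have ji: "j \<noteq> i" "k < t j" using e(1) by (auto split: if_splits)
        have jab: "a < j" "j < b" using crosses_Ein[of e a b j] e(2,3) A by auto
        have only: "j' = i \<or> j' = j" if "crosses j' e" "k < t j'" for j'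
          using e(4)[OF that(1)] that(2) by (cases "j' = i") auto
        have "j \<in> hits t k A"
        proof (rule ccontr)
          assume nh: "j \<notin> hits t k A"
          have ci: "crosses i e"
          proof (rule ccontr)
            assume "\<not> crosses i e"
            then have "j \<in> hits t k A" using hitsI[of k t j e A] only ji e(2,3) by blast
            then show False using nh by simp
          qed
          then have eS: "e \<in> ?S" using e(2) by simp
          consider "i < j" | "j < i" using ji by linarith
          then show False
          proof cases
            case 1
            show False
              by (rule no_new_hit_right[OF i(1) 1 jab(2) ji(2) top[OF jab] nh e(2) ci e(3) only e0 connv[OF eS]])
          next
            case 2
            show False
              by (rule no_new_hit_left[OF jab(1) 2 i(2) ji(2) top[OF jab] nh e(2) ci e(3) only e0 connu[OF eS]])
          qed
        qed
        then show "j \<in> hits t k A - {i}" using ji by simp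
      qed
      have "card (hits ?t k A) \<le> card (hits t k A - {i})" by (rule card_mono[OF _ hsub]) (use finhits[OF A] in simp)
      then have h: "card (hits ?t k A) + 1 \<le> card (hits t k A)"
        using hit[OF k] finhits[OF A, of t k] by (simp add: card_gt_0_iff Suc_le_eq) (metis One_nat_def Suc_pred card_gt_0_iff empty_iff le_imp_less_Suc)
      let ?H = "unc t k A"
      \<comment> \<open>The edges that become graphic once \<open>i\<close> is inactive. By
        \<open>no_merge\<close> on either side they all join the same two components of
        \<open>?H\<close>, so together they merge at most one pair.\<close>
      define Z where "Z = {e \<in> ?S. \<forall>j. crosses j e \<and> k < t j \<longrightarrow> j = i}"
      have uZ: "unc ?t k A = ?H \<union> Z"
        unfolding unc_def Z_def using k by (auto simp: not_le[symmetric] split: if_splits)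
      have Zl: "u \<in> Lv l i" "v \<in> Lv i r" if "{u, v} \<in> Z" "lev u < i" "i \<le> lev v" for u v
      proof -
        have e: "{u, v} \<in> Ein a b" "crosses i {u, v}" using that A by (auto simp: Z_def)
        have "\<not> crosses l {u, v}" "\<not> crosses r {u, v}" using that lr by (auto simp: Z_def)
        then have "{u, v} \<in> Ein l b" "{u, v} \<in> Ein a r"
          using Ein_cross_l[OF e] Ein_cross_r[OF e] lr by auto
        then show "u \<in> Lv l i" "v \<in> Lv i r" using Ein_sub_Lv that by (auto simp: Lv_def dest!: Ein_sub_Lv)
      qed
      have e0Z: "{u0, v0} \<in> Z" using e0 uv0 by (auto simp: Z_def)
      have lp: "r \<le> p + 1" using lr bp by simp
      have layl: "layer t l i" by (rule layer_sub[of _ _ _ k]) (use lr k i bp in auto)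
      have layr: "layer t i r" by (rule layer_sub[of _ _ _ k]) (use lr k lp in auto)
      have subl: "A \<inter> Ein l i \<subseteq> ?H"
      proof
        fix e assume e: "e \<in> A \<inter> Ein l i"
        then have "t j \<le> k" if "crosses j e" for j using crosses_Ein[of e l i j] that lr(7)[of j] lr(3) by auto
        then show "e \<in> ?H" using e by (auto simp: unc_def)
      qed
      have subr: "A \<inter> Ein i r \<subseteq> ?H"
      proof
        fix e assume e: "e \<in> A \<inter> Ein i r"
        then have "t j \<le> k" if "crosses j e" for j using crosses_Ein[of e i r j] that lr(7)[of j] lr(2) by auto
        then show "e \<in> ?H" using e by (auto simp: unc_def)
      qed
      have Zconn: "conn (insert {u0, v0} ?H) x y" if xy: "{x, y} \<in> Z" for x y
      proof -
        obtain u v where uv: "{x, y} = {u, v}" "lev u < i" "i \<le> lev v" using Sends[of "{x, y}"] xy by (auto simp: Z_def)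
        have S: "{u, v} \<in> ?S" using xy uv by (auto simp: Z_def)
        have "conn (A \<inter> Ein l i) u u0"
          by (rule no_merge[OF layl lr(1) _ _ _ _ _ connu[OF S]])
            (use i lr k Zl[of u v] Zl[OF e0Z] uv uv0 xy in auto)
        then have 1: "conn (insert {u0, v0} ?H) u u0" by (rule conn_mono) (use subl in auto)
        have "conn (A \<inter> Ein i r) v0 v"
          by (rule no_merge[OF layr _ lr(4) _ _ _ _ connv[OF S]])
            (use i lr k Zl[of u v] Zl[OF e0Z] uv uv0 xy in auto)
        then have 2: "conn (insert {u0, v0} ?H) v0 v" by (rule conn_mono) (use subr in auto)
        have 3: "conn (insert {u0, v0} ?H) u0 v0" by (rule conn_edge) simp
        have "conn (insert {u0, v0} ?H) u v" using conn_trans[OF conn_trans[OF 1 3] 2] .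
        then show ?thesis using uv(1) conn_sym by (auto simp: doubleton_eq_iff)
      qed
      have "ncomp (Lv a b) ?H \<le> ncomp (Lv a b) (?H \<union> Z) + 1"
      proof -
        have "{u0, v0} \<subseteq> Lv a b" using Ein_sub_Lv[of e0 a b] e0 A uv0 by auto
        then have "ncomp (Lv a b) ?H \<le> ncomp (Lv a b) (insert {u0, v0} ?H) + 1"
          using ncomp_insert_conn[OF finLv, of ?H u0 v0 a b] ncomp_insert_nconn[OF finLv, of ?H u0 v0 a b]
          by (cases "conn ?H u0 v0") auto
        moreover have "ncomp (Lv a b) (insert {u0, v0} ?H) \<le> ncomp (Lv a b) (?H \<union> Z)"
        proof -
          have "conn (insert {u0, v0} ?H) y z" if "conn (?H \<union> Z) y z" for y z
          proof -
            have "conn (insert {u0, v0} ?H \<union> Z) y z" by (rule conn_mono[OF that]) auto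
            then show ?thesis by (rule conn_union_conn[rotated]) (rule Zconn)
          qed
          then have "card (vcomp (Lv a b) (insert {u0, v0} ?H) ` Lv a b) \<le> ncomp (Lv a b) (?H \<union> Z)"
            by (intro vcomp_image_le(1)[OF finLv subset_refl])
          then show ?thesis by (simp add: ncomp_def contracted_verts_def)
        qed
        ultimately show ?thesis by simp
      qed
      then show ?thesis unfolding cor_def uZ using h by linarith
    qed
    then have "(\<Sum>k<n. w k * cor t k a b A) \<le> (\<Sum>k<n. w k * cor ?t k a b A)"
      by (intro sum_mono mult_left_mono) (use less_imp_le[OF wpos] in auto)
    ultimately have "bound t a b A" unfolding bound_def by linarith
    then show False using neg by simp
  qed
qed

end

section \<open>The rank inequality for the whole graph\<close>

context leveled_graph
begin

theorem bound_all:
  assumes "adm t" "layer t a b" "A \<subseteq> Ein a b"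
  shows "bound t a b A"
  using assms
proof (induction "pos t a b" arbitrary: t a b A rule: less_induct)
  case outer: less
  show ?case using outer(4)
  proof (induction "card (Ein a b - A)" arbitrary: A rule: less_induct)
    case inner: less
    show ?case
    proof (rule ccontr)
      assume neg: "\<not> bound t a b A"
      have "min_counter V E x lev p nu n w t a b A"
      proof unfold_locales
        fix F assume F: "F \<subseteq> Ein a b" "\<not> F \<subseteq> A"
        show "bound t a b (A \<union> F)"
        proof (rule inner(1))
          show "card (Ein a b - (A \<union> F)) < card (Ein a b - A)"
            by (rule psubset_card_mono) (use F finEin in auto)
        qed (use F inner(2) in auto)
      qed (use outer inner(2) neg in auto)
      then show False by (rule min_counter.contradiction)
    qed
  qed
qed

lemma Ein_all: "Ein 0 (p + 1) = E"
proof -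
  have "Lv 0 (p + 1) = V" using lev_le by (auto simp: Lv_def less_Suc_eq_le)
  then show ?thesis using EV by (auto simp: Ein_def ind_def vpairs_def)
qed

text \<open>Since \<open>nu\<close> vanishes at the two trivial cuts, so does \<open>slack\<close>
  on the full range of levels, and the correction term disappears.\<close>

corollary rank_inequality:
  assumes "adm t" "t 0 = n" "t (p + 1) = n" "nu 0 = 0" "nu (p + 1) = 0" "A \<subseteq> E"
  shows "(\<Sum>k<n. w k * cor t k 0 (p + 1) A) \<le> sum x (E - A)"
proof -
  have "layer t 0 (p + 1)" using assms by (auto simp: layer_def adm_def)
  then have b: "bound t 0 (p + 1) A" using bound_all assms Ein_all by simp
  have "slack 0 (p + 1) \<le> 0"
    using slack_eq[of 0 "p + 1"] xnn'[of "{e \<in> E. crosses 0 e \<and> crosses (p + 1) e}"] assms by auto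
  then have "slack 0 (p + 1) = 0" using slack_nonneg[of 0 "p + 1"] by simp
  then show ?thesis using b Ein_all unfolding bound_def by (simp split: if_splits)
qed

end

section \<open>The chain of narrow cuts\<close>

locale lp_sol =
  fixes V :: "'v set" and s t :: 'v and x :: "'v set \<Rightarrow> real"
  assumes finV: "finite V" and sV: "s \<in> V" and tV: "t \<in> V" and feas: "lp_feasible V s t x"
begin

abbreviation "E \<equiv> supp_edges V x"

definition xd :: "'v set \<Rightarrow> real" where
  "xd U = sum x (cut_edges V U)"

lemma finvp: "finite (vpairs V)" using finite_vpairs[OF finV] .

lemma Evp: "E \<subseteq> vpairs V" by (auto simp: supp_edges_def)

lemma finE: "finite E" using finite_subset[OF Evp finvp] .

lemma xpos: "e \<in> E \<Longrightarrow> 0 < x e" by (simp add: supp_edges_def)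

lemma xnn: "e \<in> vpairs V \<Longrightarrow> 0 \<le> x e" using feas by (simp add: lp_feasible_def)

lemma xzero: "e \<in> vpairs V \<Longrightarrow> e \<notin> E \<Longrightarrow> x e = 0"
  using xnn[of e] by (auto simp: supp_edges_def)

lemma sum_supp: "A \<subseteq> vpairs V \<Longrightarrow> sum x A = sum x (A \<inter> E)"
  by (rule sum.mono_neutral_right) (use finite_subset[OF _ finvp] xzero in auto)

lemma xd_supp: "U \<subseteq> V \<Longrightarrow> xd U = sum x (cut_edges V U \<inter> E)"
  unfolding xd_def by (rule sum_supp[OF cut_edges_subset])

lemma demand: "U \<noteq> {} \<Longrightarrow> U \<subset> V \<Longrightarrow> cut_demand s t U \<le> xd U"
  using feas by (auto simp: lp_feasible_def xd_def)

text \<open>For \<open>s = t\<close> the LP is infeasible: \<open>{s, t}\<close> is then a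
  singleton, which forces degree \<open>1\<close> at \<open>s\<close>, while the complement of
  \<open>{s}\<close> has demand \<open>2\<close> (and if it is empty there are no edges at
  all).\<close>

lemma st: "s \<noteq> t"
proof
  assume st: "s = t"
  have one: "xd {s} = 1" using feas sV st by (simp add: lp_feasible_def xd_def cut_demand_def)
  show False
  proof (cases "V = {s}")
    case True
    then have "cut_edges V {s} = {}" by (auto simp: cut_edges_def)
    then show False using one by (simp add: xd_def)
  next
    case False
    have "cut_demand s t (V - {s}) = 2" using st by (simp add: cut_demand_def)
    moreover have "V - {s} \<noteq> {}" "V - {s} \<subset> V" using False sV by auto
    ultimately have "2 \<le> xd (V - {s})" using demand by metis
    then show False using one cut_edges_compl[of "{s}" V] sV by (simp add: xd_def)
  qed
qed

lemma card_inter_st: "card (U \<inter> {s, t}) = of_bool (s \<in> U) + of_bool (t \<in> U)"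
  using st by (auto simp: Int_insert_right)

lemma demand_one: "cut_demand s t U = (if (s \<in> U) \<noteq> (t \<in> U) then 1 else 2)"
  by (auto simp: cut_demand_def card_inter_st)

lemma degree: "v \<in> V \<Longrightarrow> xd {v} = 2 - of_bool (v = s) - of_bool (v = t)"
  using feas st by (auto simp: lp_feasible_def xd_def demand_one)

lemma double_count:
  assumes "U \<subseteq> V"
  shows "(\<Sum>v\<in>U. xd {v}) = 2 * sum x (ind E U) + xd U"
proof -
  have finU: "finite U" using finite_subset[OF assms finV] .
  have "xd {v} = (\<Sum>e\<in>vpairs V. if v \<in> e then x e else 0)" if "v \<in> U" for v
  proof -
    have "cut_edges V {v} = {e \<in> vpairs V. v \<in> e}"
      using that assms by (auto simp: cut_edges_pair_iff elim!: vpairsD)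
        (auto simp: cut_edges_def vpairs_iff)
    then show ?thesis using finvp by (simp add: xd_def sum.inter_filter)
  qed
  then have "(\<Sum>v\<in>U. xd {v}) = (\<Sum>v\<in>U. \<Sum>e\<in>vpairs V. if v \<in> e then x e else 0)" by simp
  also have "\<dots> = (\<Sum>e\<in>vpairs V. \<Sum>v\<in>U. if v \<in> e then x e else 0)" by (rule sum.swap)
  also have "\<dots> = (\<Sum>e\<in>vpairs V. 2 * (if e \<subseteq> U then x e else 0) + (if e \<in> cut_edges V U then x e else 0))"
  proof (rule sum.cong[OF refl])
    fix e assume "e \<in> vpairs V"
    then obtain a b where ab: "e = {a, b}" "a \<noteq> b" "a \<in> V" "b \<in> V" by (rule vpairsD)
    have "(\<Sum>v\<in>U. if v \<in> e then x e else 0) = x e * real (card (U \<inter> e))"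
      using finU by (simp add: sum.If_cases Int_def)
    moreover have "card (U \<inter> e) = (if e \<subseteq> U then 2 else if e \<in> cut_edges V U then 1 else 0)"
      using ab by (auto simp: cut_edges_pair_iff Int_insert_right)
    moreover have "\<not> (e \<subseteq> U \<and> e \<in> cut_edges V U)" using ab by (auto simp: cut_edges_pair_iff)
    ultimately show "(\<Sum>v\<in>U. if v \<in> e then x e else 0) =
      2 * (if e \<subseteq> U then x e else 0) + (if e \<in> cut_edges V U then x e else 0)" by auto
  qed
  also have "\<dots> = 2 * sum x {e \<in> vpairs V. e \<subseteq> U} + sum x {e \<in> vpairs V. e \<in> cut_edges V U}"
    using finvp by (simp add: sum.distrib sum.inter_filter sum_distrib_left[symmetric])
  also have "sum x {e \<in> vpairs V. e \<subseteq> U} = sum x ({e \<in> vpairs V. e \<subseteq> U} \<inter> E)" by (rule sum_supp) auto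
  also have "{e \<in> vpairs V. e \<subseteq> U} \<inter> E = ind E U" using Evp by (auto simp: ind_def)
  also have "{e \<in> vpairs V. e \<in> cut_edges V U} = cut_edges V U" using cut_edges_subset[OF assms] by auto
  finally show ?thesis by (simp add: xd_def)
qed

lemma inner_sum:
  assumes "U \<subseteq> V"
  shows "2 * sum x (ind E U) + xd U = 2 * real (card U) - of_bool (s \<in> U) - of_bool (t \<in> U)"
proof -
  have fin: "finite U" using finite_subset[OF assms finV] .
  have "(\<Sum>v\<in>U. xd {v}) = (\<Sum>v\<in>U. 2 - of_bool (v = s) - of_bool (v = t))"
    by (rule sum.cong) (use degree assms in auto)
  also have "\<dots> = 2 * real (card U) - (\<Sum>v\<in>U. of_bool (v = s)) - (\<Sum>v\<in>U. of_bool (v = t))"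
    by (simp add: sum_subtractf)
  finally have "(\<Sum>v\<in>U. xd {v}) = 2 * real (card U) - (\<Sum>v\<in>U. of_bool (v = s)) - (\<Sum>v\<in>U. of_bool (v = t))" .
  moreover have "(\<Sum>v\<in>U. of_bool (v = a)) = (of_bool (a \<in> U) :: real)" for a
    using fin by (simp add: of_bool_def)
  ultimately show ?thesis using double_count[OF assms] by simp
qed

lemma xd_V: "xd V = 0" by (simp add: xd_def cut_edges_def)

lemma forest:
  assumes "U \<subseteq> V" "U \<noteq> {}"
  shows "sum x (ind E U) \<le> real (card U) - 1"
proof (cases "U = V")
  case True
  then show ?thesis using inner_sum[of V] sV tV xd_V by simp
next
  case False
  then have "cut_demand s t U \<le> xd U" using demand assms by auto
  then show ?thesis using inner_sum[OF assms(1)] by (auto simp: demand_one split: if_splits)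
qed

lemma sum_E: "sum x E = real (card V) - 1"
proof -
  have "ind E V = E" using Evp by (auto simp: ind_def vpairs_def)
  then show ?thesis using inner_sum[of V] sV tV xd_V by simp
qed

lemma xd_diff:
  assumes "U \<subseteq> V" "U' \<subseteq> V"
  shows "xd (U - U') + xd (U' - U) \<le> xd U + xd U'"
proof -
  have conv: "xd Z = (\<Sum>e\<in>vpairs V. x e * of_bool (e \<in> cut_edges V Z))" if "Z \<subseteq> V" for Z
  proof -
    have "(\<Sum>e\<in>vpairs V. x e * of_bool (e \<in> cut_edges V Z)) = sum x {e \<in> vpairs V. e \<in> cut_edges V Z}"
      using finvp by (simp add: sum.inter_filter of_bool_def if_distrib cong: if_cong)
    also have "{e \<in> vpairs V. e \<in> cut_edges V Z} = cut_edges V Z" using cut_edges_subset[OF that] by auto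
    finally show ?thesis by (simp add: xd_def)
  qed
  have sub: "U - U' \<subseteq> V" "U' - U \<subseteq> V" using assms by auto
  show ?thesis
    unfolding conv[OF assms(1)] conv[OF assms(2)] conv[OF sub(1)] conv[OF sub(2)] sum.distrib[symmetric] distrib_left[symmetric]
  proof (intro sum_mono mult_left_mono)
    fix e assume e: "e \<in> vpairs V"
    then obtain a b where "e = {a, b}" "a \<noteq> b" "a \<in> V" "b \<in> V" by (rule vpairsD)
    then show "of_bool (e \<in> cut_edges V (U - U')) + of_bool (e \<in> cut_edges V (U' - U))
      \<le> of_bool (e \<in> cut_edges V U) + (of_bool (e \<in> cut_edges V U') :: real)"
      by (auto simp: cut_edges_pair_iff)
    show "0 \<le> x e" using xnn e .
  qed
qed

definition narrow :: "'v set set" where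
  "narrow = {U. s \<in> U \<and> U \<subset> V \<and> xd U < 2}"

lemma narrow_ne: "U \<in> narrow \<Longrightarrow> U \<noteq> {}"
  by (auto simp: narrow_def)

lemma narrow_t: "U \<in> narrow \<Longrightarrow> t \<notin> U"
  using demand[OF narrow_ne, of U] by (auto simp: narrow_def demand_one split: if_splits)

lemma narrow_ge1: "U \<in> narrow \<Longrightarrow> 1 \<le> xd U"
  using demand[OF narrow_ne, of U] narrow_t[of U] by (auto simp: narrow_def demand_one)

lemma narrow_sub: "U \<in> narrow \<Longrightarrow> U \<subseteq> V" by (auto simp: narrow_def)

lemma finite_narrow: "finite narrow"
  by (rule finite_subset[of _ "Pow V"]) (use finV in \<open>auto simp: narrow_def\<close>)

text \<open>Uncrossing by differences: both differences avoid \<open>s\<close> and \<open>t\<close>,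
  so if neither were empty their cuts would weigh at least \<open>4\<close> together, more than two
  narrow cuts do.\<close>

lemma narrow_chain:
  assumes "U \<in> narrow" "U' \<in> narrow"
  shows "U \<subseteq> U' \<or> U' \<subseteq> U"
proof (rule ccontr)
  assume "\<not> ?thesis"
  then have ne: "U - U' \<noteq> {}" "U' - U \<noteq> {}" by auto
  have "s \<notin> U - U'" "s \<notin> U' - U" "t \<notin> U - U'" "t \<notin> U' - U" using assms narrow_t by (auto simp: narrow_def)
  then have "2 \<le> xd (U - U')" "2 \<le> xd (U' - U)"
    using demand[of "U - U'"] demand[of "U' - U"] ne assms by (auto simp: narrow_def demand_one)
  then show False using xd_diff[of U U'] assms by (auto simp: narrow_def)
qed

lemma narrow_cuts_eq: "narrow_cuts V x = (\<lambda>U. cut_edges V U \<inter> E) ` narrow"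
proof
  show "(\<lambda>U. cut_edges V U \<inter> E) ` narrow \<subseteq> narrow_cuts V x"
    using xd_supp by (auto simp: narrow_cuts_def narrow_def)
  show "narrow_cuts V x \<subseteq> (\<lambda>U. cut_edges V U \<inter> E) ` narrow"
  proof
    fix Q assume "Q \<in> narrow_cuts V x"
    then obtain U where U: "U \<noteq> {}" "U \<subset> V" "Q = cut_edges V U \<inter> E" "sum x Q < 2" by (auto simp: narrow_cuts_def)
    define U' where "U' = (if s \<in> U then U else V - U)"
    have "cut_edges V U' = cut_edges V U" using cut_edges_compl[of U V] U by (auto simp: U'_def)
    moreover have "s \<in> U'" "U' \<subset> V" using U sV by (auto simp: U'_def)
    ultimately have "U' \<in> narrow" using xd_supp[of U'] U by (auto simp: narrow_def)
    then show "Q \<in> (\<lambda>U. cut_edges V U \<inter> E) ` narrow" using U \<open>cut_edges V U' = cut_edges V U\<close> by auto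
  qed
qed

definition lev :: "'v \<Rightarrow> nat" where
  "lev v = card {U \<in> narrow. v \<notin> U}"

definition p :: nat where "p = card narrow"

definition Ui :: "nat \<Rightarrow> 'v set" where
  "Ui i = {v \<in> V. lev v < i}"

definition idx :: "'v set \<Rightarrow> nat" where
  "idx U = card {U' \<in> narrow. U' \<subseteq> U}"

lemma lev_le: "lev v \<le> p"
  unfolding lev_def p_def by (rule card_mono[OF finite_narrow]) auto

lemma idx_range: "U \<in> narrow \<Longrightarrow> 1 \<le> idx U \<and> idx U \<le> p"
proof -
  assume U: "U \<in> narrow"
  have "idx U \<le> p" unfolding idx_def p_def by (rule card_mono[OF finite_narrow]) auto
  moreover have "0 < idx U" unfolding idx_def using U finite_narrow by (auto simp: card_gt_0_iff)
  ultimately show ?thesis by simp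
qed

lemma Ui_idx:
  assumes "U \<in> narrow"
  shows "Ui (idx U) = U"
proof -
  have "lev v < idx U \<longleftrightarrow> v \<in> U" if "v \<in> V" for v
  proof
    assume "v \<in> U"
    then have "{U' \<in> narrow. v \<notin> U'} \<subset> {U' \<in> narrow. U' \<subseteq> U}" using narrow_chain[OF _ assms] assms by blast
    then show "lev v < idx U" unfolding lev_def idx_def using finite_narrow by (intro psubset_card_mono) auto
  next
    assume l: "lev v < idx U"
    show "v \<in> U"
    proof (rule ccontr)
      assume "v \<notin> U"
      then have "{U' \<in> narrow. U' \<subseteq> U} \<subseteq> {U' \<in> narrow. v \<notin> U'}" by auto
      then have "idx U \<le> lev v" unfolding lev_def idx_def using finite_narrow by (intro card_mono) auto
      then show False using l by simp
    qed
  qed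
  then show ?thesis using narrow_sub[OF assms] by (auto simp: Ui_def)
qed

lemma Ui_narrow:
  assumes "1 \<le> i" "i \<le> p"
  shows "Ui i \<in> narrow" "idx (Ui i) = i"
proof -
  have inj: "inj_on idx narrow" using Ui_idx by (metis inj_onI)
  have "idx ` narrow = {1..p}"
    by (rule card_subset_eq) (use idx_range card_image[OF inj] in \<open>auto simp: p_def\<close>)
  then obtain U where "U \<in> narrow" "idx U = i" using assms by (metis atLeastAtMost_iff imageE)
  then show "Ui i \<in> narrow" "idx (Ui i) = i" using Ui_idx by auto
qed

lemma lev_s: "lev s = 0"
proof -
  have "{U \<in> narrow. s \<notin> U} = {}" by (auto simp: narrow_def)
  then show ?thesis unfolding lev_def by (simp only: card.empty)
qed

lemma lev_t: "lev t = p"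
proof -
  have "{U \<in> narrow. t \<notin> U} = narrow" using narrow_t by auto
  then show ?thesis by (simp add: lev_def p_def)
qed

lemma lev_ex:
  assumes "j \<le> p"
  shows "\<exists>v\<in>V. lev v = j"
proof (cases "j = 0 \<or> j = p")
  case True then show ?thesis using lev_s lev_t sV tV by auto
next
  case False
  then have j: "1 \<le> j" "j \<le> p" "1 \<le> j + 1" "j + 1 \<le> p" using assms by auto
  have "Ui j \<subseteq> Ui (j + 1)" by (auto simp: Ui_def)
  moreover have "Ui j \<noteq> Ui (j + 1)" using Ui_narrow(2)[OF j(1,2)] Ui_narrow(2)[OF j(3,4)] by (metis n_not_Suc_n Suc_eq_plus1)
  ultimately obtain v where "v \<in> Ui (j + 1)" "v \<notin> Ui j" by blast
  then have "v \<in> V" "lev v = j" by (auto simp: Ui_def)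
  then show ?thesis by blast
qed

text \<open>The default \<open>0\<close> matters at the indices \<open>0\<close> and
  \<open>p + 1\<close>: the trivial cuts then enter \<open>cross2\<close> like cuts of weight
  one.\<close>

definition nu :: "nat \<Rightarrow> real" where
  "nu i = (if 1 \<le> i \<and> i \<le> p then xd (Ui i) - 1 else 0)"

lemma nu_range: "0 \<le> nu i" "nu i < 1"
  using Ui_narrow(1)[of i] narrow_ge1[of "Ui i"] by (auto simp: nu_def narrow_def)

lemma cut_Ui_iff:
  assumes "e \<in> E"
  shows "e \<in> cut_edges V (Ui i) \<longleftrightarrow> (\<exists>u\<in>e. lev u < i) \<and> (\<exists>u\<in>e. i \<le> lev u)"
proof -
  obtain u v where "e = {u, v}" "u \<in> V" "v \<in> V" using assms Evp by (meson subsetD vpairsD)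
  then show ?thesis by (auto simp: cut_edges_pair_iff Ui_def)
qed

lemma Ui_sub: "Ui i \<subseteq> V" by (auto simp: Ui_def)

lemma cut_sum: "i \<le> p + 1 \<Longrightarrow> sum x (cut_edges V (Ui i) \<inter> E) + of_bool (i = 0 \<or> i = p + 1) = 1 + nu i"
proof -
  assume i: "i \<le> p + 1"
  show ?thesis
  proof (cases "1 \<le> i \<and> i \<le> p")
    case True then show ?thesis using xd_supp[OF Ui_sub, of i] by (simp add: nu_def)
  next
    case False
    then have "i = 0 \<or> i = p + 1" using i by auto
    moreover have "Ui 0 = {}" "Ui (p + 1) = V" using lev_le by (auto simp: Ui_def less_Suc_eq_le)
    ultimately have "cut_edges V (Ui i) = {}" by (auto simp: cut_edges_def)
    moreover have "nu i = 0" using False unfolding nu_def by (rule if_not_P)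
    ultimately show ?thesis using \<open>i = 0 \<or> i = p + 1\<close> by auto
  qed
qed

lemma cut_pair:
  assumes ab: "a < b" "b \<le> p + 1"
  shows "xd (Ui b - Ui a) + 2 * sum x (cut_edges V (Ui a) \<inter> cut_edges V (Ui b) \<inter> E)
    = sum x (cut_edges V (Ui a) \<inter> E) + sum x (cut_edges V (Ui b) \<inter> E)"
proof -
  let ?a = "cut_edges V (Ui a) \<inter> E" and ?b = "cut_edges V (Ui b) \<inter> E"
  have Uab: "Ui a \<subseteq> Ui b" using ab by (auto simp: Ui_def)
  have "cut_edges V (Ui b - Ui a) \<inter> E = (?a - ?b) \<union> (?b - ?a)"
  proof -
    have "e \<in> cut_edges V (Ui b - Ui a) \<longleftrightarrow> (e \<in> cut_edges V (Ui a)) \<noteq> (e \<in> cut_edges V (Ui b))" if eE: "e \<in> E" for e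
    proof -
      obtain u v where "e = {u, v}" "u \<in> V" "v \<in> V" using eE Evp by (meson subsetD vpairsD)
      then show ?thesis using Uab by (auto simp: cut_edges_pair_iff)
    qed
    then show ?thesis by blast
  qed
  moreover have "Ui b - Ui a \<subseteq> V" using Ui_sub[of b] by auto
  ultimately have "xd (Ui b - Ui a) = sum x ((?a - ?b) \<union> (?b - ?a))" using xd_supp by metis
  also have "\<dots> = sum x (?a - ?b) + sum x (?b - ?a)" by (rule sum.union_disjoint) (use finE in auto)
  finally have "xd (Ui b - Ui a) = sum x (?a - ?b) + sum x (?b - ?a)" .
  moreover have "sum x ?a = sum x (?a - ?b) + sum x (?a \<inter> ?b)" "sum x ?b = sum x (?b - ?a) + sum x (?a \<inter> ?b)"
    using sum.Int_Diff[of ?a x ?b] sum.Int_Diff[of ?b x ?a] finE by (simp_all add: Int_commute)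
  moreover have "?a \<inter> ?b = cut_edges V (Ui a) \<inter> cut_edges V (Ui b) \<inter> E" by auto
  ultimately show ?thesis by simp
qed

lemma layer_set: "{v \<in> V. a \<le> lev v \<and> lev v < b} = Ui b - Ui a"
  by (auto simp: Ui_def)

text \<open>Half the degree sum of the layer, with the cut around it resolved by
  \<open>cut_pair\<close>. A layer containing \<open>s\<close> or \<open>t\<close> has a degree sum
  smaller by one at each, which offsets the weight one that a trivial cut lacks.\<close>

lemma cross2:
  assumes ab: "a < b" "b \<le> p + 1"
  shows "real (card {v \<in> V. a \<le> lev v \<and> lev v < b}) - 1 - sum x (ind E {v \<in> V. a \<le> lev v \<and> lev v < b})
      + sum x {e \<in> E. (\<exists>u\<in>e. lev u < a) \<and> (\<exists>u\<in>e. b \<le> lev u)} = (nu a + nu b) / 2"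
proof -
  let ?K = "Ui b - Ui a"
  have "{e \<in> E. (\<exists>u\<in>e. lev u < a) \<and> (\<exists>u\<in>e. b \<le> lev u)} = cut_edges V (Ui a) \<inter> cut_edges V (Ui b) \<inter> E"
    using cut_Ui_iff[of _ a] cut_Ui_iff[of _ b] ab by fastforce
  moreover have "s \<in> ?K \<longleftrightarrow> a = 0" "t \<in> ?K \<longleftrightarrow> b = p + 1" using lev_s lev_t sV tV ab by (auto simp: Ui_def)
  moreover have "2 * sum x (ind E ?K) + xd ?K = 2 * real (card ?K) - of_bool (s \<in> ?K) - of_bool (t \<in> ?K)"
    by (rule inner_sum) (use Ui_sub in auto)
  ultimately show ?thesis unfolding layer_set
    using cut_pair[OF ab] cut_sum[of a] cut_sum[of b] ab by (auto simp: of_bool_def split: if_splits)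
qed

lemma connE:
  assumes "u \<in> V" "v \<in> V"
  shows "conn E u v"
proof (rule ccontr)
  assume n: "\<not> conn E u v"
  have sub: "ccomp E u \<subseteq> V" using conn_in[OF _ Evp assms(1)] by (auto simp: ccomp_def)
  have "v \<notin> ccomp E u" "u \<in> ccomp E u" using n by (auto simp: ccomp_def)
  then have "ccomp E u \<noteq> {}" "ccomp E u \<subset> V" using sub assms by auto
  then have "1 \<le> xd (ccomp E u)" using demand[of "ccomp E u"] by (auto simp: demand_one split: if_splits)
  moreover have "cut_edges V (ccomp E u) \<inter> E = {}" using ccomp_cut[OF Evp] by auto
  ultimately show False using xd_supp[OF sub] by simp
qed

end

section \<open>Decomposition into layered trees\<close>

context leveled_graph
begin

definition trees :: "(nat \<Rightarrow> nat) \<Rightarrow> nat \<Rightarrow> 'v set set set" where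
  "trees t k = {S. S \<subseteq> E \<and> card S + 1 = card V \<and> cor t k 0 (p + 1) S = 0}"

lemma Lv_all: "Lv 0 (p + 1) = V" using lev_le by (auto simp: Lv_def less_Suc_eq_le)

lemma card_V_pos: "1 \<le> card V"
  using lev_ex[of 0] finV by (auto simp: Suc_le_eq card_gt_0_iff)

lemma cor_zero_hit:
  assumes "cor t k a b S = 0" "S \<subseteq> Ein a b" "b \<le> p + 1" "a < i" "i < b" "k < t i"
  shows "i \<in> hits t k S" "cor t k a i (S \<inter> Ein a i) = 0" "cor t k i b (S \<inter> Ein i b) = 0"
proof -
  have "0 \<le> cor t k a i (S \<inter> Ein a i)" "0 \<le> cor t k i b (S \<inter> Ein i b)"
    by (rule cor_nonneg; use assms in auto)+
  then show "i \<in> hits t k S" "cor t k a i (S \<inter> Ein a i) = 0" "cor t k i b (S \<inter> Ein i b) = 0"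
    using cor_split[of a i b k t S] assms by (auto split: if_splits)
qed

lemma cor_zero_conn:
  assumes "cor t k a b S = 0" "S \<subseteq> Ein a b" "a < b" "b \<le> p + 1"
  shows "ncomp (Lv a b) S \<le> 1"
  using assms
proof (induction "b - a" arbitrary: a b S rule: less_induct)
  case less
  show ?case
  proof (cases "\<exists>i. a < i \<and> i < b \<and> k < t i")
    case False
    then have "t j \<le> k" if "a < j" "j < b" for j using that by (meson not_le)
    then show ?thesis using cor_top(1)[of a b t k S] less by simp
  next
    case True
    then obtain i where i: "a < i" "i < b" "k < t i" by auto
    note z = cor_zero_hit[OF less(2,3,5) i]
    have "ncomp (Lv a i) (S \<inter> Ein a i) \<le> 1" "ncomp (Lv i b) (S \<inter> Ein i b) \<le> 1"
      by (rule less(1); use z i less in auto)+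
    then have n2: "ncomp (Lv a b) {e \<in> S. \<not> crosses i e} \<le> 2" using ncomp_join[OF i(1,2) less(3)] by simp
    obtain e where e: "e \<in> S" "crosses i e" using z(1) by (auto elim: hitsE)
    have "e \<in> Ein a b" using e less(3) by blast
    then obtain u v where uv: "e = {u, v}" "lev u < i" "i \<le> lev v" using e(2) crossing_ends[of e i] Ein_sub by blast
    have "ncomp (Lv a b) {e \<in> S. \<not> crosses i e} = ncomp (Lv a b) (insert {u, v} {e \<in> S. \<not> crosses i e}) + 1"
      by (rule ncomp_insert_nconn[OF finLv])
        (use nonconn_across[of "{e \<in> S. \<not> crosses i e}" i u v] uv Ein_sub_Lv[OF \<open>e \<in> Ein a b\<close>] in auto)
    moreover have "ncomp (Lv a b) S \<le> ncomp (Lv a b) (insert {u, v} {e \<in> S. \<not> crosses i e})"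
      by (rule ncomp_antimono[OF finLv]) (use e uv in auto)
    ultimately show ?thesis using n2 by simp
  qed
qed

text \<open>By counting: \<open>unc t k S\<close> has at least \<open>card V - 1 - card ?H\<close>
  edges, so at most one edge per hit cut remains. The private edges \<open>g j\<close> use up all of
  these, so no edge crosses two active cuts.\<close>

lemma tree_cut:
  assumes S: "S \<in> trees t k" and i: "1 \<le> i" "i \<le> p" "k < t i"
  shows "\<exists>e. {e \<in> S. crosses i e} = {e}"
proof -
  have SE: "S \<subseteq> E" "card S + 1 = card V" and c0: "cor t k 0 (p + 1) S = 0" using S by (auto simp: trees_def)
  have SE': "S \<subseteq> Ein 0 (p + 1)" using SE Ein_all by simp
  have finS: "finite S" using finite_subset[OF SE(1) finE] .
  let ?H = "hits t k S"
  have finH: "finite ?H" using finhits[OF SE'] .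
  have "\<forall>j\<in>?H. \<exists>e. e \<in> S \<and> crosses j e \<and> (\<forall>j'. crosses j' e \<longrightarrow> k < t j' \<longrightarrow> j' = j)"
    by (auto elim!: hitsE)
  then obtain g where g: "\<And>j. j \<in> ?H \<Longrightarrow> g j \<in> S \<and> crosses j (g j) \<and> (\<forall>j'. crosses j' (g j) \<longrightarrow> k < t j' \<longrightarrow> j' = j)"
    by metis
  have tH: "k < t j" if "j \<in> ?H" for j using that by (auto elim: hitsE)
  have "inj_on g ?H"
  proof (rule inj_onI)
    fix j j' assume j: "j \<in> ?H" "j' \<in> ?H" "g j = g j'"
    then show "j = j'" using g[OF j(1)] g[OF j(2)] tH[OF j(1)] by metis
  qed
  then have cg: "card (g ` ?H) = card ?H" by (rule card_image)
  have sub: "g ` ?H \<subseteq> S - unc t k S"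
  proof
    fix e assume "e \<in> g ` ?H"
    then obtain j where j: "j \<in> ?H" "e = g j" by auto
    then have "\<not> t j \<le> k" using tH by (simp add: not_le)
    then have "e \<notin> unc t k S" using g[OF j(1)] j(2) by (auto simp: unc_def)
    then show "e \<in> S - unc t k S" using g[OF j(1)] j(2) by simp
  qed
  have "card V \<le> ncomp V (unc t k S) + card (unc t k S)"
    by (rule card_le_ncomp_edges[OF finV]) (use finite_subset[OF unc_sub finS] unc_sub SE(1) EV in blast)+
  moreover have "real (ncomp V (unc t k S)) = 1 + real (card ?H)" using c0 unfolding cor_def Lv_all by simp
  moreover have "card (S - unc t k S) = card S - card (unc t k S)"
    by (rule card_Diff_subset[OF finite_subset[OF unc_sub finS] unc_sub])
  ultimately have "card (S - unc t k S) \<le> card (g ` ?H)" unfolding cg using SE(2) by linarith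
  then have eq: "g ` ?H = S - unc t k S" using card_seteq[of "S - unc t k S" "g ` ?H"] finS sub by auto
  have iH: "i \<in> ?H" using cor_zero_hit(1)[OF c0 SE', of i] i by simp
  have "{e \<in> S. crosses i e} = {g i}"
  proof
    show "{g i} \<subseteq> {e \<in> S. crosses i e}" using g[OF iH] by auto
    show "{e \<in> S. crosses i e} \<subseteq> {g i}"
    proof
      fix e assume e: "e \<in> {e \<in> S. crosses i e}"
      then have "e \<in> S - unc t k S" using i(3) by (auto simp: unc_def not_le)
      then obtain j where j: "j \<in> ?H" "e = g j" using eq by blast
      then show "e \<in> {g i}" using g[OF j(1)] e i(3) by auto
    qed
  qed
  then show ?thesis by blast
qed

text \<open>The corank fits \<open>greedy_basis\<close>: an edge is spanned if its ends are
  connected in the graphic part, if its only active cut is already hit, or if it crosses several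
  active cuts, and all this persists in larger sets. The tree obtained has full rank in every level
  set of \<open>\<omega>\<close> at once, the form in which the rank inequality applies.\<close>

lemma level_tree:
  fixes \<omega> :: "'v set \<Rightarrow> real"
  assumes c0: "cor t k 0 (p + 1) E = 0"
  shows "\<exists>S\<in>trees t k. \<forall>r. real (card {e \<in> S. r < \<omega> e}) = real (card V) - 1 - cor t k 0 (p + 1) {e \<in> E. r < \<omega> e}"
proof -
  define f where "f A = int (ncomp V (unc t k A)) - 1 - int (card (hits t k A))" for A
  have fc: "cor t k 0 (p + 1) A = real_of_int (f A)" for A unfolding f_def cor_def Lv_all by simp
  have fh: "finite (hits t k A)" if "A \<subseteq> E" for A using finhits[of A 0 "p + 1"] that Ein_all by simp
  have ins: "unc t k (insert e A) = (if \<forall>j. crosses j e \<longrightarrow> t j \<le> k then insert e (unc t k A) else unc t k A)"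
    for e A by (auto simp: unc_def)
  define act where "act e = {j. crosses j e \<and> k < t j}" for e
  have hin: "hits t k (insert e A) = hits t k A \<union> {j. act e = {j}}" for e A
    by (auto simp: hits_def act_def)
  have a0: "act e = {} \<longleftrightarrow> (\<forall>j. crosses j e \<longrightarrow> t j \<le> k)" for e by (auto simp: act_def not_le)
  have step: "f (insert e A) = f A \<or> f (insert e A) = f A - 1"
    and eqv: "f (insert e A) = f A \<longleftrightarrow> (if act e = {} then (\<forall>u v. e = {u, v} \<longrightarrow> conn (unc t k A) u v)
        else (\<forall>j. act e = {j} \<longrightarrow> j \<in> hits t k A))" if eA: "e \<in> E" "A \<subseteq> E" for e A
  proof -
    obtain u v where uv: "e = {u, v}" "u \<in> V" "v \<in> V" using E_ex2[OF eA(1)] by blast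
    have "(f (insert e A) = f A \<or> f (insert e A) = f A - 1) \<and> (f (insert e A) = f A \<longleftrightarrow>
      (if act e = {} then (\<forall>u v. e = {u, v} \<longrightarrow> conn (unc t k A) u v) else (\<forall>j. act e = {j} \<longrightarrow> j \<in> hits t k A)))"
    proof (cases "act e = {}")
      case True
      then have h: "hits t k (insert e A) = hits t k A" "unc t k (insert e A) = insert e (unc t k A)"
        using hin[of e A] ins[of e A] a0[of e] by auto
      have cc: "(\<forall>u' v'. e = {u', v'} \<longrightarrow> conn (unc t k A) u' v') \<longleftrightarrow> conn (unc t k A) u v"
        using uv(1) conn_sym by (auto simp: doubleton_eq_iff)
      show ?thesis
        using ncomp_insert_conn[OF finV, of "unc t k A" u v] ncomp_insert_nconn[OF finV, of "unc t k A" u v] uv True cc h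
        by (cases "conn (unc t k A) u v") (auto simp: f_def)
    next
      case False
      then have u: "unc t k (insert e A) = unc t k A" using ins[of e A] a0[of e] by auto
      show ?thesis
      proof (cases "\<exists>j. act e = {j} \<and> j \<notin> hits t k A")
        case True
        then obtain j where j: "act e = {j}" "j \<notin> hits t k A" by auto
        then have "hits t k (insert e A) = insert j (hits t k A)" using hin[of e A] by auto
        then show ?thesis using j False u fh[OF eA(2)] by (auto simp: f_def)
      next
        case none: False
        then have "hits t k (insert e A) = hits t k A" using hin[of e A] by auto
        then show ?thesis using False none u by (auto simp: f_def)
      qed
    qed
    then show "f (insert e A) = f A \<or> f (insert e A) = f A - 1"
      "f (insert e A) = f A \<longleftrightarrow> (if act e = {} then (\<forall>u v. e = {u, v} \<longrightarrow> conn (unc t k A) u v)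
        else (\<forall>j. act e = {j} \<longrightarrow> j \<in> hits t k A))" by blast+
  qed
  have cl: "f (insert e B) = f B" if "e \<in> E" "A \<subseteq> B" "B \<subseteq> E" "f (insert e A) = f A" for e A B
  proof -
    have "A \<subseteq> E" using that by auto
    have m: "unc t k A \<subseteq> unc t k B" "hits t k A \<subseteq> hits t k B" using that(2) by (auto simp: unc_def hits_def)
    have "if act e = {} then (\<forall>u v. e = {u, v} \<longrightarrow> conn (unc t k B) u v) else (\<forall>j. act e = {j} \<longrightarrow> j \<in> hits t k B)"
      using eqv[OF that(1) \<open>A \<subseteq> E\<close>] that(4) conn_mono[OF _ m(1)] m(2) by (auto split: if_splits)
    then show ?thesis using eqv[OF that(1,3)] by blast
  qed
  have "\<exists>R\<subseteq>E. f R = f E \<and>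
    (\<forall>X\<subseteq>E. (\<forall>e\<in>X. \<forall>e'\<in>E. \<omega> e \<le> \<omega> e' \<longrightarrow> e' \<in> X) \<longrightarrow> int (card (R \<inter> X)) = f {} - f X)"
  proof (rule greedy_basis[OF finE])
    show "f (insert e A) = f A \<or> f (insert e A) = f A - 1" if "e \<in> E" "A \<subseteq> E" for e A
      using step[OF that] .
    show "f (insert e B) = f B" if "e \<in> E" "A \<subseteq> B" "B \<subseteq> E" "f (insert e A) = f A" for e A B
      using cl[OF that] .
  qed
  then obtain S where S0: "S \<subseteq> E" "f S = f E" "\<forall>X\<subseteq>E. (\<forall>e\<in>X. \<forall>e'\<in>E. \<omega> e \<le> \<omega> e' \<longrightarrow> e' \<in> X) \<longrightarrow> int (card (S \<inter> X)) = f {} - f X"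
    by (elim exE conjE)
  note S = S0(1,2) S0(3)[rule_format]
  have f0: "f {} = int (card V) - 1"
  proof -
    have "unc t k {} = {}" "hits t k {} = {}" by (auto simp: unc_def hits_def)
    then show ?thesis by (simp add: f_def ncomp_empty[OF finV])
  qed
  have fE: "f E = 0" using c0 fc[of E] by simp
  have "int (card (S \<inter> E)) = int (card V) - 1" using S(3)[of E] f0 fE by simp
  moreover have "S \<inter> E = S" using S by auto
  ultimately have "S \<in> trees t k" using S(1,2) fE fc[of S] card_V_pos by (simp add: trees_def)
  moreover have "real (card {e \<in> S. r < \<omega> e}) = real (card V) - 1 - cor t k 0 (p + 1) {e \<in> E. r < \<omega> e}" for r
  proof -
    have "S \<inter> {e \<in> E. r < \<omega> e} = {e \<in> S. r < \<omega> e}" using S(1) by auto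
    moreover have "int (card (S \<inter> {e \<in> E. r < \<omega> e})) = f {} - f {e \<in> E. r < \<omega> e}" by (rule S(3)) auto
    ultimately have "int (card {e \<in> S. r < \<omega> e}) = int (card V) - 1 - f {e \<in> E. r < \<omega> e}" using f0 by simp
    then have "real_of_int (int (card {e \<in> S. r < \<omega> e})) = real_of_int (int (card V) - 1 - f {e \<in> E. r < \<omega> e})" by (rule arg_cong)
    then show ?thesis unfolding fc by simp
  qed
  ultimately show ?thesis by blast
qed

text \<open>By Farkas' lemma only vectors \<open>y\<close> that are nonnegative on all pairs of a
  class and one of its trees need to be tested. The critical trees maximize \<open>- y\<close> in
  each class, and comparing their weighted sum with \<open>x\<close> on level sets is the rank
  inequality.\<close>

theorem tree_decomposition:
  assumes t: "adm t" "t 0 = n" "t (p + 1) = n" "nu 0 = 0" "nu (p + 1) = 0" and xE: "sum x E = real (card V) - 1"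
  shows "\<exists>G mu. finite G \<and> card G \<le> card E + n \<and> (\<forall>g\<in>G. fst g < n \<and> snd g \<in> trees t (fst g) \<and> 0 < mu g) \<and>
    (\<forall>e\<in>E. (\<Sum>g\<in>G. mu g * of_bool (e \<in> snd g)) = x e) \<and> (\<forall>k<n. (\<Sum>g\<in>G. mu g * of_bool (fst g = k)) = w k)"
proof -
  have lp: "0 < p + 1" by simp
  have nn: "0 \<le> cor t k 0 (p + 1) E" for k using cor_nonneg[OF lp] Ein_all by simp
  have cE: "cor t k 0 (p + 1) E = 0" if "k < n" for k
  proof -
    have "(\<Sum>k<n. w k * cor t k 0 (p + 1) E) \<le> 0" using rank_inequality[OF t, of E] by simp
    moreover have "0 \<le> w k * cor t k 0 (p + 1) E" if "k < n" for k using nn wpos[OF that] by simp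
    ultimately have "(\<Sum>k<n. w k * cor t k 0 (p + 1) E) = 0" by (intro antisym sum_nonneg) auto
    then have "w k * cor t k 0 (p + 1) E = 0"
      using sum_nonneg_eq_0_iff[of "{..<n}" "\<lambda>k. w k * cor t k 0 (p + 1) E"] nn wpos that less_imp_le
      by (metis (no_types, lifting) finite_lessThan lessThan_iff zero_le_mult_iff)
    then show ?thesis using wpos[OF that] by simp
  qed
  \<comment> \<open>One coordinate per edge and one per class: the latter prescribe the weight
    \<open>w k\<close> of each class and thereby how often each cut is lonely.\<close>
  define a :: "nat \<times> 'v set set \<Rightarrow> 'v set + nat \<Rightarrow> real" where
    "a g r = (case r of Inl e \<Rightarrow> of_bool (e \<in> snd g) | Inr k \<Rightarrow> of_bool (fst g = k))" for g r
  define b where "b r = (case r of Inl e \<Rightarrow> x e | Inr k \<Rightarrow> w k)" for r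
  let ?J = "Sigma {..<n} (trees t)" and ?R = "Inl ` E \<union> Inr ` {..<n} :: ('v set + nat) set"
  have finT: "finite (trees t k)" for k by (rule finite_subset[of _ "Pow E"]) (use finE in \<open>auto simp: trees_def\<close>)
  have fin: "finite ?J" "finite ?R" using finT finE by auto
  have sumR: "(\<Sum>r\<in>?R. h r) = (\<Sum>e\<in>E. h (Inl e)) + (\<Sum>k<n. h (Inr k))" for h :: "'v set + nat \<Rightarrow> real"
    using finE by (subst sum.union_disjoint) (auto simp: sum.reindex)
  have key: "0 \<le> (\<Sum>r\<in>?R. y r * b r)" if pos: "\<And>g. g \<in> ?J \<Longrightarrow> 0 \<le> (\<Sum>r\<in>?R. y r * a g r)" for y
  proof -
    \<comment> \<open>A shift making \<open>\<omega>\<close> nonnegative for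
      \<open>layer_cake_nonneg\<close>; it has no effect on the sum because \<open>q\<close> sums to
      zero over \<open>E\<close>.\<close>
    define m where "m = (\<Sum>e\<in>E. \<bar>y (Inl e)\<bar>)"
    define \<omega> where "\<omega> e = m - y (Inl e)" for e
    have om: "0 \<le> \<omega> e" if "e \<in> E" for e
    proof -
      have "\<bar>y (Inl e)\<bar> \<le> m" unfolding m_def by (rule member_le_sum[OF that]) (use finE in auto)
      then show ?thesis by (simp add: \<omega>_def)
    qed
    define good where "good k S \<longleftrightarrow> S \<in> trees t k \<and>
      (\<forall>r. real (card {e \<in> S. r < \<omega> e}) = real (card V) - 1 - cor t k 0 (p + 1) {e \<in> E. r < \<omega> e})" for k S
    have "\<exists>S. good k S" if "k < n" for k
      using level_tree[OF cE[OF that], of \<omega>] unfolding good_def by blast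
    then obtain S where Sg: "\<And>k. k < n \<Longrightarrow> good k (S k)" by metis
    have S: "S k \<in> trees t k"
      "real (card {e \<in> S k. r < \<omega> e}) = real (card V) - 1 - cor t k 0 (p + 1) {e \<in> E. r < \<omega> e}" if "k < n" for k r
      using Sg[OF that] unfolding good_def by blast+
    have SE: "S k \<subseteq> E" "card (S k) + 1 = card V" if "k < n" for k using S(1)[OF that] by (auto simp: trees_def)
    define q where "q e = (\<Sum>k<n. w k * of_bool (e \<in> S k)) - x e" for e
    have qs: "sum q X = (\<Sum>k<n. w k * real (card (S k \<inter> X))) - sum x X" if "X \<subseteq> E" for X
    proof -
      have "finite X" using finite_subset[OF that finE] .
      have "(\<Sum>e\<in>X. \<Sum>k<n. w k * of_bool (e \<in> S k)) = (\<Sum>k<n. \<Sum>e\<in>X. w k * of_bool (e \<in> S k))" by (rule sum.swap)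
      also have "\<dots> = (\<Sum>k<n. w k * real (card (S k \<inter> X)))"
        using \<open>finite X\<close> by (simp add: sum_distrib_left[symmetric] of_bool_def sum.If_cases Int_commute)
      finally show ?thesis by (simp add: q_def sum_subtractf)
    qed
    have "0 \<le> (\<Sum>e\<in>E. q e * \<omega> e)"
    proof (rule layer_cake_nonneg[OF finE om])
      fix r :: real
      let ?X = "{e \<in> E. r < \<omega> e}"
      have "(\<Sum>k<n. w k * real (card (S k \<inter> ?X))) = (\<Sum>k<n. w k * (real (card V) - 1) - w k * cor t k 0 (p + 1) ?X)"
      proof (rule sum.cong[OF refl])
        fix k assume "k \<in> {..<n}"
        then have k: "k < n" by simp
        have "S k \<inter> ?X = {e \<in> S k. r < \<omega> e}" using SE(1)[OF k] by auto
        then show "w k * real (card (S k \<inter> ?X)) = w k * (real (card V) - 1) - w k * cor t k 0 (p + 1) ?X"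
          unfolding \<open>S k \<inter> ?X = {e \<in> S k. r < \<omega> e}\<close> S(2)[OF k, of r] by (simp add: right_diff_distrib)
      qed
      also have "\<dots> = (real (card V) - 1) - (\<Sum>k<n. w k * cor t k 0 (p + 1) ?X)"
        using wsum by (simp add: sum_subtractf sum_distrib_right[symmetric])
      finally have eq: "(\<Sum>k<n. w k * real (card (S k \<inter> ?X))) = (real (card V) - 1) - (\<Sum>k<n. w k * cor t k 0 (p + 1) ?X)" .
      have "(\<Sum>k<n. w k * cor t k 0 (p + 1) ?X) \<le> sum x (E - ?X)" by (rule rank_inequality[OF t]) blast
      moreover have "sum x (E - ?X) = sum x E - sum x ?X" by (rule sum_diff[OF finE]) blast
      moreover have "sum q ?X = (\<Sum>k<n. w k * real (card (S k \<inter> ?X))) - sum x ?X" by (rule qs) blast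
      ultimately show "0 \<le> sum q ?X" using eq xE by linarith
    qed simp
    moreover have "(\<Sum>e\<in>E. q e * \<omega> e) = m * sum q E - (\<Sum>e\<in>E. q e * y (Inl e))"
      by (simp add: \<omega>_def algebra_simps sum_subtractf sum_distrib_left)
    moreover have "sum q E = 0"
    proof -
      have "(\<Sum>k<n. w k * real (card (S k \<inter> E))) = (\<Sum>k<n. w k * (real (card V) - 1))"
      proof (rule sum.cong[OF refl])
        fix k assume "k \<in> {..<n}"
        then have "S k \<inter> E = S k" "real (card (S k)) = real (card V) - 1" using SE[of k] by auto
        then show "w k * real (card (S k \<inter> E)) = w k * (real (card V) - 1)" by simp
      qed
      then show ?thesis using qs[of E] xE wsum by (simp add: sum_distrib_right[symmetric])
    qed
    ultimately have le: "(\<Sum>e\<in>E. q e * y (Inl e)) \<le> 0" by simp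
    have "(\<Sum>e\<in>E. q e * y (Inl e)) = (\<Sum>k<n. w k * (\<Sum>e\<in>E. y (Inl e) * of_bool (e \<in> S k))) - (\<Sum>e\<in>E. y (Inl e) * x e)"
    proof -
      have "(\<Sum>e\<in>E. \<Sum>k<n. w k * of_bool (e \<in> S k) * y (Inl e)) = (\<Sum>k<n. \<Sum>e\<in>E. w k * of_bool (e \<in> S k) * y (Inl e))"
        by (rule sum.swap)
      also have "\<dots> = (\<Sum>k<n. w k * (\<Sum>e\<in>E. y (Inl e) * of_bool (e \<in> S k)))"
        by (simp only: sum_distrib_left ac_simps)
      finally show ?thesis
        by (simp only: q_def left_diff_distrib sum_subtractf sum_distrib_right mult.commute[of "x _" "y _"])
    qed
    moreover have "(\<Sum>k<n. w k * (\<Sum>e\<in>E. y (Inl e) * of_bool (e \<in> S k))) \<ge> (\<Sum>k<n. w k * (- y (Inr k)))"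
    proof (intro sum_mono mult_left_mono)
      fix k assume "k \<in> {..<n}"
      then have k: "k < n" by simp
      have "(k, S k) \<in> ?J" using S(1)[OF k] k by simp
      then have "0 \<le> (\<Sum>r\<in>?R. y r * a (k, S k) r)" by (rule pos)
      also have "\<dots> = (\<Sum>e\<in>E. y (Inl e) * of_bool (e \<in> S k)) + (\<Sum>k'<n. y (Inr k') * of_bool (k = k'))"
        unfolding sumR by (simp add: a_def)
      also have "(\<Sum>k'<n. y (Inr k') * of_bool (k = k')) = y (Inr k)"
        using k by (simp add: of_bool_def if_distrib sum.delta' cong: if_cong)
      finally show "- y (Inr k) \<le> (\<Sum>e\<in>E. y (Inl e) * of_bool (e \<in> S k))" by simp
      show "0 \<le> w k" using wpos[OF k] by simp
    qed
    ultimately have "0 \<le> (\<Sum>e\<in>E. y (Inl e) * x e) + (\<Sum>k<n. w k * y (Inr k))"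
      using le by (simp add: sum_negf)
    then show ?thesis unfolding sumR by (simp add: b_def mult.commute)
  qed
  obtain G mu where G: "G \<subseteq> ?J" "card G \<le> card ?R" "\<And>g. g \<in> G \<Longrightarrow> 0 < mu g"
    "\<And>r. r \<in> ?R \<Longrightarrow> (\<Sum>g\<in>G. mu g * a g r) = b r"
    using cone_combination[OF fin key] by blast
  have "card ?R \<le> card E + n"
  proof -
    have "card ?R \<le> card (Inl ` E :: ('v set + nat) set) + card (Inr ` {..<n} :: ('v set + nat) set)" by (rule card_Un_le)
    then show ?thesis by (simp add: card_image)
  qed
  then have "card G \<le> card E + n" using G(2) by simp
  moreover have "finite G" using finite_subset[OF G(1) fin(1)] .
  moreover have "\<forall>e\<in>E. (\<Sum>g\<in>G. mu g * of_bool (e \<in> snd g)) = x e" using G(4)[of "Inl _"] by (simp add: a_def b_def)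
  moreover have "\<forall>k<n. (\<Sum>g\<in>G. mu g * of_bool (fst g = k)) = w k" using G(4)[of "Inr _"] by (simp add: a_def b_def)
  ultimately show ?thesis using G(1,3) by (intro exI[of _ G] exI[of _ mu]) auto
qed

end

section \<open>Cycles, spanning trees and paths\<close>

lemma cyclic_remove:
  assumes "mg_cyclic ends D"
  shows "\<exists>e\<in>D. (adj_rel ends D)\<^sup>* = (adj_rel ends (D - {e}))\<^sup>*"
proof -
  obtain vs es where c: "es \<noteq> []" "length vs = length es" "distinct es" "set es \<subseteq> D"
    "\<And>i. i < length es \<Longrightarrow> ends (es ! i) = {vs ! i, vs ! (Suc i mod length es)}"
    using assms unfolding mg_cyclic_def by blast
  let ?m = "length es" and ?e = "es ! 0"
  let ?R = "adj_rel ends (D - {?e})"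
  have m: "0 < ?m" using c(1) by simp
  \<comment> \<open>The walk leads around the cycle away from the removed edge. Indices modulo the
    length also cover a loop, where \<open>1 mod 1 = 0\<close> and nothing has to be walked.\<close>
  have walk: "1 \<le> i \<Longrightarrow> i \<le> ?m \<Longrightarrow> (vs ! (1 mod ?m), vs ! (i mod ?m)) \<in> ?R\<^sup>*" for i
  proof (induction i rule: dec_induct)
    case base then show ?case by simp
  next
    case (step i)
    then have i: "i < ?m" "(vs ! (1 mod ?m), vs ! (i mod ?m)) \<in> ?R\<^sup>*" by auto
    have "es ! i \<in> D - {?e}" using c(3,4) i(1) step(1) m by (auto simp: nth_eq_iff_index_eq)
    then have "(vs ! i, vs ! (Suc i mod ?m)) \<in> ?R" using c(5)[OF i(1)] by (auto simp: adj_rel_def)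
    then show ?case using i by auto
  qed
  have 1: "(vs ! (1 mod ?m), vs ! 0) \<in> ?R\<^sup>*" using walk[of ?m] m by (simp add: Suc_le_eq)
  have 2: "(vs ! 0, vs ! (1 mod ?m)) \<in> ?R\<^sup>*" using 1 sym_rtrancl[OF sym_adj_rel] by (meson symD)
  have "adj_rel ends D \<subseteq> ?R\<^sup>*"
  proof
    fix y assume "y \<in> adj_rel ends D"
    then obtain u v e where e: "y = (u, v)" "e \<in> D" "ends e = {u, v}" by (auto simp: adj_rel_def)
    show "y \<in> ?R\<^sup>*"
    proof (cases "e = ?e")
      case True
      then have "{u, v} = {vs ! 0, vs ! (1 mod ?m)}" using c(5)[OF m] e by simp
      then show ?thesis using 1 2 e(1) by (auto simp: doubleton_eq_iff)
    next
      case False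
      then show ?thesis using e by (auto simp: adj_rel_def)
    qed
  qed
  then have "(adj_rel ends D)\<^sup>* \<subseteq> ?R\<^sup>*" by (rule rtrancl_subset_rtrancl)
  moreover have "?R\<^sup>* \<subseteq> (adj_rel ends D)\<^sup>*" by (rule rtrancl_mono[OF adj_rel_mono]) auto
  moreover have "?e \<in> D" using c(4) m by auto
  ultimately show ?thesis by blast
qed

lemma connected_contains_tree:
  assumes "finite D0" "D0 \<subseteq> A" "mg_connected W ends D0"
  shows "\<exists>D\<subseteq>D0. is_spanning_tree W ends A D"
  using assms
proof (induction "card D0" arbitrary: D0 rule: less_induct)
  case less
  show ?case
  proof (cases "mg_cyclic ends D0")
    case False
    then show ?thesis using less by (auto simp: is_spanning_tree_def)
  next
    case True
    then obtain e where e: "e \<in> D0" "(adj_rel ends D0)\<^sup>* = (adj_rel ends (D0 - {e}))\<^sup>*"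
      using cyclic_remove by blast
    have "\<exists>D\<subseteq>D0 - {e}. is_spanning_tree W ends A D"
      by (rule less(1)) (use less e card_Diff1_less[OF less(2) e(1)] in \<open>auto simp: mg_connected_def\<close>)
    then show ?thesis by blast
  qed
qed

lemma min_spanning_tree_exists:
  assumes "finite A" "mg_connected W ends A"
  shows "\<exists>D. is_min_spanning_tree W ends A c D"
proof -
  let ?T = "{D. is_spanning_tree W ends A D}"
  have fin: "finite ?T" by (rule finite_subset[of _ "Pow A"]) (use assms in \<open>auto simp: is_spanning_tree_def\<close>)
  have ne: "?T \<noteq> {}" using connected_contains_tree[OF assms(1) subset_refl assms(2)] by auto
  then have "Min (sum c ` ?T) \<in> sum c ` ?T" using fin by (intro Min_in) auto
  then obtain D where "D \<in> ?T" "sum c D = Min (sum c ` ?T)" by auto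
  then show ?thesis using fin unfolding is_min_spanning_tree_def by (intro exI[of _ D]) auto
qed

lemma mg_connected_id: "mg_connected V id H \<longleftrightarrow> (\<forall>u\<in>V. \<forall>v\<in>V. conn H u v)"
  by (simp add: mg_connected_def conn_def)

lemma spanning_tree_of_card:
  assumes "finite V" "V \<noteq> {}" "S \<subseteq> A" "A \<subseteq> vpairs V" "card S + 1 = card V" "ncomp V S \<le> 1"
  shows "is_spanning_tree V id A S"
proof -
  have c: "conn S u v" if "u \<in> V" "v \<in> V" for u v using ncomp_eq1_conn[OF assms(1,6) that] .
  have finS: "finite S" using assms finite_vpairs finite_subset by (metis subset_trans)
  have "\<not> mg_cyclic id S"
  proof
    assume "mg_cyclic id S"
    then obtain e where e: "e \<in> S" "(adj_rel id S)\<^sup>* = (adj_rel id (S - {e}))\<^sup>*" using cyclic_remove by blast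
    then have "ncomp V (S - {e}) = 1"
      using c by (intro conn_ncomp_eq1[OF assms(2)]) (simp add: conn_def)
    moreover have "card V \<le> ncomp V (S - {e}) + card (S - {e})"
      by (rule card_le_ncomp_edges) (use assms finS in auto)
    moreover have "card (S - {e}) < card S" using card_Diff1_less[OF finS e(1)] .
    ultimately show False using assms(5) by simp
  qed
  then show ?thesis using c assms(3) by (simp add: is_spanning_tree_def mg_connected_id)
qed

lemma conn_path:
  assumes "conn H u v"
  shows "\<exists>vs. vs \<noteq> [] \<and> hd vs = u \<and> last vs = v \<and> distinct vs \<and> (\<forall>i. Suc i < length vs \<longrightarrow> {vs ! i, vs ! Suc i} \<in> H)"
  using assms
proof (induction rule: conn_induct)
  case refl then show ?case by (intro exI[of _ "[u]"]) auto
next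
  case (step w z)
  then obtain vs where vs: "vs \<noteq> []" "hd vs = u" "last vs = w" "distinct vs"
    "\<And>i. Suc i < length vs \<Longrightarrow> {vs ! i, vs ! Suc i} \<in> H" by auto
  show ?case
  proof (cases "z \<in> set vs")
    case True
    then obtain ys zs where yz: "vs = ys @ z # zs" by (auto simp: in_set_conv_decomp)
    have "{(ys @ [z]) ! i, (ys @ [z]) ! Suc i} \<in> H" if "Suc i < length (ys @ [z])" for i
      using vs(5)[of i] that by (auto simp: yz nth_append split: if_splits)
    then show ?thesis using vs yz by (intro exI[of _ "ys @ [z]"]) (cases ys; auto)
  next
    case False
    have "{(vs @ [z]) ! i, (vs @ [z]) ! Suc i} \<in> H" if "Suc i < length (vs @ [z])" for i
    proof (cases "Suc i < length vs")
      case True then show ?thesis using vs(5)[of i] by (simp add: nth_append)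
    next
      case False
      then have "i = length vs - 1" using that by simp
      then show ?thesis using vs step(2) by (simp add: nth_append last_conv_nth)
    qed
    then show ?thesis using vs False by (intro exI[of _ "vs @ [z]"]) auto
  qed
qed

lemma tree_bridge:
  assumes "is_spanning_tree V id A S" "{u, v} \<in> S" "u \<noteq> v"
  shows "\<not> conn (S - {{u, v}}) u v"
proof
  assume "conn (S - {{u, v}}) u v"
  from conn_path[OF this] obtain vs where vs: "vs \<noteq> []" "hd vs = u" "last vs = v" "distinct vs"
    "\<And>i. Suc i < length vs \<Longrightarrow> {vs ! i, vs ! Suc i} \<in> S - {{u, v}}" by blast
  define m where "m = length vs"
  have m: "0 < m" using vs(1) by (simp add: m_def)
  define es where "es = map (\<lambda>i. {vs ! i, vs ! Suc i}) [0..<m - 1] @ [{u, v}]"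
  have len: "length es = m" using m by (simp add: es_def)
  have nth: "es ! i = {vs ! i, vs ! (Suc i mod m)}" if "i < m" for i
  proof (cases "i = m - 1")
    case True
    then have "es ! i = {u, v}" by (simp add: es_def nth_append)
    moreover have "vs ! i = v" using vs(1,3) True by (simp add: m_def last_conv_nth)
    moreover have "vs ! 0 = u" using vs(1,2) by (simp add: hd_conv_nth)
    ultimately show ?thesis using True m by auto
  next
    case False
    then have "i < m - 1" "Suc i < m" using that by auto
    then show ?thesis by (simp add: es_def nth_append)
  qed
  have sub: "set es \<subseteq> S" using vs(5) assms(2) by (auto simp: es_def m_def)
  have inj: "inj_on (\<lambda>i. {vs ! i, vs ! Suc i}) {0..<m - 1}"
  proof (rule inj_onI)
    fix i j assume "i \<in> {0..<m - 1}" "j \<in> {0..<m - 1}" "{vs ! i, vs ! Suc i} = {vs ! j, vs ! Suc j}"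
    then show "i = j" using nth_eq_iff_index_eq[OF vs(4)] by (auto simp: doubleton_eq_iff m_def)
  qed
  have "{vs ! i, vs ! Suc i} \<noteq> {u, v}" if "i < m - 1" for i using vs(5)[of i] that by (simp add: m_def)
  then have "{u, v} \<notin> (\<lambda>i. {vs ! i, vs ! Suc i}) ` {0..<m - 1}" by force
  then have "distinct es" using inj by (simp add: es_def distinct_map)
  then have "mg_cyclic id S" unfolding mg_cyclic_def
    by (intro exI[of _ vs] exI[of _ es]) (use len m sub nth vs(4) in \<open>auto simp: m_def\<close>)
  then show False using assms(1) by (simp add: is_spanning_tree_def)
qed

text \<open>The unit interval is cut at the values of \<open>lam\<close>, and class \<open>k\<close>
  receives the length of the \<open>k\<close>-th piece, so the classes below \<open>t i\<close>
  weigh \<open>lam i\<close> together. The extra breakpoint \<open>0\<close> makes the sums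
  telescope, and equal values share a threshold.\<close>

lemma exists_thresholds:
  fixes lam :: "nat \<Rightarrow> real"
  assumes "\<And>i. i \<le> p + 1 \<Longrightarrow> 0 < lam i \<and> lam i \<le> 1" "lam 0 = 1" "lam (p + 1) = 1"
  obtains n w t where "\<And>k. k < n \<Longrightarrow> 0 < w k" "(\<Sum>k<n. w k) = (1 :: real)" "n \<le> p + 1"
    "\<And>i. i \<le> p + 1 \<Longrightarrow> t i \<le> n \<and> (\<Sum>k<t i. w k) = lam i" "t 0 = n" "t (p + 1) = n"
proof -
  define M where "M = insert 0 (lam ` {..p})"
  have finM: "finite M" by (simp add: M_def)
  define ts where "ts = sorted_list_of_set M"
  have ts: "set ts = M" "distinct ts" "sorted ts" using finM by (auto simp: ts_def)
  define n where "n = length ts - 1"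
  have lam_in: "lam i \<in> M" if "i \<le> p + 1" for i
    using that assms(2,3) by (cases "i = p + 1") (auto simp: M_def image_iff intro: bexI[of _ 0])
  have ne: "ts \<noteq> []" using ts(1) by (auto simp: M_def)
  have range: "0 \<le> y \<and> y \<le> 1" if "y \<in> M" for y
  proof -
    from that consider "y = 0" | i where "i \<le> p" "y = lam i" by (auto simp: M_def)
    then show ?thesis using assms(1) by cases (auto simp: less_imp_le)
  qed
  have len: "length ts = n + 1" using ne by (simp add: n_def)
  have mono: "ts ! i \<le> ts ! j" if "i \<le> j" "j \<le> n" for i j using sorted_nth_mono[OF ts(3) that(1)] that len by simp
  have t0: "ts ! 0 = 0"
  proof -
    obtain i where "i < length ts" "ts ! i = 0" using ts(1) by (metis M_def in_set_conv_nth insertI1)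
    then have "ts ! 0 \<le> 0" using mono[of 0 i] len by simp
    moreover have "ts ! 0 \<in> M" using ts(1) len by auto
    ultimately show ?thesis using range by fastforce
  qed
  have tn: "ts ! n = 1"
  proof -
    have "1 \<in> M" using lam_in[of 0] assms(2) by simp
    then obtain i where "i < length ts" "ts ! i = 1" using ts(1) by (metis in_set_conv_nth)
    then have "1 \<le> ts ! n" using mono[of i n] len by simp
    moreover have "ts ! n \<in> M" using ts(1) len by auto
    ultimately show ?thesis using range by fastforce
  qed
  define w where "w k = ts ! Suc k - ts ! k" for k
  have wpos: "0 < w k" if "k < n" for k
    using mono[of k "Suc k"] nth_eq_iff_index_eq[OF ts(2), of k "Suc k"] that len by (simp add: w_def)
  have W: "(\<Sum>k<m. w k) = ts ! m" for m using sum_lessThan_telescope[of "\<lambda>k. ts ! k" m] t0 by (simp add: w_def)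
  define t where "t i = (SOME m. m \<le> n \<and> ts ! m = lam i)" for i
  have t: "t i \<le> n \<and> ts ! t i = lam i" if i: "i \<le> p + 1" for i
  proof -
    obtain m where "m < length ts" "ts ! m = lam i" using lam_in[OF i] ts(1) by (metis in_set_conv_nth)
    then have "m \<le> n \<and> ts ! m = lam i" using len by simp
    then show ?thesis unfolding t_def by (rule someI)
  qed
  have tend: "t i = n" if "i \<le> p + 1" "lam i = 1" for i
    using t[OF that(1)] that(2) tn nth_eq_iff_index_eq[OF ts(2), of "t i" n] len by simp
  have "n \<le> p + 1"
  proof -
    have "length ts = card M" using ts by (metis distinct_card)
    also have "\<dots> \<le> Suc (card (lam ` {..p}))" unfolding M_def by (rule card_insert_le_m1) auto
    also have "card (lam ` {..p}) \<le> card {..p}" by (rule card_image_le) simp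
    finally show ?thesis using len by simp
  qed
  then show ?thesis using that[of n w t] wpos W tn t tend assms(2,3) by auto
qed

section \<open>Layered combinations for the LP solution\<close>

context lp_sol
begin

lemma card_V_le: "card V \<le> card E + 1"
proof -
  have "V \<noteq> {}" using sV by auto
  then have "ncomp V E = 1" using connE by (intro conn_ncomp_eq1)
  then show ?thesis using card_le_ncomp_edges[OF finV finE Evp] by simp
qed

lemma p_less: "p < card V"
proof -
  have "{..p} \<subseteq> lev ` V" using lev_ex by force
  then have "card {..p} \<le> card (lev ` V)" using finV by (intro card_mono) auto
  also have "\<dots> \<le> card V" using finV by (rule card_image_le)
  finally show ?thesis by simp
qed

lemma E_pos: "1 \<le> card E"
proof -
  have "card {s, t} \<le> card V" using sV tV finV by (intro card_mono) auto
  then show ?thesis using card_V_le st by simp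
qed

abbreviation Q :: "nat \<Rightarrow> 'v set set" where "Q i \<equiv> cut_edges V (Ui i) \<inter> E"

lemma narrow_cuts_Q: "narrow_cuts V x = Q ` {1..p}"
proof -
  have "narrow = Ui ` {1..p}"
  proof
    show "narrow \<subseteq> Ui ` {1..p}"
    proof
      fix U assume "U \<in> narrow"
      then show "U \<in> Ui ` {1..p}" using Ui_idx[of U] idx_range[of U] by (metis atLeastAtMost_iff image_eqI)
    qed
    show "Ui ` {1..p} \<subseteq> narrow" using Ui_narrow(1) by auto
  qed
  then show ?thesis unfolding narrow_cuts_eq by (simp add: image_image)
qed

lemma sum_Q: "1 \<le> i \<Longrightarrow> i \<le> p \<Longrightarrow> sum x (Q i) = 1 + nu i"
  using cut_sum[of i] by simp

text \<open>An edge in both cuts avoids the levels from \<open>i\<close> to \<open>j - 1\<close>. If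
  it were the only tree edge in either cut, no tree edge would leave these levels, and the tree
  would not reach \<open>s\<close> from there.\<close>

lemma cut_singleton_inj:
  assumes "i < j" "j \<le> p" "1 \<le> i" "S \<subseteq> E" "\<And>u v. u \<in> V \<Longrightarrow> v \<in> V \<Longrightarrow> conn S u v" "Q i \<inter> S = {e}" "Q j \<inter> S = {e}"
  shows False
proof -
  obtain v where v: "v \<in> V" "lev v = i" using lev_ex[of i] assms by auto
  have "conn S v s" using assms(5) v(1) sV .
  then have "s \<in> {u. i \<le> lev u \<and> lev u < j}"
  proof (rule conn_closed)
    show "v \<in> {u. i \<le> lev u \<and> lev u < j}" using v assms by simp
    fix u z assume uz: "u \<in> {u. i \<le> lev u \<and> lev u < j}" "{u, z} \<in> S"
    have e: "{u, z} \<in> E" using uz(2) assms(4) by blast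
    have cr: "{u, z} \<in> Q k \<longleftrightarrow> (lev u < k) \<noteq> (lev z < k)" for k
      using cut_Ui_iff[OF e, of k] e by (cases "lev u < k"; cases "lev z < k") simp_all
    show "z \<in> {u. i \<le> lev u \<and> lev u < j}"
    proof (rule ccontr)
      assume z: "z \<notin> {u. i \<le> lev u \<and> lev u < j}"
      then have "{u, z} \<in> Q i \<or> {u, z} \<in> Q j" using uz(1) unfolding cr by auto
      then have "{u, z} \<in> Q i \<inter> S \<or> {u, z} \<in> Q j \<inter> S" using uz(2) by (simp only: Int_iff) blast
      then have "{u, z} = e" unfolding assms(6,7) by simp
      moreover have "e \<in> Q i \<inter> S" "e \<in> Q j \<inter> S" unfolding assms(6,7) by simp_all
      ultimately have "{u, z} \<in> Q i" "{u, z} \<in> Q j" by simp_all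
      then show False using uz(1) unfolding cr by auto
    qed
  qed
  then show False using lev_s assms by simp
qed

text \<open>In a tree of class \<open>k\<close> the cuts with threshold above \<open>k\<close> are
  declared lonely. Thresholds grow with \<open>2 - x (Q)\<close>, which gives layeredness, and the
  classes below the threshold of a cut weigh \<open>2 - x (Q)\<close>, which gives the condition on
  \<open>lonely_vec\<close>.\<close>

theorem layered_exists: "\<exists>n lam S L. n \<le> 3 * card E \<and> layered_combination V x n lam S L"
proof -
  have r: "0 < 1 - nu i \<and> 1 - nu i \<le> 1" for i using nu_range[of i] by simp
  have nu0: "nu 0 = 0" "nu (p + 1) = 0" by (simp_all add: nu_def)
  obtain n w tt where w: "\<And>k. k < n \<Longrightarrow> 0 < w k" "(\<Sum>k<n. w k) = 1" "n \<le> p + 1"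
    and tt: "\<And>i. i \<le> p + 1 \<Longrightarrow> tt i \<le> n \<and> (\<Sum>k<tt i. w k) = 1 - nu i" "tt 0 = n" "tt (p + 1) = n"
    by (rule exists_thresholds[of p "\<lambda>i. 1 - nu i"]) (use r nu0 in auto)
  have cr: "sum x {e \<in> E. (\<exists>u\<in>e. lev u < i) \<and> (\<exists>u\<in>e. i \<le> lev u)} \<le> 1 + nu i" if "1 \<le> i" "i \<le> p" for i
  proof -
    have "{e \<in> E. (\<exists>u\<in>e. lev u < i) \<and> (\<exists>u\<in>e. i \<le> lev u)} = Q i" using cut_Ui_iff by blast
    then show ?thesis using sum_Q[OF that] by simp
  qed
  interpret G: leveled_graph V E x lev p nu n w
    by unfold_locales (use finV Evp xpos less_imp_le lev_le lev_ex forest cr cross2 w in \<open>auto\<close>)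
  have adm: "G.adm tt" using tt by (simp add: G.adm_def G.W_def)
  obtain G mu where G: "finite G" "card G \<le> card E + n" "\<And>g. g \<in> G \<Longrightarrow> fst g < n \<and> snd g \<in> G.trees tt (fst g) \<and> 0 < mu g"
    "\<And>e. e \<in> E \<Longrightarrow> (\<Sum>g\<in>G. mu g * of_bool (e \<in> snd g)) = x e" "\<And>k. k < n \<Longrightarrow> (\<Sum>g\<in>G. mu g * of_bool (fst g = k)) = w k"
    using G.tree_decomposition[OF adm tt(2,3) nu0 sum_E] by blast
  define N where "N = card G"
  obtain f where f: "bij_betw f {..<N} G" using ex_bij_betw_nat_finite[OF G(1)] by (auto simp: N_def atLeast0LessThan)
  have reidx: "(\<Sum>i<N. h (f i)) = (\<Sum>g\<in>G. h g)" for h :: "nat \<times> 'v set set \<Rightarrow> real" using sum.reindex_bij_betw[OF f] by simp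
  have fG: "f i \<in> G" if "i < N" for i using f that by (auto simp: bij_betw_def)
  define lam where "lam i = mu (f i)" for i
  define S where "S i = snd (f i)" for i
  define K where "K i = fst (f i)" for i
  define L where "L i = {e \<in> S i. \<exists>j. 1 \<le> j \<and> j \<le> p \<and> K i < tt j \<and> e \<in> Q j}" for i
  have T: "S i \<in> G.trees tt (K i)" "K i < n" "0 < lam i" if "i < N" for i
    using G(3)[OF fG[OF that]] by (auto simp: S_def K_def lam_def)
  have SE: "S i \<subseteq> E" if "i < N" for i using T(1)[OF that] by (simp add: G.trees_def)
  have crQ: "{e \<in> A. G.crosses j e} = Q j \<inter> A" if "A \<subseteq> E" for A j
    using cut_Ui_iff[of _ j] that by (auto simp: G.crosses_def)
  have one: "\<exists>e. Q j \<inter> S i = {e}" if "i < N" "1 \<le> j" "j \<le> p" "K i < tt j" for i j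
    using G.tree_cut[OF T(1)[OF that(1)] that(2-4)] crQ[OF SE[OF that(1)], of j] by simp
  have nc: "ncomp V (S i) \<le> 1" if "i < N" for i
    using G.cor_zero_conn[of tt "K i" 0 "p + 1" "S i"] T(1)[OF that] G.Ein_all G.Lv_all by (simp add: G.trees_def)
  have V0: "V \<noteq> {}" using sV by auto
  have tree: "is_spanning_tree V id E (S i)" if "i < N" for i
    using spanning_tree_of_card[OF finV V0 SE[OF that] Evp _ nc[OF that]] T(1)[OF that] by (simp add: G.trees_def)
  have cS: "conn (S i) u v" if "i < N" "u \<in> V" "v \<in> V" for i u v
    using ncomp_eq1_conn[OF finV nc[OF that(1)] that(2,3)] .
  have Lc: "L i \<subseteq> lonely_candidates V x (S i)" if i: "i < N" for i
  proof
    fix e assume "e \<in> L i"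
    then obtain j where j: "e \<in> S i" "1 \<le> j" "j \<le> p" "K i < tt j" "e \<in> Q j" by (auto simp: L_def)
    then have "Q j \<inter> S i = {e}" using one[OF i j(2-4)] by auto
    then show "e \<in> lonely_candidates V x (S i)" using j narrow_cuts_Q by (auto simp: lonely_candidates_def)
  qed
  have lonely: "Q j \<in> lonely_cuts V x (S i) (L i) \<longleftrightarrow> K i < tt j" if i: "i < N" and j: "1 \<le> j" "j \<le> p" for i j
  proof
    assume "K i < tt j"
    then obtain e where e: "Q j \<inter> S i = {e}" using one[OF i j] by auto
    then have "e \<in> L i" using j \<open>K i < tt j\<close> by (auto simp: L_def)
    then show "Q j \<in> lonely_cuts V x (S i) (L i)" using e j narrow_cuts_Q by (auto simp: lonely_cuts_def)
  next
    assume "Q j \<in> lonely_cuts V x (S i) (L i)"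
    then obtain e where e: "e \<in> L i" "Q j \<inter> S i = {e}" by (auto simp: lonely_cuts_def)
    then obtain j' where j': "1 \<le> j'" "j' \<le> p" "K i < tt j'" "e \<in> Q j'" "e \<in> S i" by (auto simp: L_def)
    then have "Q j' \<inter> S i = {e}" using one[OF i j'(1-3)] by auto
    \<comment> \<open>An edge may have entered \<open>L i\<close> on behalf of another cut, and
      \<open>lonely_cuts\<close> would then also accept \<open>Q j\<close>; that one edge serves
      only one cut excludes this.\<close>
    then have "j = j'" using cut_singleton_inj[of j j' "S i" e] cut_singleton_inj[of j' j "S i" e] j j' e SE[OF i] cS[OF i]
      by (metis linorder_neqE_nat)
    then show "K i < tt j" using j' by simp
  qed
  have sumK: "(\<Sum>i | i < N \<and> K i < m. lam i) = (\<Sum>k<m. w k)" if "m \<le> n" for m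
  proof -
    have "(\<Sum>i | i < N \<and> K i < m. lam i) = (\<Sum>i<N. lam i * of_bool (K i < m))"
      by (simp add: of_bool_def if_distrib sum.If_cases Int_def cong: if_cong)
    also have "\<dots> = (\<Sum>g\<in>G. mu g * of_bool (fst g < m))"
      using reidx[of "\<lambda>g. mu g * of_bool (fst g < m)"] by (simp add: lam_def K_def)
    also have "\<dots> = (\<Sum>g\<in>G. \<Sum>k<m. mu g * of_bool (fst g = k))"
      by (rule sum.cong[OF refl]) (simp add: of_bool_def if_distrib sum.delta' cong: if_cong)
    also have "\<dots> = (\<Sum>k<m. \<Sum>g\<in>G. mu g * of_bool (fst g = k))" by (rule sum.swap)
    also have "\<dots> = (\<Sum>k<m. w k)" by (rule sum.cong) (use G(5) that in auto)
    finally show ?thesis .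
  qed
  have "tree_combination V x N lam S L"
  proof -
    have "(\<Sum>i<N. lam i) = 1"
    proof -
      have "{i. i < N \<and> K i < n} = {..<N}" using T(2) by auto
      then show ?thesis using sumK[of n] w(2) by simp
    qed
    then show ?thesis using T(3) tree Lc by (simp add: tree_combination_def)
  qed
  moreover have "(\<Sum>i<N. lam i * of_bool (e \<in> S i)) = x e" if "e \<in> E" for e
    using reidx[of "\<lambda>g. mu g * of_bool (e \<in> snd g)"] G(4)[OF that] by (simp add: lam_def S_def)
  moreover have "sum (lonely_vec V x N lam S L C) C = 2 - sum x C" if C: "C \<in> narrow_cuts V x" for C
  proof -
    obtain j where j: "1 \<le> j" "j \<le> p" "C = Q j" using C narrow_cuts_Q by auto
    have finC: "finite C" using j finE by simp
    have "sum (lonely_vec V x N lam S L C) C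
        = (\<Sum>e\<in>C. \<Sum>i\<in>{i \<in> {i. i < N \<and> C \<in> lonely_cuts V x (S i) (L i)}. lonely_edge (S i) C = e}. lam i)"
      unfolding lonely_vec_def by (simp add: conj_assoc)
    also have "\<dots> = (\<Sum>i\<in>{i. i < N \<and> C \<in> lonely_cuts V x (S i) (L i)}. lam i)"
    proof (rule sum.group)
      show "(\<lambda>i. lonely_edge (S i) C) ` {i. i < N \<and> C \<in> lonely_cuts V x (S i) (L i)} \<subseteq> C"
        by (auto simp: lonely_cuts_def lonely_edge_def)
    qed (use finC in auto)
    also have "{i. i < N \<and> C \<in> lonely_cuts V x (S i) (L i)} = {i. i < N \<and> K i < tt j}"
      using lonely j by blast
    also have "(\<Sum>i\<in>\<dots>. lam i) = 1 - nu j" using sumK[of "tt j"] tt(1)[of j] j by simp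
    finally show ?thesis using sum_Q[OF j(1,2)] j(3) by simp
  qed
  moreover have "layered_tree V x (S i) (L i)" if i: "i < N" for i
    unfolding layered_tree_def
  proof (intro ballI impI)
    fix C C' assume C: "C \<in> lonely_cuts V x (S i) (L i)" "C' \<in> narrow_cuts V x" "sum x C' \<le> sum x C"
    have "C \<in> narrow_cuts V x" using C(1) by (simp add: lonely_cuts_def)
    then obtain j j' where j: "1 \<le> j" "j \<le> p" "C = Q j" "1 \<le> j'" "j' \<le> p" "C' = Q j'" using C(2) narrow_cuts_Q by auto
    have "nu j' \<le> nu j" using C(3) sum_Q j by simp
    then have le: "G.W (tt j) \<le> G.W (tt j')" using tt(1)[of j] tt(1)[of j'] j by (simp add: G.W_def)
    have "tt j \<le> tt j'"
    proof (rule ccontr)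
      assume "\<not> tt j \<le> tt j'"
      then have "G.W (tt j') + w (tt j') \<le> G.W (tt j)" using G.W_mono[of "Suc (tt j')" "tt j"] tt(1)[of j] j by (simp add: G.W_def)
      then show False using le w(1)[of "tt j'"] tt(1)[of j] j \<open>\<not> tt j \<le> tt j'\<close> by simp
    qed
    then have "K i < tt j'" using lonely[OF i j(1,2)] C(1) j(3) by simp
    then show "C' \<in> lonely_cuts V x (S i) (L i)" using lonely[OF i j(4,5)] j(6) by simp
  qed
  ultimately have "layered_combination V x N lam S L" by (simp add: layered_combination_def)
  \<comment> \<open>At most \<open>card E + n\<close> trees occur, where
    \<open>n \<le> p + 1 \<le> card V \<le> card E + 1\<close>, and \<open>E\<close> is
    nonempty.\<close>
  moreover have "N \<le> 3 * card E" using G(2) w(3) p_less card_V_le E_pos by (simp add: N_def)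
  ultimately show ?thesis by blast
qed

end

section \<open>The join polyhedron\<close>

lemma join_exists:
  assumes "finite V" "E \<subseteq> vpairs V" "\<And>u v. u \<in> V \<Longrightarrow> v \<in> V \<Longrightarrow> conn E u v" "T \<subseteq> V" "even (card T)"
  shows "\<exists>J\<subseteq>E. oddv V J = T"
  using assms(4,5)
proof (induction "card T" arbitrary: T rule: less_induct)
  case less
  have finT: "finite T" using finite_subset[OF less(2) assms(1)] .
  have finE: "finite E" using finite_subset[OF assms(2) finite_vpairs[OF assms(1)]] .
  show ?case
  proof (cases "T = {}")
    case True then show ?thesis by (intro exI[of _ "{}"]) auto
  next
    case False
    then obtain u where u: "u \<in> T" by auto
    have "T \<noteq> {u}" using less(3) by auto
    then obtain v where v: "v \<in> T" "v \<noteq> u" using u by auto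
    have c: "card (T - {u, v}) + 2 = card T" using u v finT by (simp add: card_Diff_subset card_gt_0_iff) (metis Suc_diff_Suc card_gt_0_iff card_le_Suc0_iff_eq diff_Suc_1 empty_iff le_less_linear less_Suc_eq_le numeral_2_eq_2 Suc_pred)
    have "even (card (T - {u, v}))" using c less(3) by presburger
    then have "\<exists>J\<subseteq>E. oddv V J = T - {u, v}" by (intro less(1)) (use c less(2) in auto)
    then obtain J where J: "J \<subseteq> E" "oddv V J = T - {u, v}" by auto
    obtain P where P: "P \<subseteq> E" "oddv V P = sym_diff {u} {v}"
      using join_in_conn[OF assms(3)[of u v] assms(2) finE] u(1) v(1) less(2) by (metis subsetD)
    have "oddv V (sym_diff J P) = T"
      using oddv_sym_diff[of J P V] J P finite_subset[OF _ finE] u v by auto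
    then show ?thesis using J P by (intro exI[of _ "sym_diff J P"]) auto
  qed
qed

lemma sum_sym_diff:
  fixes w :: "'e \<Rightarrow> real"
  assumes "finite A" "finite B"
  shows "sum w (sym_diff A B) = sum w A + sum w B - 2 * sum w (A \<inter> B)"
proof -
  have "sum w (sym_diff A B) = sum w (A - B) + sum w (B - A)" using assms by (intro sum.union_disjoint) auto
  then show ?thesis using sum.Int_Diff[OF assms(1), of w B] sum.Int_Diff[OF assms(2), of w A] by (simp add: Int_commute)
qed

locale tjoin =
  fixes V :: "'v set" and E :: "'v set set" and T :: "'v set"
  assumes finV: "finite V" and EV: "E \<subseteq> vpairs V" and TV: "T \<subseteq> V"
begin

lemma finE: "finite E" using finite_subset[OF EV finite_vpairs[OF finV]] .

lemma fin_sub: "J \<subseteq> E \<Longrightarrow> finite J" using finite_subset[OF _ finE] .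

text \<open>For \<open>v\<close> minimizing the weight of a minimum \<open>T \<triangle> {a, v}\<close>-join, the set of vertices
  at zero distance from \<open>v\<close> defines a cut that every minimum \<open>T\<close>-join meets exactly once.\<close>

lemma common_tight_cut:
  fixes w :: "'v set \<Rightarrow> real"
  assumes wnn: "\<And>e. e \<in> E \<Longrightarrow> 0 \<le> w e" and J0: "J0 \<subseteq> E" "oddv V J0 = T" "0 < sum w J0"
    and min: "\<And>J. J \<subseteq> E \<Longrightarrow> oddv V J = T \<Longrightarrow> \<tau> \<le> sum w J" and tau: "sum w J0 = \<tau>"
  shows "\<exists>U\<subseteq>V. odd (card (T \<inter> U)) \<and> (\<forall>e\<in>cut_edges V U \<inter> E. 0 < w e) \<and>
    (\<forall>J\<subseteq>E. oddv V J = T \<and> sum w J = \<tau> \<longrightarrow> card (J \<inter> cut_edges V U) = 1)"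
proof -
  have sd: "oddv V (sym_diff A B) = sym_diff (oddv V A) (oddv V B)" if "A \<subseteq> E" "B \<subseteq> E" for A B
    using oddv_sym_diff fin_sub that by blast
  have nn: "0 \<le> sum w A" if "A \<subseteq> E" for A using wnn that by (intro sum_nonneg) auto
  have "\<exists>e\<in>J0. 0 < w e"
  proof (rule ccontr)
    assume "\<not> ?thesis"
    then have "sum w J0 \<le> 0" by (intro sum_nonpos) (auto simp: not_less)
    then show False using J0(3) by simp
  qed
  \<comment> \<open>Removing \<open>e0\<close> from \<open>J0\<close> gives a cheaper join for the
    target changed at \<open>a\<close> and \<open>v0\<close>. Hence \<open>m < \<tau>\<close>, which
    keeps \<open>a\<close> out of \<open>U\<close> below.\<close>
  then obtain e0 where e0: "e0 \<in> J0" "0 < w e0" by auto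
  obtain a v0 where av: "e0 = {a, v0}" "a \<noteq> v0" "a \<in> V" "v0 \<in> V" using e0(1) J0(1) EV by (meson subsetD vpairsD)
  define cand where "cand = {(v, J). v \<in> V \<and> J \<subseteq> E \<and> oddv V J = sym_diff T (sym_diff {a} {v})}"
  have fc: "finite cand" by (rule finite_subset[of _ "V \<times> Pow E"]) (use finV finE in \<open>auto simp: cand_def\<close>)
  have "oddv V (sym_diff J0 {e0}) = sym_diff T e0"
    using sd[of J0 "{e0}"] oddv_single[of e0 V] J0 e0 av by auto
  moreover have "sym_diff {a} {v0} = e0" using av by auto
  ultimately have c0: "(v0, sym_diff J0 {e0}) \<in> cand" using av J0 e0 by (auto simp: cand_def)
  define m where "m = Min ((\<lambda>(v, J). sum w J) ` cand)"
  have "m \<in> (\<lambda>(v, J). sum w J) ` cand" unfolding m_def using fc c0 by (intro Min_in) auto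
  then obtain v Js where vJ: "(v, Js) \<in> cand" "sum w Js = m" by auto
  have mle: "m \<le> sum w J" if "(u, J) \<in> cand" for u J unfolding m_def using fc that by (intro Min_le) force+
  have "sym_diff J0 {e0} = J0 - {e0}" using e0 by auto
  then have "sum w (sym_diff J0 {e0}) < \<tau>" using sum.remove[OF fin_sub[OF J0(1)] e0(1), of w] e0(2) tau by simp
  then have mt: "m < \<tau>" using mle[OF c0] by simp
  define Z where "Z = {e \<in> E. w e = 0}"
  define U where "U = {z \<in> V. conn Z v z}"
  have v: "v \<in> V" "Js \<subseteq> E" "oddv V Js = sym_diff T (sym_diff {a} {v})" using vJ by (auto simp: cand_def)
  have ZE: "Z \<subseteq> E" "Z \<subseteq> vpairs V" using EV by (auto simp: Z_def)
  have UV: "U \<subseteq> V" by (auto simp: U_def)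
  have zpath: "\<exists>P\<subseteq>Z. oddv V P = sym_diff {b} {c}" if "b \<in> U" "c \<in> U" for b c
  proof (rule join_in_conn)
    show "conn Z b c" using that by (auto simp: U_def intro: conn_trans conn_sym)
  qed (use that ZE fin_sub[OF ZE(1)] UV in auto)
  have zw: "sum w (sym_diff A P) = sum w A" if "A \<subseteq> E" "P \<subseteq> Z" for A P
  proof -
    have "sum w P = 0" "sum w (A \<inter> P) = 0" using that by (auto simp: Z_def intro!: sum.neutral)
    then show ?thesis using sum_sym_diff[of A P w] fin_sub[of A] fin_sub[of P] that ZE by auto
  qed
  have cutpos: "0 < w e" if e: "e \<in> cut_edges V U \<inter> E" for e
  proof (rule ccontr)
    assume "\<not> 0 < w e"
    then have "e \<in> Z" using e wnn[of e] by (auto simp: Z_def)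
    obtain b c where bc: "e = {b, c}" "b \<in> U" "c \<in> V - U" using e by (auto simp: cut_edges_def)
    then have "conn Z v c" using \<open>e \<in> Z\<close> conn_edge[of b c Z] by (auto simp: U_def intro: conn_trans)
    then show False using bc by (auto simp: U_def)
  qed
  have aU: "a \<notin> U"
  proof
    assume "a \<in> U"
    moreover have "v \<in> U" using v by (simp add: U_def)
    ultimately have "\<exists>P\<subseteq>Z. oddv V P = sym_diff {a} {v}" by (rule zpath)
    then obtain P where P: "P \<subseteq> Z" "oddv V P = sym_diff {a} {v}" by (elim exE conjE)
    have PE: "P \<subseteq> E" using P(1) ZE(1) by (rule subset_trans)
    have "oddv V (sym_diff Js P) = T" unfolding sd[OF v(2) PE] P(2) v(3) by auto
    moreover have "sym_diff Js P \<subseteq> E" using v(2) PE by blast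
    ultimately have "\<tau> \<le> sum w (sym_diff Js P)" using min by blast
    then show False using zw[OF v(2) P(1)] vJ(2) mt by simp
  qed
  \<comment> \<open>Inside \<open>U\<close> the target can be moved from \<open>u\<close> to any
    \<open>b\<close> at no cost. Leaving \<open>U\<close> along an edge of the join would then save
    the positive weight of this edge, against the choice of \<open>m\<close>.\<close>
  have nocut: "J \<inter> cut_edges V U = {}" if J: "(u, J) \<in> cand" "sum w J = m" "u \<in> U" for u J
  proof (rule ccontr)
    assume "J \<inter> cut_edges V U \<noteq> {}"
    then obtain e where e: "e \<in> J" "e \<in> cut_edges V U" by auto
    obtain b c where bc: "e = {b, c}" "b \<in> U" "c \<in> V - U" using e by (auto simp: cut_edges_def)
    have JE: "J \<subseteq> E" "oddv V J = sym_diff T (sym_diff {a} {u})" using J by (auto simp: cand_def)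
    have we: "0 < w e" using cutpos e JE by auto
    from zpath[OF J(3) bc(2)] obtain P where P: "P \<subseteq> Z" "oddv V P = sym_diff {u} {b}" by (elim exE conjE)
    have eP: "e \<notin> P" using P we by (auto simp: Z_def)
    define J' where "J' = sym_diff J P"
    have PE: "P \<subseteq> E" using P(1) ZE(1) by (rule subset_trans)
    have "oddv V J' = sym_diff (sym_diff T (sym_diff {a} {u})) (sym_diff {u} {b})"
      unfolding J'_def sd[OF JE(1) PE] JE(2) P(2) ..
    also have "\<dots> = sym_diff T (sym_diff {a} {b})" by auto
    finally have J'o: "oddv V J' = sym_diff T (sym_diff {a} {b})" .
    have "J' \<subseteq> E" using JE(1) PE unfolding J'_def by blast
    moreover have "sum w J' = m" unfolding J'_def using zw[OF JE(1) P(1)] J(2) by simp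
    moreover have "e \<in> J'" unfolding J'_def using e(1) eP by simp
    ultimately have J': "J' \<subseteq> E" "oddv V J' = sym_diff T (sym_diff {a} {b})" "sum w J' = m" "e \<in> J'" using J'o by auto
    have "oddv V {e} = {b, c}" using oddv_single[of e V] bc UV by auto
    then have "oddv V (sym_diff J' {e}) = sym_diff (sym_diff T (sym_diff {a} {b})) {b, c}"
      using sd[OF J'(1), of "{e}"] J'(2) subsetD[OF J'(1,4)] by simp
    also have "\<dots> = sym_diff T (sym_diff {a} {c})" using bc by auto
    finally have "oddv V (sym_diff J' {e}) = sym_diff T (sym_diff {a} {c})" .
    moreover have je: "sym_diff J' {e} = J' - {e}" using J' by auto
    ultimately have "(c, J' - {e}) \<in> cand" using J' bc by (auto simp: cand_def)
    then have "m \<le> sum w (J' - {e})" by (rule mle)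
    also have "\<dots> < m" using sum.remove[OF fin_sub[OF J'(1)] J'(4), of w] J'(3) we by simp
    finally show False by simp
  qed
  have vU: "v \<in> U" using v by (simp add: U_def)
  have Jsc: "Js \<inter> cut_edges V U = {}" using nocut[OF vJ vU] .
  have odd: "odd (card (T \<inter> U))"
  proof -
    have "even (card (oddv V Js \<inter> U))" using oddv_cut_parity[OF fin_sub[OF v(2)] _ finV UV] v(2) EV Jsc by auto
    moreover have "oddv V Js \<inter> U = sym_diff (T \<inter> U) {v}" using v(3) aU vU by auto
    moreover have "finite (T \<inter> U)" using UV finV finite_subset by blast
    ultimately show ?thesis using even_card_sym_diff[of "T \<inter> U" "{v}"] by auto
  qed
  have "card (J \<inter> cut_edges V U) = 1" if J: "J \<subseteq> E" "oddv V J = T" "sum w J = \<tau>" for J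
  proof (rule ccontr)
    assume ne1: "card (J \<inter> cut_edges V U) \<noteq> 1"
    have finC: "finite (J \<inter> cut_edges V U)" using fin_sub[OF J(1)] by simp
    have "odd (card (J \<inter> cut_edges V U))"
      using oddv_cut_parity[OF fin_sub[OF J(1)] _ finV UV] J EV odd by (auto simp: Int_commute)
    then have "\<not> card (J \<inter> cut_edges V U) \<le> Suc 0" using ne1 by presburger
    then obtain e1 e2 where e12: "e1 \<in> J \<inter> cut_edges V U" "e2 \<in> J \<inter> cut_edges V U" "e1 \<noteq> e2"
      using card_le_Suc0_iff_eq[OF finC] by blast
    define D where "D = sym_diff J Js"
    have DE: "D \<subseteq> E" using J v by (auto simp: D_def)
    have oD: "oddv V D = {a, v}" using sd[OF J(1) v(2)] J v aU vU TV by (auto simp: D_def)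
    have Dc: "D \<inter> cut_edges V U = J \<inter> cut_edges V U" using Jsc by (auto simp: D_def)
    \<comment> \<open>Otherwise \<open>e\<close> lies in an even set \<open>O'\<close> inside
      \<open>D \<union> Z\<close>. Exchanging along \<open>O'\<close> preserves both kinds of joins
      without raising the total weight, so the modified \<open>Js\<close> is still minimum; but it
      crosses \<open>U\<close> at \<open>e\<close>.\<close>
    have noncon: "\<not> conn ((D - {e}) \<union> Z) z b" if e: "e \<in> J \<inter> cut_edges V U" "e = {b, z}" "b \<in> U" "z \<in> V - U" for e b z
    proof
      assume "conn ((D - {e}) \<union> Z) z b"
      moreover have HE: "(D - {e}) \<union> Z \<subseteq> E" using DE ZE by auto
      moreover have "finite ((D - {e}) \<union> Z)" using fin_sub[OF HE] .
      ultimately have "\<exists>P\<subseteq>(D - {e}) \<union> Z. oddv V P = sym_diff {z} {b}"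
        using join_in_conn[of "(D - {e}) \<union> Z" z b V] subset_trans[OF HE EV] e(4) by simp
      then obtain P where P: "P \<subseteq> (D - {e}) \<union> Z" "oddv V P = sym_diff {z} {b}" by (elim exE conjE)
      have we: "0 < w e" using cutpos e(1) J by auto
      have eP: "e \<notin> P" using P(1) we by (auto simp: Z_def)
      define O' where "O' = insert e P"
      have OE: "O' \<subseteq> E" using P(1) HE e(1) J by (auto simp: O'_def)
      have "O' = sym_diff P {e}" using eP by (auto simp: O'_def)
      moreover have "oddv V {e} = {b, z}" using oddv_single[of e V] e UV by auto
      moreover have "P \<subseteq> E" "{e} \<subseteq> E" using OE by (auto simp: O'_def)
      ultimately have "oddv V O' = sym_diff (sym_diff {z} {b}) {b, z}" using sd[of P "{e}"] P(2) by simp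
      also have "\<dots> = {}" using e(3,4) by auto
      finally have oO: "oddv V O' = {}" .
      have O1: "O' \<subseteq> D \<union> Z" "e \<in> D" using P(1) e(1) Dc by (auto simp: O'_def)
      have wO: "sum w O' \<le> sum w (J \<inter> O') + sum w (Js \<inter> O')"
      proof -
        have "sum w O' = sum w (O' \<inter> D)"
          by (rule sum.mono_neutral_right) (use fin_sub[OF OE] O1 in \<open>auto simp: Z_def\<close>)
        also have "\<dots> \<le> sum w ((J \<inter> O') \<union> (Js \<inter> O'))"
          by (rule sum_mono2) (use fin_sub[OF OE] wnn OE in \<open>auto simp: D_def\<close>)
        also have "\<dots> \<le> sum w (J \<inter> O') + sum w (Js \<inter> O')"
        proof -
          have "0 \<le> sum w (J \<inter> O' \<inter> (Js \<inter> O'))" using OE by (intro nn) auto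
          then show ?thesis using sum.union_inter[of "J \<inter> O'" "Js \<inter> O'" w] fin_sub[OF OE] by simp
        qed
        finally show ?thesis .
      qed
      have "sym_diff J O' \<subseteq> E" "sym_diff Js O' \<subseteq> E" using J(1) v(2) OE by blast+
      moreover have "oddv V (sym_diff J O') = T" unfolding sd[OF J(1) OE] J(2) oO by simp
      moreover have "oddv V (sym_diff Js O') = sym_diff T (sym_diff {a} {v})" unfolding sd[OF v(2) OE] v(3) oO by simp
      ultimately have JO: "\<tau> \<le> sum w (sym_diff J O')" and cJ: "(v, sym_diff Js O') \<in> cand"
        using min v(1) by (simp_all add: cand_def)
      from JO have "sum w (sym_diff Js O') \<le> m"
        using sum_sym_diff[OF fin_sub[OF J(1)] fin_sub[OF OE], of w] sum_sym_diff[OF fin_sub[OF v(2)] fin_sub[OF OE], of w]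
          wO J(3) vJ(2) by simp
      then have "sum w (sym_diff Js O') = m" using mle[OF cJ] by simp
      then have "sym_diff Js O' \<inter> cut_edges V U = {}" using nocut[OF cJ _ vU] by blast
      moreover have "e \<in> sym_diff Js O'" "e \<in> cut_edges V U" using e(1) Jsc by (auto simp: O'_def)
      ultimately show False by blast
    qed
    obtain b1 z1 where 1: "e1 = {b1, z1}" "b1 \<in> U" "z1 \<in> V - U" using e12(1) by (auto simp: cut_edges_def)
    obtain b2 z2 where 2: "e2 = {b2, z2}" "b2 \<in> U" "z2 \<in> V - U" using e12(2) by (auto simp: cut_edges_def)
    \<comment> \<open>After deletion of \<open>e\<close>, the component of \<open>z\<close> is left
      by \<open>D\<close> only through \<open>e\<close>, so by parity it contains exactly one odd
      vertex of \<open>D\<close>; as it avoids \<open>U\<close>, this is \<open>a\<close>. This is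
      impossible for two edges at once: from \<open>z1\<close> one would get via \<open>a\<close>,
      \<open>z2\<close> and \<open>e2\<close> back into \<open>U\<close>.\<close>
    have far: "conn ((D - {e}) \<union> Z) z a \<and> ccomp ((D - {e}) \<union> Z) z \<inter> U = {}"
      if e: "e \<in> J \<inter> cut_edges V U" "e = {b, z}" "b \<in> U" "z \<in> V - U" for e b z
    proof -
      let ?H = "(D - {e}) \<union> Z"
      let ?C = "ccomp ?H z"
      have CU: "?C \<inter> U = {}"
      proof (rule ccontr)
        assume "?C \<inter> U \<noteq> {}"
        then obtain u where u: "conn ?H z u" "u \<in> U" by (auto simp: ccomp_def)
        have "conn Z u b" using u(2) e(3) by (auto simp: U_def intro: conn_trans conn_sym)
        then have "conn ?H u b" by (rule conn_mono) auto
        then show False using noncon[OF e] conn_trans[OF u(1)] by blast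
      qed
      have HV: "?H \<subseteq> vpairs V" using DE ZE EV by auto
      have CV: "?C \<subseteq> V" using conn_in[OF _ HV] e(4) by (auto simp: ccomp_def)
      have zC: "z \<in> ?C" by (simp add: ccomp_def)
      have "D \<inter> cut_edges V ?C = {e}"
      proof -
        have "(D - {e}) \<inter> cut_edges V ?C = {}" using ccomp_cut[OF HV, of z] by auto
        moreover have "e \<in> cut_edges V ?C" using e zC CU UV by (auto simp: cut_edges_pair_iff)
        moreover have "e \<in> D" using e(1) Dc by auto
        ultimately show ?thesis by blast
      qed
      then have "odd (card (oddv V D \<inter> ?C))" using oddv_cut_parity[OF fin_sub[OF DE] _ finV CV] DE EV by auto
      moreover have "v \<notin> ?C" using vU CU by auto
      ultimately have "a \<in> ?C" unfolding oD by (cases "a \<in> ?C") auto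
      then show ?thesis using CU by (simp add: ccomp_def)
    qed
    note f1 = far[OF e12(1) 1] and f2 = far[OF e12(2) 2]
    have "conn ((D - {e1}) \<union> Z) z2 a"
    proof -
      have "conn ((D - {e1}) \<union> Z) z2 y" if "conn ((D - {e2}) \<union> Z) z2 y" for y
        using that
      proof (induction rule: conn_induct)
        case refl then show ?case by simp
      next
        case (step y y')
        have "y \<notin> U" using f2 step(1) by (auto simp: ccomp_def)
        moreover have "y' \<notin> U" using f2 conn_trans[OF step(1) conn_edge[OF step(2)]] by (auto simp: ccomp_def)
        ultimately have "{y, y'} \<noteq> e1" using 1 by auto
        then have "{y, y'} \<in> (D - {e1}) \<union> Z" using step(2) by auto
        then show ?case using step(3) conn_edge conn_trans by metis
      qed
      then show ?thesis using f2 by blast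
    qed
    then have "conn ((D - {e1}) \<union> Z) z1 z2" using f1 conn_trans conn_sym by metis
    moreover have "e2 \<in> D" using e12(2) Dc by auto
    then have "conn ((D - {e1}) \<union> Z) z2 b2" using 2(1) e12(3) by (intro conn_edge) (auto simp: insert_commute)
    ultimately have "b2 \<in> ccomp ((D - {e1}) \<union> Z) z1" using conn_trans by (auto simp: ccomp_def)
    then show False using f1 2(2) by blast
  qed
  then show ?thesis using UV odd cutpos by (intro exI[of _ U]) auto
qed

text \<open>Lowering \<open>w\<close> by \<open>\<epsilon>\<close> on a common tight cut keeps all
  minimum joins minimum and lowers the minimum by exactly \<open>\<epsilon>\<close>, while the right
  side falls at least as much because \<open>y\<close> has weight one on the cut. With the largest
  possible \<open>\<epsilon>\<close> an edge weight vanishes or a new join becomes minimum, so the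
  measure drops.\<close>

lemma join_weight_le:
  fixes w y :: "'v set \<Rightarrow> real"
  assumes ex: "\<exists>J\<subseteq>E. oddv V J = T" and ynn: "\<And>e. e \<in> E \<Longrightarrow> 0 \<le> y e"
    and cut: "\<And>U. U \<subseteq> V \<Longrightarrow> odd (card (T \<inter> U)) \<Longrightarrow> 1 \<le> sum y (cut_edges V U \<inter> E)"
    and wnn: "\<And>e. e \<in> E \<Longrightarrow> 0 \<le> w e"
  shows "\<exists>J\<subseteq>E. oddv V J = T \<and> sum w J \<le> (\<Sum>e\<in>E. w e * y e)"
proof -
  define JJ where "JJ = {J. J \<subseteq> E \<and> oddv V J = T}"
  have fJ: "finite JJ" by (rule finite_subset[of _ "Pow E"]) (use finE in \<open>auto simp: JJ_def\<close>)
  define \<tau> where "\<tau> w = Min (sum w ` JJ)" for w :: "'v set \<Rightarrow> real"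
  have neJ: "JJ \<noteq> {}" using ex by (auto simp: JJ_def)
  have tle: "\<tau> w \<le> sum w J" if "J \<in> JJ" for w J unfolding \<tau>_def using fJ that by auto
  have tin: "\<exists>J\<in>JJ. sum w J = \<tau> w" for w
  proof -
    have "\<tau> w \<in> sum w ` JJ" unfolding \<tau>_def using fJ neJ by (intro Min_in) auto
    then show ?thesis by auto
  qed
  have "\<tau> w \<le> (\<Sum>e\<in>E. w e * y e)"
    using wnn
  proof (induction "card {e \<in> E. 0 < w e} + card {J \<in> JJ. \<tau> w < sum w J}" arbitrary: w rule: less_induct)
    case (less w)
    have wy: "0 \<le> (\<Sum>e\<in>E. w e * y e)" using less(2) ynn by (intro sum_nonneg) auto
    show ?case
    proof (cases "\<tau> w \<le> 0")
      case True then show ?thesis using wy by simp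
    next
      case False
      obtain J0 where J0: "J0 \<in> JJ" "sum w J0 = \<tau> w" using tin by blast
      obtain U where U: "U \<subseteq> V" "odd (card (T \<inter> U))" "\<And>e. e \<in> cut_edges V U \<inter> E \<Longrightarrow> 0 < w e"
        "\<And>J. J \<subseteq> E \<Longrightarrow> oddv V J = T \<Longrightarrow> sum w J = \<tau> w \<Longrightarrow> card (J \<inter> cut_edges V U) = 1"
        using common_tight_cut[of w J0 "\<tau> w"] less(2) J0 False tle by (auto simp: JJ_def)
      let ?d = "cut_edges V U \<inter> E"
      define A1 where "A1 = w ` ?d"
      define B where "B = {J \<in> JJ. \<tau> w < sum w J \<and> 1 < card (J \<inter> ?d)}"
      \<comment> \<open>A join meeting the cut more than once loses weight faster than the minimum
        does, and \<open>g J\<close> is the reduction at which it becomes minimum itself.\<close>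
      define g where "g J = (sum w J - \<tau> w) / (real (card (J \<inter> ?d)) - 1)" for J
      have Jd: "J \<inter> ?d = J \<inter> cut_edges V U" if "J \<in> JJ" for J using that by (auto simp: JJ_def)
      have c0: "card (J0 \<inter> ?d) = 1" using U(4)[of J0] J0 Jd[OF J0(1)] by (simp add: JJ_def)
      have ne: "?d \<noteq> {}" using c0 by auto
      have finA: "finite (A1 \<union> g ` B)" "A1 \<union> g ` B \<noteq> {}" using finE fJ ne by (auto simp: A1_def B_def)
      define \<epsilon> where "\<epsilon> = Min (A1 \<union> g ` B)"
      have epos: "0 < \<epsilon>"
      proof -
        have "\<epsilon> \<in> A1 \<union> g ` B" unfolding \<epsilon>_def using finA by (rule Min_in)
        then show ?thesis using U(3) by (auto simp: A1_def B_def g_def)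
      qed
      have eA: "\<epsilon> \<le> w e" if "e \<in> ?d" for e unfolding \<epsilon>_def using finA that by (intro Min_le) (auto simp: A1_def)
      have eB: "\<epsilon> \<le> g J" if "J \<in> B" for J unfolding \<epsilon>_def using finA that by (intro Min_le) auto
      define w' where "w' e = w e - (if e \<in> ?d then \<epsilon> else 0)" for e
      have w'nn: "0 \<le> w' e" if "e \<in> E" for e using eA[of e] less(2)[OF that] by (auto simp: w'_def)
      have sw: "sum w' J = sum w J - \<epsilon> * real (card (J \<inter> ?d))" if "J \<in> JJ" for J
      proof -
        have "finite J" using that fin_sub by (auto simp: JJ_def)
        then show ?thesis by (simp add: w'_def sum_subtractf sum.If_cases Int_def)
      qed
      have ge: "\<tau> w - \<epsilon> \<le> sum w' J" if J: "J \<in> JJ" for J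
      proof (cases "sum w J = \<tau> w")
        case True
        then have "card (J \<inter> ?d) = 1" using U(4)[of J] J Jd[OF J] by (simp add: JJ_def)
        then show ?thesis using sw[OF J] True by simp
      next
        case False
        then have lt: "\<tau> w < sum w J" using tle[OF J, of w] by simp
        show ?thesis
        proof (cases "1 < card (J \<inter> ?d)")
          case True
          then have "\<epsilon> \<le> g J" using eB J lt by (auto simp: B_def)
          then have "\<epsilon> * (real (card (J \<inter> ?d)) - 1) \<le> sum w J - \<tau> w" using True by (simp add: g_def pos_le_divide_eq)
          then show ?thesis using sw[OF J] by (simp add: algebra_simps)
        next
          case False
          then have "real (card (J \<inter> ?d)) \<le> 1" by simp
          then have "\<epsilon> * real (card (J \<inter> ?d)) \<le> \<epsilon>" using epos by (simp add: mult_left_le)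
          then show ?thesis using sw[OF J] lt by simp
        qed
      qed
      have J0': "sum w' J0 = \<tau> w - \<epsilon>" using sw[OF J0(1)] c0 J0(2) by simp
      have tw': "\<tau> w' = \<tau> w - \<epsilon>"
      proof (rule antisym)
        show "\<tau> w' \<le> \<tau> w - \<epsilon>" using tle[OF J0(1), of w'] J0' by simp
        obtain J where "J \<in> JJ" "sum w' J = \<tau> w'" using tin by blast
        then show "\<tau> w - \<epsilon> \<le> \<tau> w'" using ge by metis
      qed
      have s1: "{e \<in> E. 0 < w' e} \<subseteq> {e \<in> E. 0 < w e}" using epos by (auto simp: w'_def split: if_splits)
      have s2: "{J \<in> JJ. \<tau> w' < sum w' J} \<subseteq> {J \<in> JJ. \<tau> w < sum w J}"
      proof
        fix J assume J: "J \<in> {J \<in> JJ. \<tau> w' < sum w' J}"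
        have "sum w J \<noteq> \<tau> w"
        proof
          assume eq: "sum w J = \<tau> w"
          then have "card (J \<inter> ?d) = 1" using U(4)[of J] J Jd[of J] by (simp add: JJ_def)
          then show False using J sw[of J] eq tw' by simp
        qed
        then show "J \<in> {J \<in> JJ. \<tau> w < sum w J}" using J tle[of J w] by auto
      qed
      have "\<epsilon> \<in> A1 \<union> g ` B" unfolding \<epsilon>_def using finA by (rule Min_in)
      then have "{e \<in> E. 0 < w' e} \<noteq> {e \<in> E. 0 < w e} \<or> {J \<in> JJ. \<tau> w' < sum w' J} \<noteq> {J \<in> JJ. \<tau> w < sum w J}"
      proof
        assume "\<epsilon> \<in> A1"
        then obtain e where "e \<in> ?d" "\<epsilon> = w e" by (auto simp: A1_def)
        then have "e \<in> {e \<in> E. 0 < w e}" "e \<notin> {e \<in> E. 0 < w' e}" using epos by (auto simp: w'_def)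
        then show ?thesis by blast
      next
        assume "\<epsilon> \<in> g ` B"
        then obtain J where J: "J \<in> B" "\<epsilon> = g J" by auto
        then have "\<epsilon> * (real (card (J \<inter> ?d)) - 1) = sum w J - \<tau> w" by (simp add: B_def g_def)
        then have "sum w' J = \<tau> w'" using sw[of J] J tw' by (simp add: B_def algebra_simps)
        then have "J \<in> {J \<in> JJ. \<tau> w < sum w J}" "J \<notin> {J \<in> JJ. \<tau> w' < sum w' J}" using J by (auto simp: B_def)
        then show ?thesis by blast
      qed
      then have "card {e \<in> E. 0 < w' e} + card {J \<in> JJ. \<tau> w' < sum w' J} < card {e \<in> E. 0 < w e} + card {J \<in> JJ. \<tau> w < sum w J}"
      proof
        assume "{e \<in> E. 0 < w' e} \<noteq> {e \<in> E. 0 < w e}"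
        then have "card {e \<in> E. 0 < w' e} < card {e \<in> E. 0 < w e}" using s1 finE by (intro psubset_card_mono) auto
        then show ?thesis using card_mono[OF _ s2] fJ by (simp add: add_less_le_mono)
      next
        assume "{J \<in> JJ. \<tau> w' < sum w' J} \<noteq> {J \<in> JJ. \<tau> w < sum w J}"
        then have "card {J \<in> JJ. \<tau> w' < sum w' J} < card {J \<in> JJ. \<tau> w < sum w J}" using s2 fJ by (intro psubset_card_mono) auto
        then show ?thesis using card_mono[OF _ s1] finE by (simp add: add_le_less_mono)
      qed
      from less(1)[OF this w'nn] have "\<tau> w - \<epsilon> \<le> (\<Sum>e\<in>E. w' e * y e)" using tw' by simp
      also have "\<dots> = (\<Sum>e\<in>E. w e * y e) - \<epsilon> * sum y ?d"
      proof -
        have "(\<Sum>e\<in>E. w' e * y e) = (\<Sum>e\<in>E. w e * y e - (if e \<in> ?d then \<epsilon> * y e else 0))"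
          by (rule sum.cong) (auto simp: w'_def algebra_simps)
        also have "\<dots> = (\<Sum>e\<in>E. w e * y e) - (\<Sum>e\<in>{e \<in> E. e \<in> ?d}. \<epsilon> * y e)"
          using finE by (simp only: sum_subtractf sum.inter_filter)
        also have "{e \<in> E. e \<in> ?d} = ?d" by auto
        finally show ?thesis by (simp add: sum_distrib_left)
      qed
      also have "\<dots> \<le> (\<Sum>e\<in>E. w e * y e) - \<epsilon>" using cut[OF U(1,2)] epos by (simp add: mult_le_cancel_left1)
      finally show ?thesis by simp
    qed
  qed
  moreover obtain J where "J \<in> JJ" "sum w J = \<tau> w" using tin by blast
  ultimately show ?thesis by (intro exI[of _ J]) (auto simp: JJ_def)
qed

lemma is_join_iff: "is_join V E T J \<longleftrightarrow> J \<subseteq> E \<and> oddv V J = T"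
  using odd_verts_mset_set[OF fin_sub] by (auto simp: is_join_def)

theorem join_combination_exists:
  assumes ex: "\<exists>J\<subseteq>E. oddv V J = T" and ynn: "\<And>e. e \<in> E \<Longrightarrow> 0 \<le> y e"
    and cut: "\<And>U. U \<subseteq> V \<Longrightarrow> odd (card (T \<inter> U)) \<Longrightarrow> 1 \<le> sum y (cut_edges V U \<inter> E)"
  shows "\<exists>m mu J. m \<le> card E + 1 \<and> join_combination V E T y m mu J"
proof -
  have fJ: "finite {J. J \<subseteq> E \<and> oddv V J = T}" by (rule finite_subset[of _ "Pow E"]) (use finE in auto)
  have "\<exists>m mu J. m \<le> card E + 1 \<and> (\<forall>j<m. 0 < mu j \<and> J j \<in> {J. J \<subseteq> E \<and> oddv V J = T}) \<and> (\<Sum>j<m. mu j) = (1::real) \<and>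
    (\<forall>e\<in>E. (\<Sum>j<m. mu j * of_bool (e \<in> J j)) \<le> y e)"
  proof (rule convex_combination_below[OF finE fJ])
    fix w :: "'v set \<Rightarrow> real" assume "\<And>e. e \<in> E \<Longrightarrow> 0 \<le> w e"
    then show "\<exists>J\<in>{J. J \<subseteq> E \<and> oddv V J = T}. sum w J \<le> (\<Sum>e\<in>E. w e * y e)"
      using join_weight_le[OF ex ynn cut, of w] by auto
  qed auto
  then show ?thesis by (simp add: join_combination_def is_join_iff)
qed

end

section \<open>Paths and contractions\<close>

lemma path_edges_single [simp]: "path_edges [v] = {}"
  by (auto simp: path_edges_def)

lemma path_edges_Cons2: "path_edges (u # v # vs) = insert {u, v} (path_edges (v # vs))"
proof (intro equalityI subsetI)
  fix e assume "e \<in> path_edges (u # v # vs)"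
  then obtain i where i: "e = {(u # v # vs) ! i, (u # v # vs) ! Suc i}" "Suc i < length (u # v # vs)" by (auto simp: path_edges_def)
  show "e \<in> insert {u, v} (path_edges (v # vs))"
  proof (cases i)
    case 0 then show ?thesis using i by simp
  next
    case (Suc j)
    then have "e = {(v # vs) ! j, (v # vs) ! Suc j}" "Suc j < length (v # vs)" using i by auto
    then show ?thesis unfolding path_edges_def by blast
  qed
next
  fix e assume "e \<in> insert {u, v} (path_edges (v # vs))"
  then consider "e = {u, v}" | j where "e = {(v # vs) ! j, (v # vs) ! Suc j}" "Suc j < length (v # vs)"
    by (auto simp: path_edges_def)
  then show "e \<in> path_edges (u # v # vs)"
  proof cases
    case 1
    then have "e = {(u # v # vs) ! 0, (u # v # vs) ! Suc 0}" "Suc 0 < length (u # v # vs)" by auto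
    then show ?thesis unfolding path_edges_def by blast
  next
    case 2
    then have "e = {(u # v # vs) ! Suc j, (u # v # vs) ! Suc (Suc j)}" "Suc (Suc j) < length (u # v # vs)" by auto
    then show ?thesis unfolding path_edges_def by blast
  qed
qed

lemma path_edges_subset: "e \<in> path_edges vs \<Longrightarrow> e \<subseteq> set vs"
  by (auto simp: path_edges_def)

lemma finite_path_edges: "finite (path_edges vs)"
proof -
  have "path_edges vs = (\<lambda>i. {vs ! i, vs ! Suc i}) ` {i. Suc i < length vs}" by (auto simp: path_edges_def)
  moreover have "finite {i. Suc i < length vs}" by (rule finite_subset[of _ "{..<length vs}"]) auto
  ultimately show ?thesis by simp
qed

lemma oddv_path: "vs \<noteq> [] \<Longrightarrow> distinct vs \<Longrightarrow> set vs \<subseteq> V \<Longrightarrow> oddv V (path_edges vs) = sym_diff {hd vs} {last vs}"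
proof (induction vs rule: induct_list012)
  case (3 u v vs)
  have "{u, v} \<notin> path_edges (v # vs)" using path_edges_subset[of "{u, v}" "v # vs"] 3(4) by auto
  then have "path_edges (u # v # vs) = sym_diff {{u, v}} (path_edges (v # vs))" by (auto simp: path_edges_Cons2)
  then have "oddv V (path_edges (u # v # vs)) = sym_diff {u, v} (sym_diff {v} {last (v # vs)})"
    using oddv_sym_diff[of "{{u, v}}" "path_edges (v # vs)" V] finite_path_edges[of "v # vs"] 3 oddv_single[of "{u, v}" V] by simp
  moreover have "u \<notin> set (v # vs)" "last (v # vs) \<in> set (v # vs)" using 3(4) last_in_set[of "v # vs"] by auto
  ultimately show ?case by auto
qed auto

lemma path_eq_of_edges:
  "vs \<noteq> [] \<Longrightarrow> vs' \<noteq> [] \<Longrightarrow> distinct vs \<Longrightarrow> distinct vs' \<Longrightarrow> hd vs = hd vs' \<Longrightarrow> path_edges vs = path_edges vs' \<Longrightarrow> vs = vs'"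
proof (induction vs arbitrary: vs' rule: induct_list012)
  case (2 u)
  then obtain ws where "vs' = u # ws" by (cases vs') auto
  then show ?case using 2 by (cases ws) (auto simp: path_edges_Cons2)
next
  case (3 u v vs)
  then obtain ws where ws: "vs' = u # ws" by (cases vs') auto
  have e: "{u, v} \<in> path_edges vs'" using 3(8) path_edges_Cons2[of u v vs] by auto
  then obtain v' ws' where vs': "vs' = u # v' # ws'" using ws by (cases ws) auto
  have n1: "{u, v} \<notin> path_edges (v # vs)" using path_edges_subset[of "{u, v}" "v # vs"] 3(5) by auto
  have n2: "{u, z} \<notin> path_edges (v' # ws')" for z using path_edges_subset[of "{u, z}" "v' # ws'"] 3(6) vs' by auto
  have "{u, v} = {u, v'}" using e n2[of v] unfolding vs' path_edges_Cons2 by (simp only: insert_iff simp_thms)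
  then have vv: "v = v'" by (auto simp: doubleton_eq_iff)
  have "path_edges (v # vs) = path_edges (v' # ws')"
    using insert_eq_iff[OF n1[unfolded vv] n2[of v']] 3(8) unfolding vs' path_edges_Cons2 vv by simp
  then have "v # vs = v' # ws'" using 3(2)[of "v' # ws'"] 3(5,6) vs' vv by auto
  then show ?case using vs' by simp
qed auto

text \<open>The symmetric difference is an even subset of the tree. Each of its edges is a bridge of
  the tree and would be its only edge in some cut, against parity.\<close>

lemma tree_join_unique:
  assumes T: "is_spanning_tree V id A S" and fin: "finite V" and A: "A \<subseteq> vpairs V"
    and J: "J1 \<subseteq> S" "J2 \<subseteq> S" "oddv V J1 = oddv V J2"
  shows "J1 = J2"
proof (rule ccontr)
  assume ne: "J1 \<noteq> J2"
  have SV: "S \<subseteq> vpairs V" using T A by (auto simp: is_spanning_tree_def)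
  have finS: "finite S" using finite_subset[OF SV finite_vpairs[OF fin]] .
  let ?O = "sym_diff J1 J2"
  have OS: "?O \<subseteq> S" using J by auto
  have o: "oddv V ?O = {}" using oddv_sym_diff[of J1 J2 V] J finite_subset[OF _ finS] by auto
  obtain e where e: "e \<in> ?O" using ne by auto
  then obtain u v where uv: "e = {u, v}" "u \<noteq> v" "u \<in> V" "v \<in> V" using SV OS by (meson subsetD vpairsD)
  have nb: "\<not> conn (S - {e}) u v" using tree_bridge[OF T, of u v] uv e OS by auto
  let ?C = "ccomp (S - {e}) u"
  have SeV: "S - {e} \<subseteq> vpairs V" using SV by auto
  have CV: "?C \<subseteq> V" using conn_in[OF _ SeV uv(3)] by (auto simp: ccomp_def)
  have "?O \<inter> cut_edges V ?C = {e}"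
  proof -
    have "(S - {e}) \<inter> cut_edges V ?C = {}" by (rule ccomp_cut[OF SeV])
    moreover have "e \<in> cut_edges V ?C" using uv nb by (auto simp: cut_edges_pair_iff ccomp_def)
    ultimately show ?thesis using e OS by blast
  qed
  then show False using oddv_cut_parity[OF finite_subset[OF OS finS] subset_trans[OF OS SV] fin CV] o by simp
qed

text \<open>A path is a join of its ends and a tree contains only one such join. Together with
  \<open>path_eq_of_edges\<close> this makes the description in \<open>tree_path\<close> denote a
  unique path.\<close>

lemma tree_path_join:
  assumes T: "is_spanning_tree V id A S" and fin: "finite V" and A: "A \<subseteq> vpairs V" and st: "s \<in> V" "t \<in> V"
  shows "tree_path V S s t \<subseteq> S" "oddv V (tree_path V S s t) = sym_diff {s} {t}"
proof -
  have SV: "S \<subseteq> vpairs V" using T A by (auto simp: is_spanning_tree_def)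
  have "conn S s t" using T st by (simp add: is_spanning_tree_def mg_connected_id)
  then obtain vs where vs: "vs \<noteq> []" "hd vs = s" "last vs = t" "distinct vs"
    "\<And>i. Suc i < length vs \<Longrightarrow> {vs ! i, vs ! Suc i} \<in> S" using conn_path[of S s t] by blast
  have "set vs \<subseteq> V"
  proof
    fix z assume "z \<in> set vs"
    then obtain i where i: "i < length vs" "z = vs ! i" by (auto simp: in_set_conv_nth)
    show "z \<in> V"
    proof (cases i)
      case 0 then show ?thesis using i vs st by (simp add: hd_conv_nth)
    next
      case (Suc k)
      then have "{vs ! k, vs ! Suc k} \<in> vpairs V" using vs(5)[of k] i SV by auto
      then show ?thesis using i Suc by (simp add: vpairs_iff)
    qed
  qed
  then have p: "is_vertex_path V S s t vs" using vs by (simp add: is_vertex_path_def)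
  have props: "path_edges ws \<subseteq> S" "oddv V (path_edges ws) = sym_diff {s} {t}" if "is_vertex_path V S s t ws" for ws
    using that oddv_path[of ws V] by (auto simp: is_vertex_path_def path_edges_def)
  have "(THE ws. is_vertex_path V S s t ws) = vs"
  proof (rule the_equality[of "is_vertex_path V S s t" vs, OF p])
    fix ws assume w: "is_vertex_path V S s t ws"
    have "path_edges ws = path_edges vs"
      by (rule tree_join_unique[OF T fin A]) (use props[OF w] props[OF p] in auto)
    then show "ws = vs" using path_eq_of_edges[of ws vs] w p by (auto simp: is_vertex_path_def)
  qed
  then show "tree_path V S s t \<subseteq> S" "oddv V (tree_path V S s t) = sym_diff {s} {t}"
    using props[OF p] by (auto simp: tree_path_def)
qed

lemma contracted_connected_iff:
  assumes HV: "H \<subseteq> vpairs V" and AV: "A \<subseteq> vpairs V"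
  shows "mg_connected (contracted_verts V H) (contracted_ends V H) A \<longleftrightarrow> (\<forall>u\<in>V. \<forall>v\<in>V. conn (H \<union> A) u v)"
proof
  let ?R = "adj_rel (contracted_ends V H) A"
  assume c: "mg_connected (contracted_verts V H) (contracted_ends V H) A"
  show "\<forall>u\<in>V. \<forall>v\<in>V. conn (H \<union> A) u v"
  proof (intro ballI)
    fix u v assume uv: "u \<in> V" "v \<in> V"
    have "(vcomp V H u, vcomp V H v) \<in> ?R\<^sup>*" using c uv by (auto simp: mg_connected_def contracted_verts_def)
    then have "\<forall>z\<in>vcomp V H v. conn (H \<union> A) u z"
    proof (induction rule: rtrancl_induct)
      case base
      then show ?case by (auto simp: vcomp_def intro: conn_mono)
    next
      case (step X Y)
      then obtain e where e: "e \<in> A" "contracted_ends V H e = {X, Y}" by (auto simp: adj_rel_def)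
      then obtain a b where ab: "e = {a, b}" "a \<in> V" "b \<in> V" using AV by (meson subsetD vpairsD)
      have "{vcomp V H a, vcomp V H b} = {X, Y}" using e ab by (simp add: contracted_ends_def)
      moreover have "conn (H \<union> A) a b" "conn (H \<union> A) b a" using e(1) ab(1) by (auto intro!: conn_edge simp: insert_commute)
      moreover have "a \<in> vcomp V H a" "b \<in> vcomp V H b" using ab by (auto simp: vcomp_def)
      ultimately obtain a' b' where "a' \<in> X" "Y = vcomp V H b'" "conn (H \<union> A) a' b'" by (auto simp: doubleton_eq_iff)
      moreover then have "conn (H \<union> A) u a'" using step by blast
      ultimately show ?case by (auto simp: vcomp_def intro: conn_trans conn_mono)
    qed
    then show "conn (H \<union> A) u v" using uv by (auto simp: vcomp_def)
  qed
next
  let ?R = "adj_rel (contracted_ends V H) A"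
  assume c: "\<forall>u\<in>V. \<forall>v\<in>V. conn (H \<union> A) u v"
  have "(vcomp V H u, vcomp V H v) \<in> ?R\<^sup>*" if uv: "u \<in> V" "conn (H \<union> A) u v" for u v
    using uv(2)
  proof (induction rule: conn_induct)
    case refl then show ?case by simp
  next
    case (step w z)
    have zV: "z \<in> V" using step(2) HV AV by (auto simp: vpairs_iff dest!: subsetD)
    from step(2) consider "{w, z} \<in> H" | "{w, z} \<in> A" by auto
    then show ?case
    proof cases
      case 1
      then have "vcomp V H w = vcomp V H z" using vcomp_eq_iff[OF zV, of H w] conn_edge by metis
      then show ?thesis using step by simp
    next
      case 2
      then have "(vcomp V H w, vcomp V H z) \<in> ?R" by (auto simp: adj_rel_def contracted_ends_def intro!: bexI[of _ "{w, z}"])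
      then show ?thesis using step by (meson rtrancl.rtrancl_into_rtrancl)
    qed
  qed
  then show "mg_connected (contracted_verts V H) (contracted_ends V H) A"
    using c by (auto simp: mg_connected_def contracted_verts_def)
qed

text \<open>Meaningful only if \<open>X\<close> has an element above \<open>h\<close>, hence the
  recurring restriction to such \<open>h\<close>.\<close>

definition succ_in :: "nat set \<Rightarrow> nat \<Rightarrow> nat" where
  "succ_in X h = Min {k \<in> X. h < k}"

lemma succ_in:
  assumes "finite X" "k \<in> X" "h < k"
  shows "succ_in X h \<in> X" "h < succ_in X h" "succ_in X h \<le> k"
proof -
  have f: "finite {k \<in> X. h < k}" and k: "k \<in> {k \<in> X. h < k}" using assms by auto
  have "Min {k \<in> X. h < k} \<in> {k \<in> X. h < k}" by (rule Min_in[OF f]) (use k in blast)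
  then show "succ_in X h \<in> X" "h < succ_in X h" unfolding succ_in_def by blast+
  show "succ_in X h \<le> k" unfolding succ_in_def by (rule Min_le[OF f k])
qed

text \<open>Every element except the first and the last occurs once as predecessor and once as
  successor. The left side has one summand \<open>1/2\<close> fewer, which by
  \<open>lam \<le> 1\<close> makes up for the two missing quarters at the ends.\<close>

lemma succ_sum_le:
  fixes lam :: "nat \<Rightarrow> real"
  assumes "finite X" "\<And>h. h \<in> X \<Longrightarrow> lam h \<le> 1"
  shows "(\<Sum>h\<in>{h \<in> X. \<exists>k\<in>X. h < k}. 1/2 - (lam h + lam (succ_in X h)) / 4) \<le> (\<Sum>h\<in>X. 1/2 - lam h / 2)"
proof -
  \<comment> \<open>The stronger form keeps a quarter of \<open>lam (Max X)\<close> open for the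
    successor that \<open>Max X\<close> gets when a new maximum is appended.\<close>
  have "X \<noteq> {} \<Longrightarrow> (\<Sum>h\<in>{h \<in> X. \<exists>k\<in>X. h < k}. 1/2 - (lam h + lam (succ_in X h)) / 4)
      \<le> (\<Sum>h\<in>X. 1/2 - lam h / 2) - 1/4 + lam (Max X) / 4"
    using assms
  proof (induction X rule: finite_linorder_max_induct)
    case (insert m X)
    let ?I = "{h \<in> X. \<exists>k\<in>X. h < k}"
    show ?case
    proof (cases "X = {}")
      case True
      then have e: "{h \<in> insert m X. \<exists>k\<in>insert m X. h < k} = {}" by auto
      show ?thesis unfolding e using True insert(5)[of m] by simp
    next
      case False
      let ?M = "Max X"
      have M: "?M \<in> X" "\<And>k. k \<in> X \<Longrightarrow> k \<le> ?M" using insert(1) False by auto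
      have I: "{h \<in> insert m X. \<exists>k\<in>insert m X. h < k} = insert ?M ?I"
      proof (intro equalityI subsetI)
        fix h assume h: "h \<in> {h \<in> insert m X. \<exists>k\<in>insert m X. h < k}"
        then have hX: "h \<in> X" using insert(2) by fastforce
        show "h \<in> insert ?M ?I" using M(1) M(2)[OF hX] hX by (cases "h = ?M") (auto intro!: bexI[of _ ?M])
      next
        fix h assume "h \<in> insert ?M ?I"
        then show "h \<in> {h \<in> insert m X. \<exists>k\<in>insert m X. h < k}" using M(1) insert(2) by auto
      qed
      have nM: "?M \<notin> ?I" using M(2) leD by blast
      have s1: "succ_in (insert m X) ?M = m"
      proof -
        have "\<not> ?M < k" if "k \<in> X" for k using M(2)[OF that] by simp
        moreover have "?M < m" using insert(2) M(1) by blast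
        ultimately have "{k \<in> insert m X. ?M < k} = {m}" by auto
        then show ?thesis by (simp add: succ_in_def)
      qed
      have s2: "succ_in (insert m X) h = succ_in X h" if h: "h \<in> ?I" for h
      proof (rule antisym)
        obtain k where k: "k \<in> X" "h < k" using h by auto
        note a = succ_in[OF insert(1) k]
        note b = succ_in[of "insert m X" k h]
        show "succ_in (insert m X) h \<le> succ_in X h" using succ_in(3)[of "insert m X" "succ_in X h" h] a insert(1) by simp
        have "k < m" using insert(2) k(1) by blast
        then have "succ_in (insert m X) h \<in> X" using b k insert(1) by auto
        then show "succ_in X h \<le> succ_in (insert m X) h" using succ_in(3)[OF insert(1), of _ h] b k insert(1) by auto
      qed
      have mX: "m \<notin> X" using insert(2) by blast
      have "Max (insert m X) = m" using insert(1,2) by (intro Max_eqI) (auto simp: less_imp_le)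
      then have e1: "lam (Max (insert m X)) = lam m" by simp
      have e2: "(\<Sum>h\<in>{h \<in> insert m X. \<exists>k\<in>insert m X. h < k}. 1/2 - (lam h + lam (succ_in (insert m X) h)) / 4)
        = (1/2 - (lam ?M + lam m) / 4) + (\<Sum>h\<in>?I. 1/2 - (lam h + lam (succ_in X h)) / 4)"
        unfolding I using insert(1) nM s1 s2 by simp
      have e3: "(\<Sum>h\<in>?I. 1/2 - (lam h + lam (succ_in X h)) / 4) \<le> (\<Sum>h\<in>X. 1/2 - lam h / 2) - 1/4 + lam ?M / 4"
        using insert(3) False insert(5) by auto
      have e4: "(\<Sum>h\<in>insert m X. 1/2 - lam h / 2) = (1/2 - lam m / 2) + (\<Sum>h\<in>X. 1/2 - lam h / 2)"
        using insert(1) mX by simp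
      have arith: "A \<le> B - 1/4 + c / 4"
        if "c = d" "A = (1/2 - (M + d) / 4) + R" "R \<le> S - 1/4 + M / 4" "B = (1/2 - d / 2) + S" for A B R S M c d :: real
        using that by argo
      show ?thesis by (rule arith[OF e1 e2 e3 e4])
    qed
  qed simp
  moreover have "X \<noteq> {} \<Longrightarrow> lam (Max X) \<le> 1" using assms by simp
  ultimately show ?thesis by (cases "X = {}") auto
qed

section \<open>The vector of the algorithm\<close>

locale layered_lp = lp_sol +
  fixes n :: nat and lam :: "nat \<Rightarrow> real" and S L :: "nat \<Rightarrow> 'a set set"
  assumes lay: "layered_combination V x n lam S L"
begin

definition lambda :: "nat \<Rightarrow> real" where "lambda j = 1 - nu j"

definition lon :: "nat \<Rightarrow> nat set" where
  "lon i = {j. 1 \<le> j \<and> j \<le> p \<and> Q j \<in> lonely_cuts V x (S i) (L i)}"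

definition le :: "nat \<Rightarrow> nat \<Rightarrow> 'a set" where
  "le i j = lonely_edge (S i) (Q j)"

definition F :: "nat \<Rightarrow> 'a set set" where
  "F i = S i - L i"

definition P :: "nat \<Rightarrow> 'a set set" where
  "P i = tree_path V (S i) s t"

lemma tc: "i < n \<Longrightarrow> 0 < lam i" "i < n \<Longrightarrow> is_spanning_tree V id E (S i)"
  "i < n \<Longrightarrow> L i \<subseteq> lonely_candidates V x (S i)" "(\<Sum>i<n. lam i) = 1"
  using lay by (auto simp: layered_combination_def tree_combination_def)

lemma lam_x: "e \<in> E \<Longrightarrow> (\<Sum>i<n. lam i * of_bool (e \<in> S i)) = x e"
  using lay by (auto simp: layered_combination_def)

lemma SE: "i < n \<Longrightarrow> S i \<subseteq> E" using tc(2) by (simp add: is_spanning_tree_def)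

lemma finS: "i < n \<Longrightarrow> finite (S i)" using finite_subset[OF SE finE] .

lemma Svp: "i < n \<Longrightarrow> S i \<subseteq> vpairs V" using SE Evp by blast

lemma LS: "i < n \<Longrightarrow> L i \<subseteq> S i" using tc(3)[of i] by (auto simp: lonely_candidates_def)

lemma connS: "i < n \<Longrightarrow> u \<in> V \<Longrightarrow> v \<in> V \<Longrightarrow> conn (S i) u v"
  using tc(2)[of i] by (simp add: is_spanning_tree_def mg_connected_id)

lemma lambda_range: "0 < lambda j" "lambda j \<le> 1" using nu_range[of j] by (auto simp: lambda_def)

lemma sum_Q': "1 \<le> j \<Longrightarrow> j \<le> p \<Longrightarrow> sum x (Q j) = 2 - lambda j" using sum_Q by (simp add: lambda_def)

lemma lon_range: "j \<in> lon i \<Longrightarrow> 1 \<le> j \<and> j \<le> p" by (simp add: lon_def)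

lemma finlon: "finite (lon i)" by (rule finite_subset[of _ "{..p}"]) (auto simp: lon_def)

lemma lonD:
  assumes "j \<in> lon i" shows "Q j \<inter> S i = {le i j} \<and> le i j \<in> L i"
proof -
  obtain e where e: "e \<in> L i" "Q j \<inter> S i = {e}"
    using assms unfolding lon_def lonely_cuts_def mem_Collect_eq by (elim conjE bexE)
  then have "le i j = e" unfolding le_def lonely_edge_def by (simp only: the_elem_eq)
  then show ?thesis using e by (simp only: simp_thms)
qed

lemma le_inj:
  assumes "i < n" "j \<in> lon i" "j' \<in> lon i'" "Q j' \<inter> S i = {le i j}"
  shows "j = j'"
proof (rule ccontr)
  assume "j \<noteq> j'"
  then consider "j < j'" | "j' < j" by linarith
  then show False
  proof cases
    case 1
    show False
      by (rule cut_singleton_inj[OF 1 conjunct2[OF lon_range[OF assms(3)]] conjunct1[OF lon_range[OF assms(2)]]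
            SE[OF assms(1)] connS[OF assms(1)] conjunct1[OF lonD[OF assms(2)]] assms(4)])
  next
    case 2
    show False
      by (rule cut_singleton_inj[OF 2 conjunct2[OF lon_range[OF assms(2)]] conjunct1[OF lon_range[OF assms(3)]]
            SE[OF assms(1)] connS[OF assms(1)] assms(4) conjunct1[OF lonD[OF assms(2)]]])
  qed
qed

lemma leQ: "j \<in> lon i \<Longrightarrow> le i j \<in> Q j" and leS: "j \<in> lon i \<Longrightarrow> le i j \<in> S i"
  and leL: "j \<in> lon i \<Longrightarrow> le i j \<in> L i"
  using equalityD2[OF conjunct1[OF lonD[of j i]]] conjunct2[OF lonD[of j i]] by (simp_all only: insert_subset Int_iff)

lemma leI: "j \<in> lon i \<Longrightarrow> e \<in> Q j \<Longrightarrow> e \<in> S i \<Longrightarrow> e = le i j"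
  using equalityD1[OF conjunct1[OF lonD[of j i]]] by (metis IntI singletonD subsetD)

lemma le_only:
  assumes "i < n" "j \<in> lon i" "j' \<in> lon i" "le i j \<in> Q j'"
  shows "j = j'"
proof -
  have "le i j = le i j'" by (rule leI[OF assms(3,4) leS[OF assms(2)]])
  then have "Q j' \<inter> S i = {le i j}" using conjunct1[OF lonD[OF assms(3)]] by (simp only:)
  then show ?thesis using le_inj[OF assms(1-3)] by (simp only:)
qed

lemma inj_le:
  assumes "i < n" shows "inj_on (le i) (lon i)"
proof (rule inj_onI)
  fix j j' assume j: "j \<in> lon i" "j' \<in> lon i" "le i j = le i j'"
  show "j = j'" by (rule le_only[OF assms j(1,2)]) (unfold j(3), rule leQ[OF j(2)])
qed

lemma Lle:
  assumes i: "i < n" shows "L i = le i ` lon i"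
proof
  show "le i ` lon i \<subseteq> L i" using leL by (intro image_subsetI)
  show "L i \<subseteq> le i ` lon i"
  proof
    fix e assume e: "e \<in> L i"
    then obtain C where C: "C \<in> narrow_cuts V x" "C \<inter> S i = {e}" using tc(3)[OF i] by (auto simp: lonely_candidates_def)
    then obtain j where j: "1 \<le> j" "j \<le> p" "C = Q j" using narrow_cuts_Q by auto
    have "Q j \<in> lonely_cuts V x (S i) (L i)" using C e j(3) by (auto simp: lonely_cuts_def)
    then have "j \<in> lon i" using j by (simp add: lon_def)
    moreover have "e = le i j" using C(2) j(3) by (simp add: le_def lonely_edge_def)
    ultimately show "e \<in> le i ` lon i" by blast
  qed
qed

text \<open>Equal edge sets would leave no edge around the layer between the two cuts. Injectivity
  allows sums over cuts to be reindexed by \<open>1..p\<close>.\<close>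

lemma Q_inj: "inj_on Q {1..p}"
proof -
  have False if ij: "1 \<le> i" "i < j" "j \<le> p" "Q i = Q j" for i j
  proof -
    let ?K = "Ui j - Ui i"
    obtain v where v: "v \<in> V" "lev v = i" using lev_ex[of i] ij by auto
    have "v \<in> ?K" using v ij by (auto simp: Ui_def)
    moreover have "s \<notin> ?K" using lev_s ij by (auto simp: Ui_def)
    ultimately have "?K \<noteq> {}" "?K \<subset> V" using Ui_sub[of j] sV by auto
    then have "1 \<le> xd ?K" using demand[of ?K] by (auto simp: demand_one split: if_splits)
    moreover have "cut_edges V (Ui i) \<inter> cut_edges V (Ui j) \<inter> E = Q i" using ij(4) by blast
    ultimately show False using cut_pair[of i j] ij by simp
  qed
  then show ?thesis by (intro inj_onI) (metis atLeastAtMost_iff linorder_neqE_nat)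
qed

lemma lonely_cuts_eq: "lonely_cuts V x (S i) (L i) = Q ` lon i"
proof
  show "Q ` lon i \<subseteq> lonely_cuts V x (S i) (L i)" by (auto simp: lon_def)
  show "lonely_cuts V x (S i) (L i) \<subseteq> Q ` lon i"
  proof
    fix C assume C: "C \<in> lonely_cuts V x (S i) (L i)"
    then have "C \<in> Q ` {1..p}" using narrow_cuts_Q by (auto simp: lonely_cuts_def)
    then show "C \<in> Q ` lon i" using C by (auto simp: lon_def)
  qed
qed

text \<open>Inside the tree, the join of \<open>u\<close> and \<open>v\<close> crosses each cut of
  \<open>X\<close> an even number of times, so it never uses the only tree edge of such a
  cut.\<close>

lemma layer_conn:
  assumes i: "i < n" and X: "X \<subseteq> lon i" and uv: "u \<in> V" "v \<in> V" "\<And>j. j \<in> X \<Longrightarrow> lev u < j \<longleftrightarrow> lev v < j"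
  shows "conn (S i - le i ` X) u v"
proof (cases "u = v")
  case False
  obtain J where J: "J \<subseteq> S i" "oddv V J = sym_diff {u} {v}"
    using join_in_conn[OF connS[OF i uv(1,2)] Svp[OF i] finS[OF i] uv(1)] by (elim exE conjE)
  have finJ: "finite J" using finite_subset[OF J(1) finS[OF i]] .
  have "le i j \<notin> J" if j: "j \<in> X" for j
  proof
    assume e: "le i j \<in> J"
    have jl: "j \<in> lon i" using X j by blast
    have Jc: "J \<inter> cut_edges V (Ui j) = {le i j}" using lonD[OF jl] e J(1) SE[OF i] by blast
    have "even (card (oddv V J \<inter> Ui j))"
      using J(2) uv False uv(3)[OF j] by (auto simp: Ui_def Int_insert_left)
    then have "even (card (J \<inter> cut_edges V (Ui j)))"
      using oddv_cut_parity[OF finJ subset_trans[OF J(1) Svp[OF i]] finV Ui_sub] by simp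
    then show False by (simp add: Jc)
  qed
  then have sub: "J \<subseteq> S i - le i ` X" using J(1) by auto
  have "conn J u v"
    by (rule conn_of_join[OF _ subset_trans[OF J(1) Svp[OF i]] finV]) (use J(2) False in auto)
  then show ?thesis by (rule conn_mono[OF _ sub])
qed simp

lemma F_eq: "i < n \<Longrightarrow> F i = S i - le i ` lon i" by (simp add: F_def Lle)

text \<open>Cut \<open>j\<close> alone separates the levels \<open>j - 1\<close> and
  \<open>j\<close>. If it is not lonely, deleting the lonely edges leaves vertices of these two
  levels connected, so \<open>F i\<close> crosses it.\<close>

lemma F_cut_empty:
  assumes i: "i < n" and j: "1 \<le> j" "j \<le> p" and e: "F i \<inter> Q j = {}"
  shows "j \<in> lon i"
proof (rule ccontr)
  assume nj: "j \<notin> lon i"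
  have jm: "j - 1 \<le> p" using j by simp
  obtain u where u: "u \<in> V" "lev u = j - 1" using lev_ex[OF jm] by (elim bexE)
  obtain v where v: "v \<in> V" "lev v = j" using lev_ex[OF j(2)] by (elim bexE)
  note uv = u v
  have "conn (F i) u v" unfolding F_eq[OF i]
  proof (rule layer_conn[OF i subset_refl uv(1,3)])
    fix j' assume "j' \<in> lon i"
    then have "j' \<noteq> j" using nj by auto
    then show "lev u < j' \<longleftrightarrow> lev v < j'" using uv(2,4) by auto
  qed
  then have "v \<in> {z. lev z < j}"
  proof (rule conn_closed)
    show "u \<in> {z. lev z < j}" using uv j by simp
    fix w z assume wz: "w \<in> {z. lev z < j}" "{w, z} \<in> F i"
    have "{w, z} \<in> E" using wz(2) SE[OF i] by (auto simp: F_def)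
    then show "z \<in> {z. lev z < j}" using e wz cut_Ui_iff[of "{w, z}" j] by (auto simp: not_less)
  qed
  then show False using uv by simp
qed

lemma lonely_F:
  assumes "j \<in> lon i" shows "F i \<inter> Q j = {}"
proof (rule equals0I)
  fix e assume e: "e \<in> F i \<inter> Q j"
  then have "e = le i j" by (intro leI[OF assms]) (simp_all add: F_def)
  then show False using e leL[OF assms] by (simp add: F_def)
qed

lemma path_props:
  assumes i: "i < n"
  shows "P i \<subseteq> S i" "oddv V (P i) = sym_diff {s} {t}"
  using tree_path_join[OF tc(2)[OF i] finV Evp sV tV] by (simp_all add: P_def)

lemma st_cut: "1 \<le> j \<Longrightarrow> j \<le> p \<Longrightarrow> s \<in> Ui j \<and> t \<notin> Ui j"
  using lev_s lev_t sV by (auto simp: Ui_def)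

lemma path_cut:
  assumes "i < n" "1 \<le> j" "j \<le> p"
  shows "P i \<inter> Q j \<noteq> {}"
proof
  assume e: "P i \<inter> Q j = {}"
  have PS: "P i \<subseteq> vpairs V" using path_props(1)[OF assms(1)] Svp[OF assms(1)] by blast
  have "P i \<inter> cut_edges V (Ui j) = {}" using e path_props(1)[OF assms(1)] SE[OF assms(1)] by blast
  then have "even (card (oddv V (P i) \<inter> Ui j))"
    using oddv_cut_parity[OF finite_subset[OF PS finvp] PS finV Ui_sub] by simp
  moreover have "oddv V (P i) \<inter> Ui j = {s}" using path_props(2)[OF assms(1)] st_cut[OF assms(2,3)] st by auto
  ultimately show False by simp
qed

definition evn :: "nat \<Rightarrow> nat \<Rightarrow> bool" where
  "evn i j \<longleftrightarrow> 2 \<le> card (Q j \<inter> F i) \<and> even (card (Q j \<inter> F i))"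

text \<open>Truncation at \<open>0\<close> encodes the condition
  \<open>x (Q) < 2 - 2 * bomd_gamma\<close> of \<open>y_vec\<close>, so that sums can range over all
  cuts.\<close>

definition gg :: "nat \<Rightarrow> real" where
  "gg j = max 0 (lambda j / 2 - bomd_gamma)"

definition lv :: "nat \<Rightarrow> 'a set \<Rightarrow> real" where
  "lv j e = lonely_vec V x n lam S L (Q j) e"

definition y :: "nat \<Rightarrow> 'a set \<Rightarrow> real" where
  "y i e = y_vec V s t x n lam S L i e"

lemma gg_nonneg: "0 \<le> gg j" by (simp add: gg_def)

lemma y_eq:
  "y i e = x e / 2 + bomd_gamma * of_bool (e \<in> P i) + (\<Sum>j\<in>lon i. gg j * of_bool (le i j = e))
    + (\<Sum>j\<in>{j \<in> {1..p}. evn i j}. gg j / lambda j * lv j e)"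
proof -
  have inj: "inj_on Q I" if "I \<subseteq> {1..p}" for I using inj_on_subset[OF Q_inj that] .
  have cond: "sum x (Q j) < 2 - 2 * bomd_gamma \<longleftrightarrow> 2 * bomd_gamma < lambda j"
    "1 - sum x (Q j) / 2 - bomd_gamma = lambda j / 2 - bomd_gamma" "2 - sum x (Q j) = lambda j" if "1 \<le> j" "j \<le> p" for j
    using sum_Q'[OF that] by (auto simp: field_simps)
  have A: "(\<Sum>C | C \<in> lonely_cuts V x (S i) (L i) \<and> sum x C < 2 - 2 * bomd_gamma.
      (1 - sum x C / 2 - bomd_gamma) * of_bool (lonely_edge (S i) C = e)) = (\<Sum>j\<in>lon i. gg j * of_bool (le i j = e))"
  proof -
    let ?I = "{j \<in> lon i. 2 * bomd_gamma < lambda j}"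
    have "{C. C \<in> lonely_cuts V x (S i) (L i) \<and> sum x C < 2 - 2 * bomd_gamma} = Q ` ?I"
      unfolding lonely_cuts_eq using cond(1) lon_range by auto
    moreover have "inj_on Q ?I" by (rule inj) (use lon_range in auto)
    ultimately have "(\<Sum>C | C \<in> lonely_cuts V x (S i) (L i) \<and> sum x C < 2 - 2 * bomd_gamma.
      (1 - sum x C / 2 - bomd_gamma) * of_bool (lonely_edge (S i) C = e))
      = (\<Sum>j\<in>?I. (1 - sum x (Q j) / 2 - bomd_gamma) * of_bool (lonely_edge (S i) (Q j) = e))" by (simp add: sum.reindex)
    also have "\<dots> = (\<Sum>j\<in>?I. gg j * of_bool (le i j = e))"
      by (rule sum.cong[OF refl]) (use cond(2) lon_range in \<open>auto simp: gg_def le_def\<close>)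
    also have "\<dots> = (\<Sum>j\<in>lon i. gg j * of_bool (le i j = e))"
      by (rule sum.mono_neutral_left[OF finlon]) (auto simp: gg_def not_less)
    finally show ?thesis .
  qed
  have B: "(\<Sum>C | C \<in> narrow_cuts V x \<and> sum x C < 2 - 2 * bomd_gamma \<and>
              2 \<le> card (C \<inter> (S i - L i)) \<and> even (card (C \<inter> (S i - L i))).
          (1 - sum x C / 2 - bomd_gamma) / (2 - sum x C) * lonely_vec V x n lam S L C e)
      = (\<Sum>j\<in>{j \<in> {1..p}. evn i j}. gg j / lambda j * lv j e)"
  proof -
    let ?I = "{j \<in> {1..p}. evn i j \<and> 2 * bomd_gamma < lambda j}"
    have "{C. C \<in> narrow_cuts V x \<and> sum x C < 2 - 2 * bomd_gamma \<and>
              2 \<le> card (C \<inter> (S i - L i)) \<and> even (card (C \<inter> (S i - L i)))} = Q ` ?I"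
      unfolding narrow_cuts_Q using cond(1) by (auto simp: evn_def F_def) 
    moreover have "inj_on Q ?I" by (rule inj) auto
    ultimately have "(\<Sum>C | C \<in> narrow_cuts V x \<and> sum x C < 2 - 2 * bomd_gamma \<and>
              2 \<le> card (C \<inter> (S i - L i)) \<and> even (card (C \<inter> (S i - L i))).
          (1 - sum x C / 2 - bomd_gamma) / (2 - sum x C) * lonely_vec V x n lam S L C e)
      = (\<Sum>j\<in>?I. (1 - sum x (Q j) / 2 - bomd_gamma) / (2 - sum x (Q j)) * lonely_vec V x n lam S L (Q j) e)"
      by (simp add: sum.reindex)
    also have "\<dots> = (\<Sum>j\<in>?I. gg j / lambda j * lv j e)"
      by (rule sum.cong[OF refl]) (use cond(2,3) in \<open>auto simp: gg_def lv_def\<close>)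
    also have "\<dots> = (\<Sum>j\<in>{j \<in> {1..p}. evn i j}. gg j / lambda j * lv j e)"
      by (rule sum.mono_neutral_left) (auto simp: gg_def not_less)
    finally show ?thesis .
  qed
  show ?thesis unfolding y_def y_vec_def A B P_def ..
qed

lemma lv_nonneg: "0 \<le> lv j e"
  unfolding lv_def lonely_vec_def by (rule sum_nonneg) (use tc(1) less_imp_le in auto)

lemma lv_eq: "lv j e = (\<Sum>i | i < n \<and> j \<in> lon i \<and> le i j = e. lam i)" if "1 \<le> j" "j \<le> p"
  using that by (simp add: lv_def lonely_vec_def lon_def le_def conj_commute)

lemma lv_sum: "1 \<le> j \<Longrightarrow> j \<le> p \<Longrightarrow> sum (lv j) (Q j) = lambda j"
proof -
  assume j: "1 \<le> j" "j \<le> p"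
  then have "Q j \<in> narrow_cuts V x" using narrow_cuts_Q by auto
  then have "sum (lonely_vec V x n lam S L (Q j)) (Q j) = 2 - sum x (Q j)" using lay by (auto simp: layered_combination_def)
  then show ?thesis using sum_Q'[OF j] by (simp add: lv_def)
qed

lemma lonely_weight: "1 \<le> j \<Longrightarrow> j \<le> p \<Longrightarrow> (\<Sum>i | i < n \<and> j \<in> lon i. lam i) = lambda j"
proof -
  assume j: "1 \<le> j" "j \<le> p"
  have finQ: "finite (Q j)" using finE by simp
  have "lambda j = (\<Sum>e\<in>Q j. \<Sum>i\<in>{i \<in> {i. i < n \<and> j \<in> lon i}. le i j = e}. lam i)"
    unfolding lv_sum[OF j, symmetric] using lv_eq[OF j] by (simp add: conj_assoc)
  also have "\<dots> = (\<Sum>i\<in>{i. i < n \<and> j \<in> lon i}. lam i)"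
  proof (rule sum.group)
    show "(\<lambda>i. le i j) ` {i. i < n \<and> j \<in> lon i} \<subseteq> Q j" using leQ by blast
  qed (use finQ in auto)
  finally show ?thesis by simp
qed

lemma y_terms:
  "0 \<le> bomd_gamma * of_bool (e \<in> P i)" "0 \<le> (\<Sum>j\<in>lon i. gg j * of_bool (le i j = e))"
  "0 \<le> (\<Sum>j\<in>{j \<in> {1..p}. evn i j}. gg j / lambda j * lv j e)"
  using gg_nonneg lv_nonneg less_imp_le[OF lambda_range(1)]
  by (auto simp: bomd_gamma_def intro!: sum_nonneg mult_nonneg_nonneg divide_nonneg_nonneg)

lemma y_ge_half: "x e / 2 \<le> y i e" unfolding y_eq using y_terms[where e = e and i = i] by linarith

lemma y_nonneg: "e \<in> E \<Longrightarrow> 0 \<le> y i e" using y_ge_half[of e i] xpos[of e] by linarith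

definition T :: "nat \<Rightarrow> 'a set" where
  "T i = sym_diff (oddv V (F i)) (sym_diff {s} {t})"

lemma F_sub: "i < n \<Longrightarrow> F i \<subseteq> E" using SE by (auto simp: F_def)

lemma finF: "i < n \<Longrightarrow> finite (F i)" using finite_subset[OF F_sub finE] .

lemma TV: "T i \<subseteq> V" using oddv_subset[of V "F i"] sV tV by (auto simp: T_def)

lemma T_parity:
  assumes i: "i < n" and U: "U \<subseteq> V"
  shows "odd (card (T i \<inter> U)) \<longleftrightarrow> (odd (card (F i \<inter> cut_edges V U)) \<noteq> ((s \<in> U) \<noteq> (t \<in> U)))"
proof -
  have fU: "finite U" using finite_subset[OF U finV] .
  have "T i \<inter> U = sym_diff (oddv V (F i) \<inter> U) ({s, t} \<inter> U)" using st by (auto simp: T_def)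
  then have "even (card (T i \<inter> U)) \<longleftrightarrow> (even (card (oddv V (F i) \<inter> U)) \<longleftrightarrow> even (card ({s, t} \<inter> U)))"
    using even_card_sym_diff[of "oddv V (F i) \<inter> U" "{s, t} \<inter> U"] fU by simp
  moreover have "even (card (oddv V (F i) \<inter> U)) \<longleftrightarrow> even (card (F i \<inter> cut_edges V U))"
    by (rule oddv_cut_parity[OF finF[OF i] subset_trans[OF F_sub[OF i] Evp] finV U])
  moreover have "odd (card ({s, t} \<inter> U)) \<longleftrightarrow> ((s \<in> U) \<noteq> (t \<in> U))"
    using card_inter_st[of U] by (auto simp: Int_commute)
  ultimately show ?thesis by blast
qed

lemma T_even: "i < n \<Longrightarrow> even (card (T i))"
proof -
  assume i: "i < n"
  have "T i \<inter> V = T i" using TV by auto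
  moreover have "cut_edges V V = {}" by (auto simp: cut_edges_def)
  ultimately show ?thesis using T_parity[OF i subset_refl] sV tV by simp
qed

text \<open>A cut of weight two is covered by \<open>x / 2\<close>. A narrow cut that is odd for
  \<open>T i\<close> meets \<open>F i\<close> in an even number of edges: if in none, it is lonely
  and its lonely edge carries \<open>gg j\<close>; otherwise the multiple of \<open>lv j\<close>, of
  total weight \<open>lambda j\<close> on the cut, supplies \<open>gg j\<close>. The path crosses
  every narrow cut and adds \<open>bomd_gamma\<close>.\<close>

lemma y_cut:
  assumes i: "i < n" and U: "U \<subseteq> V" "odd (card (T i \<inter> U))"
  shows "1 \<le> sum (y i) (cut_edges V U \<inter> E)"
proof (cases "2 \<le> xd U")
  case True
  have "1 \<le> xd U / 2" using True by simp
  also have "\<dots> = (\<Sum>e\<in>cut_edges V U \<inter> E. x e / 2)" using xd_supp[OF U(1)] by (simp add: sum_divide_distrib)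
  also have "\<dots> \<le> sum (y i) (cut_edges V U \<inter> E)" by (rule sum_mono) (rule y_ge_half)
  finally show ?thesis .
next
  case False
  have ne: "U \<noteq> {}" using U(2) by auto
  have neV: "U \<noteq> V"
  proof
    assume "U = V"
    then have "T i \<inter> U = T i" using TV by auto
    then show False using T_even[OF i] U(2) by simp
  qed
  have ps: "U \<subset> V" using neV U(1) by (rule psubsetI[rotated])
  have sep: "(s \<in> U) \<noteq> (t \<in> U)" using demand[OF ne ps] False unfolding demand_one by (metis (full_types))
  have "cut_edges V U \<inter> E \<in> narrow_cuts V x"
    unfolding narrow_cuts_def using ne neV U(1) False xd_supp[OF U(1)] by auto
  then obtain j where j: "1 \<le> j" "j \<le> p" "cut_edges V U \<inter> E = Q j" using narrow_cuts_Q by auto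
  have "F i \<inter> cut_edges V U = Q j \<inter> F i" using j(3) F_sub[OF i] by blast
  then have ev: "even (card (Q j \<inter> F i))" using T_parity[OF i U(1)] U(2) sep by simp
  have finQ: "finite (Q j)" using finE by simp
  have half: "(\<Sum>e\<in>Q j. x e / 2) = 1 - lambda j / 2" using sum_Q'[OF j(1,2)] by (simp add: sum_divide_distrib[symmetric])
  have path: "bomd_gamma \<le> (\<Sum>e\<in>Q j. bomd_gamma * of_bool (e \<in> P i))"
  proof -
    obtain e where e: "e \<in> P i" "e \<in> Q j" using path_cut[OF i j(1,2)] by blast
    have "bomd_gamma * of_bool (e \<in> P i) \<le> (\<Sum>e\<in>Q j. bomd_gamma * of_bool (e \<in> P i))"
      by (rule member_le_sum[OF e(2)]) (use finQ in \<open>auto simp: bomd_gamma_def\<close>)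
    then show ?thesis using e by simp
  qed
  let ?l = "\<Sum>e\<in>Q j. \<Sum>j'\<in>lon i. gg j' * of_bool (le i j' = e)"
  let ?v = "\<Sum>e\<in>Q j. \<Sum>j'\<in>{j' \<in> {1..p}. evn i j'}. gg j' / lambda j' * lv j' e"
  have ln: "0 \<le> ?l" "0 \<le> ?v" using y_terms(2,3) by (auto intro: sum_nonneg)
  have "gg j \<le> ?l + ?v"
  proof (cases "Q j \<inter> F i = {}")
    case True
    then have jl: "j \<in> lon i" using F_cut_empty[OF i j(1,2)] by (simp add: Int_commute)
    have eQ: "le i j \<in> Q j" by (rule leQ[OF jl])
    have "gg j * of_bool (le i j = le i j) \<le> (\<Sum>j'\<in>lon i. gg j' * of_bool (le i j' = le i j))"
      by (rule member_le_sum[OF jl]) (use gg_nonneg finlon in auto)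
    also have "\<dots> \<le> ?l" by (rule member_le_sum[OF eQ]) (use y_terms(2) finQ in auto)
    finally show ?thesis using ln by simp
  next
    case False
    then have "card (Q j \<inter> F i) \<noteq> 0" using finQ by simp
    then have "2 \<le> card (Q j \<inter> F i)" using ev by (cases "card (Q j \<inter> F i) = 1") simp_all
    then have je: "j \<in> {j' \<in> {1..p}. evn i j'}" using ev j by (simp add: evn_def)
    have "gg j = gg j / lambda j * sum (lv j) (Q j)" using lv_sum[OF j(1,2)] lambda_range(1)[of j] by simp
    also have "\<dots> = (\<Sum>e\<in>Q j. gg j / lambda j * lv j e)" by (simp add: sum_distrib_left)
    also have "\<dots> \<le> ?v"
    proof (rule sum_mono)
      fix e assume "e \<in> Q j"
      show "gg j / lambda j * lv j e \<le> (\<Sum>j'\<in>{j' \<in> {1..p}. evn i j'}. gg j' / lambda j' * lv j' e)"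
        by (rule member_le_sum[OF je]) (use gg_nonneg lv_nonneg less_imp_le[OF lambda_range(1)] in \<open>auto intro!: mult_nonneg_nonneg divide_nonneg_nonneg\<close>)
    qed
    finally show ?thesis using ln by simp
  qed
  moreover have "lambda j / 2 - bomd_gamma \<le> gg j" by (simp add: gg_def)
  ultimately show ?thesis unfolding j(3) y_eq sum.distrib using half path by linarith
qed

lemma joins_exist: "i < n \<Longrightarrow> \<exists>m mu J. m \<le> card E + 1 \<and> join_combination V E (T i) (y i) m mu J"
proof -
  assume i: "i < n"
  interpret tjoin V E "T i" by unfold_locales (use finV Evp TV in auto)
  show ?thesis
  proof (rule join_combination_exists)
    show "\<exists>J\<subseteq>E. oddv V J = T i" by (rule join_exists[OF finV Evp connE TV T_even[OF i]])
  qed (use y_nonneg y_cut[OF i] in auto)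
qed

text \<open>By layeredness, \<open>x\<^sup>Q\<close> vanishes on \<open>Q j\<close> whenever \<open>Q\<close> is not lonely for the tree but \<open>Q j\<close> is, so
  only \<open>x / 2\<close> contributes.\<close>

lemma y_double:
  assumes i: "i < n" and j: "j \<in> lon i" "j' \<in> lon i" "j < j'"
  shows "sum (y i) (Q j \<inter> Q j') \<le> 1/2 - (lambda j + lambda j') / 4"
proof -
  note r = lon_range[OF j(1)] lon_range[OF j(2)]
  have yx: "y i e = x e / 2" if e: "e \<in> Q j" "e \<in> Q j'" for e
  proof -
    have eS: "e \<notin> S i"
    proof
      assume "e \<in> S i"
      then have "e = le i j" using leI[OF j(1) e(1)] by simp
      then show False using le_only[OF i j(1,2)] e(2) j(3) by simp
    qed
    have "e \<notin> P i" using eS path_props(1)[OF i] by blast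
    moreover have "(\<Sum>k\<in>lon i. gg k * of_bool (le i k = e)) = 0"
      by (rule sum.neutral) (use leS eS in auto)
    moreover have "(\<Sum>k\<in>{k \<in> {1..p}. evn i k}. gg k / lambda k * lv k e) = 0"
    proof (rule sum.neutral, rule ballI)
      fix k assume k: "k \<in> {k \<in> {1..p}. evn i k}"
      then have kp: "1 \<le> k" "k \<le> p" by auto
      have kl: "k \<notin> lon i"
      proof
        assume "k \<in> lon i"
        then have "Q k \<inter> F i = {}" using lonely_F by blast
        then show False using k by (simp add: evn_def)
      qed
      have "{i'. i' < n \<and> k \<in> lon i' \<and> le i' k = e} = {}"
      proof (rule ccontr)
        assume "{i'. i' < n \<and> k \<in> lon i' \<and> le i' k = e} \<noteq> {}"
        then obtain i' where i': "i' < n" "k \<in> lon i'" "le i' k = e" by auto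
        have lti: "layered_tree V x (S i) (L i)" "layered_tree V x (S i') (L i')"
          using lay i i'(1) by (auto simp: layered_combination_def)
        have nar: "Q k \<in> narrow_cuts V x" "Q j \<in> narrow_cuts V x" using narrow_cuts_Q kp r by auto
        \<comment> \<open>Layeredness of tree \<open>i\<close> makes \<open>Q j\<close> the smaller
          cut; layeredness of tree \<open>i'\<close> then makes \<open>Q j\<close> lonely there too,
          and \<open>e\<close> would be the lonely edge of two cuts.\<close>
        have "\<not> sum x (Q k) \<le> sum x (Q j)"
        proof
          assume "sum x (Q k) \<le> sum x (Q j)"
          then have "Q k \<in> lonely_cuts V x (S i) (L i)" using lti(1) nar j(1) unfolding layered_tree_def lon_def by blast
          then show False using kl kp by (simp add: lon_def)
        qed
        then have "Q j \<in> lonely_cuts V x (S i') (L i')" using lti(2) nar i'(2) unfolding layered_tree_def lon_def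
          by (metis (no_types, lifting) linear mem_Collect_eq)
        then have jl: "j \<in> lon i'" using r by (simp add: lon_def)
        then have "k = j" using le_only[OF i'(1,2) jl] i'(3) e(1) by simp
        then show False using kl j(1) by simp
      qed
      then have "lv k e = 0" unfolding lv_eq[OF kp] by (simp only: sum.empty)
      then show "gg k / lambda k * lv k e = 0" by simp
    qed
    ultimately show ?thesis by (simp add: y_eq)
  qed
  let ?K = "Ui j' - Ui j"
  have "2 \<le> xd ?K"
  proof -
    obtain v where v: "v \<in> V" "lev v = j" using lev_ex[of j] r by auto
    have "v \<in> ?K" using v j(3) by (auto simp: Ui_def)
    moreover have "s \<notin> ?K" "t \<notin> ?K" using st_cut r by auto
    ultimately have "?K \<noteq> {}" "?K \<subset> V" using Ui_sub[of j'] sV by auto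
    then show ?thesis using demand[of ?K] \<open>s \<notin> ?K\<close> \<open>t \<notin> ?K\<close> unfolding demand_one by presburger
  qed
  moreover have "cut_edges V (Ui j) \<inter> cut_edges V (Ui j') \<inter> E = Q j \<inter> Q j'" by auto
  ultimately have "sum x (Q j \<inter> Q j') \<le> 1 - (lambda j + lambda j') / 2"
    using cut_pair[OF j(3)] r sum_Q'[of j] sum_Q'[of j'] by (simp add: field_simps)
  moreover have "sum (y i) (Q j \<inter> Q j') = sum x (Q j \<inter> Q j') / 2"
    unfolding sum_divide_distrib by (rule sum.cong[OF refl]) (rule yx, blast+)
  ultimately show ?thesis by simp
qed

end

section \<open>Reconnection\<close>

context layered_lp
begin

text \<open>\<open>F i\<close> misses a lonely cut, and this cut separates \<open>s\<close> from
  \<open>t\<close>, so it is odd for \<open>T i\<close>.\<close>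

lemma join_crosses:
  assumes i: "i < n" and J: "J \<subseteq> E" "oddv V J = T i" and h: "h \<in> lon i"
  shows "J \<inter> Q h \<noteq> {}"
proof
  assume e: "J \<inter> Q h = {}"
  have JV: "J \<subseteq> vpairs V" using J(1) Evp by (rule subset_trans)
  have "J \<inter> cut_edges V (Ui h) = {}" using e J(1) by blast
  then have "even (card (T i \<inter> Ui h))"
    using oddv_cut_parity[OF finite_subset[OF J(1) finE] JV finV Ui_sub[of h]] J(2) by simp
  moreover have "F i \<inter> cut_edges V (Ui h) = {}" using lonely_F[OF h] F_sub[OF i] by blast
  ultimately show False using T_parity[OF i Ui_sub[of h]] st_cut[of h] lon_range[OF h] by simp
qed

text \<open>A component not containing \<open>s\<close> is charged to the last cut \<open>h\<close> of \<open>X\<close> below its lowest vertex: the join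
  has an edge in \<open>Q h\<close>, and were its upper end in the layer following \<open>h\<close>, it would be connected to the
  component and the lower end would be a lower vertex.\<close>

lemma components_le:
  assumes i: "i < n" and J: "J \<subseteq> E" "oddv V J = T i" and X: "X \<subseteq> lon i"
  shows "ncomp V (F i \<union> J \<union> le i ` (lon i - X))
    \<le> Suc (card {h \<in> {h \<in> X. \<exists>k\<in>X. h < k}. J \<inter> (Q h \<inter> Q (succ_in X h)) \<noteq> {}})"
proof -
  let ?H = "F i \<union> J \<union> le i ` (lon i - X)"
  let ?B = "{h \<in> {h \<in> X. \<exists>k\<in>X. h < k}. J \<inter> (Q h \<inter> Q (succ_in X h)) \<noteq> {}}"
  have finX: "finite X" using X finlon by (rule finite_subset)
  have SH: "S i - le i ` X \<subseteq> ?H" unfolding F_def Lle[OF i] by blast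
  have HE: "?H \<subseteq> E" using F_sub[OF i] J(1) leS SE[OF i] by blast
  have lc: "conn ?H u v" if "u \<in> V" "v \<in> V" "\<And>j. j \<in> X \<Longrightarrow> lev u < j \<longleftrightarrow> lev v < j" for u v
    by (rule conn_mono[OF layer_conn[OF i X that] SH])
  \<comment> \<open>\<open>?r Z h\<close> says that \<open>Z\<close> meets the layer directly above
    \<open>h\<close>. A layer is connected, so no cut is charged by two components.\<close>
  let ?r = "\<lambda>Z h. \<exists>v\<in>Z. h \<in> X \<and> h \<le> lev v \<and> (\<forall>k\<in>X. k \<le> lev v \<longrightarrow> k \<le> h)"
  have "card (contracted_verts V ?H - {vcomp V ?H s}) \<le> card ?B"
  proof (rule card_le_if_inj_on_rel[where r = ?r])
    show "finite ?B" using finX by simp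
  next
    fix Z assume "Z \<in> contracted_verts V ?H - {vcomp V ?H s}"
    then obtain u where u: "u \<in> V" "Z = vcomp V ?H u" "vcomp V ?H u \<noteq> vcomp V ?H s" by (auto simp: contracted_verts_def)
    have "u \<in> Z" using u by (simp add: vcomp_def)
    then obtain v where v: "v \<in> Z" "\<And>w. w \<in> Z \<Longrightarrow> lev v \<le> lev w"
      using ex_has_least_nat[of "\<lambda>w. w \<in> Z" u lev] by blast
    have vV: "v \<in> V" and uv: "conn ?H u v" using v(1) u(2) by (simp_all add: vcomp_def)
    let ?K = "{k \<in> X. k \<le> lev v}"
    have "?K \<noteq> {}"
    proof
      assume k: "?K = {}"
      have "conn ?H s v" by (rule lc[OF sV vV]) (use k lev_s in auto)
      then have "conn ?H u s" by (rule conn_trans[OF uv conn_sym])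
      then show False using u(3) vcomp_eq_iff[OF sV, of ?H u] by (simp only: simp_thms)
    qed
    moreover have finK: "finite ?K" using finX by simp
    ultimately have hK: "Max ?K \<in> ?K" by (rule Max_in[rotated])
    define h where "h = Max ?K"
    have h: "h \<in> X" "h \<le> lev v" "\<And>k. k \<in> X \<Longrightarrow> k \<le> lev v \<Longrightarrow> k \<le> h"
      using hK Max_ge[OF finK] by (auto simp: h_def)
    have "J \<inter> Q h \<noteq> {}" by (rule join_crosses[OF i J subsetD[OF X h(1)]])
    then obtain e where e: "e \<in> J" "e \<in> Q h" by (meson disjoint_iff)
    have eE: "e \<in> E" using e(1) J(1) by blast
    then obtain a b where ab: "e = {a, b}" "a \<in> V" "b \<in> V" "lev a < h" "h \<le> lev b"
    proof -
      obtain a b where ab: "e = {a, b}" "a \<in> V" "b \<in> V" using eE Evp by (meson subsetD vpairsD)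
      have "(lev a < h \<and> h \<le> lev b) \<or> (lev b < h \<and> h \<le> lev a)"
        using cut_Ui_iff[OF eE, of h] e(2) ab(1) by auto
      then show thesis using ab that[of a b] that[of b a] by (auto simp: insert_commute)
    qed
    have ba: "conn ?H b a" by (rule conn_edge) (use e(1) ab(1) in \<open>simp add: insert_commute\<close>)
    have "\<exists>k\<in>X. lev v < k \<and> k \<le> lev b"
    proof (rule ccontr)
      assume n: "\<not> (\<exists>k\<in>X. lev v < k \<and> k \<le> lev b)"
      have "conn ?H v b"
      proof (rule lc[OF vV ab(3)])
        fix j assume j: "j \<in> X"
        show "lev v < j \<longleftrightarrow> lev b < j" using n j h(3)[OF j] ab(5) by force
      qed
      then have "conn ?H u a" by (rule conn_trans[OF uv conn_trans[OF _ ba]])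
      then have "a \<in> Z" using ab(2) u(2) by (simp add: vcomp_def)
      then show False using v(2)[of a] ab(4) h(2) by simp
    qed
    then obtain k where k: "k \<in> X" "lev v < k" "k \<le> lev b" by blast
    have hk: "h < k" using h(2) k(2) by simp
    note sc = succ_in[OF finX k(1) hk]
    have "e \<in> cut_edges V (Ui (succ_in X h))"
      unfolding cut_Ui_iff[OF eE] using ab sc k by (auto intro!: bexI[of _ a] bexI[of _ b])
    then have "e \<in> J \<inter> (Q h \<inter> Q (succ_in X h))" using e eE by simp
    then have "h \<in> ?B" using h(1) k(1) hk by blast
    then show "\<exists>h. h \<in> ?B \<and> ?r Z h" using v(1) h by blast
  next
    fix Z Z' h assume Z: "Z \<in> contracted_verts V ?H - {vcomp V ?H s}" "Z' \<in> contracted_verts V ?H - {vcomp V ?H s}"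
      and r: "?r Z h" "?r Z' h"
    obtain u u' where u: "u \<in> V" "Z = vcomp V ?H u" "u' \<in> V" "Z' = vcomp V ?H u'"
      using Z by (auto simp: contracted_verts_def)
    obtain v where v: "v \<in> Z" "h \<le> lev v" "\<forall>k\<in>X. k \<le> lev v \<longrightarrow> k \<le> h" using r(1) by blast
    obtain v' where v': "v' \<in> Z'" "h \<le> lev v'" "\<forall>k\<in>X. k \<le> lev v' \<longrightarrow> k \<le> h" using r(2) by blast
    have c: "v \<in> V" "conn ?H u v" "v' \<in> V" "conn ?H u' v'" using v(1) v'(1) u by (simp_all add: vcomp_def)
    have "conn ?H v v'"
    proof (rule lc[OF c(1,3)])
      fix j assume j: "j \<in> X"
      show "lev v < j \<longleftrightarrow> lev v' < j" using v(2,3) v'(2,3) j by force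
    qed
    then have "conn ?H u u'" by (rule conn_trans[OF c(2) conn_trans[OF _ conn_sym[OF c(4)]]])
    then show "Z = Z'" unfolding u(2,4) by (simp only: vcomp_eq_iff[OF u(3), of ?H u])
  qed
  moreover have "card (contracted_verts V ?H) = Suc (card (contracted_verts V ?H - {vcomp V ?H s}))"
    by (rule card.remove) (use finite_contracted_verts[OF finV] sV in \<open>auto simp: contracted_verts_def\<close>)
  ultimately show ?thesis by (simp add: ncomp_def)
qed

text \<open>Kruskal's algorithm on the lonely edges: the chosen edges dearer than \<open>r\<close>
  are as many as the components left by the cheaper ones, minus one. \<open>components_le\<close>
  bounds this, with the cuts of the dearer edges as \<open>X\<close>.\<close>

lemma reconnecting_edges:
  fixes c :: "'a set \<Rightarrow> real"
  assumes i: "i < n" and J: "J \<subseteq> E" "oddv V J = T i"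
  shows "\<exists>R\<subseteq>lon i. (\<forall>u\<in>V. \<forall>v\<in>V. conn (F i \<union> J \<union> le i ` R) u v) \<and>
    (\<forall>r. let X = {h \<in> lon i. r < c (le i h)} in
      card {h \<in> R. r < c (le i h)} \<le> card {h \<in> {h \<in> X. \<exists>k\<in>X. h < k}. J \<inter> (Q h \<inter> Q (succ_in X h)) \<noteq> {}})"
proof -
  let ?f = "\<lambda>A. int (ncomp V (F i \<union> J \<union> A))"
  have finL: "finite (L i)" using finlon by (simp add: Lle[OF i])
  have ins: "F i \<union> J \<union> insert e A = insert e (F i \<union> J \<union> A)" for e A by blast
  have LV: "L i \<subseteq> vpairs V" using LS[OF i] Svp[OF i] by blast
  have key: "conn (F i \<union> J \<union> A) a b \<and> ?f (insert {a, b} A) = ?f A \<or>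
      \<not> conn (F i \<union> J \<union> A) a b \<and> ?f (insert {a, b} A) = ?f A - 1" if "a \<in> V" "b \<in> V" for a b A
  proof (cases "conn (F i \<union> J \<union> A) a b")
    case True
    then show ?thesis unfolding ins using ncomp_insert_conn[OF finV True] by simp
  next
    case False
    then show ?thesis unfolding ins using ncomp_insert_nconn[OF finV False that] by simp
  qed
  have "\<exists>R\<subseteq>L i. ?f R = ?f (L i) \<and>
    (\<forall>X\<subseteq>L i. (\<forall>e\<in>X. \<forall>e'\<in>L i. - c e \<le> - c e' \<longrightarrow> e' \<in> X) \<longrightarrow> int (card (R \<inter> X)) = ?f {} - ?f X)"
  proof (rule greedy_basis[OF finL])
    fix e A assume "e \<in> L i" "A \<subseteq> L i"
    then obtain a b where ab: "e = {a, b}" "a \<in> V" "b \<in> V" using LV by (meson subsetD vpairsD)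
    show "?f (insert e A) = ?f A \<or> ?f (insert e A) = ?f A - 1" unfolding ab(1) using key[OF ab(2,3)] by metis
  next
    fix e A B assume a: "e \<in> L i" "A \<subseteq> B" "B \<subseteq> L i" "?f (insert e A) = ?f A"
    obtain a b where ab: "e = {a, b}" "a \<in> V" "b \<in> V" using a(1) LV by (meson subsetD vpairsD)
    have "conn (F i \<union> J \<union> A) a b" using key[OF ab(2,3), of A] a(4) unfolding ab(1) by linarith
    then have "conn (F i \<union> J \<union> B) a b" by (rule conn_mono) (use a(2) in blast)
    then show "?f (insert e B) = ?f B" using key[OF ab(2,3), of B] unfolding ab(1) by blast
  qed
  then obtain R where R: "R \<subseteq> L i" "?f R = ?f (L i)"
    "\<And>X. X \<subseteq> L i \<Longrightarrow> \<forall>e\<in>X. \<forall>e'\<in>L i. - c e \<le> - c e' \<longrightarrow> e' \<in> X \<Longrightarrow> int (card (R \<inter> X)) = ?f {} - ?f X" by blast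
  have "ncomp V (F i \<union> J \<union> L i) = 1"
  proof (rule conn_ncomp_eq1)
    fix u v assume "u \<in> V" "v \<in> V"
    from connS[OF i this] show "conn (F i \<union> J \<union> L i) u v" by (rule conn_mono) (auto simp: F_def)
  qed (use sV in auto)
  then have f1: "?f (L i) = 1" by simp
  then have conR: "conn (F i \<union> J \<union> R) u v" if "u \<in> V" "v \<in> V" for u v
    using ncomp_eq1_conn[OF finV _ that, of "F i \<union> J \<union> R"] R(2) by simp
  let ?R = "{h \<in> lon i. le i h \<in> R}"
  have RR: "le i ` ?R = R" using R(1) unfolding Lle[OF i] by blast
  have finR: "finite R" using finite_subset[OF R(1) finL] .
  show ?thesis
  proof (rule exI[of _ ?R], intro conjI allI)
    show "?R \<subseteq> lon i" by blast
    show "\<forall>u\<in>V. \<forall>v\<in>V. conn (F i \<union> J \<union> le i ` ?R) u v" unfolding RR using conR by blast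
    fix r
    define X where "X = {h \<in> lon i. r < c (le i h)}"
    have XL: "X \<subseteq> lon i" by (auto simp: X_def)
    let ?X0 = "le i ` (lon i - X)"
    have "?X0 = {e \<in> L i. c e \<le> r}" unfolding Lle[OF i] X_def by auto
    then have "int (card (R \<inter> {e \<in> L i. c e \<le> r})) = ?f {} - ?f ?X0" using R(3)[of ?X0] by auto
    moreover have "int (card R) = ?f {} - 1" using R(3)[of "L i"] R(1) f1 by (simp add: Int_absorb2)
    moreover have "card R = card (R \<inter> {e \<in> L i. c e \<le> r}) + card {e \<in> R. r < c e}"
    proof -
      have "R = (R \<inter> {e \<in> L i. c e \<le> r}) \<union> {e \<in> R. r < c e}" using R(1) by auto
      moreover have "card ((R \<inter> {e \<in> L i. c e \<le> r}) \<union> {e \<in> R. r < c e}) = card (R \<inter> {e \<in> L i. c e \<le> r}) + card {e \<in> R. r < c e}"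
        by (rule card_Un_disjoint) (use finR in auto)
      ultimately show ?thesis by simp
    qed
    moreover have "card {e \<in> R. r < c e} = card {h \<in> ?R. r < c (le i h)}"
    proof -
      have "{e \<in> R. r < c e} = le i ` {h \<in> ?R. r < c (le i h)}" using R(1) unfolding Lle[OF i] by blast
      moreover have "inj_on (le i) {h \<in> ?R. r < c (le i h)}" by (rule inj_on_subset[OF inj_le[OF i]]) auto
      ultimately show ?thesis by (simp add: card_image)
    qed
    ultimately have "Suc (card {h \<in> ?R. r < c (le i h)}) = ncomp V (F i \<union> J \<union> ?X0)" by linarith
    then show "let X = {h \<in> lon i. r < c (le i h)} in
      card {h \<in> ?R. r < c (le i h)} \<le> card {h \<in> {h \<in> X. \<exists>k\<in>X. h < k}. J \<inter> (Q h \<inter> Q (succ_in X h)) \<noteq> {}}"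
      using components_le[OF i J XL] unfolding Let_def X_def[symmetric] by simp
  qed
qed

text \<open>Any connecting set of lonely edges bounds the minimum spanning tree. \<open>?q h\<close>
  is the probability that the lonely edge of \<open>h\<close> is bought back, to be compared with
  \<open>1/2 - lambda h / 2\<close>.\<close>

lemma reconnection_cost:
  fixes c :: "'a set \<Rightarrow> real"
  assumes i: "i < n" and c: "\<And>e. e \<in> E \<Longrightarrow> 0 \<le> c e"
    and jc: "join_combination V E (T i) (y i) m mu J"
    and D: "\<And>j. j < m \<Longrightarrow> is_min_spanning_tree (contracted_verts V (F i \<union> J j)) (contracted_ends V (F i \<union> J j)) E c (D j)"
  shows "(\<Sum>j<m. mu j * sum c (D j)) \<le> (\<Sum>h\<in>lon i. (1/2 - lambda h / 2) * c (le i h))"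
proof -
  interpret tjoin V E "T i" by unfold_locales (use finV Evp TV in auto)
  have mu: "0 < mu j" "J j \<subseteq> E" "oddv V (J j) = T i" if "j < m" for j
    using jc that is_join_iff by (auto simp: join_combination_def)
  have Jy: "(\<Sum>j<m. mu j * of_bool (e \<in> J j)) \<le> y i e" if "e \<in> E" for e
    using jc that by (auto simp: join_combination_def)
  define X where "X r = {h \<in> lon i. r < c (le i h)}" for r
  define B where "B r = {h \<in> X r. \<exists>k\<in>X r. h < k}" for r
  define W where "W r h = Q h \<inter> Q (succ_in (X r) h)" for r h
  define G where "G j R \<longleftrightarrow> R \<subseteq> lon i \<and> (\<forall>u\<in>V. \<forall>v\<in>V. conn (F i \<union> J j \<union> le i ` R) u v) \<and>
      (\<forall>r. card {h \<in> R. r < c (le i h)} \<le> card {h \<in> B r. J j \<inter> W r h \<noteq> {}})" for j R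
  have "\<exists>R. G j R" if "j < m" for j
    using reconnecting_edges[OF i mu(2,3)[OF that], of c]
    unfolding G_def Let_def X_def[symmetric] B_def[symmetric] W_def[symmetric] .
  then have "\<forall>j. \<exists>R. j < m \<longrightarrow> G j R" by blast
  then obtain R where "\<forall>j. j < m \<longrightarrow> G j (R j)" by (rule choice[THEN exE])
  then have R: "R j \<subseteq> lon i" "\<And>u v. u \<in> V \<Longrightarrow> v \<in> V \<Longrightarrow> conn (F i \<union> J j \<union> le i ` R j) u v"
    "\<And>r. card {h \<in> R j. r < c (le i h)} \<le> card {h \<in> B r. J j \<inter> W r h \<noteq> {}}" if "j < m" for j
    using that by (simp_all add: G_def)
  have leE: "le i h \<in> E" if "h \<in> lon i" for h using leS[OF that] SE[OF i] by blast
  have DR: "sum c (D j) \<le> (\<Sum>h\<in>R j. c (le i h))" if j: "j < m" for j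
  proof -
    let ?A = "le i ` R j"
    have finR: "finite (R j)" using finite_subset[OF R(1)[OF j] finlon] .
    have AE: "?A \<subseteq> E" using R(1)[OF j] leE by blast
    have HE: "F i \<union> J j \<subseteq> E" using F_sub[OF i] mu(2)[OF j] by blast
    have "mg_connected (contracted_verts V (F i \<union> J j)) (contracted_ends V (F i \<union> J j)) ?A"
      using contracted_connected_iff[of "F i \<union> J j" V ?A] R(2)[OF j] subset_trans[OF AE Evp] subset_trans[OF HE Evp] by blast
    then obtain D' where D': "D' \<subseteq> ?A" "is_spanning_tree (contracted_verts V (F i \<union> J j)) (contracted_ends V (F i \<union> J j)) E D'"
      using connected_contains_tree[OF finite_imageI[OF finR] AE] by blast
    have "sum c (D j) \<le> sum c D'" using D[OF j] D'(2) by (simp add: is_min_spanning_tree_def)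
    also have "\<dots> \<le> sum c ?A" by (rule sum_mono2) (use finR D'(1) AE c in auto)
    also have "\<dots> = (\<Sum>h\<in>R j. c (le i h))"
      by (simp add: sum.reindex[OF inj_on_subset[OF inj_le[OF i] R(1)[OF j]]])
    finally show ?thesis .
  qed
  let ?q = "\<lambda>h. \<Sum>j<m. mu j * of_bool (h \<in> R j)"
  have "(\<Sum>j<m. mu j * sum c (D j)) \<le> (\<Sum>j<m. mu j * (\<Sum>h\<in>R j. c (le i h)))"
    by (rule sum_mono) (use DR mu(1) in \<open>auto intro!: mult_left_mono less_imp_le\<close>)
  also have "\<dots> = (\<Sum>j<m. \<Sum>h\<in>lon i. mu j * of_bool (h \<in> R j) * c (le i h))"
  proof (rule sum.cong[OF refl])
    fix j assume j: "j \<in> {..<m}"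
    have "(\<Sum>h\<in>R j. c (le i h)) = (\<Sum>h\<in>lon i. of_bool (h \<in> R j) * c (le i h))"
      by (rule sum.mono_neutral_cong_left[OF finlon]) (use R(1) j in auto)
    then show "mu j * (\<Sum>h\<in>R j. c (le i h)) = (\<Sum>h\<in>lon i. mu j * of_bool (h \<in> R j) * c (le i h))"
      by (simp add: sum_distrib_left mult.assoc)
  qed
  also have "\<dots> = (\<Sum>h\<in>lon i. ?q h * c (le i h))" by (subst sum.swap) (simp only: sum_distrib_right)
  finally have a: "(\<Sum>j<m. mu j * sum c (D j)) \<le> (\<Sum>h\<in>lon i. ?q h * c (le i h))" .
  \<comment> \<open>The comparison is made only in sum over the edges dearer than \<open>r\<close>,
    for every \<open>r\<close>: there the join edges in two consecutive cuts are counted, and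
    \<open>y_double\<close> and \<open>succ_sum_le\<close> bound their average number.\<close>
  have "0 \<le> (\<Sum>h\<in>lon i. (1/2 - lambda h / 2 - ?q h) * c (le i h))"
  proof (rule layer_cake_nonneg[OF finlon])
    fix h assume "h \<in> lon i" then show "0 \<le> c (le i h)" using c leE by blast
  next
    fix r :: real
    have XL: "X r \<subseteq> lon i" by (auto simp: X_def)
    have finX: "finite (X r)" using finite_subset[OF XL finlon] .
    have finB: "finite (B r)" using finX by (simp add: B_def)
    have "sum ?q (X r) = (\<Sum>j<m. mu j * (\<Sum>h\<in>X r. of_bool (h \<in> R j)))"
      by (subst sum.swap) (simp add: sum_distrib_left)
    also have "\<dots> \<le> (\<Sum>j<m. mu j * (\<Sum>h\<in>B r. \<Sum>e\<in>W r h. of_bool (e \<in> J j)))"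
    proof (rule sum_mono)
      fix j assume j: "j \<in> {..<m}"
      have "(\<Sum>h\<in>X r. of_bool (h \<in> R j)) = real (card {h \<in> R j. r < c (le i h)})"
      proof -
        have "X r \<inter> R j = {h \<in> R j. r < c (le i h)}" using R(1) j by (auto simp: X_def)
        then show ?thesis using finX by (simp add: of_bool_def sum.If_cases Int_def)
      qed
      also have "\<dots> \<le> real (card {h \<in> B r. J j \<inter> W r h \<noteq> {}})" using R(3)[of j r] j by simp
      also have "\<dots> = (\<Sum>h\<in>B r. of_bool (J j \<inter> W r h \<noteq> {}))"
        using finB by (simp add: of_bool_def sum.If_cases Int_def)
      also have "\<dots> \<le> (\<Sum>h\<in>B r. \<Sum>e\<in>W r h. of_bool (e \<in> J j))"
      proof (rule sum_mono)
        fix h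
        have finO: "finite (W r h)" using finE by (simp add: W_def)
        show "of_bool (J j \<inter> W r h \<noteq> {}) \<le> (\<Sum>e\<in>W r h. of_bool (e \<in> J j) :: real)"
        proof (cases "J j \<inter> W r h = {}")
          case False
          then obtain e where e: "e \<in> J j" "e \<in> W r h" by blast
          have "of_bool (e \<in> J j) \<le> (\<Sum>e\<in>W r h. of_bool (e \<in> J j) :: real)"
            by (rule member_le_sum[OF e(2)]) (use finO in auto)
          then show ?thesis using e by simp
        qed (simp add: sum_nonneg)
      qed
      finally show "mu j * (\<Sum>h\<in>X r. of_bool (h \<in> R j)) \<le> mu j * (\<Sum>h\<in>B r. \<Sum>e\<in>W r h. of_bool (e \<in> J j))"
        using mu(1)[of j] j by (auto intro!: mult_left_mono less_imp_le)
    qed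
    also have "\<dots> = (\<Sum>h\<in>B r. \<Sum>e\<in>W r h. \<Sum>j<m. mu j * of_bool (e \<in> J j))"
    proof -
      have "(\<Sum>j<m. mu j * (\<Sum>h\<in>B r. \<Sum>e\<in>W r h. of_bool (e \<in> J j))) = (\<Sum>j<m. \<Sum>h\<in>B r. \<Sum>e\<in>W r h. mu j * of_bool (e \<in> J j))"
        by (simp only: sum_distrib_left)
      also have "\<dots> = (\<Sum>h\<in>B r. \<Sum>j<m. \<Sum>e\<in>W r h. mu j * of_bool (e \<in> J j))" by (rule sum.swap)
      also have "\<dots> = (\<Sum>h\<in>B r. \<Sum>e\<in>W r h. \<Sum>j<m. mu j * of_bool (e \<in> J j))" by (rule sum.cong[OF refl]) (rule sum.swap)
      finally show ?thesis .
    qed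
    also have "\<dots> \<le> (\<Sum>h\<in>B r. sum (y i) (W r h))"
      by (intro sum_mono Jy) (auto simp: W_def)
    also have "\<dots> \<le> (\<Sum>h\<in>B r. 1/2 - (lambda h + lambda (succ_in (X r) h)) / 4)"
    proof (rule sum_mono)
      fix h assume "h \<in> B r"
      then obtain k where k: "h \<in> X r" "k \<in> X r" "h < k" by (auto simp: B_def)
      note sc = succ_in[OF finX k(2,3)]
      show "sum (y i) (W r h) \<le> 1/2 - (lambda h + lambda (succ_in (X r) h)) / 4"
        unfolding W_def by (rule y_double[OF i _ _ sc(2)]) (use XL k(1) sc(1) in auto)
    qed
    also have "\<dots> \<le> (\<Sum>h\<in>X r. 1/2 - lambda h / 2)"
      unfolding B_def by (rule succ_sum_le[OF finX lambda_range(2)])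
    finally have "0 \<le> (\<Sum>h\<in>X r. 1/2 - lambda h / 2) - sum ?q (X r)" by simp
    then show "0 \<le> (\<Sum>h\<in>{h \<in> lon i. r < c (le i h)}. 1/2 - lambda h / 2 - ?q h)"
      unfolding X_def[symmetric] sum_subtractf .
  qed
  then have "(\<Sum>h\<in>lon i. ?q h * c (le i h)) \<le> (\<Sum>h\<in>lon i. (1/2 - lambda h / 2) * c (le i h))"
    by (simp add: left_diff_distrib sum_subtractf)
  then show ?thesis using a by linarith
qed

end

section \<open>Tour costs\<close>

lemma ex_min_real:
  fixes f :: "'b \<Rightarrow> real"
  assumes "finite A" "A \<noteq> {}"
  shows "\<exists>a\<in>A. \<forall>b\<in>A. f a \<le> f b"
proof -
  have "Min (f ` A) \<in> f ` A" using assms by simp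
  then obtain a where "a \<in> A" "f a = Min (f ` A)" by auto
  then show ?thesis using assms by (intro bexI[of _ a]) auto
qed

lemma odd_verts_add: "odd_verts V (A + B) = sym_diff (odd_verts V A) (odd_verts V B)"
  by (auto simp: odd_verts_def)

lemma repeat_mset_two: "repeat_mset 2 M = M + M"
  by (rule multiset_eqI) simp

lemma tour_cost_add: "tour_cost c (A + B) = tour_cost c A + tour_cost c B"
  by (simp add: tour_cost_def)

lemma tour_cost_mset_set: "tour_cost c (mset_set A) = sum c A"
  by (simp add: tour_cost_def sum_unfold_sum_mset)

context layered_lp
begin

abbreviation candidate :: "nat \<Rightarrow> 'a set set \<Rightarrow> 'a set set \<Rightarrow> 'a set multiset" where
  "candidate i J D \<equiv> mset_set (F i) + mset_set J + repeat_mset 2 (mset_set D)"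

abbreviation "contracted_mst c i J D \<equiv>
  is_min_spanning_tree (contracted_verts V (F i \<union> J)) (contracted_ends V (F i \<union> J)) E c D"

lemma tour_cost_candidate: "tour_cost c (candidate i J D) = sum c (F i) + sum c J + 2 * sum c D"
  by (simp add: repeat_mset_two tour_cost_add tour_cost_mset_set)

lemma y_vec_eq: "y_vec V s t x n lam S L i = y i"
  by (rule ext) (simp add: y_def)

lemma bomd_first_iff:
  assumes "i < n"
  shows "bomd_first k V s t c x n lam S L i R \<longleftrightarrow> (\<exists>m mu J D. m \<le> k \<and> join_combination V E (T i) (y i) m mu J \<and>
    (\<forall>j<m. contracted_mst c i (J j) (D j)) \<and>
    (\<exists>j<m. R = candidate i (J j) (D j) \<and>
      (\<forall>j'<m. tour_cost c (candidate i (J j) (D j)) \<le> tour_cost c (candidate i (J j') (D j')))))"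
  unfolding bomd_first_def Let_def F_def[symmetric] y_vec_eq odd_verts_mset_set[OF finF[OF assms]] T_def[symmetric] ..

lemma is_join_oddv: "is_join V E A J \<longleftrightarrow> J \<subseteq> E \<and> oddv V J = A"
proof -
  have "odd_verts V (mset_set J) = oddv V J" if "J \<subseteq> E"
    by (rule odd_verts_mset_set[OF finite_subset[OF that finE]])
  then show ?thesis unfolding is_join_def by metis
qed

lemma candidate_tour:
  assumes i: "i < n" and J: "is_join V E (T i) J" and D: "contracted_mst c i J D"
  shows "is_tour V s t (candidate i J D)"
proof -
  have JE: "J \<subseteq> E" and oJ: "oddv V J = T i" using J by (simp_all add: is_join_oddv)
  have DE: "D \<subseteq> E" using D by (simp add: is_min_spanning_tree_def is_spanning_tree_def)
  have fin: "finite J" "finite D" using finite_subset[OF JE finE] finite_subset[OF DE finE] .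
  have HE: "F i \<union> J \<subseteq> E" using F_sub[OF i] JE by blast
  have set: "set_mset (candidate i J D) = F i \<union> J \<union> D"
    using fin finF[OF i] by (simp add: repeat_mset_two)
  have "mg_connected (contracted_verts V (F i \<union> J)) (contracted_ends V (F i \<union> J)) D"
    using D by (simp add: is_min_spanning_tree_def is_spanning_tree_def)
  then have "\<forall>u\<in>V. \<forall>v\<in>V. conn (F i \<union> J \<union> D) u v"
    using contracted_connected_iff[OF subset_trans[OF HE Evp] subset_trans[OF DE Evp]] by (simp only:)
  then have con: "mg_connected V id (F i \<union> J \<union> D)" unfolding mg_connected_id .
  have "odd_verts V (candidate i J D) = sym_diff (sym_diff (oddv V (F i)) (T i)) {}"
    unfolding repeat_mset_two odd_verts_add odd_verts_mset_set[OF finF[OF i]] odd_verts_mset_set[OF fin(1)] oJ by simp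
  also have "\<dots> = sym_diff {s} {t}" unfolding T_def by (simp only: Diff_empty) blast
  finally have "odd_verts V (candidate i J D) = sym_diff {s} {t}" .
  moreover have "F i \<union> J \<union> D \<subseteq> vpairs V" using HE DE Evp by blast
  ultimately show ?thesis unfolding is_tour_def set using con by simp
qed

definition cy :: "('a set \<Rightarrow> real) \<Rightarrow> nat \<Rightarrow> real" where
  "cy c i = (\<Sum>e\<in>E. c e * y i e)"

definition cl :: "('a set \<Rightarrow> real) \<Rightarrow> nat \<Rightarrow> real" where
  "cl c j = (\<Sum>e\<in>E. c e * lv j e)"

lemma leE: "i < n \<Longrightarrow> h \<in> lon i \<Longrightarrow> le i h \<in> E"
  using leS SE by blast

lemma sum_c_F:
  assumes "i < n"
  shows "sum c (F i) = sum c (S i) - (\<Sum>h\<in>lon i. (c (le i h) :: real))"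
proof -
  have "sum c (F i) = sum c (S i) - sum c (le i ` lon i)"
    unfolding F_eq[OF assms] by (rule sum_diff[OF finS[OF assms]]) (use leS in blast)
  then show ?thesis by (simp add: sum.reindex[OF inj_le[OF assms]])
qed

text \<open>The best candidate costs at most the average over the joins. Deletion saves the lonely
  edges and the doubled reconnection returns the fraction \<open>1 - lambda h\<close> of each, which
  leaves a net saving of \<open>lambda h\<close>.\<close>

lemma bomd_first_tour_cost:
  fixes c :: "'a set \<Rightarrow> real"
  assumes i: "i < n" and c: "\<And>e. e \<in> E \<Longrightarrow> 0 \<le> c e" and R: "bomd_first k V s t c x n lam S L i R"
  shows "is_tour V s t R" "tour_cost c R \<le> sum c (S i) + cy c i - (\<Sum>h\<in>lon i. lambda h * c (le i h))"
proof -
  obtain m mu J D j where b: "join_combination V E (T i) (y i) m mu J" "\<And>j. j < m \<Longrightarrow> contracted_mst c i (J j) (D j)"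
    "j < m" "R = candidate i (J j) (D j)" "\<And>j'. j' < m \<Longrightarrow> tour_cost c R \<le> tour_cost c (candidate i (J j') (D j'))"
    using R unfolding bomd_first_iff[OF i] by blast
  have J: "is_join V E (T i) (J j)" "0 < mu j" if "j < m" for j using b(1) that by (simp_all add: join_combination_def)
  show "is_tour V s t R" unfolding b(4) by (rule candidate_tour[OF i J(1)[OF b(3)] b(2)[OF b(3)]])
  have mu1: "(\<Sum>j<m. mu j) = 1" using b(1) by (simp add: join_combination_def)
  have "tour_cost c R = (\<Sum>j<m. mu j * tour_cost c R)" by (simp add: sum_distrib_right[symmetric] mu1)
  also have "\<dots> \<le> (\<Sum>j<m. mu j * tour_cost c (candidate i (J j) (D j)))"
    by (rule sum_mono) (use b(5) J(2) in \<open>auto intro!: mult_left_mono less_imp_le\<close>)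
  also have "\<dots> = (\<Sum>j<m. mu j) * sum c (F i) + (\<Sum>j<m. mu j * sum c (J j)) + 2 * (\<Sum>j<m. mu j * sum c (D j))"
  proof -
    have "(\<Sum>j<m. mu j * (a + b j + 2 * d j)) = (\<Sum>j<m. mu j) * a + (\<Sum>j<m. mu j * b j) + 2 * (\<Sum>j<m. mu j * d j)"
      for a :: real and b d by (simp add: distrib_left sum.distrib sum_distrib_left sum_distrib_right mult.left_commute)
    then show ?thesis unfolding tour_cost_candidate .
  qed
  also have "(\<Sum>j<m. mu j * sum c (J j)) \<le> cy c i"
  proof -
    have "sum c (J j) = (\<Sum>e\<in>E. c e * of_bool (e \<in> J j))" if "j < m" for j
      by (rule sum.mono_neutral_cong_left[OF finE]) (use J(1)[OF that] in \<open>auto simp: is_join_def\<close>)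
    then have "(\<Sum>j<m. mu j * sum c (J j)) = (\<Sum>j<m. \<Sum>e\<in>E. c e * (mu j * of_bool (e \<in> J j)))"
      by (intro sum.cong[OF refl]) (simp add: sum_distrib_left mult.left_commute)
    also have "\<dots> = (\<Sum>e\<in>E. c e * (\<Sum>j<m. mu j * of_bool (e \<in> J j)))"
      by (subst sum.swap) (simp only: sum_distrib_left)
    also have "\<dots> \<le> cy c i" unfolding cy_def
      by (rule sum_mono, rule mult_left_mono) (use b(1) c in \<open>auto simp only: join_combination_def\<close>)
    finally show ?thesis .
  qed
  also note reconnection_cost[OF i c b(1,2)]
  also have "(\<Sum>j<m. mu j) * sum c (F i) + cy c i + 2 * (\<Sum>h\<in>lon i. (1/2 - lambda h / 2) * c (le i h))
      = sum c (S i) + cy c i - (\<Sum>h\<in>lon i. lambda h * c (le i h))"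
  proof -
    have "2 * (\<Sum>h\<in>lon i. (1/2 - lambda h / 2) * c (le i h)) = (\<Sum>h\<in>lon i. c (le i h) - lambda h * c (le i h))"
      unfolding sum_distrib_left by (rule sum.cong[OF refl]) (simp add: algebra_simps)
    then show ?thesis unfolding mu1 sum_c_F[OF i] sum_subtractf by simp
  qed
  finally show "tour_cost c R \<le> sum c (S i) + cy c i - (\<Sum>h\<in>lon i. lambda h * c (le i h))" by simp
qed

text \<open>The tree without its path from \<open>s\<close> to \<open>t\<close> is one of the joins
  over which the minimum is taken.\<close>

lemma bomd_second_tour_cost:
  fixes c :: "'a set \<Rightarrow> real"
  assumes i: "i < n" and R: "bomd_second V s t c x (S i) R"
  shows "is_tour V s t R" "tour_cost c R \<le> 2 * sum c (S i) - sum c (P i)"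
proof -
  let ?T = "sym_diff (oddv V (S i)) (sym_diff {s} {t})"
  obtain J where J: "is_min_join V E c ?T J" "R = mset_set (S i) + mset_set J"
    using R unfolding bomd_second_def odd_verts_mset_set[OF finS[OF i]] by blast
  have JE: "J \<subseteq> E" and oJ: "oddv V J = ?T" using J(1) unfolding is_min_join_def is_join_oddv by blast+
  have finJ: "finite J" using finite_subset[OF JE finE] .
  have finP: "finite (P i)" using finite_subset[OF path_props(1)[OF i] finS[OF i]] .
  have "S i - P i = sym_diff (S i) (P i)" using path_props(1)[OF i] by blast
  then have "oddv V (S i - P i) = ?T" using oddv_sym_diff[OF finS[OF i] finP, of V] path_props(2)[OF i] by simp
  then have "is_join V E ?T (S i - P i)" unfolding is_join_oddv using SE[OF i] by blast
  then have "sum c J \<le> sum c (S i - P i)" using J(1) unfolding is_min_join_def by blast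
  also have "\<dots> = sum c (S i) - sum c (P i)" by (rule sum_diff[OF finS[OF i] path_props(1)[OF i]])
  finally show "tour_cost c R \<le> 2 * sum c (S i) - sum c (P i)"
    unfolding J(2) tour_cost_add tour_cost_mset_set by simp
  have set: "set_mset R = S i \<union> J" using finJ finS[OF i] by (simp add: J(2))
  have "mg_connected V id (S i \<union> J)" unfolding mg_connected_id
    by (intro ballI conn_mono[OF connS[OF i]]) simp_all
  moreover have "S i \<union> J \<subseteq> vpairs V" using SE[OF i] JE Evp by blast
  moreover have "odd_verts V R = sym_diff (oddv V (S i)) ?T"
    unfolding J(2) odd_verts_add odd_verts_mset_set[OF finS[OF i]] odd_verts_mset_set[OF finJ] oJ ..
  moreover have "sym_diff (oddv V (S i)) ?T = sym_diff {s} {t}" by blast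
  ultimately show "is_tour V s t R" unfolding is_tour_def set by simp
qed

lemma cl_eq:
  fixes c :: "'a set \<Rightarrow> real"
  assumes j: "1 \<le> j" "j \<le> p"
  shows "cl c j = (\<Sum>i | i < n \<and> j \<in> lon i. lam i * c (le i j))"
proof -
  let ?A = "{i. i < n \<and> j \<in> lon i}"
  have "cl c j = (\<Sum>e\<in>E. \<Sum>i\<in>{i \<in> ?A. le i j = e}. lam i * c (le i j))"
    unfolding cl_def
  proof (rule sum.cong[OF refl])
    fix e
    have "{i. i < n \<and> j \<in> lon i \<and> le i j = e} = {i \<in> ?A. le i j = e}" by blast
    then show "c e * lv j e = (\<Sum>i\<in>{i \<in> ?A. le i j = e}. lam i * c (le i j))"
      unfolding lv_eq[OF j] sum_distrib_left by (intro sum.cong) auto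
  qed
  also have "\<dots> = (\<Sum>i\<in>?A. lam i * c (le i j))"
    by (rule sum.group) (use finE leE in auto)
  finally show ?thesis .
qed

lemma lonely_swap:
  fixes c :: "'a set \<Rightarrow> real"
  shows "(\<Sum>i<n. lam i * (\<Sum>h\<in>lon i. \<phi> h * c (le i h))) = (\<Sum>h\<in>{1..p}. \<phi> h * cl c h)"
proof -
  have "(\<Sum>i<n. lam i * (\<Sum>h\<in>lon i. \<phi> h * c (le i h))) = (\<Sum>i<n. \<Sum>h\<in>{1..p}. if h \<in> lon i then \<phi> h * (lam i * c (le i h)) else 0)"
  proof (rule sum.cong[OF refl])
    fix i
    have "lon i = {h \<in> {1..p}. h \<in> lon i}" using lon_range by auto
    then have "(\<Sum>h\<in>lon i. \<phi> h * (lam i * c (le i h))) = (\<Sum>h\<in>{h \<in> {1..p}. h \<in> lon i}. \<phi> h * (lam i * c (le i h)))" by (simp only:)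
    also have "\<dots> = (\<Sum>h\<in>{1..p}. if h \<in> lon i then \<phi> h * (lam i * c (le i h)) else 0)" by (rule sum.inter_filter) simp
    finally show "lam i * (\<Sum>h\<in>lon i. \<phi> h * c (le i h)) = (\<Sum>h\<in>{1..p}. if h \<in> lon i then \<phi> h * (lam i * c (le i h)) else 0)"
      by (simp only: sum_distrib_left mult.left_commute)
  qed
  also have "\<dots> = (\<Sum>h\<in>{1..p}. \<Sum>i<n. if h \<in> lon i then \<phi> h * (lam i * c (le i h)) else 0)" by (rule sum.swap)
  also have "\<dots> = (\<Sum>h\<in>{1..p}. \<phi> h * cl c h)"
  proof (rule sum.cong[OF refl])
    fix h assume h: "h \<in> {1..p}"
    have "{i \<in> {..<n}. h \<in> lon i} = {i. i < n \<and> h \<in> lon i}" by auto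
    then show "(\<Sum>i<n. if h \<in> lon i then \<phi> h * (lam i * c (le i h)) else 0) = \<phi> h * cl c h"
      using h by (simp add: sum.inter_filter[symmetric] cl_eq sum_distrib_left)
  qed
  finally show ?thesis .
qed

text \<open>\<open>F\<close> misses a lonely cut, so the trees with \<open>evn\<close> are disjoint
  from those for which the cut is lonely, and the latter weigh \<open>lambda j\<close>.\<close>

lemma even_weight:
  assumes j: "1 \<le> j" "j \<le> p"
  shows "(\<Sum>i | i < n \<and> evn i j. lam i) \<le> 1 - lambda j"
proof -
  have dis: "{i. i < n \<and> evn i j} \<inter> {i. i < n \<and> j \<in> lon i} = {}"
    using lonely_F by (auto simp: evn_def Int_commute)
  have "(\<Sum>i | i < n \<and> evn i j. lam i) + (\<Sum>i | i < n \<and> j \<in> lon i. lam i)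
      = sum lam ({i. i < n \<and> evn i j} \<union> {i. i < n \<and> j \<in> lon i})"
    by (rule sum.union_disjoint[symmetric]) (use dis in auto)
  also have "\<dots> \<le> sum lam {..<n}" by (rule sum_mono2) (use tc(1) less_imp_le in auto)
  finally show ?thesis using tc(4) lonely_weight[OF j] by simp
qed

lemma cy_eq:
  fixes c :: "'a set \<Rightarrow> real"
  assumes i: "i < n"
  shows "cy c i = (\<Sum>e\<in>E. c e * x e) / 2 + bomd_gamma * sum c (P i) + (\<Sum>h\<in>lon i. gg h * c (le i h))
    + (\<Sum>h\<in>{h \<in> {1..p}. evn i h}. gg h / lambda h * cl c h)"
proof -
  have PE: "P i \<subseteq> E" using path_props(1)[OF i] SE[OF i] by blast
  have "cy c i = (\<Sum>e\<in>E. c e * x e / 2) + (\<Sum>e\<in>E. bomd_gamma * (c e * of_bool (e \<in> P i)))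
    + (\<Sum>e\<in>E. \<Sum>h\<in>lon i. gg h * (c e * of_bool (le i h = e)))
    + (\<Sum>e\<in>E. \<Sum>h\<in>{h \<in> {1..p}. evn i h}. gg h / lambda h * (c e * lv h e))"
    unfolding cy_def y_eq sum.distrib[symmetric] distrib_left sum_distrib_left
    by (rule sum.cong[OF refl]) (simp only: mult.left_commute times_divide_eq_right)
  moreover have "(\<Sum>e\<in>E. c e * x e / 2) = (\<Sum>e\<in>E. c e * x e) / 2" by (rule sum_divide_distrib[symmetric])
  moreover have "(\<Sum>e\<in>E. bomd_gamma * (c e * of_bool (e \<in> P i))) = bomd_gamma * sum c (P i)"
  proof -
    have "sum c (P i) = (\<Sum>e\<in>E. c e * of_bool (e \<in> P i))"
      by (rule sum.mono_neutral_cong_left[OF finE PE]) auto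
    then show ?thesis by (simp only: sum_distrib_left)
  qed
  moreover have "(\<Sum>e\<in>E. \<Sum>h\<in>lon i. gg h * (c e * of_bool (le i h = e))) = (\<Sum>h\<in>lon i. gg h * c (le i h))"
  proof -
    have "(\<Sum>e\<in>E. \<Sum>h\<in>lon i. gg h * (c e * of_bool (le i h = e))) = (\<Sum>h\<in>lon i. \<Sum>e\<in>E. gg h * (c e * of_bool (le i h = e)))"
      by (rule sum.swap)
    also have "\<dots> = (\<Sum>h\<in>lon i. gg h * c (le i h))"
    proof (rule sum.cong[OF refl])
      fix h assume h: "h \<in> lon i"
      have "(\<Sum>e\<in>E. gg h * (c e * of_bool (le i h = e))) = (\<Sum>e\<in>E. if e = le i h then gg h * c e else 0)"
        by (rule sum.cong[OF refl]) auto
      also have "\<dots> = gg h * c (le i h)" using finE leE[OF i h] by (simp only: sum.delta if_True)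
      finally show "(\<Sum>e\<in>E. gg h * (c e * of_bool (le i h = e))) = gg h * c (le i h)" .
    qed
    finally show ?thesis .
  qed
  moreover have "(\<Sum>e\<in>E. \<Sum>h\<in>{h \<in> {1..p}. evn i h}. gg h / lambda h * (c e * lv h e)) = (\<Sum>h\<in>{h \<in> {1..p}. evn i h}. gg h / lambda h * cl c h)"
    by (subst sum.swap) (simp only: cl_def sum_distrib_left)
  ultimately show ?thesis by (simp only:)
qed

text \<open>Per unit of lonely cost at cut \<open>j\<close>: \<open>gg j\<close> is spent when the
  cut is lonely and \<open>gg j / lambda j\<close> when it is even, the latter with probability at
  most \<open>1 - lambda j\<close>. Both add up to \<open>gg j / lambda j\<close>, and the saving is
  \<open>lambda j\<close>. The inequality is tight at \<open>lambda j = 1/4\<close>, which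
  determines the choice of \<open>bomd_gamma\<close>.\<close>

lemma gg_bound: "gg j + gg j / lambda j * (1 - lambda j) \<le> lambda j"
proof -
  have l: "0 < lambda j" using lambda_range(1) .
  have "gg j \<le> lambda j * lambda j"
  proof -
    have "0 \<le> (lambda j - 1/4) * (lambda j - 1/4)" by simp
    then have "lambda j / 2 - 1/16 \<le> lambda j * lambda j" by (simp add: algebra_simps)
    then show ?thesis using l by (simp add: gg_def bomd_gamma_def)
  qed
  then have "gg j / lambda j \<le> lambda j" using l by (simp add: field_simps)
  moreover have "gg j + gg j / lambda j * (1 - lambda j) = gg j / lambda j" using l by (simp add: field_simps)
  ultimately show ?thesis by simp
qed

lemma lam_sum_S:
  fixes c :: "'a set \<Rightarrow> real"
  shows "(\<Sum>i<n. lam i * sum c (S i)) = (\<Sum>e\<in>E. c e * x e)"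
proof -
  have "(\<Sum>i<n. lam i * sum c (S i)) = (\<Sum>i<n. \<Sum>e\<in>E. c e * (lam i * of_bool (e \<in> S i)))"
  proof (rule sum.cong[OF refl])
    fix i assume "i \<in> {..<n}"
    then have "sum c (S i) = (\<Sum>e\<in>E. c e * of_bool (e \<in> S i))"
      by (intro sum.mono_neutral_cong_left[OF finE SE]) auto
    then show "lam i * sum c (S i) = (\<Sum>e\<in>E. c e * (lam i * of_bool (e \<in> S i)))"
      by (simp only: sum_distrib_left mult.left_commute)
  qed
  also have "\<dots> = (\<Sum>e\<in>E. c e * (\<Sum>i<n. lam i * of_bool (e \<in> S i)))"
    by (subst sum.swap) (simp only: sum_distrib_left)
  also have "\<dots> = (\<Sum>e\<in>E. c e * x e)" by (rule sum.cong[OF refl]) (simp only: lam_x)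
  finally show ?thesis .
qed

lemma average_first:
  fixes c :: "'a set \<Rightarrow> real"
  assumes c: "\<And>e. e \<in> E \<Longrightarrow> 0 \<le> c e"
  shows "(\<Sum>i<n. lam i * (sum c (S i) + cy c i - (\<Sum>h\<in>lon i. lambda h * c (le i h))))
    \<le> 3/2 * (\<Sum>e\<in>E. c e * x e) + (\<Sum>i<n. lam i * sum c (P i)) / 16"
proof -
  let ?C = "\<Sum>e\<in>E. c e * x e"
  have cl0: "0 \<le> cl c h" for h unfolding cl_def by (rule sum_nonneg) (use c lv_nonneg in auto)
  have ev: "(\<Sum>i<n. lam i * (\<Sum>h\<in>{h \<in> {1..p}. evn i h}. gg h / lambda h * cl c h))
      \<le> (\<Sum>h\<in>{1..p}. gg h / lambda h * (1 - lambda h) * cl c h)"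
  proof -
    have "(\<Sum>i<n. lam i * (\<Sum>h\<in>{h \<in> {1..p}. evn i h}. gg h / lambda h * cl c h))
      = (\<Sum>i<n. \<Sum>h\<in>{1..p}. if evn i h then gg h / lambda h * cl c h * lam i else 0)"
      unfolding sum.inter_filter[OF finite_atLeastAtMost, symmetric] sum_distrib_left
      by (intro sum.cong[OF refl]) (simp only: mult_ac)
    also have "\<dots> = (\<Sum>h\<in>{1..p}. \<Sum>i<n. if evn i h then gg h / lambda h * cl c h * lam i else 0)" by (rule sum.swap)
    also have "\<dots> \<le> (\<Sum>h\<in>{1..p}. gg h / lambda h * (1 - lambda h) * cl c h)"
    proof (rule sum_mono)
      fix h assume h: "h \<in> {1..p}"
      have "{i \<in> {..<n}. evn i h} = {i. i < n \<and> evn i h}" by auto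
      then have "(\<Sum>i<n. if evn i h then gg h / lambda h * cl c h * lam i else 0)
        = gg h / lambda h * cl c h * (\<Sum>i | i < n \<and> evn i h. lam i)"
        by (simp only: sum.inter_filter[OF finite_lessThan, symmetric] sum_distrib_left)
      also have "\<dots> \<le> gg h / lambda h * cl c h * (1 - lambda h)"
        by (rule mult_left_mono[OF even_weight])
          (use h gg_nonneg[of h] less_imp_le[OF lambda_range(1)[of h]] cl0 in auto)
      finally show "(\<Sum>i<n. if evn i h then gg h / lambda h * cl c h * lam i else 0) \<le> gg h / lambda h * (1 - lambda h) * cl c h"
        by (simp only: mult_ac)
    qed
    finally show ?thesis .
  qed
  have "(\<Sum>i<n. lam i * (sum c (S i) + cy c i - (\<Sum>h\<in>lon i. lambda h * c (le i h))))
    = (\<Sum>i<n. lam i * sum c (S i)) + (\<Sum>i<n. lam i) * (?C / 2) + bomd_gamma * (\<Sum>i<n. lam i * sum c (P i))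
      + (\<Sum>i<n. lam i * (\<Sum>h\<in>lon i. gg h * c (le i h)))
      + (\<Sum>i<n. lam i * (\<Sum>h\<in>{h \<in> {1..p}. evn i h}. gg h / lambda h * cl c h))
      - (\<Sum>i<n. lam i * (\<Sum>h\<in>lon i. lambda h * c (le i h)))"
    unfolding sum_distrib_right sum_distrib_left[of bomd_gamma] sum.distrib[symmetric] sum_subtractf[symmetric]
  proof (rule sum.cong[OF refl])
    fix i assume "i \<in> {..<n}"
    then have i: "i < n" by simp
    have ar: "l * (A + (B + g * G + H + K) - M) = l * A + l * B + g * (l * G) + l * H + l * K - l * M"
      for l A B g G H K M :: real by (simp add: algebra_simps)
    show "lam i * (sum c (S i) + cy c i - (\<Sum>h\<in>lon i. lambda h * c (le i h))) =
      lam i * sum c (S i) + lam i * (?C / 2) + bomd_gamma * (lam i * sum c (P i))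
      + lam i * (\<Sum>h\<in>lon i. gg h * c (le i h))
      + lam i * (\<Sum>h\<in>{h \<in> {1..p}. evn i h}. gg h / lambda h * cl c h)
      - lam i * (\<Sum>h\<in>lon i. lambda h * c (le i h))"
      unfolding cy_eq[OF i] by (rule ar)
  qed
  moreover have "(\<Sum>h\<in>{1..p}. gg h * cl c h) + (\<Sum>h\<in>{1..p}. gg h / lambda h * (1 - lambda h) * cl c h) \<le> (\<Sum>h\<in>{1..p}. lambda h * cl c h)"
    unfolding sum.distrib[symmetric] distrib_right[symmetric] by (rule sum_mono, rule mult_right_mono[OF gg_bound cl0])
  ultimately show ?thesis using ev unfolding lam_sum_S tc(4) lonely_swap bomd_gamma_def by argo
qed

lemma lp_cost_supp: "lp_cost V c x = (\<Sum>e\<in>E. c e * x e)"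
  unfolding lp_cost_def by (rule sum.mono_neutral_right) (use finvp Evp xzero in auto)

lemma bomd_output_tour_cost:
  assumes c: "\<And>e. e \<in> E \<Longrightarrow> 0 \<le> c e" and out: "bomd_output k V s t c x n lam S L R"
  shows "is_tour V s t R" "tour_cost c R \<le> (3/2 + 1/34) * lp_cost V c x"
proof -
  obtain P1 P2 where b: "\<And>i. i < n \<Longrightarrow> bomd_first k V s t c x n lam S L i (P1 i)"
    "\<And>i. i < n \<Longrightarrow> bomd_second V s t c x (S i) (P2 i)"
    "R \<in> P1 ` {..<n} \<union> P2 ` {..<n}" "\<And>R'. R' \<in> P1 ` {..<n} \<union> P2 ` {..<n} \<Longrightarrow> tour_cost c R \<le> tour_cost c R'"
    using out unfolding bomd_output_def by blast
  show "is_tour V s t R"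
    using b(3) bomd_first_tour_cost(1)[OF _ c b(1)] bomd_second_tour_cost(1)[OF _ b(2)] by auto
  let ?C = "\<Sum>e\<in>E. c e * x e" and ?a = "\<Sum>i<n. lam i * sum c (P i)"
  have "tour_cost c R = (\<Sum>i<n. lam i * tour_cost c R)" by (simp add: sum_distrib_right[symmetric] tc(4))
  \<comment> \<open>The bound for the first kind of tours carries \<open>?a / 16\<close>, the second
    \<open>- ?a\<close>. The weights cancel these and leave the factor
    \<open>(16 * 3/2 + 2) / 17 = 26/17\<close>.\<close>
  also have "\<dots> \<le> (\<Sum>i<n. 16/17 * (lam i * (sum c (S i) + cy c i - (\<Sum>h\<in>lon i. lambda h * c (le i h))))
      + 1/17 * (2 * (lam i * sum c (S i)) - lam i * sum c (P i)))"
  proof (rule sum_mono)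
    fix i assume "i \<in> {..<n}"
    then have i: "i < n" by simp
    let ?f = "sum c (S i) + cy c i - (\<Sum>h\<in>lon i. lambda h * c (le i h))"
    have "tour_cost c R \<le> ?f"
      using b(4)[of "P1 i"] i bomd_first_tour_cost(2)[OF i c b(1)[OF i]] by simp
    moreover have "tour_cost c R \<le> 2 * sum c (S i) - sum c (P i)"
      using b(4)[of "P2 i"] i bomd_second_tour_cost(2)[OF i b(2)[OF i]] by simp
    moreover have ar: "z \<le> f \<Longrightarrow> z \<le> g \<Longrightarrow> z \<le> 16/17 * f + 1/17 * g" for z f g :: real by argo
    ultimately have "tour_cost c R \<le> 16/17 * ?f + 1/17 * (2 * sum c (S i) - sum c (P i))" by (intro ar)
    then have "lam i * tour_cost c R \<le> lam i * (16/17 * ?f + 1/17 * (2 * sum c (S i) - sum c (P i)))"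
      by (rule mult_left_mono) (use tc(1)[OF i] in simp)
    also have "\<dots> = 16/17 * (lam i * ?f) + 1/17 * (2 * (lam i * sum c (S i)) - lam i * sum c (P i))"
      by (simp add: algebra_simps)
    finally show "lam i * tour_cost c R \<le> 16/17 * (lam i * ?f) + 1/17 * (2 * (lam i * sum c (S i)) - lam i * sum c (P i))" .
  qed
  also have "\<dots> = 16/17 * (\<Sum>i<n. lam i * (sum c (S i) + cy c i - (\<Sum>h\<in>lon i. lambda h * c (le i h))))
      + 1/17 * (2 * (\<Sum>i<n. lam i * sum c (S i)) - ?a)"
    by (simp only: sum.distrib sum_subtractf sum_distrib_left[symmetric])
  also have "\<dots> \<le> (3/2 + 1/34) * ?C"
  proof -
    have "(\<Sum>i<n. lam i * (sum c (S i) + cy c i - (\<Sum>h\<in>lon i. lambda h * c (le i h)))) \<le> 3/2 * ?C + ?a / 16"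
      by (rule average_first) (rule c)
    then show ?thesis unfolding lam_sum_S by argo
  qed
  finally show "tour_cost c R \<le> (3/2 + 1/34) * lp_cost V c x" unfolding lp_cost_supp .
qed

lemma bomd_first_exists:
  assumes i: "i < n" and k: "card E + 1 \<le> k"
  shows "\<exists>R. bomd_first k V s t c x n lam S L i R"
proof -
  obtain m mu J where mJ: "m \<le> k" "join_combination V E (T i) (y i) m mu J"
    using joins_exist[OF i] k by (meson le_trans)
  have "\<exists>D. j < m \<longrightarrow> contracted_mst c i (J j) D" for j
  proof (cases "j < m")
    case True
    have JE: "J j \<subseteq> E" using mJ(2) True by (simp add: join_combination_def is_join_def)
    have HE: "F i \<union> J j \<subseteq> E" using F_sub[OF i] JE by blast
    have "\<forall>u\<in>V. \<forall>v\<in>V. conn (F i \<union> J j \<union> E) u v" by (intro ballI conn_mono[OF connE]) simp_all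
    then have "mg_connected (contracted_verts V (F i \<union> J j)) (contracted_ends V (F i \<union> J j)) E"
      using contracted_connected_iff[OF subset_trans[OF HE Evp] Evp] by (simp only:)
    from min_spanning_tree_exists[OF finE this] show ?thesis by blast
  qed simp
  then have "\<forall>j. \<exists>D. j < m \<longrightarrow> contracted_mst c i (J j) D" by blast
  then obtain D where D: "\<forall>j. j < m \<longrightarrow> contracted_mst c i (J j) (D j)" by (rule choice[THEN exE])
  have "m \<noteq> 0"
  proof
    assume "m = 0"
    then show False using mJ(2) by (simp add: join_combination_def)
  qed
  then have "{..<m} \<noteq> {}" by auto
  then obtain j where "j \<in> {..<m}" "\<forall>j'\<in>{..<m}. tour_cost c (candidate i (J j) (D j)) \<le> tour_cost c (candidate i (J j') (D j'))"
    using ex_min_real[OF finite_lessThan, of m "\<lambda>j. tour_cost c (candidate i (J j) (D j))"] by blast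
  then show ?thesis using mJ D unfolding bomd_first_iff[OF i] lessThan_iff by blast
qed

lemma bomd_second_exists:
  assumes i: "i < n"
  shows "\<exists>R. bomd_second V s t c x (S i) R"
proof -
  let ?T = "sym_diff (oddv V (S i)) (sym_diff {s} {t})"
  let ?J = "{J. is_join V E ?T J}"
  have SP: "S i - P i = sym_diff (S i) (P i)" using path_props(1)[OF i] by blast
  have finP: "finite (P i)" using finite_subset[OF path_props(1)[OF i] finS[OF i]] .
  have "S i - P i \<in> ?J"
    unfolding mem_Collect_eq is_join_oddv
    using SP oddv_sym_diff[OF finS[OF i] finP, of V] path_props(2)[OF i] SE[OF i] by auto
  then have ne: "?J \<noteq> {}" by blast
  have fin: "finite ?J" by (rule finite_subset[of _ "Pow E"]) (use finE in \<open>auto simp: is_join_def\<close>)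
  obtain J where "J \<in> ?J" "\<forall>J'\<in>?J. sum c J \<le> sum c J'" using ex_min_real[OF fin ne, of "sum c"] by blast
  then have "is_min_join V E c ?T J" by (simp add: is_min_join_def)
  then show ?thesis unfolding bomd_second_def odd_verts_mset_set[OF finS[OF i]] by blast
qed

lemma bomd_output_exists:
  assumes k: "card E + 1 \<le> k"
  shows "\<exists>R. bomd_output k V s t c x n lam S L R"
proof -
  have "\<forall>i. \<exists>R. i < n \<longrightarrow> bomd_first k V s t c x n lam S L i R" using bomd_first_exists[OF _ k] by blast
  then obtain P1 where P1: "\<forall>i. i < n \<longrightarrow> bomd_first k V s t c x n lam S L i (P1 i)" by (rule choice[THEN exE])
  have "\<forall>i. \<exists>R. i < n \<longrightarrow> bomd_second V s t c x (S i) R" using bomd_second_exists by blast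
  then obtain P2 where P2: "\<forall>i. i < n \<longrightarrow> bomd_second V s t c x (S i) (P2 i)" by (rule choice[THEN exE])
  let ?A = "P1 ` {..<n} \<union> P2 ` {..<n}"
  have "n \<noteq> 0"
  proof
    assume "n = 0" then show False using tc(4) by simp
  qed
  then have "?A \<noteq> {}" by auto
  then obtain R where "R \<in> ?A" "\<forall>R'\<in>?A. tour_cost c R \<le> tour_cost c R'"
    using ex_min_real[of ?A "tour_cost c"] by blast
  then show ?thesis unfolding bomd_output_def using P1 P2 by blast
qed

end

text \<open>The algorithm is a relation, so a bound on its outputs alone could hold vacuously. Hence
  a layered combination and, for each such combination, an output are also shown to exist. Fixing
  \<open>K\<close> before the instance expresses the linear numbers of trees and joins.\<close>

theorem theorem5:
  shows "\<exists>K::nat. \<forall>(V :: 'v set) s t (c :: 'v set \<Rightarrow> real) (x :: 'v set \<Rightarrow> real).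
    finite V \<and> s \<in> V \<and> t \<in> V \<and> is_metric_cost V c \<and> lp_optimal V s t c x \<longrightarrow>
      (\<exists>n lam S L. n \<le> K * card (supp_edges V x) \<and> layered_combination V x n lam S L) \<and>
      (\<forall>n lam S L. layered_combination V x n lam S L \<longrightarrow>
         (\<exists>R. bomd_output (K * card (supp_edges V x)) V s t c x n lam S L R) \<and>
         (\<forall>k R. bomd_output k V s t c x n lam S L R \<longrightarrow>
            is_tour V s t R \<and> tour_cost c R \<le> (3 / 2 + 1 / 34) * lp_cost V c x))"
\<comment> \<open>\<open>3\<close> serves both purposes: it is the factor in
  \<open>layered_exists\<close>, and the \<open>card E + 1\<close> joins that suffice are at most
  \<open>3 * card E\<close> as \<open>E\<close> is nonempty.\<close>
proof (intro exI[of _ 3] allI impI)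
  fix V :: "'v set" and s t and c x :: "'v set \<Rightarrow> real"
  assume a: "finite V \<and> s \<in> V \<and> t \<in> V \<and> is_metric_cost V c \<and> lp_optimal V s t c x"
  interpret lp_sol V s t x by unfold_locales (use a in \<open>auto simp: lp_optimal_def\<close>)
  have c: "0 \<le> c e" if "e \<in> E" for e using a that Evp by (auto simp: is_metric_cost_def)
  show "(\<exists>n lam S L. n \<le> 3 * card E \<and> layered_combination V x n lam S L) \<and>
      (\<forall>n lam S L. layered_combination V x n lam S L \<longrightarrow>
         (\<exists>R. bomd_output (3 * card E) V s t c x n lam S L R) \<and>
         (\<forall>k R. bomd_output k V s t c x n lam S L R \<longrightarrow>
            is_tour V s t R \<and> tour_cost c R \<le> (3 / 2 + 1 / 34) * lp_cost V c x))"
  proof (intro conjI allI impI)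
    fix n lam S L assume "layered_combination V x n lam S L"
    then interpret layered_lp V s t x n lam S L by unfold_locales
    show "\<exists>R. bomd_output (3 * card E) V s t c x n lam S L R"
      by (rule bomd_output_exists) (use E_pos in simp)
    fix k R assume R: "bomd_output k V s t c x n lam S L R"
    show "is_tour V s t R" by (rule bomd_output_tour_cost(1)[OF c R])
    show "tour_cost c R \<le> (3 / 2 + 1 / 34) * lp_cost V c x" by (rule bomd_output_tour_cost(2)[OF c R])
  qed (rule layered_exists)
qed

end
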